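(* Let $K$ be a field, let $G$ be a connected indecomposable block graph with vertex set $[n]$, let $S=K[x_1,\ldots,x_n,y_1,\ldots,y_n]$, let $J_G\subset S$ be the binomial edge ideal of $G$, and let $i(G)$ be the number of inner vertices of $G$. Then: (a) $\operatorname{reg}(S/J_G)\ge i(G)+1$. (b) The following conditions are equivalent: (i) $S/J_G$ admits precisely one extremal Betti number. (ii) $G$ contains none of the graphs $T_0,T_1,T_2,T_3$ as an induced subgraph, where: $T_0$ is the graph on 7 vertices consisting of three triangles sharing one common vertex $c$ and otherwise disjoint; $T_1$ is the graph on 8 vertices consisting of two triangles sharing one common vertex $c$ and otherwise disjoint, together with a further vertex $w$ adjacent to $c$ and two further vertices of degree 1 adjacent to $w$; $T_2$ is the graph on 9 vertices consisting of one triangle containing a vertex $c$, together with two further vertices $w_1,w_2$ adjacent to $c$, and, for each of $k=1,2$, two further vertices of degree 1 adjacent to $w_k$; $T_3$ is the tree on 10 vertices consisting of a vertex $c$ with exactly three neighbours $w_1,w_2,w_3$, and, for each of $k=1,2,3$, two further vertices of degree 1 adjacent to $w_k$. (iii) Let $P=\{v\in V(G) : \deg(v)\neq 1\}$ and let $G_{|P}$ be the induced subgraph of $G$ on $P$. Then each cutpoint of $G_{|P}$ belongs to exactly two maximal cliques of $G_{|P}$.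
   Context: All graphs are finite and simple; $\deg(v)$ is the number of neighbours of $v$ in $G$. The polynomial ring $S$ is standard graded. The binomial edge ideal of a graph $G$ on $[n]$ is $J_G=(x_iy_j-x_jy_i : \{i,j\}\in E(G),\ i<j)\subset S$. For a finitely generated graded $S$-module $M$, $\beta_{i,j}(M)=\dim_K\operatorname{Tor}^S_i(M,K)_j$ and $\operatorname{reg}(M)=\max\{j : \beta_{i,i+j}(M)\neq0 \text{ for some } i\}$ is the Castelnuovo–Mumford regularity. A graded Betti number $\beta_{i,i+j}(M)\ne 0$ is called extremal if $\beta_{k,k+l}(M)=0$ for all pairs $(k,l)\neq(i,j)$ with $k\ge i$ and $l\ge j$. A clique of $G$ is a set of pairwise adjacent vertices. The clique degree $\operatorname{cdeg}(v)$ of a vertex $v$ is the number of maximal cliques of $G$ containing $v$. A vertex $v$ is free if $\operatorname{cdeg}(v)=1$ and inner if $\operatorname{cdeg}(v)>1$. A cutpoint of a graph is a vertex whose removal increases the number of connected components. A block of $G$ is a connected subgraph that has no cutpoint and is maximal with this property. $G$ is a block graph if each block of $G$ is a clique (complete graph). $G$ is decomposable if there are subgraphs $G_1,G_2$ of $G$, neither of them just a single vertex, such that $G=G_1\cup G_2$, $V(G_1)\cap V(G_2)=\{v\}$, and $v$ is a free vertex of both $G_1$ and $G_2$; otherwise $G$ is indecomposable. A block graph is decomposable if and only if it has a vertex $v$ with $\operatorname{cdeg}(v)=2$.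
   Formalization: Part (a) is stated for n ≥ 2 only: for the one-vertex graph (n = 1) we have i(G) = 0 and J_G = 0, so reg(S/J_G) = 0 and the inequality reg(S/J_G) ≥ i(G)+1 fails; part (b) is stated for all n. *)

theory Defs
  imports
    Complex_Main
    "HOL-Library.Poly_Mapping"
    "HOL-Library.Function_Algebras"
    "HOL-Algebra.Ideal"
begin

section \<open>Finite simple graphs\<close>

record 'a graph =
  vset :: "'a set"
  eset :: "'a set set"

definition simple_graph :: "'a graph \<Rightarrow> bool" where
  "simple_graph G \<longleftrightarrow> finite (vset G) \<and> (\<forall>e\<in>eset G. e \<subseteq> vset G \<and> card e = 2)"

definition vertex_degree :: "'a graph \<Rightarrow> 'a \<Rightarrow> nat" where
  "vertex_degree G v = card {u \<in> vset G. {u, v} \<in> eset G}"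

definition subgraph :: "'a graph \<Rightarrow> 'a graph \<Rightarrow> bool" where
  "subgraph H G \<longleftrightarrow> simple_graph H \<and> vset H \<subseteq> vset G \<and> eset H \<subseteq> eset G"

definition induced :: "'a graph \<Rightarrow> 'a set \<Rightarrow> 'a graph" where
  "induced G W = \<lparr>vset = vset G \<inter> W, eset = {e \<in> eset G. e \<subseteq> W}\<rparr>"

definition reach :: "'a graph \<Rightarrow> ('a \<times> 'a) set" where
  "reach G = {(u, v). u \<in> vset G \<and> v \<in> vset G \<and> (u, v) \<in> {(a, b). {a, b} \<in> eset G}\<^sup>*}"

definition connected_graph :: "'a graph \<Rightarrow> bool" where
  "connected_graph G \<longleftrightarrow> vset G \<noteq> {} \<and> (\<forall>u\<in>vset G. \<forall>v\<in>vset G. (u, v) \<in> reach G)"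

definition num_components :: "'a graph \<Rightarrow> nat" where
  "num_components G = card (vset G // reach G)"

definition cutpoint :: "'a graph \<Rightarrow> 'a \<Rightarrow> bool" where
  "cutpoint G v \<longleftrightarrow>
     v \<in> vset G \<and> num_components (induced G (vset G - {v})) > num_components G"

definition clique :: "'a graph \<Rightarrow> 'a set \<Rightarrow> bool" where
  "clique G W \<longleftrightarrow> W \<subseteq> vset G \<and> (\<forall>u\<in>W. \<forall>v\<in>W. u \<noteq> v \<longrightarrow> {u, v} \<in> eset G)"

definition max_clique :: "'a graph \<Rightarrow> 'a set \<Rightarrow> bool" where
  "max_clique G W \<longleftrightarrow> clique G W \<and> (\<forall>W'. clique G W' \<and> W \<subseteq> W' \<longrightarrow> W' = W)"

definition cdeg :: "'a graph \<Rightarrow> 'a \<Rightarrow> nat" where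
  "cdeg G v = card {W. max_clique G W \<and> v \<in> W}"

definition free_vertex :: "'a graph \<Rightarrow> 'a \<Rightarrow> bool" where
  "free_vertex G v \<longleftrightarrow> v \<in> vset G \<and> cdeg G v = 1"

definition inner_vertex :: "'a graph \<Rightarrow> 'a \<Rightarrow> bool" where
  "inner_vertex G v \<longleftrightarrow> v \<in> vset G \<and> cdeg G v > 1"

definition num_inner :: "'a graph \<Rightarrow> nat" where
  "num_inner G = card {v. inner_vertex G v}"

definition block :: "'a graph \<Rightarrow> 'a graph \<Rightarrow> bool" where
  "block G B \<longleftrightarrow>
     subgraph B G \<and> connected_graph B \<and> (\<nexists>v. cutpoint B v) \<and>
     (\<forall>B'. subgraph B' G \<and> connected_graph B' \<and> (\<nexists>v. cutpoint B' v) \<and> subgraph B B'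
        \<longrightarrow> B' = B)"

definition block_graph :: "'a graph \<Rightarrow> bool" where
  "block_graph G \<longleftrightarrow> (\<forall>B. block G B \<longrightarrow> clique B (vset B))"

definition decomposable :: "'a graph \<Rightarrow> bool" where
  "decomposable G \<longleftrightarrow>
     (\<exists>G1 G2 v. subgraph G1 G \<and> subgraph G2 G \<and> card (vset G1) \<noteq> 1 \<and> card (vset G2) \<noteq> 1 \<and>
        vset G = vset G1 \<union> vset G2 \<and> eset G = eset G1 \<union> eset G2 \<and>
        vset G1 \<inter> vset G2 = {v} \<and> free_vertex G1 v \<and> free_vertex G2 v)"

definition graph_iso :: "'a graph \<Rightarrow> 'b graph \<Rightarrow> bool" where
  "graph_iso G H \<longleftrightarrow>
     (\<exists>f. bij_betw f (vset G) (vset H) \<and>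
        (\<forall>u\<in>vset G. \<forall>v\<in>vset G. {u, v} \<in> eset G \<longleftrightarrow> {f u, f v} \<in> eset H))"

definition contains_induced :: "'a graph \<Rightarrow> 'b graph \<Rightarrow> bool" where
  "contains_induced G T \<longleftrightarrow> (\<exists>W\<subseteq>vset G. graph_iso (induced G W) T)"

text \<open>In the following four graphs the vertex \<open>c\<close> is \<open>0\<close>.\<close>

definition T0 :: "nat graph" where
  "T0 = \<lparr>vset = {0..6},
         eset = {{0,1},{0,2},{1,2}, {0,3},{0,4},{3,4}, {0,5},{0,6},{5,6}}\<rparr>"

definition T1 :: "nat graph" where
  "T1 = \<lparr>vset = {0..7},
         eset = {{0,1},{0,2},{1,2}, {0,3},{0,4},{3,4}, {0,5},{5,6},{5,7}}\<rparr>"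

definition T2 :: "nat graph" where
  "T2 = \<lparr>vset = {0..8},
         eset = {{0,1},{0,2},{1,2}, {0,3},{3,4},{3,5}, {0,6},{6,7},{6,8}}\<rparr>"

definition T3 :: "nat graph" where
  "T3 = \<lparr>vset = {0..9},
         eset = {{0,1},{1,2},{1,3}, {0,4},{4,5},{4,6}, {0,7},{7,8},{7,9}}\<rparr>"

section \<open>The polynomial ring and binomial edge ideals\<close>

datatype vname = X nat | Y nat

type_synonym 'k mpoly = "(vname \<Rightarrow>\<^sub>0 nat) \<Rightarrow>\<^sub>0 'k"

text \<open>The type \<open>'k mpoly\<close> has infinitely many variables; \<open>poly_ring V\<close> is the ring
  of polynomials in the variables \<open>X i\<close>, \<open>Y i\<close> with \<open>i \<in> V\<close> only.\<close>

definition poly_ring :: "nat set \<Rightarrow> ('k::comm_ring_1) mpoly ring" where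
  "poly_ring V =
     \<lparr>carrier = {p. \<forall>m\<in>Poly_Mapping.keys p. Poly_Mapping.keys m \<subseteq> X ` V \<union> Y ` V},
      mult = (*), one = 1, zero = 0, add = (+)\<rparr>"

definition var :: "vname \<Rightarrow> ('k::comm_ring_1) mpoly" where
  "var z = Poly_Mapping.single (Poly_Mapping.single z 1) 1"

definition total_degree :: "(vname \<Rightarrow>\<^sub>0 nat) \<Rightarrow> nat" where
  "total_degree m = (\<Sum>z\<in>Poly_Mapping.keys m. Poly_Mapping.lookup m z)"

definition homogeneous :: "('k::comm_ring_1) mpoly \<Rightarrow> int \<Rightarrow> bool" where
  "homogeneous p d \<longleftrightarrow> (\<forall>m\<in>Poly_Mapping.keys p. int (total_degree m) = d)"

definition binomial_edge_ideal :: "nat graph \<Rightarrow> ('k::comm_ring_1) mpoly set" where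
  "binomial_edge_ideal G =
     Idl\<^bsub>poly_ring (vset G)\<^esub>
       {var (X i) * var (Y j) - var (X j) * var (Y i) | i j. {i, j} \<in> eset G \<and> i < j}"

lemma cring_poly_ring: "cring (poly_ring V :: ('k::comm_ring_1) mpoly ring)"
proof -
  let ?C = "{p :: 'k mpoly. \<forall>m\<in>Poly_Mapping.keys p. Poly_Mapping.keys m \<subseteq> X ` V \<union> Y ` V}"
  have add: "p + q \<in> ?C" if "p \<in> ?C" "q \<in> ?C" for p q
    using that Poly_Mapping.keys_add[of p q] by blast
  have mult: "p * q \<in> ?C" if pq: "p \<in> ?C" "q \<in> ?C" for p q
  proof (rule CollectI, rule ballI)
    fix m assume "m \<in> Poly_Mapping.keys (p * q)"
    then obtain a b where ab: "m = a + b" "a \<in> Poly_Mapping.keys p" "b \<in> Poly_Mapping.keys q"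
      using keys_mult[of p q] by blast
    have "Poly_Mapping.keys (a + b) \<subseteq> Poly_Mapping.keys a \<union> Poly_Mapping.keys b"
      by (rule Poly_Mapping.keys_add)
    moreover have "Poly_Mapping.keys a \<subseteq> X ` V \<union> Y ` V" "Poly_Mapping.keys b \<subseteq> X ` V \<union> Y ` V"
      using pq ab by auto
    ultimately show "Poly_Mapping.keys m \<subseteq> X ` V \<union> Y ` V"
      unfolding ab(1) by blast
  qed
  have neg: "- p \<in> ?C" if "p \<in> ?C" for p
    using that by (simp add: keys_def)
  have minus: "\<exists>q\<in>?C. q + p = 0" if "p \<in> ?C" for p
    using neg[OF that] by (intro bexI[of _ "- p"]) simp_all
  have zero: "0 \<in> ?C" and one: "1 \<in> ?C"
    by simp_all
  have ring: "carrier (poly_ring V :: 'k mpoly ring) = ?C"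
    "\<And>p q :: 'k mpoly. p \<otimes>\<^bsub>poly_ring V\<^esub> q = p * q"
    "\<And>p q :: 'k mpoly. p \<oplus>\<^bsub>poly_ring V\<^esub> q = p + q"
    "\<zero>\<^bsub>poly_ring V\<^esub> = (0 :: 'k mpoly)" "\<one>\<^bsub>poly_ring V\<^esub> = (1 :: 'k mpoly)"
    by (simp_all add: poly_ring_def)
  show ?thesis
  proof (rule cringI)
    show "abelian_group (poly_ring V :: 'k mpoly ring)"
      by (rule abelian_groupI; unfold ring)
        (rule add zero add.assoc add.commute add_0 minus; assumption)+
    show "comm_monoid (poly_ring V :: 'k mpoly ring)"
      by (rule comm_monoidI; unfold ring)
        (rule mult one mult.assoc mult.commute mult_1; assumption)+
  qed (unfold ring, rule distrib_right)
qed

section \<open>Graded Betti numbers\<close>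

text \<open>Write \<open>S\<close> for \<open>poly_ring V\<close>. A value of the following record encodes graded
  free \<open>S\<close>-modules \<open>F\<^sub>i = \<Oplus>\<^bsub>k < rk i\<^esub> S(-shift i k)\<close>, together with the matrices
  \<open>bd i\<close> of maps \<open>F\<^bsub>i+1\<^esub> \<rightarrow> F\<^sub>i\<close> and polynomials \<open>aug k\<close> representing the images in
  \<open>S/I\<close> of the basis elements of \<open>F\<^sub>0\<close> under an augmentation \<open>F\<^sub>0 \<rightarrow> S/I\<close>. Elements of
  \<open>F\<^sub>i\<close> are coordinate functions on \<open>nat\<close> vanishing outside \<open>{..<rk i}\<close>.\<close>

record (overloaded) 'k free_cpx =
  rk :: "nat \<Rightarrow> nat"
  shift :: "nat \<Rightarrow> nat \<Rightarrow> int"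
  aug :: "nat \<Rightarrow> 'k mpoly"
  bd :: "nat \<Rightarrow> nat \<Rightarrow> nat \<Rightarrow> 'k mpoly"

definition mat_app :: "nat \<Rightarrow> (nat \<Rightarrow> nat \<Rightarrow> 'r::semiring_0) \<Rightarrow> (nat \<Rightarrow> 'r) \<Rightarrow> nat \<Rightarrow> 'r" where
  "mat_app c A v = (\<lambda>k. \<Sum>l<c. A k l * v l)"

definition free_mod :: "nat set \<Rightarrow> nat \<Rightarrow> (nat \<Rightarrow> ('k::comm_ring_1) mpoly) set" where
  "free_mod V r = {f. \<forall>k. f k \<in> carrier (poly_ring V) \<and> (k \<ge> r \<longrightarrow> f k = 0)}"

definition graded_free_resolution ::
    "nat set \<Rightarrow> ('k::comm_ring_1) mpoly set \<Rightarrow> 'k free_cpx \<Rightarrow> bool" where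
  "graded_free_resolution V I F \<longleftrightarrow>
     (\<forall>k<rk F 0. aug F k \<in> carrier (poly_ring V) \<and> homogeneous (aug F k) (shift F 0 k)) \<and>
     (\<forall>i k l. if k < rk F i \<and> l < rk F (Suc i)
        then bd F i k l \<in> carrier (poly_ring V) \<and>
             homogeneous (bd F i k l) (shift F (Suc i) l - shift F i k)
        else bd F i k l = 0) \<and>
     (\<forall>s\<in>carrier (poly_ring V). \<exists>f\<in>free_mod V (rk F 0). s - (\<Sum>k<rk F 0. f k * aug F k) \<in> I) \<and>
     {f \<in> free_mod V (rk F 0). (\<Sum>k<rk F 0. f k * aug F k) \<in> I}
       = mat_app (rk F 1) (bd F 0) ` free_mod V (rk F 1) \<and>
     (\<forall>i. {f \<in> free_mod V (rk F (Suc i)). mat_app (rk F (Suc i)) (bd F i) f = 0}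
       = mat_app (rk F (Suc (Suc i))) (bd F (Suc i)) ` free_mod V (rk F (Suc (Suc i))))"

text \<open>The complex \<open>F \<otimes>\<^sub>S K\<close> with \<open>K = S/(x, y)\<close>: in homological degree \<open>i\<close> and internal
  degree \<open>j\<close> it is the \<open>K\<close>-span of the basis elements of \<open>F\<^sub>i\<close> of degree \<open>j\<close>, and the
  matrices of its differentials are the constant terms of those of \<open>F\<close>.\<close>

definition tensor_part :: "('k::comm_ring_1) free_cpx \<Rightarrow> nat \<Rightarrow> int \<Rightarrow> (nat \<Rightarrow> 'k) set" where
  "tensor_part F i j = {v. \<forall>k. v k \<noteq> 0 \<longrightarrow> k < rk F i \<and> shift F i k = j}"

definition tensor_bd :: "('k::comm_ring_1) free_cpx \<Rightarrow> nat \<Rightarrow> (nat \<Rightarrow> 'k) \<Rightarrow> nat \<Rightarrow> 'k" where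
  "tensor_bd F i = mat_app (rk F (Suc i)) (\<lambda>k l. Poly_Mapping.lookup (bd F i k l) 0)"

definition tensor_cycles :: "('k::comm_ring_1) free_cpx \<Rightarrow> nat \<Rightarrow> int \<Rightarrow> (nat \<Rightarrow> 'k) set" where
  "tensor_cycles F i j =
     {v \<in> tensor_part F i j. \<forall>i'. i = Suc i' \<longrightarrow> tensor_bd F i' v = 0}"

definition tensor_boundaries :: "('k::comm_ring_1) free_cpx \<Rightarrow> nat \<Rightarrow> int \<Rightarrow> (nat \<Rightarrow> 'k) set" where
  "tensor_boundaries F i j = tensor_bd F i ` tensor_part F (Suc i) j"

definition fscale :: "'k::field \<Rightarrow> (nat \<Rightarrow> 'k) \<Rightarrow> nat \<Rightarrow> 'k" where
  "fscale c v = (\<lambda>k. c * v k)"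

lemma vector_space_fscale: "vector_space (fscale :: 'k::field \<Rightarrow> _)"
  by unfold_locales (simp_all add: fscale_def fun_eq_iff algebra_simps)

text \<open>\<open>betti V I i j\<close> is the dimension of the degree \<open>j\<close> part of \<open>Tor\<^sub>i(S/I, K)\<close>, computed
  from an arbitrary graded free resolution of \<open>S/I\<close> for a homogeneous ideal \<open>I\<close>. The
  boundaries are a subspace of the finite-dimensional space of cycles, so the
  subtraction does not truncate.\<close>

definition betti :: "nat set \<Rightarrow> ('k::field) mpoly set \<Rightarrow> nat \<Rightarrow> int \<Rightarrow> nat" where
  "betti V I i j =
     (let F = (SOME F. graded_free_resolution V I F) in
        vector_space.dim fscale (tensor_cycles F i j)
          - vector_space.dim fscale (tensor_boundaries F i j))"

definition reg :: "nat set \<Rightarrow> ('k::field) mpoly set \<Rightarrow> int" where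
  "reg V I = Max {j. \<exists>i. betti V I i (int i + j) \<noteq> 0}"

definition extremal_betti :: "nat set \<Rightarrow> ('k::field) mpoly set \<Rightarrow> nat \<Rightarrow> int \<Rightarrow> bool" where
  "extremal_betti V I i j \<longleftrightarrow>
     betti V I i (int i + j) \<noteq> 0 \<and>
     (\<forall>k l. (k, l) \<noteq> (i, j) \<and> k \<ge> i \<and> l \<ge> j \<longrightarrow> betti V I k (int k + l) = 0)"

end

theory Submission
  imports Defs
begin

text \<open>The Betti numbers of \<open>S/J\<^sub>G\<close> are read off from Koszul homology, where nonvanishing can be tracked
  through long exact sequences without dimension counts. The family of maximal cliques of a
  block graph is an acyclic hypergraph, a notion that is stable under the two operations in Ohtani's
  decomposition \<open>J\<^sub>G = J\<^bsub>G\<^sub>v\<^esub> \<inter> ((x\<^sub>v, y\<^sub>v) + J\<^bsub>G - v\<^esub>)\<close>: merging the cliques at an inner vertex \<open>v\<close>, and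
  deleting \<open>v\<close>. Induction on the number of inner vertices along the Mayer--Vietoris sequence shows that
  the last column of the Betti table, of index \<open>n - 1\<close>, has its lowest nonzero entry in row \<open>i(G) + 1\<close>;
  this entry is extremal, and (a) follows.

  Call a clique at \<open>v\<close> a petal if it has at least three vertices or is an edge \<open>vw\<close> with
  \<open>cdeg w \<ge> 3\<close>. If no vertex has three petals, then the same induction bounds all rows by \<open>i(G) + 1\<close>, so the
  extremal Betti number is unique. If \<open>v\<close> has three petals, then the corner entry of \<open>G - v\<close> lies in a
  lower row, and it survives in \<open>G\<close> because \<open>J\<^sub>G\<close> lies between \<open>J\<^bsub>G - v\<^esub>\<close> and \<open>J\<^bsub>G - v\<^esub> + (x\<^sub>v, y\<^sub>v)\<close>, where
  \<open>x\<^sub>v, y\<^sub>v\<close> do not occur in \<open>J\<^bsub>G - v\<^esub>\<close>. Conditions (ii) and (iii) both say that no vertex has three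
  petals: a petal at \<open>v\<close> contains a triangle or a fork at \<open>v\<close>, and in the indecomposable case the
  petals are the cliques at \<open>v\<close> without vertices of degree 1.\<close>

section \<open>Koszul homology\<close>

text \<open>Deleting a vertex may disconnect the graph, so the induction runs over acyclic
  hypergraphs with any number of components; \<open>card (\<Union>\<B>) - hpd \<B>\<close> is that
  number, and for a connected graph it is the 1 in i(G) + 1. The third Mayer--Vietoris term, the sum
  of the two ideals, is of the same kind: merge at v, then delete v, and adjoin x_v, y_v. Columns
  decide what survives: this sum has a corner one column beyond the last columns of the two ideals,
  so the corner can only come from the intersection, with column index one less and row index one
  more.

  The definition of \<open>betti\<close> picks some graded free resolution, so one has to exist. Its
  existence is extracted from the same induction: it bounds the rows of the Koszul homology, so
  every column vanishes in high degrees, and this property yields finite generating sets and passes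
  to syzygies. A resolution and the Koszul complex are compared by dimension shift. This compares
  vanishing only, which is enough, since regularity and extremality depend only on which Betti
  numbers are nonzero.\<close>

fun vord :: "vname \<Rightarrow> nat" where
  "vord (X i) = 2 * i"
| "vord (Y i) = 2 * i + 1"

lemma vord_inj: "vord a = vord b \<longleftrightarrow> a = b"
  by (cases a; cases b; simp; presburger)

text \<open>The sign of moving e_z past the smaller elements of \<tau>, in the order of variables
  fixed by \<open>vord\<close>.\<close>

definition ksgn :: "vname \<Rightarrow> vname set \<Rightarrow> 'm::comm_ring_1" where
  "ksgn z \<tau> = (-1) ^ card {u \<in> \<tau>. vord u < vord z}"

lemma ksgn_sq: "ksgn z \<tau> * ksgn z \<tau> = (1 :: 'm::comm_ring_1)"
  unfolding ksgn_def by (simp flip: power_mult_distrib)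

lemma ksgn_cases: "ksgn z \<tau> = (1 :: 'm::comm_ring_1) \<or> ksgn z \<tau> = (-1 :: 'm)"
  unfolding ksgn_def by (cases "even (card {u \<in> \<tau>. vord u < vord z})") auto

lemma ksgn_insert:
  assumes "finite \<tau>" "w \<notin> \<tau>"
  shows "ksgn z (insert w \<tau>) = (if vord w < vord z then - ksgn z \<tau> else (ksgn z \<tau> :: 'm::comm_ring_1))"
proof (cases "vord w < vord z")
  case True
  have "{u \<in> insert w \<tau>. vord u < vord z} = insert w {u \<in> \<tau>. vord u < vord z}"
    using True by auto
  then show ?thesis using assms True by (simp add: ksgn_def)
next
  case False
  have "{u \<in> insert w \<tau>. vord u < vord z} = {u \<in> \<tau>. vord u < vord z}"
    using False by auto
  then show ?thesis using False by (simp add: ksgn_def)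
qed

text \<open>Of two distinct variables exactly one is the larger, and only its sign changes when the
  other is inserted. This one minus sign gives both d d = 0 and the Leibniz rule.\<close>

lemma ksgn_swap:
  assumes "finite \<tau>" "z \<notin> \<tau>" "w \<notin> \<tau>" "z \<noteq> w"
  shows "ksgn z \<tau> * ksgn w (insert z \<tau>) = - (ksgn w \<tau> * ksgn z (insert w \<tau>) :: 'm::comm_ring_1)"
proof -
  have "vord z < vord w \<or> vord w < vord z"
    using assms(4) vord_inj by (metis linorder_neqE_nat)
  then show ?thesis
    using assms by (auto simp: ksgn_insert mult.commute)
qed

text \<open>A chain is the family of its coefficients, \<open>c \<sigma>\<close> being the
  coefficient of the exterior monomial e_\<sigma>. The differential is therefore given by its
  coefficient at \<tau>, to which every \<sigma> with one more element contributes.\<close>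

definition kdiff :: "(vname \<Rightarrow> 'm::comm_ring_1) \<Rightarrow> vname set \<Rightarrow> (vname set \<Rightarrow> 'm) \<Rightarrow> vname set \<Rightarrow> 'm" where
  "kdiff \<xi> W c \<tau> = (\<Sum>z\<in>W - \<tau>. ksgn z \<tau> * \<xi> z * c (insert z \<tau>))"

text \<open>Exterior multiplication by e_w from the left.\<close>

definition kwedge :: "vname \<Rightarrow> (vname set \<Rightarrow> 'm::comm_ring_1) \<Rightarrow> vname set \<Rightarrow> 'm" where
  "kwedge w c \<tau> = (if w \<in> \<tau> then ksgn w (\<tau> - {w}) * c (\<tau> - {w}) else 0)"

text \<open>The exterior generators have degree 1, so in internal degree d the coefficients of a
  p-chain have degree d - p.\<close>

definition kchain :: "vname set \<Rightarrow> (int \<Rightarrow> 'm::comm_ring_1 set) \<Rightarrow> nat \<Rightarrow> int \<Rightarrow> (vname set \<Rightarrow> 'm) set" where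
  "kchain W A p d =
     {c. \<forall>\<sigma>. c \<sigma> \<in> A (d - int p) \<and> (\<not> (\<sigma> \<subseteq> W \<and> card \<sigma> = p) \<longrightarrow> c \<sigma> = 0)}"

text \<open>\<open>kvan \<xi> W A B p d\<close> says that the Koszul homology \<open>H\<^sub>p(\<xi>; A/B)\<close> vanishes in internal
  degree \<open>d\<close>; the graded module \<open>A/B\<close> is given by the families of the homogeneous parts of
  \<open>A\<close> and \<open>B\<close>.\<close>

definition kvan :: "(vname \<Rightarrow> 'm::comm_ring_1) \<Rightarrow> vname set \<Rightarrow> (int \<Rightarrow> 'm set) \<Rightarrow> (int \<Rightarrow> 'm set) \<Rightarrow> nat \<Rightarrow> int \<Rightarrow> bool" where
  "kvan \<xi> W A B p d \<longleftrightarrow>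
     (\<forall>c\<in>kchain W A p d. (\<forall>\<tau>. kdiff \<xi> W c \<tau> \<in> B (d - int p + 1)) \<longrightarrow>
        (\<exists>b\<in>kchain W A (Suc p) d. \<forall>\<tau>. c \<tau> - kdiff \<xi> W b \<tau> \<in> B (d - int p)))"

text \<open>A graded subgroup stable under the variables in W. The ambient ring is arbitrary because
  the notion serves both for ideals of the polynomial ring and for submodules of free
  modules.\<close>

definition gsub :: "(vname \<Rightarrow> 'm::comm_ring_1) \<Rightarrow> vname set \<Rightarrow> (int \<Rightarrow> 'm set) \<Rightarrow> bool" where
  "gsub \<xi> W A \<longleftrightarrow> (\<forall>d. 0 \<in> A d \<and> (\<forall>a\<in>A d. \<forall>b\<in>A d. a - b \<in> A d) \<and>
     (\<forall>z\<in>W. \<forall>a\<in>A d. \<xi> z * a \<in> A (d + 1)))"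

lemma gsub_0: "gsub \<xi> W A \<Longrightarrow> 0 \<in> A d"
  and gsub_diff: "gsub \<xi> W A \<Longrightarrow> a \<in> A d \<Longrightarrow> b \<in> A d \<Longrightarrow> a - b \<in> A d"
  and gsub_mult: "gsub \<xi> W A \<Longrightarrow> z \<in> W \<Longrightarrow> a \<in> A d \<Longrightarrow> \<xi> z * a \<in> A (d + 1)"
  by (auto simp: gsub_def)

lemma gsub_uminus: "gsub \<xi> W A \<Longrightarrow> a \<in> A d \<Longrightarrow> - a \<in> A d"
  using gsub_diff[of \<xi> W A 0 d a] gsub_0[of \<xi> W A d] by simp

lemma gsub_add: "gsub \<xi> W A \<Longrightarrow> a \<in> A d \<Longrightarrow> b \<in> A d \<Longrightarrow> a + b \<in> A d"
  using gsub_diff[of \<xi> W A a d "-b"] gsub_uminus[of \<xi> W A b d] by simp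

lemma gsub_sum: "gsub \<xi> W A \<Longrightarrow> (\<And>i. i \<in> I \<Longrightarrow> f i \<in> A d) \<Longrightarrow> sum f I \<in> A d"
  by (induction I rule: infinite_finite_induct) (auto intro: gsub_add gsub_0)

lemma gsub_sgn:
  fixes A :: "int \<Rightarrow> 'm::comm_ring_1 set"
  shows "gsub \<xi> W A \<Longrightarrow> a \<in> A d \<Longrightarrow> ksgn z \<tau> * a \<in> A d"
  using ksgn_cases[of z \<tau>, where 'm = 'm] by (auto intro: gsub_uminus)

lemma gsub_zero: "gsub \<xi> W (\<lambda>_. {0})"
  by (simp add: gsub_def)

lemma kdiff_zero [simp]: "kdiff \<xi> W 0 = 0" "kdiff \<xi> W (\<lambda>_. 0) = 0"
  by (simp_all add: kdiff_def fun_eq_iff)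

lemma kdiff_add: "kdiff \<xi> W (b + c) = kdiff \<xi> W b + kdiff \<xi> W c"
  by (simp add: kdiff_def fun_eq_iff algebra_simps sum.distrib)

lemma kdiff_diff: "kdiff \<xi> W (b - c) = kdiff \<xi> W b - kdiff \<xi> W c"
  by (simp add: kdiff_def fun_eq_iff algebra_simps sum_subtractf)

lemma kdiff_scale: "kdiff \<xi> W (\<lambda>\<tau>. r * c \<tau>) = (\<lambda>\<tau>. r * kdiff \<xi> W c \<tau>)"
  by (simp add: kdiff_def fun_eq_iff sum_distrib_left algebra_simps)

lemma kchainI:
  "(\<And>\<sigma>. c \<sigma> \<in> A (d - int p)) \<Longrightarrow> (\<And>\<sigma>. \<not> (\<sigma> \<subseteq> W \<and> card \<sigma> = p) \<Longrightarrow> c \<sigma> = 0) \<Longrightarrow> c \<in> kchain W A p d"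
  by (auto simp: kchain_def)

lemma kchain_val: "c \<in> kchain W A p d \<Longrightarrow> e = d - int p \<Longrightarrow> c \<sigma> \<in> A e"
  and kchain_supp: "c \<in> kchain W A p d \<Longrightarrow> \<not> (\<sigma> \<subseteq> W \<and> card \<sigma> = p) \<Longrightarrow> c \<sigma> = 0"
  by (auto simp: kchain_def)

lemma kchain_sub: "c \<in> kchain W A p d \<Longrightarrow> (\<And>\<sigma>. c \<sigma> \<in> B (d - int p)) \<Longrightarrow> c \<in> kchain W B p d"
  by (auto simp: kchain_def)

lemma kchain_mono: "c \<in> kchain W A p d \<Longrightarrow> (\<And>d. A d \<subseteq> B d) \<Longrightarrow> c \<in> kchain W B p d"
  by (force simp: kchain_def)

lemma kchain_diff: "gsub \<xi> W A \<Longrightarrow> b \<in> kchain W A p d \<Longrightarrow> c \<in> kchain W A p d \<Longrightarrow> b - c \<in> kchain W A p d"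
  by (auto simp: kchain_def gsub_diff)

lemma kchain_add: "gsub \<xi> W A \<Longrightarrow> b \<in> kchain W A p d \<Longrightarrow> c \<in> kchain W A p d \<Longrightarrow> b + c \<in> kchain W A p d"
  by (auto simp: kchain_def gsub_add)

lemma kchain_zero: "gsub \<xi> W A \<Longrightarrow> 0 \<in> kchain W A p d"
  by (auto simp: kchain_def gsub_0)

lemma kchain_scale:
  "gsub \<xi> W A \<Longrightarrow> z \<in> W \<Longrightarrow> c \<in> kchain W A p d \<Longrightarrow> (\<lambda>\<tau>. \<xi> z * c \<tau>) \<in> kchain W A p (d + 1)"
  using gsub_mult[of \<xi> W A z _ "d - int p"] by (fastforce simp: kchain_def algebra_simps)

text \<open>The decompositions are chosen coefficient by coefficient and set to zero off the
  support, so that both parts are chains again.\<close>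

lemma kchain_split:
  assumes c: "c \<in> kchain W A p d" and z: "0 \<in> B (d - int p)" "0 \<in> C e"
    and ex: "\<And>\<sigma>. \<exists>a\<in>B (d - int p). \<exists>s\<in>C e. c \<sigma> = a + r * s" and e: "e = d' - int p"
  obtains a s where "a \<in> kchain W B p d" "s \<in> kchain W C p d'"
    "\<And>\<sigma>. c \<sigma> = a \<sigma> + r * s \<sigma>"
proof -
  let ?P = "\<lambda>\<sigma>. \<sigma> \<subseteq> W \<and> card \<sigma> = p"
  obtain a s where as: "\<And>\<sigma>. a \<sigma> \<in> B (d - int p) \<and> s \<sigma> \<in> C e \<and> c \<sigma> = a \<sigma> + r * s \<sigma>"
    using ex by metis
  show ?thesis
  proof (rule that[of "\<lambda>\<sigma>. if ?P \<sigma> then a \<sigma> else 0" "\<lambda>\<sigma>. if ?P \<sigma> then s \<sigma> else 0"])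
    show "c \<sigma> = (if ?P \<sigma> then a \<sigma> else 0) + r * (if ?P \<sigma> then s \<sigma> else 0)" for \<sigma>
      using as[of \<sigma>] kchain_supp[OF c, of \<sigma>] by auto
  qed (use as z e in \<open>auto simp: kchain_def\<close>)
qed

context
  fixes \<xi> :: "vname \<Rightarrow> 'm::comm_ring_1" and W :: "vname set"
  assumes finW: "finite W"
begin

lemma kdiff_val:
  assumes "gsub \<xi> W A" "\<And>\<tau>. c \<tau> \<in> A e"
  shows "kdiff \<xi> W c \<tau> \<in> A (e + 1)"
  unfolding kdiff_def mult.assoc
  by (intro gsub_sum[OF assms(1)] gsub_sgn[OF assms(1)] gsub_mult[OF assms(1)] assms(2)) auto

lemma kdiff_supp:
  assumes "c \<in> kchain W A p d" "\<not> (\<tau> \<subseteq> W \<and> Suc (card \<tau>) = p)"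
  shows "kdiff \<xi> W c \<tau> = 0"
  unfolding kdiff_def
proof (rule sum.neutral, rule ballI)
  fix z assume z: "z \<in> W - \<tau>"
  have "\<not> (insert z \<tau> \<subseteq> W \<and> card (insert z \<tau>) = p)"
  proof
    assume a: "insert z \<tau> \<subseteq> W \<and> card (insert z \<tau>) = p"
    then have "finite \<tau>" using finW by (meson finite_subset insert_subset)
    then show False using a z assms(2) by simp
  qed
  then show "ksgn z \<tau> * \<xi> z * c (insert z \<tau>) = 0"
    using kchain_supp[OF assms(1)] by simp
qed

lemma kdiff_chain:
  assumes "gsub \<xi> W A" "c \<in> kchain W A (Suc p) d"
  shows "kdiff \<xi> W c \<in> kchain W A p d"
proof (rule kchainI)
  show "kdiff \<xi> W c \<sigma> \<in> A (d - int p)" for \<sigma>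
    using kdiff_val[OF assms(1), of c "d - int (Suc p)" \<sigma>] kchain_val[OF assms(2)] by simp
  show "\<not> (\<sigma> \<subseteq> W \<and> card \<sigma> = p) \<Longrightarrow> kdiff \<xi> W c \<sigma> = 0" for \<sigma>
    using kdiff_supp[OF assms(2), of \<sigma>] by simp
qed

lemma kdiff_kdiff:
  assumes "c \<in> kchain W A p d"
  shows "kdiff \<xi> W (kdiff \<xi> W c) = 0"
proof
  fix \<tau>
  show "kdiff \<xi> W (kdiff \<xi> W c) \<tau> = 0 \<tau>"
  proof (cases "\<tau> \<subseteq> W")
    case False
    then have "kdiff \<xi> W c (insert z \<tau>) = 0" for z
      by (intro kdiff_supp[OF assms]) auto
    then show ?thesis by (simp add: kdiff_def[of _ _ "kdiff \<xi> W c"])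
  next
    case True
    then have fin: "finite \<tau>" using finW finite_subset by blast
    let ?g = "\<lambda>(z, w). ksgn z \<tau> * ksgn w (insert z \<tau>) * (\<xi> z * \<xi> w * c (insert z (insert w \<tau>)))"
    let ?S = "{(z, w). z \<in> W - \<tau> \<and> w \<in> W - \<tau> \<and> z \<noteq> w}"
    have finS: "finite ?S"
      by (rule finite_subset[of _ "W \<times> W"]) (use finW in auto)
    have eq: "kdiff \<xi> W (kdiff \<xi> W c) \<tau> = sum ?g ?S"
    proof -
      have "kdiff \<xi> W (kdiff \<xi> W c) \<tau> =
          (\<Sum>z\<in>W - \<tau>. \<Sum>w\<in>W - insert z \<tau>. ?g (z, w))"
        unfolding kdiff_def sum_distrib_left
        by (intro sum.cong refl) (simp add: algebra_simps insert_commute)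
      also have "\<dots> = sum ?g (Sigma (W - \<tau>) (\<lambda>z. W - insert z \<tau>))"
        using finW by (subst sum.Sigma) auto
      also have "Sigma (W - \<tau>) (\<lambda>z. W - insert z \<tau>) = ?S" by auto
      finally show ?thesis .
    qed
    \<comment> \<open>Exchanging the two inserted variables is a bijection between these halves of
      the index set, and it reverses the sign of the summand.\<close>
    let ?L = "{(z, w) \<in> ?S. vord z < vord w}" and ?R = "{(z, w) \<in> ?S. vord w < vord z}"
    have "vord z < vord w \<or> vord w < vord z" if "z \<noteq> w" for z w
      using that vord_inj by (metis linorder_neqE_nat)
    then have "?S = ?L \<union> ?R" by blast
    moreover have "?L \<inter> ?R = {}" by auto
    moreover have "finite ?L" "finite ?R" by (rule finite_subset[OF _ finS]; auto)+
    ultimately have "sum ?g ?S = sum ?g ?L + sum ?g ?R"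
      by (metis (no_types, lifting) sum.union_disjoint)
    moreover have "sum ?g ?R = (\<Sum>x\<in>?L. ?g (prod.swap x))"
      by (rule sum.reindex_bij_witness[of _ prod.swap prod.swap]) auto
    moreover have "\<dots> = (\<Sum>x\<in>?L. - ?g x)"
    proof (rule sum.cong[OF refl])
      fix x assume "x \<in> ?L"
      then obtain z w where x: "x = (z, w)" "z \<notin> \<tau>" "w \<notin> \<tau>" "z \<noteq> w" by auto
      show "?g (prod.swap x) = - ?g x"
        using ksgn_swap[OF fin x(3,2), where 'm = 'm] x(4)
        by (simp add: x(1) insert_commute[of w z] mult.commute[of "\<xi> w"])
    qed
    ultimately show ?thesis using eq by (simp add: sum_negf)
  qed
qed

lemma kwedge_chain:
  assumes "gsub \<xi> W A" "c \<in> kchain W A p d" "w \<in> W"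
  shows "kwedge w c \<in> kchain W A (Suc p) (d + 1)"
proof (rule kchainI)
  show "kwedge w c \<sigma> \<in> A (d + 1 - int (Suc p))" for \<sigma>
    using kchain_val[OF assms(2) refl, of "\<sigma> - {w}"]
    by (auto simp: kwedge_def intro: gsub_sgn[OF assms(1)] gsub_0[OF assms(1)])
  fix \<sigma> assume n: "\<not> (\<sigma> \<subseteq> W \<and> card \<sigma> = Suc p)"
  show "kwedge w c \<sigma> = 0"
  proof (cases "w \<in> \<sigma>")
    case True
    have "\<not> (\<sigma> - {w} \<subseteq> W \<and> card (\<sigma> - {w}) = p)"
    proof
      assume a: "\<sigma> - {w} \<subseteq> W \<and> card (\<sigma> - {w}) = p"
      then have "finite \<sigma>" using finW finite_subset by (metis finite_Diff2 finite.emptyI finite.insertI)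
      then have "card \<sigma> = Suc p" using a True by (metis card_Suc_Diff1)
      then show False using a n assms(3) by auto
    qed
    then show ?thesis using kchain_supp[OF assms(2), of "\<sigma> - {w}"] by (simp add: kwedge_def)
  qed (simp add: kwedge_def)
qed

lemma kwedge_val:
  assumes "gsub \<xi> W A" "\<And>\<tau>. c \<tau> \<in> A e"
  shows "kwedge w c \<tau> \<in> A e"
  using assms by (auto simp: kwedge_def intro: gsub_sgn gsub_0)

text \<open>The Leibniz rule for the Koszul differential, with d e_w = \<xi>_w. It makes
  multiplication by a variable null-homotopic, which is what all results on regular variables below
  rest on.\<close>

lemma kwedge_homotopy:
  assumes c: "c \<in> kchain W A p d" and w: "w \<in> W"
  shows "kdiff \<xi> W (kwedge w c) \<tau> + kwedge w (kdiff \<xi> W c) \<tau> = \<xi> w * c \<tau>"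
proof (cases "\<tau> \<subseteq> W")
  case False
  then obtain x where "x \<in> \<tau>" "x \<notin> W" "x \<noteq> w" using w by auto
  then have "\<not> \<tau> \<subseteq> W" "\<And>z. \<not> insert z \<tau> - {w} \<subseteq> W" "\<not> \<tau> - {w} \<subseteq> W"
    by auto
  then have "c \<tau> = 0" "\<And>z. c (insert z \<tau> - {w}) = 0" "kdiff \<xi> W c (\<tau> - {w}) = 0"
    by (simp_all add: kchain_supp[OF c] kdiff_supp[OF c])
  then have "kwedge w c (insert z \<tau>) = 0" for z by (simp add: kwedge_def)
  then show ?thesis
    using \<open>c \<tau> = 0\<close> \<open>kdiff \<xi> W c (\<tau> - {w}) = 0\<close>
    by (simp add: kdiff_def[of _ _ "kwedge w c"]) (simp add: kwedge_def)
next
  case True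
  then have fin: "finite \<tau>" using finW finite_subset by blast
  show ?thesis
  proof (cases "w \<in> \<tau>")
    case False
    have "kdiff \<xi> W (kwedge w c) \<tau> = (\<Sum>z\<in>W - \<tau>. if z = w then \<xi> w * c \<tau> else 0)"
      unfolding kdiff_def
    proof (rule sum.cong[OF refl])
      fix z assume "z \<in> W - \<tau>"
      have "ksgn w \<tau> * \<xi> w * (ksgn w \<tau> * c \<tau>) = (ksgn w \<tau> * ksgn w \<tau>) * (\<xi> w * c \<tau>)"
        by (simp only: ac_simps)
      then show "ksgn z \<tau> * \<xi> z * kwedge w c (insert z \<tau>) = (if z = w then \<xi> w * c \<tau> else 0)"
        using False by (auto simp: kwedge_def ksgn_sq)
    qed
    also have "\<dots> = \<xi> w * c \<tau>" using w False finW by simp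
    finally show ?thesis using False by (simp add: kwedge_def)
  next
    case T: True
    define \<rho> where "\<rho> = \<tau> - {w}"
    have \<tau>: "\<tau> = insert w \<rho>" "w \<notin> \<rho>" "finite \<rho>" using T fin by (auto simp: \<rho>_def)
    \<comment> \<open>In the differential at \<open>\<rho>\<close> the summand z = w gives
      \<open>\<xi> w * c \<tau>\<close>; the other summands cancel against the differential of the
      wedge by \<open>ksgn_swap\<close>.\<close>
    have sp: "W - \<rho> = insert w (W - \<tau>)" "w \<notin> W - \<tau>" using \<tau> w by auto
    have "kwedge w (kdiff \<xi> W c) \<tau> = ksgn w \<rho> * kdiff \<xi> W c \<rho>"
      using T by (simp add: kwedge_def \<rho>_def)
    also have "\<dots> = ksgn w \<rho> * (ksgn w \<rho> * \<xi> w * c \<tau>) +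
        (\<Sum>z\<in>W - \<tau>. ksgn w \<rho> * (ksgn z \<rho> * \<xi> z * c (insert z \<rho>)))"
      unfolding kdiff_def sp(1) using finW sp(2)
      by (subst sum.insert) (auto simp: algebra_simps sum_distrib_left \<tau>(1))
    also have "ksgn w \<rho> * (ksgn w \<rho> * \<xi> w * c \<tau>) = \<xi> w * c \<tau>"
      by (simp add: ksgn_sq flip: mult.assoc)
    finally have 1: "kwedge w (kdiff \<xi> W c) \<tau> = \<xi> w * c \<tau> +
        (\<Sum>z\<in>W - \<tau>. ksgn w \<rho> * (ksgn z \<rho> * \<xi> z * c (insert z \<rho>)))" .
    have 2: "kdiff \<xi> W (kwedge w c) \<tau> =
        - (\<Sum>z\<in>W - \<tau>. ksgn w \<rho> * (ksgn z \<rho> * \<xi> z * c (insert z \<rho>)))"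
      unfolding kdiff_def sum_negf[symmetric]
    proof (rule sum.cong[OF refl])
      fix z assume z: "z \<in> W - \<tau>"
      then have zw: "z \<noteq> w" "z \<notin> \<rho>" using \<tau> by auto
      have ins: "insert z \<tau> - {w} = insert z \<rho>" using zw \<tau> by auto
      have sw: "ksgn w \<rho> * ksgn z \<tau> = - (ksgn z \<rho> * ksgn w (insert z \<rho>) :: 'm)"
        using ksgn_swap[OF \<tau>(3,2) zw(2), where 'm='m] zw \<tau>(1) by simp
      have "ksgn z \<tau> * ksgn w (insert z \<rho>) = ksgn w \<rho> * ksgn w \<rho> * ksgn z \<tau> * (ksgn w (insert z \<rho>)::'m)"
        by (simp add: ksgn_sq)
      also have "\<dots> = - (ksgn w \<rho> * ksgn z \<rho> * (ksgn w (insert z \<rho>) * ksgn w (insert z \<rho>)))"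
        using sw by (metis (no_types, lifting) mult.assoc mult_minus_left mult_minus_right)
      finally have "ksgn z \<tau> * ksgn w (insert z \<rho>) = - (ksgn w \<rho> * ksgn z \<rho> :: 'm)"
        by (simp add: ksgn_sq)
      then have "ksgn z \<tau> * ksgn w (insert z \<rho>) * (\<xi> z * c (insert z \<rho>)) = - (ksgn w \<rho> * ksgn z \<rho>) * (\<xi> z * c (insert z \<rho>))"
        by simp
      then show "ksgn z \<tau> * \<xi> z * kwedge w c (insert z \<tau>) =
          - (ksgn w \<rho> * (ksgn z \<rho> * \<xi> z * c (insert z \<rho>)))"
        using T by (simp add: kwedge_def ins ac_simps)
    qed
    show ?thesis using 1 2 by simp
  qed
qed

lemma kvanD:
  assumes "kvan \<xi> W A B p d" "c \<in> kchain W A p d" "\<And>\<tau>. kdiff \<xi> W c \<tau> \<in> B (d - int p + 1)"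
  obtains b where "b \<in> kchain W A (Suc p) d" "\<And>\<tau>. c \<tau> - kdiff \<xi> W b \<tau> \<in> B (d - int p)"
  using assms unfolding kvan_def by blast

text \<open>Vanishing of \<open>H\<^sub>p(A/(I\<^sub>1 + I\<^sub>2))\<close> and \<open>H\<^sub>p(A/(I\<^sub>1 \<inter> I\<^sub>2))\<close> from the Mayer--Vietoris sequence.\<close>

lemma kvan_sum:
  assumes A: "gsub \<xi> W A" and I1: "gsub \<xi> W I1" and I2: "gsub \<xi> W I2"
    and sub: "\<And>d. I1 d \<subseteq> A d" "\<And>d. I2 d \<subseteq> A d"
    and S: "\<And>d x. x \<in> S d \<longleftrightarrow> (\<exists>a\<in>I1 d. \<exists>b\<in>I2 d. x = a + b)"
    and v0: "kvan \<xi> W A (\<lambda>d. I1 d \<inter> I2 d) p d"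
    and v1: "kvan \<xi> W A I1 (Suc p) d" and v2: "kvan \<xi> W A I2 (Suc p) d"
  shows "kvan \<xi> W A S (Suc p) d"
  unfolding kvan_def
proof (intro ballI impI)
  fix c assume c: "c \<in> kchain W A (Suc p) d" and "\<forall>\<tau>. kdiff \<xi> W c \<tau> \<in> S (d - int (Suc p) + 1)"
  then have ex: "\<exists>a\<in>I1 (d - int p). \<exists>b\<in>I2 (d - int p). kdiff \<xi> W c \<tau> = a + 1 * b" for \<tau>
    using S by simp
  obtain a b where a: "a \<in> kchain W I1 p d" and b: "b \<in> kchain W I2 p d"
    and ab: "\<And>\<tau>. kdiff \<xi> W c \<tau> = a \<tau> + 1 * b \<tau>"
    using kchain_split[OF kdiff_chain[OF A c], of I1 I2 "d - int p" 1 d] ex gsub_0[OF I1] gsub_0[OF I2]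
    by blast
  have aA: "a \<in> kchain W A p d" using kchain_mono[OF a sub(1)] .
  have abf: "kdiff \<xi> W c = a + b" using ab by (simp add: fun_eq_iff)
  \<comment> \<open>The class of \<open>a\<close> modulo the intersection is the image of
    \<open>c\<close> under the connecting map: as d d = 0, the boundaries of \<open>a\<close> and
    \<open>b\<close> are opposite and hence lie in both ideals.\<close>
  have "kdiff \<xi> W a + kdiff \<xi> W b = 0"
    using kdiff_kdiff[OF c] by (simp add: abf kdiff_add)
  then have ba: "kdiff \<xi> W b = - kdiff \<xi> W a" by (simp add: eq_neg_iff_add_eq_0 add.commute)
  have "kdiff \<xi> W a \<tau> \<in> I1 (d - int p + 1) \<inter> I2 (d - int p + 1)" for \<tau>
  proof
    show "kdiff \<xi> W a \<tau> \<in> I1 (d - int p + 1)"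
      using kdiff_val[OF I1, of a] kchain_val[OF a] by blast
    have "kdiff \<xi> W b \<tau> \<in> I2 (d - int p + 1)"
      using kdiff_val[OF I2, of b] kchain_val[OF b] by blast
    then show "kdiff \<xi> W a \<tau> \<in> I2 (d - int p + 1)"
      using gsub_uminus[OF I2] ba by fastforce
  qed
  then obtain e where e: "e \<in> kchain W A (Suc p) d"
    and ee: "\<And>\<tau>. a \<tau> - kdiff \<xi> W e \<tau> \<in> I1 (d - int p) \<inter> I2 (d - int p)"
    using kvanD[OF v0 aA] by blast
  have "kdiff \<xi> W e \<tau> \<in> I1 (d - int (Suc p) + 1)" for \<tau>
    using gsub_diff[OF I1 kchain_val[OF a refl, of \<tau>], of "a \<tau> - kdiff \<xi> W e \<tau>"] ee[of \<tau>] by simp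
  then obtain e1 where e1: "e1 \<in> kchain W A (Suc (Suc p)) d"
    and ee1: "\<And>\<tau>. e \<tau> - kdiff \<xi> W e1 \<tau> \<in> I1 (d - int (Suc p))"
    using kvanD[OF v1 e] by blast
  \<comment> \<open>Now \<open>c = e - (e - c)\<close>, where \<open>e\<close> is a cycle modulo I1
    and \<open>e - c\<close> a cycle modulo I2; both bound.\<close>
  have "kdiff \<xi> W (e - c) \<tau> \<in> I2 (d - int (Suc p) + 1)" for \<tau>
  proof -
    have "kdiff \<xi> W (e - c) \<tau> = - ((a \<tau> - kdiff \<xi> W e \<tau>) + b \<tau>)"
      by (simp add: kdiff_diff abf)
    also have "\<dots> \<in> I2 (d - int p)"
      using ee[of \<tau>] kchain_val[OF b refl, of \<tau>] by (intro gsub_uminus[OF I2] gsub_add[OF I2]) auto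
    finally show ?thesis by simp
  qed
  then obtain e2 where e2: "e2 \<in> kchain W A (Suc (Suc p)) d"
    and ee2: "\<And>\<tau>. (e - c) \<tau> - kdiff \<xi> W e2 \<tau> \<in> I2 (d - int (Suc p))"
    using kvanD[OF v2 kchain_diff[OF A e c]] by blast
  show "\<exists>b\<in>kchain W A (Suc (Suc p)) d. \<forall>\<tau>. c \<tau> - kdiff \<xi> W b \<tau> \<in> S (d - int (Suc p))"
  proof (intro bexI allI)
    show "e1 - e2 \<in> kchain W A (Suc (Suc p)) d" by (rule kchain_diff[OF A e1 e2])
    fix \<tau>
    have "c \<tau> - kdiff \<xi> W (e1 - e2) \<tau> = (e \<tau> - kdiff \<xi> W e1 \<tau>) + - ((e - c) \<tau> - kdiff \<xi> W e2 \<tau>)"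
      by (simp add: kdiff_diff)
    then show "c \<tau> - kdiff \<xi> W (e1 - e2) \<tau> \<in> S (d - int (Suc p))"
      unfolding S using ee1 gsub_uminus[OF I2 ee2] by blast
  qed
qed

lemma kvan_inter:
  assumes A: "gsub \<xi> W A" and I1: "gsub \<xi> W I1" and I2: "gsub \<xi> W I2"
    and sub: "\<And>d. I1 d \<subseteq> A d" "\<And>d. I2 d \<subseteq> A d"
    and S: "\<And>d x. x \<in> S d \<longleftrightarrow> (\<exists>a\<in>I1 d. \<exists>b\<in>I2 d. x = a + b)"
    and v0: "kvan \<xi> W A S (Suc p) d"
    and v1: "kvan \<xi> W A I1 p d" and v2: "kvan \<xi> W A I2 p d"
  shows "kvan \<xi> W A (\<lambda>d. I1 d \<inter> I2 d) p d"
  unfolding kvan_def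
proof (intro ballI impI)
  fix c assume c: "c \<in> kchain W A p d"
    and dc: "\<forall>\<tau>. kdiff \<xi> W c \<tau> \<in> I1 (d - int p + 1) \<inter> I2 (d - int p + 1)"
  obtain e1 where e1: "e1 \<in> kchain W A (Suc p) d" and ee1: "\<And>\<tau>. c \<tau> - kdiff \<xi> W e1 \<tau> \<in> I1 (d - int p)"
    using kvanD[OF v1 c] dc by blast
  obtain e2 where e2: "e2 \<in> kchain W A (Suc p) d" and ee2: "\<And>\<tau>. c \<tau> - kdiff \<xi> W e2 \<tau> \<in> I2 (d - int p)"
    using kvanD[OF v2 c] dc by blast
  \<comment> \<open>The chains bounding \<open>c\<close> modulo I1 and modulo I2 differ by a cycle
    modulo the sum; a primitive of it glues them.\<close>
  have "kdiff \<xi> W (e1 - e2) \<tau> \<in> S (d - int (Suc p) + 1)" for \<tau>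
  proof -
    have "kdiff \<xi> W (e1 - e2) \<tau> = - (c \<tau> - kdiff \<xi> W e1 \<tau>) + (c \<tau> - kdiff \<xi> W e2 \<tau>)"
      by (simp add: kdiff_diff)
    moreover have "d - int (Suc p) + 1 = d - int p" by simp
    ultimately show ?thesis unfolding S using ee2[of \<tau>] gsub_uminus[OF I1 ee1[of \<tau>]] by metis
  qed
  then obtain e where e: "e \<in> kchain W A (Suc (Suc p)) d"
    and ee: "\<And>\<tau>. (e1 - e2) \<tau> - kdiff \<xi> W e \<tau> \<in> S (d - int (Suc p))"
    using kvanD[OF v0 kchain_diff[OF A e1 e2]] by blast
  have "e1 - e2 - kdiff \<xi> W e \<in> kchain W A (Suc p) d"
    by (intro kchain_diff[OF A] e1 e2 kdiff_chain[OF A e])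
  moreover have "\<exists>a\<in>I1 (d - int (Suc p)). \<exists>b\<in>I2 (d - int (Suc p)). (e1 - e2 - kdiff \<xi> W e) \<tau> = a + 1 * b" for \<tau>
    using ee[of \<tau>] S by simp
  ultimately obtain a b where a: "a \<in> kchain W I1 (Suc p) d" and b: "b \<in> kchain W I2 (Suc p) d"
    and ab: "\<And>\<tau>. (e1 - e2 - kdiff \<xi> W e) \<tau> = a \<tau> + 1 * b \<tau>"
    using kchain_split[of "e1 - e2 - kdiff \<xi> W e" W A "Suc p" d I1 I2 "d - int (Suc p)" 1 d]
      gsub_0[OF I1] gsub_0[OF I2] by blast
  \<comment> \<open>\<open>e1\<close> corrected within I1 and \<open>e2\<close> corrected within I2
    agree up to a boundary, so \<open>e1 - a\<close> bounds \<open>c\<close> modulo both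
    ideals.\<close>
  have eq: "e1 - a = e2 + b + kdiff \<xi> W e" using ab by (auto simp: fun_eq_iff algebra_simps)
  then have eq': "kdiff \<xi> W (e1 - a) = kdiff \<xi> W e2 + kdiff \<xi> W b"
    using kdiff_kdiff[OF e] by (simp add: kdiff_add)
  show "\<exists>b\<in>kchain W A (Suc p) d. \<forall>\<tau>. c \<tau> - kdiff \<xi> W b \<tau> \<in> I1 (d - int p) \<inter> I2 (d - int p)"
  proof (intro bexI allI IntI)
    show "e1 - a \<in> kchain W A (Suc p) d" by (rule kchain_diff[OF A e1 kchain_mono[OF a sub(1)]])
    fix \<tau>
    have "c \<tau> - kdiff \<xi> W (e1 - a) \<tau> = (c \<tau> - kdiff \<xi> W e1 \<tau>) + kdiff \<xi> W a \<tau>"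
      by (simp add: kdiff_diff)
    then show "c \<tau> - kdiff \<xi> W (e1 - a) \<tau> \<in> I1 (d - int p)"
      using gsub_add[OF I1 ee1[of \<tau>] kchain_val[OF kdiff_chain[OF I1 a] refl, of \<tau>]] by metis
    have "c \<tau> - kdiff \<xi> W (e1 - a) \<tau> = (c \<tau> - kdiff \<xi> W e2 \<tau>) - kdiff \<xi> W b \<tau>"
      by (simp add: eq')
    then show "c \<tau> - kdiff \<xi> W (e1 - a) \<tau> \<in> I2 (d - int p)"
      using gsub_diff[OF I2 ee2[of \<tau>] kchain_val[OF kdiff_chain[OF I2 b] refl, of \<tau>]] by metis
  qed
qed

section \<open>Adjoining a regular variable to an ideal\<close>

context
  fixes A I I' :: "int \<Rightarrow> 'm set" and z :: vname
  assumes A: "gsub \<xi> W A" and I: "gsub \<xi> W I" and IA: "\<And>d. I d \<subseteq> A d" and z: "z \<in> W"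
    and I': "\<And>d x. x \<in> I' d \<longleftrightarrow> (\<exists>a\<in>I d. \<exists>s\<in>A (d - 1). x = a + \<xi> z * s)"
    and regular: "\<And>d s. s \<in> A d \<Longrightarrow> \<xi> z * s \<in> I (d + 1) \<Longrightarrow> s \<in> I d"
begin

text \<open>\<open>H\<^sub>p(A/I) \<rightarrow> H\<^sub>p(A/(I + zA))\<close> is injective, since \<open>z\<close> acts as zero on Koszul homology.\<close>

lemma kboundary_lift:
  assumes c: "c \<in> kchain W A p d" and dc: "\<And>\<tau>. kdiff \<xi> W c \<tau> \<in> I (d - int p + 1)"
    and b: "b \<in> kchain W A (Suc p) d" and cb: "\<And>\<tau>. c \<tau> - kdiff \<xi> W b \<tau> \<in> I' (d - int p)"
  shows "\<exists>b\<in>kchain W A (Suc p) d. \<forall>\<tau>. c \<tau> - kdiff \<xi> W b \<tau> \<in> I (d - int p)"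
proof -
  have "c - kdiff \<xi> W b \<in> kchain W A p d" by (intro kchain_diff[OF A] c kdiff_chain[OF A b])
  moreover have "\<exists>a\<in>I (d - int p). \<exists>s\<in>A (d - int p - 1). (c - kdiff \<xi> W b) \<tau> = a + \<xi> z * s" for \<tau>
    using cb[of \<tau>] I' by simp
  ultimately obtain a s where a: "a \<in> kchain W I p d" and s: "s \<in> kchain W A p (d - 1)"
    and as: "\<And>\<tau>. (c - kdiff \<xi> W b) \<tau> = a \<tau> + \<xi> z * s \<tau>"
    using kchain_split[of "c - kdiff \<xi> W b" W A p d I A "d - int p - 1" "\<xi> z" "d - 1"]
      gsub_0[OF I] gsub_0[OF A] by (auto simp: algebra_simps)
  have ceq: "c = kdiff \<xi> W b + a + (\<lambda>\<tau>. \<xi> z * s \<tau>)" using as by (auto simp: fun_eq_iff algebra_simps)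
  have ds: "kdiff \<xi> W s \<tau> \<in> I (d - 1 - int p + 1)" for \<tau>
  proof (rule regular)
    show "kdiff \<xi> W s \<tau> \<in> A (d - 1 - int p + 1)"
      by (rule kdiff_val[OF A]) (rule kchain_val[OF s refl])
    have "\<xi> z * kdiff \<xi> W s \<tau> = kdiff \<xi> W c \<tau> - kdiff \<xi> W a \<tau>"
      using kdiff_kdiff[OF b] by (simp add: ceq kdiff_add kdiff_scale)
    then show "\<xi> z * kdiff \<xi> W s \<tau> \<in> I (d - 1 - int p + 1 + 1)"
      using gsub_diff[OF I dc kdiff_val[OF I, of a, OF kchain_val[OF a refl]]] by simp
  qed
  show ?thesis
  proof (intro bexI allI)
    \<comment> \<open>The boundary of the wedge of z with s is z s minus the wedge of z with ds, and
      ds has coefficients in I by regularity. So this wedge absorbs the term z s.\<close>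
    show "b + kwedge z s \<in> kchain W A (Suc p) d"
      using kchain_add[OF A b] kwedge_chain[OF A s z] by simp
    fix \<tau>
    have "c \<tau> - kdiff \<xi> W (b + kwedge z s) \<tau> = a \<tau> + kwedge z (kdiff \<xi> W s) \<tau>"
      using kwedge_homotopy[OF s z, of \<tau>] by (simp add: ceq kdiff_add algebra_simps)
    moreover have "kwedge z (kdiff \<xi> W s) \<tau> \<in> I (d - int p)"
      using kwedge_val[OF I ds] by simp
    ultimately show "c \<tau> - kdiff \<xi> W (b + kwedge z s) \<tau> \<in> I (d - int p)"
      using gsub_add[OF I kchain_val[OF a refl]] by simp
  qed
qed

lemma sub_extended_ideal: "I d \<subseteq> I' d"
  using I' gsub_0[OF A] by force

lemma kvan_regular_same:
  assumes v: "kvan \<xi> W A I' p d"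
  shows "kvan \<xi> W A I p d"
  unfolding kvan_def
proof (intro ballI impI)
  fix c assume c: "c \<in> kchain W A p d" and dc: "\<forall>\<tau>. kdiff \<xi> W c \<tau> \<in> I (d - int p + 1)"
  then have "kdiff \<xi> W c \<tau> \<in> I' (d - int p + 1)" for \<tau> using sub_extended_ideal by blast
  then obtain b where "b \<in> kchain W A (Suc p) d" "\<And>\<tau>. c \<tau> - kdiff \<xi> W b \<tau> \<in> I' (d - int p)"
    using kvanD[OF v c] by blast
  then show "\<exists>b\<in>kchain W A (Suc p) d. \<forall>\<tau>. c \<tau> - kdiff \<xi> W b \<tau> \<in> I (d - int p)"
    using kboundary_lift[OF c] dc by blast
qed

text \<open>The map c -> e_z c induces an injection of H_p(A/I), shifted by one degree, into
  H_{p+1}(A/(I + zA)): the boundary of e_z c is z c modulo I, and in the end z can be cancelled by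
  regularity.\<close>

lemma kvan_regular_shift:
  assumes v: "kvan \<xi> W A I' (Suc p) (d + 1)"
  shows "kvan \<xi> W A I p d"
  unfolding kvan_def
proof (intro ballI impI)
  fix c assume c: "c \<in> kchain W A p d" and dc: "\<forall>\<tau>. kdiff \<xi> W c \<tau> \<in> I (d - int p + 1)"
  have e: "kwedge z c \<in> kchain W A (Suc p) (d + 1)" by (rule kwedge_chain[OF A c z])
  have de: "kdiff \<xi> W (kwedge z c) \<tau> = - kwedge z (kdiff \<xi> W c) \<tau> + \<xi> z * c \<tau>" for \<tau>
    using kwedge_homotopy[OF c z, of \<tau>] by (simp add: algebra_simps)
  have hI: "kwedge z (kdiff \<xi> W c) \<tau> \<in> I (d - int p + 1)" for \<tau>
    using dc by (intro kwedge_val[OF I]) auto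
  have "kdiff \<xi> W (kwedge z c) \<tau> \<in> I' (d + 1 - int (Suc p) + 1)" for \<tau>
    unfolding I' de using gsub_uminus[OF I hI[of \<tau>]] kchain_val[OF c refl, of \<tau>]
    by (intro bexI[of _ "- kwedge z (kdiff \<xi> W c) \<tau>"] bexI[of _ "c \<tau>"]) simp_all
  then obtain b where b: "b \<in> kchain W A (Suc (Suc p)) (d + 1)"
    and eb: "\<And>\<tau>. kwedge z c \<tau> - kdiff \<xi> W b \<tau> \<in> I' (d + 1 - int (Suc p))"
    using kvanD[OF v e] by blast
  have "kwedge z c - kdiff \<xi> W b \<in> kchain W A (Suc p) (d + 1)"
    by (intro kchain_diff[OF A] e kdiff_chain[OF A b])
  moreover have "\<exists>a\<in>I (d + 1 - int (Suc p)). \<exists>s\<in>A (d - int (Suc p)). (kwedge z c - kdiff \<xi> W b) \<tau> = a + \<xi> z * s" for \<tau>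
    using eb[of \<tau>] I' by (simp add: algebra_simps)
  ultimately obtain a s where a: "a \<in> kchain W I (Suc p) (d + 1)" and s: "s \<in> kchain W A (Suc p) d"
    and as: "\<And>\<tau>. (kwedge z c - kdiff \<xi> W b) \<tau> = a \<tau> + \<xi> z * s \<tau>"
    using kchain_split[of "kwedge z c - kdiff \<xi> W b" W A "Suc p" "d + 1" I A "d - int (Suc p)" "\<xi> z" d]
      gsub_0[OF I] gsub_0[OF A] by blast
  have weq: "kwedge z c = kdiff \<xi> W b + a + (\<lambda>\<tau>. \<xi> z * s \<tau>)" using as by (auto simp: fun_eq_iff algebra_simps)
  have "c \<tau> - kdiff \<xi> W s \<tau> \<in> I (d - int p)" for \<tau>
  proof (rule regular)
    show "c \<tau> - kdiff \<xi> W s \<tau> \<in> A (d - int p)"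
      using kchain_val[OF kchain_diff[OF A c kdiff_chain[OF A s]] refl, of \<tau>] by simp
    have "\<xi> z * (c \<tau> - kdiff \<xi> W s \<tau>) = kwedge z (kdiff \<xi> W c) \<tau> + kdiff \<xi> W a \<tau>"
      using de[of \<tau>] kdiff_kdiff[OF b] by (simp add: weq kdiff_add kdiff_scale algebra_simps)
    moreover have "kdiff \<xi> W a \<tau> \<in> I (d - int p + 1)"
      using kchain_val[OF kdiff_chain[OF I a] refl, of \<tau>] by (simp add: algebra_simps)
    ultimately show "\<xi> z * (c \<tau> - kdiff \<xi> W s \<tau>) \<in> I (d - int p + 1)"
      using gsub_add[OF I hI] by simp
  qed
  then show "\<exists>b\<in>kchain W A (Suc p) d. \<forall>\<tau>. c \<tau> - kdiff \<xi> W b \<tau> \<in> I (d - int p)"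
    using s by blast
qed

lemma kvan_regular_0:
  assumes v: "kvan \<xi> W A I 0 d"
  shows "kvan \<xi> W A I' 0 d"
  unfolding kvan_def
proof (intro ballI impI)
  fix c assume c: "c \<in> kchain W A 0 d"
  have "kdiff \<xi> W c \<tau> = 0" for \<tau> by (rule kdiff_supp[OF c]) simp
  then show "\<exists>b\<in>kchain W A (Suc 0) d. \<forall>\<tau>. c \<tau> - kdiff \<xi> W b \<tau> \<in> I' (d - int 0)"
    using kvanD[OF v c] gsub_0[OF I] sub_extended_ideal by (metis (no_types, lifting) subsetD)
qed

text \<open>A cycle modulo I + zA has a boundary a + z s in which s is a cycle modulo I. If s is
  bounded by b, then subtracting z b leaves a cycle modulo I.\<close>

lemma kvan_regular_Suc:
  assumes v1: "kvan \<xi> W A I (Suc p) (d + 1)" and v0: "kvan \<xi> W A I p d"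
  shows "kvan \<xi> W A I' (Suc p) (d + 1)"
  unfolding kvan_def
proof (intro ballI impI)
  fix c assume c: "c \<in> kchain W A (Suc p) (d + 1)"
    and dc: "\<forall>\<tau>. kdiff \<xi> W c \<tau> \<in> I' (d + 1 - int (Suc p) + 1)"
  have "\<exists>a\<in>I (d + 1 - int p). \<exists>s\<in>A (d - int p). kdiff \<xi> W c \<tau> = a + \<xi> z * s" for \<tau>
    using dc[rule_format, of \<tau>] I' by (simp add: algebra_simps)
  then obtain a s where a: "a \<in> kchain W I p (d + 1)" and s: "s \<in> kchain W A p d"
    and as: "\<And>\<tau>. kdiff \<xi> W c \<tau> = a \<tau> + \<xi> z * s \<tau>"
    using kchain_split[OF kdiff_chain[OF A c], of I A "d - int p" "\<xi> z" d]
      gsub_0[OF I] gsub_0[OF A] by blast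
  have deq: "kdiff \<xi> W c = a + (\<lambda>\<tau>. \<xi> z * s \<tau>)" using as by (auto simp: fun_eq_iff)
  have "kdiff \<xi> W s \<tau> \<in> I (d - int p + 1)" for \<tau>
  proof (rule regular)
    show "kdiff \<xi> W s \<tau> \<in> A (d - int p + 1)"
      by (rule kdiff_val[OF A]) (rule kchain_val[OF s refl])
    have "0 = kdiff \<xi> W a \<tau> + \<xi> z * kdiff \<xi> W s \<tau>"
      using kdiff_kdiff[OF c] unfolding deq kdiff_add kdiff_scale by (simp add: fun_eq_iff)
    then have "\<xi> z * kdiff \<xi> W s \<tau> = - kdiff \<xi> W a \<tau>" by (simp add: eq_neg_iff_add_eq_0 add.commute)
    moreover have "kdiff \<xi> W a \<tau> \<in> I (d + 1 - int p + 1)"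
      by (rule kdiff_val[OF I]) (rule kchain_val[OF a refl])
    ultimately show "\<xi> z * kdiff \<xi> W s \<tau> \<in> I (d - int p + 1 + 1)"
      using gsub_uminus[OF I] by (simp add: algebra_simps)
  qed
  then obtain b where b: "b \<in> kchain W A (Suc p) d" and sb: "\<And>\<tau>. s \<tau> - kdiff \<xi> W b \<tau> \<in> I (d - int p)"
    using kvanD[OF v0 s] by blast
  let ?zb = "\<lambda>\<tau>. \<xi> z * b \<tau>"
  have zb: "?zb \<in> kchain W A (Suc p) (d + 1)" by (rule kchain_scale[OF A z b])
  have "kdiff \<xi> W (c - ?zb) \<tau> \<in> I (d + 1 - int (Suc p) + 1)" for \<tau>
  proof -
    have "kdiff \<xi> W (c - ?zb) \<tau> = a \<tau> + \<xi> z * (s \<tau> - kdiff \<xi> W b \<tau>)"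
      by (simp add: kdiff_diff deq kdiff_scale algebra_simps)
    also have "\<dots> \<in> I (d - int p + 1)"
      using kchain_val[OF a refl, of \<tau>] gsub_mult[OF I z sb[of \<tau>]]
      by (intro gsub_add[OF I]) (auto simp: algebra_simps)
    finally show ?thesis by (simp add: algebra_simps)
  qed
  then obtain b2 where b2: "b2 \<in> kchain W A (Suc (Suc p)) (d + 1)"
    and cb2: "\<And>\<tau>. (c - ?zb) \<tau> - kdiff \<xi> W b2 \<tau> \<in> I (d + 1 - int (Suc p))"
    using kvanD[OF v1 kchain_diff[OF A c zb]] by blast
  have "c \<tau> - kdiff \<xi> W b2 \<tau> \<in> I' (d + 1 - int (Suc p))" for \<tau>
    unfolding I' using cb2[of \<tau>] kchain_val[OF b refl, of \<tau>]
    by (intro bexI[of _ "(c - ?zb) \<tau> - kdiff \<xi> W b2 \<tau>"] bexI[of _ "b \<tau>"]) (auto simp: algebra_simps)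
  then show "\<exists>b\<in>kchain W A (Suc (Suc p)) (d + 1). \<forall>\<tau>. c \<tau> - kdiff \<xi> W b \<tau> \<in> I' (d + 1 - int (Suc p))"
    using b2 by blast
qed

text \<open>The long exact sequence of multiplication by z breaks into short ones, because z acts as
  zero on Koszul homology: H_p(A/(I + zA)) is an extension of H_{p-1}(A/I), shifted by one degree,
  by H_p(A/I).\<close>

lemma kvan_regular_iff:
  "kvan \<xi> W A I' p d \<longleftrightarrow> kvan \<xi> W A I p d \<and> (\<forall>q. p = Suc q \<longrightarrow> kvan \<xi> W A I q (d - 1))"
proof (cases p)
  case 0
  then show ?thesis using kvan_regular_0 kvan_regular_same by auto
next
  case (Suc q)
  then show ?thesis
    using kvan_regular_Suc[of q "d - 1"] kvan_regular_same kvan_regular_shift[of q "d - 1"] by auto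
qed

end

text \<open>Dimension shift along \<open>0 \<rightarrow> Z \<rightarrow> F \<rightarrow> F/Z \<rightarrow> 0\<close> for acyclic \<open>F\<close>. The right-hand side
  covers the case \<open>p = 0\<close>, where it says that \<open>H\<^sub>0(Z) \<rightarrow> H\<^sub>0(F)\<close> is injective.\<close>

lemma kvan_quotient_acyclic:
  assumes F: "gsub \<xi> W F" and Z: "gsub \<xi> W Z" and sub: "\<And>d. Z d \<subseteq> F d"
    and acyclic: "kvan \<xi> W F (\<lambda>_. {0}) (Suc p) d"
  shows "kvan \<xi> W F Z (Suc p) d \<longleftrightarrow>
    (\<forall>b\<in>kchain W F (Suc p) d. (\<forall>\<tau>. kdiff \<xi> W b \<tau> \<in> Z (d - int p)) \<longrightarrow>
       (\<exists>a\<in>kchain W Z (Suc p) d. kdiff \<xi> W a = kdiff \<xi> W b))" (is "?L \<longleftrightarrow> ?R")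
proof
  have deg: "d - int (Suc p) + 1 = d - int p" by simp
  assume v: ?L
  show ?R
  proof (intro ballI impI)
    fix b assume b: "b \<in> kchain W F (Suc p) d" and db: "\<forall>\<tau>. kdiff \<xi> W b \<tau> \<in> Z (d - int p)"
    have db': "kdiff \<xi> W b \<tau> \<in> Z (d - int (Suc p) + 1)" for \<tau> using db unfolding deg by (rule spec)
    obtain e where e: "e \<in> kchain W F (Suc (Suc p)) d"
      and be: "\<And>\<tau>. b \<tau> - kdiff \<xi> W e \<tau> \<in> Z (d - int (Suc p))"
      using kvanD[OF v b db'] by metis
    have "b - kdiff \<xi> W e \<in> kchain W Z (Suc p) d"
      by (rule kchain_sub[OF kchain_diff[OF F b kdiff_chain[OF F e]]]) (simp only: minus_apply be)
    moreover have "kdiff \<xi> W (b - kdiff \<xi> W e) = kdiff \<xi> W b"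
      by (simp add: kdiff_diff kdiff_kdiff[OF e])
    ultimately show "\<exists>a\<in>kchain W Z (Suc p) d. kdiff \<xi> W a = kdiff \<xi> W b" by blast
  qed
next
  assume r: ?R
  show ?L
    unfolding kvan_def
  proof (intro ballI impI)
    fix c assume c: "c \<in> kchain W F (Suc p) d" and dc: "\<forall>\<tau>. kdiff \<xi> W c \<tau> \<in> Z (d - int (Suc p) + 1)"
    then obtain a where a: "a \<in> kchain W Z (Suc p) d" "kdiff \<xi> W a = kdiff \<xi> W c"
      using r by auto
    have ca: "c - a \<in> kchain W F (Suc p) d" using kchain_diff[OF F c kchain_mono[OF a(1) sub]] .
    have "kdiff \<xi> W (c - a) \<tau> \<in> {0}" for \<tau> using a(2) by (simp add: kdiff_diff)
    then obtain b where "b \<in> kchain W F (Suc (Suc p)) d" "\<And>\<tau>. (c - a) \<tau> - kdiff \<xi> W b \<tau> \<in> {0}"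
      using kvanD[OF acyclic ca] by blast
    moreover have "c \<tau> - kdiff \<xi> W b \<tau> = a \<tau>" if "(c - a) \<tau> - kdiff \<xi> W b \<tau> \<in> {0}" for b \<tau>
      using that by (simp add: algebra_simps)
    ultimately show "\<exists>b\<in>kchain W F (Suc (Suc p)) d. \<forall>\<tau>. c \<tau> - kdiff \<xi> W b \<tau> \<in> Z (d - int (Suc p))"
      using kchain_val[OF a(1) refl] by metis
  qed
qed

text \<open>The connecting map from H_{p+2}(F/Z) to H_{p+1}(Z) is bijective because F is acyclic in
  positive homological degrees.\<close>

lemma kvan_sub_acyclic:
  assumes F: "gsub \<xi> W F" and Z: "gsub \<xi> W Z" and sub: "\<And>d. Z d \<subseteq> F d"
    and acyclic: "\<And>p. kvan \<xi> W F (\<lambda>_. {0}) (Suc p) d"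
  shows "kvan \<xi> W F Z (Suc (Suc p)) d \<longleftrightarrow> kvan \<xi> W Z (\<lambda>_. {0}) (Suc p) d"
  unfolding kvan_quotient_acyclic[OF F Z sub acyclic]
proof
  assume r: "\<forall>b\<in>kchain W F (Suc (Suc p)) d. (\<forall>\<tau>. kdiff \<xi> W b \<tau> \<in> Z (d - int (Suc p))) \<longrightarrow>
       (\<exists>a\<in>kchain W Z (Suc (Suc p)) d. kdiff \<xi> W a = kdiff \<xi> W b)"
  show "kvan \<xi> W Z (\<lambda>_. {0}) (Suc p) d"
    unfolding kvan_def
  proof (intro ballI impI)
    fix c assume c: "c \<in> kchain W Z (Suc p) d" and dc: "\<forall>\<tau>. kdiff \<xi> W c \<tau> \<in> {0}"
    obtain b where b: "b \<in> kchain W F (Suc (Suc p)) d" "\<And>\<tau>. c \<tau> - kdiff \<xi> W b \<tau> \<in> {0}"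
      using kvanD[OF acyclic kchain_mono[OF c sub]] dc by blast
    then have "kdiff \<xi> W b = c" by (auto simp: fun_eq_iff)
    then obtain a where "a \<in> kchain W Z (Suc (Suc p)) d" "kdiff \<xi> W a = c"
      using r[rule_format, OF b(1)] kchain_val[OF c refl] by blast
    then show "\<exists>b\<in>kchain W Z (Suc (Suc p)) d. \<forall>\<tau>. c \<tau> - kdiff \<xi> W b \<tau> \<in> {0}"
      by (intro bexI[of _ a]) simp_all
  qed
next
  assume v: "kvan \<xi> W Z (\<lambda>_. {0}) (Suc p) d"
  show "\<forall>b\<in>kchain W F (Suc (Suc p)) d. (\<forall>\<tau>. kdiff \<xi> W b \<tau> \<in> Z (d - int (Suc p))) \<longrightarrow>
       (\<exists>a\<in>kchain W Z (Suc (Suc p)) d. kdiff \<xi> W a = kdiff \<xi> W b)"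
  proof (intro ballI impI)
    fix b assume b: "b \<in> kchain W F (Suc (Suc p)) d" and db: "\<forall>\<tau>. kdiff \<xi> W b \<tau> \<in> Z (d - int (Suc p))"
    have "kdiff \<xi> W b \<in> kchain W Z (Suc p) d"
      using kchain_sub[OF kdiff_chain[OF F b]] db by blast
    moreover have "kdiff \<xi> W (kdiff \<xi> W b) \<tau> \<in> {0}" for \<tau> using kdiff_kdiff[OF b] by simp
    ultimately obtain a where "a \<in> kchain W Z (Suc (Suc p)) d" "\<And>\<tau>. kdiff \<xi> W b \<tau> - kdiff \<xi> W a \<tau> \<in> {0}"
      using kvanD[OF v] by blast
    then show "\<exists>a\<in>kchain W Z (Suc (Suc p)) d. kdiff \<xi> W a = kdiff \<xi> W b"
      by (auto simp: fun_eq_iff intro!: bexI[of _ a])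
  qed
qed

end

text \<open>Koszul homology depends only on the graded quotient with the action of the variables.
  The map \<open>\<phi>\<close> represents an isomorphism A/B -> A'/B'; it is only additive and
  compatible with the variables, since it may lead from vectors to scalars.\<close>

lemma kvan_iso:
  fixes \<xi> :: "vname \<Rightarrow> 'm::comm_ring_1" and \<eta> :: "vname \<Rightarrow> 'n::comm_ring_1" and \<phi> :: "'m \<Rightarrow> 'n"
  assumes finW: "finite W" and A: "gsub \<xi> W A" and B: "gsub \<xi> W B" and A': "gsub \<eta> W A'" and B': "gsub \<eta> W B'"
    and add: "\<And>x y. \<phi> (x + y) = \<phi> x + \<phi> y" and mult: "\<And>z x. z \<in> W \<Longrightarrow> \<phi> (\<xi> z * x) = \<eta> z * \<phi> x"
    and into: "\<And>d a. a \<in> A d \<Longrightarrow> \<phi> a \<in> A' d"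
    and onto: "\<And>d a'. a' \<in> A' d \<Longrightarrow> \<exists>a\<in>A d. a' - \<phi> a \<in> B' d"
    and ker: "\<And>d a. a \<in> A d \<Longrightarrow> \<phi> a \<in> B' d \<longleftrightarrow> a \<in> B d"
  shows "kvan \<xi> W A B p d \<longleftrightarrow> kvan \<eta> W A' B' p d"
proof -
  have zero: "\<phi> 0 = 0" using add[of 0 0] by simp
  have neg: "\<phi> (- x) = - \<phi> x" for x
    using add[of x "- x"] zero by (simp add: eq_neg_iff_add_eq_0 add.commute)
  have diff: "\<phi> (x - y) = \<phi> x - \<phi> y" for x y using add[of x "- y"] neg by simp
  have sgn: "\<phi> (ksgn z \<tau> * x) = ksgn z \<tau> * \<phi> x" for z \<tau> x
    using neg by (cases "even (card {u \<in> \<tau>. vord u < vord z})") (auto simp: ksgn_def)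
  have sum: "\<phi> (sum f S) = (\<Sum>i\<in>S. \<phi> (f i))" for f and S :: "vname set"
    by (induction S rule: infinite_finite_induct) (auto simp: zero add)
  have dphi: "\<phi> (kdiff \<xi> W c \<tau>) = kdiff \<eta> W (\<phi> \<circ> c) \<tau>" for c \<tau>
    unfolding kdiff_def sum by (intro sum.cong refl) (simp add: mult.assoc sgn mult)
  have chphi: "\<phi> \<circ> c \<in> kchain W A' p d" if "c \<in> kchain W A p d" for c p
    using that into by (auto simp: kchain_def zero)
  have lift: "\<exists>b\<in>kchain W A p d. \<forall>\<tau>. b' \<tau> - \<phi> (b \<tau>) \<in> B' (d - int p)" if b': "b' \<in> kchain W A' p d" for b' p
  proof -
    obtain g where g: "\<And>\<sigma>. g \<sigma> \<in> A (d - int p) \<and> b' \<sigma> - \<phi> (g \<sigma>) \<in> B' (d - int p)"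
      using onto[OF kchain_val[OF b' refl]] by metis
    show ?thesis
      by (rule bexI[of _ "\<lambda>\<sigma>. if \<sigma> \<subseteq> W \<and> card \<sigma> = p then g \<sigma> else 0"])
        (use g kchain_supp[OF b'] gsub_0[OF A] gsub_0[OF B'] in \<open>auto simp: kchain_def zero\<close>)
  qed
  have dA: "kdiff \<xi> W c \<tau> \<in> A (d - int p + 1)" if "c \<in> kchain W A p d" for c p \<tau>
    by (rule kdiff_val[OF finW A]) (rule kchain_val[OF that refl])
  have dB': "kdiff \<eta> W c \<tau> \<in> B' (e + 1)" if "\<And>\<tau>. c \<tau> \<in> B' e" for c e \<tau>
    by (rule kdiff_val[OF finW B' that])
  show ?thesis
  proof
    assume v: "kvan \<xi> W A B p d"
    show "kvan \<eta> W A' B' p d"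
      unfolding kvan_def
    proof (intro ballI impI)
      fix c' assume c': "c' \<in> kchain W A' p d" and dc': "\<forall>\<tau>. kdiff \<eta> W c' \<tau> \<in> B' (d - int p + 1)"
      obtain c where c: "c \<in> kchain W A p d" and cc: "\<And>\<tau>. c' \<tau> - \<phi> (c \<tau>) \<in> B' (d - int p)"
        using lift[OF c'] by blast
      have "kdiff \<xi> W c \<tau> \<in> B (d - int p + 1)" for \<tau>
      proof -
        have "\<phi> (kdiff \<xi> W c \<tau>) = kdiff \<eta> W c' \<tau> - kdiff \<eta> W (c' - (\<phi> \<circ> c)) \<tau>"
          by (simp add: dphi kdiff_diff)
        moreover have "kdiff \<eta> W (c' - (\<phi> \<circ> c)) \<tau> \<in> B' (d - int p + 1)" using cc by (intro dB') simp
        ultimately have "\<phi> (kdiff \<xi> W c \<tau>) \<in> B' (d - int p + 1)" using dc' gsub_diff[OF B'] by simp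
        then show ?thesis using ker[OF dA[OF c]] by simp
      qed
      then obtain b where b: "b \<in> kchain W A (Suc p) d" and cb: "\<And>\<tau>. c \<tau> - kdiff \<xi> W b \<tau> \<in> B (d - int p)"
        using v c unfolding kvan_def by blast
      have "c' \<tau> - kdiff \<eta> W (\<phi> \<circ> b) \<tau> \<in> B' (d - int p)" for \<tau>
      proof -
        have "c \<tau> - kdiff \<xi> W b \<tau> \<in> A (d - int p)"
          using gsub_diff[OF A kchain_val[OF c refl]] dA[OF b, of \<tau>] by simp
        then have "\<phi> (c \<tau> - kdiff \<xi> W b \<tau>) \<in> B' (d - int p)" using ker cb by blast
        then show ?thesis
          using gsub_add[OF B' cc[of \<tau>]] by (fastforce simp: diff dphi)
      qed
      then show "\<exists>b\<in>kchain W A' (Suc p) d. \<forall>\<tau>. c' \<tau> - kdiff \<eta> W b \<tau> \<in> B' (d - int p)"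
        using chphi[OF b] by blast
    qed
  next
    assume v: "kvan \<eta> W A' B' p d"
    show "kvan \<xi> W A B p d"
      unfolding kvan_def
    proof (intro ballI impI)
      fix c assume c: "c \<in> kchain W A p d" and dc: "\<forall>\<tau>. kdiff \<xi> W c \<tau> \<in> B (d - int p + 1)"
      have "kdiff \<eta> W (\<phi> \<circ> c) \<tau> \<in> B' (d - int p + 1)" for \<tau>
        using dc ker[OF dA[OF c]] by (simp flip: dphi)
      then obtain b' where b': "b' \<in> kchain W A' (Suc p) d"
        and cb': "\<And>\<tau>. (\<phi> \<circ> c) \<tau> - kdiff \<eta> W b' \<tau> \<in> B' (d - int p)"
        using v chphi[OF c] unfolding kvan_def by blast
      obtain b where b: "b \<in> kchain W A (Suc p) d" and bb: "\<And>\<tau>. b' \<tau> - \<phi> (b \<tau>) \<in> B' (d - int (Suc p))"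
        using lift[OF b'] by blast
      have "c \<tau> - kdiff \<xi> W b \<tau> \<in> B (d - int p)" for \<tau>
      proof -
        have "c \<tau> - kdiff \<xi> W b \<tau> \<in> A (d - int p)"
          using gsub_diff[OF A kchain_val[OF c refl]] dA[OF b, of \<tau>] by simp
        moreover have "\<phi> (c \<tau> - kdiff \<xi> W b \<tau>) = ((\<phi> \<circ> c) \<tau> - kdiff \<eta> W b' \<tau>) + kdiff \<eta> W (b' - (\<phi> \<circ> b)) \<tau>"
          by (simp add: diff dphi kdiff_diff)
        moreover have "kdiff \<eta> W (b' - (\<phi> \<circ> b)) \<tau> \<in> B' (d - int p)"
          using dB'[of "b' - (\<phi> \<circ> b)" "d - int (Suc p)" \<tau>] bb by simp
        ultimately show ?thesis using ker gsub_add[OF B' cb'[of \<tau>]] by metis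
      qed
      then show "\<exists>b\<in>kchain W A (Suc p) d. \<forall>\<tau>. c \<tau> - kdiff \<xi> W b \<tau> \<in> B (d - int p)"
        using b by blast
    qed
  qed
qed

section \<open>Homogeneous ideals of the polynomial ring\<close>

abbreviation keys where "keys \<equiv> Poly_Mapping.keys"
abbreviation lookup where "lookup \<equiv> Poly_Mapping.lookup"
abbreviation single where "single \<equiv> Poly_Mapping.single"

definition vars :: "nat set \<Rightarrow> vname set" where
  "vars V = X ` V \<union> Y ` V"

lemma finite_vars: "finite V \<Longrightarrow> finite (vars V)"
  by (simp add: vars_def)

lemma in_vars [simp]: "X i \<in> vars V \<longleftrightarrow> i \<in> V" "Y i \<in> vars V \<longleftrightarrow> i \<in> V"
  by (auto simp: vars_def)

definition hom_part :: "nat set \<Rightarrow> int \<Rightarrow> ('k::comm_ring_1) mpoly set" where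
  "hom_part V d = {p. \<forall>m\<in>keys p. keys m \<subseteq> vars V \<and> int (total_degree m) = d}"

lemma hom_part_iff: "p \<in> hom_part V d \<longleftrightarrow> p \<in> carrier (poly_ring V) \<and> homogeneous p d"
  by (auto simp: hom_part_def poly_ring_def homogeneous_def vars_def)

lemma total_degree_alt: "finite A \<Longrightarrow> keys m \<subseteq> A \<Longrightarrow> total_degree m = (\<Sum>z\<in>A. lookup m z)"
  unfolding total_degree_def by (rule sum.mono_neutral_left) (auto simp: in_keys_iff)

lemma total_degree_add [simp]: "total_degree (a + b) = total_degree a + total_degree b"
proof -
  let ?A = "keys a \<union> keys b"
  have "total_degree (a + b) = (\<Sum>z\<in>?A. lookup (a + b) z)"
    by (rule total_degree_alt) (use Poly_Mapping.keys_add[of a b] in auto)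
  moreover have "total_degree a = (\<Sum>z\<in>?A. lookup a z)" "total_degree b = (\<Sum>z\<in>?A. lookup b z)"
    by (rule total_degree_alt; simp)+
  ultimately show ?thesis by (simp add: lookup_add sum.distrib)
qed

lemma total_degree_0 [simp]: "total_degree 0 = 0"
  by (simp add: total_degree_def)

lemma total_degree_single [simp]: "total_degree (single z n) = n"
  by (simp add: total_degree_def)

lemma keys_add_nat: "keys (a + b) = keys a \<union> keys (b :: 'a \<Rightarrow>\<^sub>0 nat)"
  by (auto simp: in_keys_iff lookup_add)

lemma mpoly_sum: "p = (\<Sum>m\<in>keys p. single m (lookup p m))"
  by (rule poly_mapping_eqI) (auto simp: lookup_sum lookup_single when_def in_keys_iff)

lemma hom_part_0 [simp]: "0 \<in> hom_part V d"
  by (simp add: hom_part_def)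

lemma hom_part_add: "p \<in> hom_part V d \<Longrightarrow> q \<in> hom_part V d \<Longrightarrow> p + q \<in> hom_part V d"
  using Poly_Mapping.keys_add[of p q] by (auto simp: hom_part_def)

lemma hom_part_uminus: "p \<in> hom_part V d \<Longrightarrow> - p \<in> hom_part V d"
  by (simp add: hom_part_def keys_def)

lemma hom_part_diff: "p \<in> hom_part V d \<Longrightarrow> q \<in> hom_part V d \<Longrightarrow> p - q \<in> hom_part V d"
  using hom_part_add[of p V d "- q"] hom_part_uminus[of q V d] by simp

lemma hom_part_single: "keys m \<subseteq> vars V \<Longrightarrow> int (total_degree m) = d \<Longrightarrow> single m c \<in> hom_part V d"
  by (simp add: hom_part_def)

lemma hom_part_mult: "p \<in> hom_part V d \<Longrightarrow> q \<in> hom_part V e \<Longrightarrow> p * q \<in> hom_part V (d + e)"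
  using keys_mult[of p q] by (fastforce simp: hom_part_def keys_add_nat)

lemma var_hom_part: "z \<in> vars V \<Longrightarrow> var z \<in> hom_part V 1"
  unfolding var_def by (rule hom_part_single) auto

lemma hom_part_neg: "d < 0 \<Longrightarrow> p \<in> hom_part V d \<Longrightarrow> p = 0"
  using keys_eq_empty[of p] by (force simp: hom_part_def)

lemma gsub_hom_part: "gsub var (vars V) (hom_part V)"
  unfolding gsub_def using hom_part_mult[OF var_hom_part]
  by (auto intro: hom_part_diff simp: add.commute)

text \<open>\<open>gid V G d\<close> is the degree \<open>d\<close> part of the ideal generated by \<open>G\<close>, whose elements are
  pairs of a degree and a homogeneous polynomial of this degree.\<close>

inductive_set gid :: "nat set \<Rightarrow> (int \<times> ('k::comm_ring_1) mpoly) set \<Rightarrow> int \<Rightarrow> 'k mpoly set"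
  for V G d where
  zero: "0 \<in> gid V G d"
| step: "p \<in> gid V G d \<Longrightarrow> (e, g) \<in> G \<Longrightarrow> keys m \<subseteq> vars V \<Longrightarrow> e + int (total_degree m) = d
    \<Longrightarrow> p + single m c * g \<in> gid V G d"

lemma gid_base: "(e, g) \<in> G \<Longrightarrow> keys m \<subseteq> vars V \<Longrightarrow> e + int (total_degree m) = d \<Longrightarrow> single m c * g \<in> gid V G d"
  using gid.step[OF gid.zero, of e g G m V d c] by simp

lemma gid_gen: "(e, g) \<in> G \<Longrightarrow> g \<in> gid V G e"
  using gid_base[of e g G 0 V e 1] by simp

lemma gid_add:
  assumes "p \<in> gid V G d" "q \<in> gid V G d"
  shows "p + q \<in> gid V G d"
  using assms(2)
  by (induction q rule: gid.induct) (use assms(1) in \<open>auto simp: add.assoc[symmetric] intro: gid.step\<close>)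

lemma gid_uminus: "p \<in> gid V G d \<Longrightarrow> - p \<in> gid V G d"
proof (induction p rule: gid.induct)
  case (step p e g m c)
  then show ?case using gid.step[OF step.IH, of e g m "- c"] by (simp add: single_uminus)
qed (simp add: gid.zero)

lemma gid_diff: "p \<in> gid V G d \<Longrightarrow> q \<in> gid V G d \<Longrightarrow> p - q \<in> gid V G d"
  using gid_add[of p V G d "- q"] gid_uminus[of q V G d] by simp

lemma gid_mult_single:
  "p \<in> gid V G d \<Longrightarrow> keys m \<subseteq> vars V \<Longrightarrow> d' = d + int (total_degree m) \<Longrightarrow> single m c * p \<in> gid V G d'"
proof (induction p rule: gid.induct)
  case (step p e g n b)
  have "single (m + n) (c * b) * g \<in> gid V G d'"
    using step by (intro gid_base[of e]) (auto simp: keys_add_nat)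
  then show ?case
    using step by (simp add: distrib_left mult.assoc[symmetric] mult_single gid_add)
qed (simp add: gid.zero)

lemma gid_sum: "(\<And>i. i \<in> I \<Longrightarrow> f i \<in> gid V G d) \<Longrightarrow> sum f I \<in> gid V G d"
  by (induction I rule: infinite_finite_induct) (auto intro: gid_add gid.zero)

lemma gid_mult_hom:
  assumes "p \<in> gid V G d" "q \<in> hom_part V e" "d' = d + e"
  shows "q * p \<in> gid V G d'"
proof -
  have "q * p = (\<Sum>m\<in>keys q. single m (lookup q m) * p)"
    using mpoly_sum[of q] by (metis sum_distrib_right)
  also have "\<dots> \<in> gid V G d'"
    using assms by (intro gid_sum gid_mult_single) (auto simp: hom_part_def)
  finally show ?thesis .
qed

lemma gsub_gid: "gsub var (vars V) (gid V G)"
  unfolding gsub_def by (auto intro: gid.zero gid_diff gid_mult_hom[OF _ var_hom_part])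

lemma gid_trans:
  assumes "\<And>e g. (e, g) \<in> G \<Longrightarrow> g \<in> gid V G' e"
  shows "gid V G d \<subseteq> gid V G' d"
proof
  fix p assume "p \<in> gid V G d"
  then show "p \<in> gid V G' d"
  proof (induction p rule: gid.induct)
    case (step p e g m c)
    then show ?case
      using gid_mult_single[OF assms[OF step(2)] step(3), of d c] by (auto intro!: gid_add)
  qed (rule gid.zero)
qed

lemma gid_mono: "G \<subseteq> G' \<Longrightarrow> gid V G d \<subseteq> gid V G' d"
  by (rule gid_trans) (auto intro: gid_gen)

lemma gid_union: "x \<in> gid V (G \<union> G') d \<longleftrightarrow> (\<exists>a\<in>gid V G d. \<exists>b\<in>gid V G' d. x = a + b)"
proof
  assume "x \<in> gid V (G \<union> G') d"
  then show "\<exists>a\<in>gid V G d. \<exists>b\<in>gid V G' d. x = a + b"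
  proof (induction x rule: gid.induct)
    case zero
    show ?case by (intro bexI[of _ 0] gid.zero) simp
  next
    case (step p e g m c)
    then obtain a b where ab: "a \<in> gid V G d" "b \<in> gid V G' d" "p = a + b" by auto
    show ?case
    proof (cases "(e, g) \<in> G")
      case True
      have "a + single m c * g \<in> gid V G d" by (rule gid.step[OF ab(1) True step(3,4)])
      then show ?thesis using ab(2,3)
        by (intro bexI[of _ "a + single m c * g"] bexI[of _ b]) (simp_all add: ac_simps)
    next
      case False
      have "b + single m c * g \<in> gid V G' d" by (rule gid.step[OF ab(2) _ step(3,4)]) (use False step(2) in auto)
      then show ?thesis using ab(1,3)
        by (intro bexI[of _ a] bexI[of _ "b + single m c * g"]) (simp_all add: ac_simps)
    qed
  qed
next
  assume "\<exists>a\<in>gid V G d. \<exists>b\<in>gid V G' d. x = a + b"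
  then show "x \<in> gid V (G \<union> G') d"
    using gid_mono[of G "G \<union> G'" V d] gid_mono[of G' "G \<union> G'" V d] by (auto intro!: gid_add)
qed

definition hom_gens :: "nat set \<Rightarrow> (int \<times> ('k::comm_ring_1) mpoly) set \<Rightarrow> bool" where
  "hom_gens V G \<longleftrightarrow> (\<forall>(e, g)\<in>G. g \<in> hom_part V e)"

lemma hom_gens_simps [simp]: "hom_gens V {}" "hom_gens V (G \<union> G') \<longleftrightarrow> hom_gens V G \<and> hom_gens V G'"
  by (auto simp: hom_gens_def)

lemma gid_hom_part: "hom_gens V G \<Longrightarrow> gid V G d \<subseteq> hom_part V d"
proof
  fix p assume G: "hom_gens V G" and "p \<in> gid V G d"
  from this(2) show "p \<in> hom_part V d"
  proof (induction p rule: gid.induct)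
    case (step p e g m c)
    have "single m c * g \<in> hom_part V (int (total_degree m) + e)"
      using G step by (intro hom_part_mult hom_part_single) (auto simp: hom_gens_def)
    then show ?case using step by (intro hom_part_add) (auto simp: add.commute)
  qed simp
qed

lemma gid_empty [simp]: "gid V {} d = {0}"
  by (auto intro: gid.zero elim: gid.cases)

definition vgens :: "vname set \<Rightarrow> (int \<times> ('k::comm_ring_1) mpoly) set" where
  "vgens Z = (\<lambda>z. (1, var z)) ` Z"

lemma hom_gens_vgens: "Z \<subseteq> vars V \<Longrightarrow> hom_gens V (vgens Z)"
  by (auto simp: hom_gens_def vgens_def intro: var_hom_part)

lemma vgens_empty [simp]: "vgens {} = {}"
  and vgens_insert: "vgens (insert z Z) = vgens Z \<union> vgens {z}"
  by (auto simp: vgens_def)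

lemma var_mult_single: "var z * single m c = single (single z 1 + m) c"
  and single_mult_var: "single m c * var z = single (m + single z 1) c"
  by (simp_all add: var_def mult_single)

lemma gid_vgens_single: "x \<in> gid V (vgens {z}) d \<Longrightarrow> \<exists>s\<in>hom_part V (d - 1). x = var z * s"
proof (induction x rule: gid.induct)
  case zero
  then show ?case by (intro bexI[of _ 0]) auto
next
  case (step p e g m c)
  then obtain s where s: "s \<in> hom_part V (d - 1)" "p = var z * s" by blast
  have g: "g = var z" "e = 1" using step by (auto simp: vgens_def)
  show ?case
    by (rule bexI[of _ "s + single m c"])
      (use s g step in \<open>auto simp: algebra_simps intro!: hom_part_add hom_part_single\<close>)
qed

text \<open>This is the description of the enlarged ideal that the results on regular variables ask
  for.\<close>

lemma gid_var:
  assumes "z \<in> vars V"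
  shows "x \<in> gid V (G \<union> vgens {z}) d \<longleftrightarrow> (\<exists>a\<in>gid V G d. \<exists>s\<in>hom_part V (d - 1). x = a + var z * s)"
proof -
  have "var z * s \<in> gid V (vgens {z}) d" if "s \<in> hom_part V (d - 1)" for s
  proof -
    have "s * var z \<in> gid V (vgens {z}) d"
      by (rule gid_mult_hom[OF gid_gen[of 1] that]) (auto simp: vgens_def)
    then show ?thesis by (simp add: mult.commute)
  qed
  then show ?thesis unfolding gid_union using gid_vgens_single by metis
qed

section \<open>Linear operators given on monomials\<close>

text \<open>The coefficient-linear extension of a map on monomials. The operators obtained in this
  way, such as division by a variable, are not linear over the polynomial ring.\<close>

definition lin :: "((vname \<Rightarrow>\<^sub>0 nat) \<Rightarrow> ('k::comm_ring_1) mpoly) \<Rightarrow> 'k mpoly \<Rightarrow> 'k mpoly" where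
  "lin \<delta> p = (\<Sum>m\<in>keys p. single 0 (lookup p m) * \<delta> m)"

lemma lin_superset: "finite M \<Longrightarrow> keys p \<subseteq> M \<Longrightarrow> lin \<delta> p = (\<Sum>m\<in>M. single 0 (lookup p m) * \<delta> m)"
  unfolding lin_def by (rule sum.mono_neutral_left) (auto simp: in_keys_iff)

lemma lin_add: "lin \<delta> (p + q) = lin \<delta> p + lin \<delta> q"
proof -
  let ?M = "keys p \<union> keys q"
  have "keys (p + q) \<subseteq> ?M" by (rule Poly_Mapping.keys_add)
  then show ?thesis
    by (simp add: lin_superset[of ?M] lookup_add single_add distrib_right sum.distrib)
qed

lemma lin_0 [simp]: "lin \<delta> 0 = 0"
  by (simp add: lin_def)

lemma lin_single [simp]: "lin \<delta> (single m c) = single 0 c * \<delta> m"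
  by (cases "c = 0") (simp_all add: lin_def)

lemma lin_uminus: "lin \<delta> (- p) = - lin \<delta> p"
  using lin_add[of \<delta> p "- p"] by (simp add: eq_neg_iff_add_eq_0 add.commute)

lemma lin_diff: "lin \<delta> (p - q) = lin \<delta> p - lin \<delta> q"
  using lin_add[of \<delta> p "- q"] by (simp add: lin_uminus)

lemma lin_sum: "lin \<delta> (sum f I) = (\<Sum>i\<in>I. lin \<delta> (f i))"
  by (induction I rule: infinite_finite_induct) (auto simp: lin_add)

lemma lin_single_mult:
  "lin \<delta> (single m c * g) = (\<Sum>k\<in>keys g. single 0 (c * lookup g k) * \<delta> (m + k))"
proof -
  have "single m c * g = (\<Sum>k\<in>keys g. single (m + k) (c * lookup g k))"
    using mpoly_sum[of g] by (metis (no_types, lifting) mult_single sum.cong sum_distrib_left)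
  then show ?thesis by (simp add: lin_sum)
qed

text \<open>Since the operator does not commute with multiplication by monomials, it is tested on
  all monomial multiples of the generators.\<close>

lemma lin_gid:
  assumes "p \<in> gid V G d" and "\<And>a b. a \<in> B \<Longrightarrow> b \<in> B \<Longrightarrow> a + b \<in> B" "0 \<in> B"
    and "\<And>e g m c. (e, g) \<in> G \<Longrightarrow> keys m \<subseteq> vars V \<Longrightarrow> e + int (total_degree m) = d \<Longrightarrow> lin \<delta> (single m c * g) \<in> B"
  shows "lin \<delta> p \<in> B"
  using assms(1) by (induction p rule: gid.induct) (auto simp: lin_add assms(2-4))

lemma sub_add_key: "z \<in> keys m \<Longrightarrow> single z 1 + (m - single z 1) = (m :: 'a \<Rightarrow>\<^sub>0 nat)"
  by (rule poly_mapping_eqI) (auto simp: lookup_add lookup_minus lookup_single when_def in_keys_iff)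

lemma keys_sub: "keys (m - n) \<subseteq> keys (m :: 'a \<Rightarrow>\<^sub>0 nat)"
  by (auto simp: in_keys_iff lookup_minus)

lemma total_degree_sub_key: "z \<in> keys m \<Longrightarrow> Suc (total_degree (m - single z 1)) = total_degree m"
  using arg_cong[OF sub_add_key[of z m], of total_degree] by simp

definition var_div :: "vname \<Rightarrow> ('k::comm_ring_1) mpoly \<Rightarrow> 'k mpoly" where
  "var_div z = lin (\<lambda>m. if z \<in> keys m then single (m - single z 1) 1 else 0)"

lemma lin_var_mult_eq:
  assumes "\<And>m. \<delta> (single z 1 + m) = single m 1"
  shows "lin \<delta> (var z * p) = p"
proof -
  have "lin \<delta> (var z * p) = (\<Sum>k\<in>keys p. single k (lookup p k))"
    unfolding var_def lin_single_mult assms by (simp add: mult_single)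
  then show ?thesis by (simp flip: mpoly_sum)
qed

lemma var_div_var: "var_div z (var z * p) = p"
  unfolding var_div_def by (rule lin_var_mult_eq) (simp add: keys_add_nat)

definition free_of :: "vname \<Rightarrow> (int \<times> ('k::comm_ring_1) mpoly) set \<Rightarrow> bool" where
  "free_of z G \<longleftrightarrow> (\<forall>(e, g)\<in>G. \<forall>m\<in>keys g. z \<notin> keys m)"

lemma free_of_Un [simp]: "free_of z (G \<union> G') \<longleftrightarrow> free_of z G \<and> free_of z G'" "free_of z {}"
  by (auto simp: free_of_def)

lemma free_of_vgens: "z \<notin> Z \<Longrightarrow> free_of z (vgens Z)"
  by (auto simp: free_of_def vgens_def var_def split: if_splits)

definition var_regular :: "nat set \<Rightarrow> vname \<Rightarrow> (int \<times> ('k::comm_ring_1) mpoly) set \<Rightarrow> bool" where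
  "var_regular V z G \<longleftrightarrow> (\<forall>d. \<forall>s\<in>hom_part V d. var z * s \<in> gid V G (d + 1) \<longrightarrow> s \<in> gid V G d)"

text \<open>Division by z, which drops the monomials without z, undoes multiplication by z. If no
  generator contains z, it maps each monomial multiple of a generator to another such multiple or to
  zero, so it preserves the ideal.\<close>

lemma var_regular_free_of:
  assumes fr: "free_of z G"
  shows "var_regular V z G"
  unfolding var_regular_def
proof (intro allI ballI impI)
  fix d s assume "var z * s \<in> gid V G (d + 1)"
  then have "var_div z (var z * s) \<in> gid V G d"
    unfolding var_div_def
  proof (rule lin_gid, goal_cases)
    case (3 e g m c)
    have nz: "z \<notin> keys k" if "k \<in> keys g" for k using fr 3(1) that by (auto simp: free_of_def)
    show ?case
    proof (cases "z \<in> keys m")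
      case True
      have "m + k - single z 1 = (m - single z 1) + k" for k
        by (rule poly_mapping_eqI) (use True in \<open>auto simp: lookup_add lookup_minus lookup_single when_def in_keys_iff\<close>)
      then have "lin (\<lambda>m. if z \<in> keys m then single (m - single z 1) 1 else 0) (single m c * g) =
          (\<Sum>k\<in>keys g. single ((m - single z 1) + k) (c * lookup g k))"
        unfolding lin_single_mult using True by (intro sum.cong) (auto simp: keys_add_nat mult_single)
      also have "\<dots> = single (m - single z 1) c * (\<Sum>k\<in>keys g. single k (lookup g k))"
        by (simp add: sum_distrib_left mult_single)
      also have "\<dots> = single (m - single z 1) c * g" by (simp flip: mpoly_sum)
      also have "\<dots> \<in> gid V G d"
        by (rule gid_base[OF 3(1)]) (use 3 True keys_sub total_degree_sub_key[OF True] in fastforce)+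
      finally show ?thesis .
    next
      case False
      then have "lin (\<lambda>m. if z \<in> keys m then single (m - single z 1) 1 else 0) (single m c * g) = 0"
        unfolding lin_single_mult by (intro sum.neutral) (use nz in \<open>auto simp: keys_add_nat\<close>)
      then show ?thesis by (simp add: gid.zero)
    qed
  qed (auto intro: gid_add gid.zero)
  then show "s \<in> gid V G d" by (simp add: var_div_var)
qed

section \<open>Nonvanishing of Koszul homology of quotients of the polynomial ring\<close>

text \<open>\<open>knz V G p j\<close> says that \<open>Tor\<^sub>p(S/(G), K)\<close> is nonzero in degree \<open>p + j\<close>.\<close>

definition knz :: "nat set \<Rightarrow> (int \<times> ('k::comm_ring_1) mpoly) set \<Rightarrow> nat \<Rightarrow> int \<Rightarrow> bool" where
  "knz V G p j \<longleftrightarrow> \<not> kvan var (vars V) (hom_part V) (gid V G) p (int p + j)"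

lemma knz_cong: "(\<And>d. gid V G d = gid V G' d) \<Longrightarrow> knz V G p j \<longleftrightarrow> knz V G' p j"
  unfolding knz_def by (metis ext)

context
  fixes V :: "nat set"
  assumes finV: "finite V"
begin

lemma knz_var_iff:
  assumes G: "hom_gens V G" and z: "z \<in> vars V" and reg: "var_regular V z G"
  shows "knz V (G \<union> vgens {z}) p j \<longleftrightarrow> knz V G p j \<or> (\<exists>q. p = Suc q \<and> knz V G q j)"
proof -
  have "kvan var (vars V) (hom_part V) (gid V (G \<union> vgens {z})) p (int p + j) \<longleftrightarrow>
    kvan var (vars V) (hom_part V) (gid V G) p (int p + j) \<and>
    (\<forall>q. p = Suc q \<longrightarrow> kvan var (vars V) (hom_part V) (gid V G) q (int p + j - 1))"
    by (rule kvan_regular_iff[OF finite_vars[OF finV] gsub_hom_part gsub_gid gid_hom_part[OF G] z gid_var[OF z]])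
      (use reg in \<open>auto simp: var_regular_def\<close>)
  then show ?thesis by (auto simp: knz_def)
qed

text \<open>Mayer--Vietoris keeps the internal degree, so the step from column p + 1 to column p
  turns row j into row j + 1.\<close>

lemma knz_sum:
  assumes G: "hom_gens V G1" "hom_gens V G2" and int: "\<And>d. gid V G0 d = gid V G1 d \<inter> gid V G2 d"
    and nz: "knz V (G1 \<union> G2) (Suc p) j"
  shows "knz V G0 p (j + 1) \<or> knz V G1 (Suc p) j \<or> knz V G2 (Suc p) j"
proof -
  have G0: "gid V G0 = (\<lambda>d. gid V G1 d \<inter> gid V G2 d)" using int by blast
  show ?thesis
    using kvan_sum[OF finite_vars[OF finV] gsub_hom_part gsub_gid gsub_gid gid_hom_part[OF G(1)]
      gid_hom_part[OF G(2)] gid_union, of p "int (Suc p) + j"] nz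
    by (auto simp: knz_def G0 algebra_simps)
qed

lemma knz_inter:
  assumes G: "hom_gens V G1" "hom_gens V G2" and int: "\<And>d. gid V G0 d = gid V G1 d \<inter> gid V G2 d"
    and nz: "knz V G0 p j"
  shows "knz V (G1 \<union> G2) (Suc p) (j - 1) \<or> knz V G1 p j \<or> knz V G2 p j"
proof -
  have G0: "gid V G0 = (\<lambda>d. gid V G1 d \<inter> gid V G2 d)" using int by blast
  show ?thesis
    using kvan_inter[OF finite_vars[OF finV] gsub_hom_part gsub_gid gsub_gid gid_hom_part[OF G(1)]
      gid_hom_part[OF G(2)] gid_union, of p "int p + j"] nz
    by (auto simp: knz_def G0 algebra_simps)
qed

text \<open>Each variable that occurs in no generator adds a copy of the table moved one column to
  the right; rows do not change. An entry is thus moved by at most \<open>card Z\<close> columns,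
  and the largest move does occur.\<close>

lemma knz_vgens_aux:
  assumes G: "hom_gens V G" and "finite Z" "Z \<subseteq> vars V" "\<forall>z\<in>Z. free_of z G"
  shows "(\<forall>p. knz V (G \<union> vgens Z) p j \<longrightarrow> (\<exists>q\<le>p. p \<le> q + card Z \<and> knz V G q j)) \<and>
    (\<forall>q. knz V G q j \<longrightarrow> knz V (G \<union> vgens Z) (q + card Z) j)"
  using assms(2-4)
proof (induction Z rule: finite_induct)
  case (insert z Z)
  have *: "G \<union> vgens (insert z Z) = (G \<union> vgens Z) \<union> vgens {z}"
    by (subst vgens_insert) auto
  have hg: "hom_gens V (G \<union> vgens Z)" using G insert.prems by (auto intro!: hom_gens_vgens)
  have fr: "free_of z (G \<union> vgens Z)" using insert by (auto intro!: free_of_vgens)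
  have z: "z \<in> vars V" using insert by auto
  note iff = knz_var_iff[OF hg z var_regular_free_of[OF fr]]
  have IH: "\<And>p. knz V (G \<union> vgens Z) p j \<Longrightarrow> \<exists>q\<le>p. p \<le> q + card Z \<and> knz V G q j"
    "\<And>q. knz V G q j \<Longrightarrow> knz V (G \<union> vgens Z) (q + card Z) j"
    using insert by auto
  show ?case
    unfolding * iff
  proof (intro conjI allI impI)
    fix p assume "knz V (G \<union> vgens Z) p j \<or> (\<exists>q. p = Suc q \<and> knz V (G \<union> vgens Z) q j)"
    then obtain p' where "p' \<le> p" "p \<le> Suc p'" "knz V (G \<union> vgens Z) p' j"
      by (metis le_refl le_SucI)
    then obtain q where "q \<le> p'" "p' \<le> q + card Z" "knz V G q j" using IH(1) by blast
    then show "\<exists>q\<le>p. p \<le> q + card (insert z Z) \<and> knz V G q j"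
      using \<open>p' \<le> p\<close> \<open>p \<le> Suc p'\<close> insert.hyps by (intro exI[of _ q]) auto
  next
    fix q assume "knz V G q j"
    then show "knz V (G \<union> vgens Z) (q + card (insert z Z)) j \<or>
        (\<exists>q'. q + card (insert z Z) = Suc q' \<and> knz V (G \<union> vgens Z) q' j)"
      using IH(2) insert.hyps by auto
  qed
qed auto

lemma knz_vgens:
  assumes "hom_gens V G" "Z \<subseteq> vars V" "\<And>z. z \<in> Z \<Longrightarrow> free_of z G"
  shows "knz V (G \<union> vgens Z) p j \<Longrightarrow> \<exists>q\<le>p. p \<le> q + card Z \<and> knz V G q j"
    and "knz V G q j \<Longrightarrow> knz V (G \<union> vgens Z) (q + card Z) j"
  using knz_vgens_aux[of G Z j] assms finite_subset[OF assms(2) finite_vars[OF finV]] by blast+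

lemma knz_bounds:
  assumes "knz V G p j"
  shows "0 \<le> j" "p \<le> card (vars V)"
proof -
  show "0 \<le> j"
  proof (rule ccontr)
    assume "\<not> 0 \<le> j"
    then have "c = 0" if "c \<in> kchain (vars V) (hom_part V) p (int p + j)" for c :: "vname set \<Rightarrow> 'a mpoly"
      using that hom_part_neg[of j _ V] kchain_val[OF that, of j] by (auto simp: fun_eq_iff)
    then show False using assms kchain_zero[OF gsub_hom_part] gid.zero
      unfolding knz_def kvan_def by (fastforce intro!: bexI[of _ 0])
  qed
  show "p \<le> card (vars V)"
  proof (rule ccontr)
    assume "\<not> p \<le> card (vars V)"
    then have "\<not> (\<sigma> \<subseteq> vars V \<and> card \<sigma> = p)" for \<sigma>
      using card_mono[OF finite_vars[OF finV], of \<sigma>] by auto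
    then have "c = 0" if "c \<in> kchain (vars V) (hom_part V) p (int p + j)" for c :: "vname set \<Rightarrow> 'a mpoly"
      using kchain_supp[OF that] by (auto simp: fun_eq_iff)
    then show False using assms kchain_zero[OF gsub_hom_part] gid.zero
      unfolding knz_def kvan_def by (fastforce intro!: bexI[of _ 0])
  qed
qed

lemma hom_part_vars:
  assumes "d > 0"
  shows "hom_part V d \<subseteq> gid V (vgens (vars V)) d"
proof
  fix p assume p: "p \<in> hom_part V d"
  have "single m c \<in> gid V (vgens (vars V)) d" if "m \<in> keys p" for m c
  proof -
    have m: "keys m \<subseteq> vars V" "int (total_degree m) = d" using p that by (auto simp: hom_part_def)
    then have "m \<noteq> 0" using assms by auto
    then obtain z where z: "z \<in> keys m" using keys_eq_empty by fastforce
    have "single (m - single z 1) c * var z \<in> gid V (vgens (vars V)) d"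
      by (rule gid_base[of 1])
        (use m z keys_sub[of m "single z 1"] total_degree_sub_key[OF z] in \<open>auto simp: vgens_def\<close>)
    then show ?thesis using sub_add_key[OF z] by (simp add: single_mult_var add.commute)
  qed
  then show "p \<in> gid V (vgens (vars V)) d" by (subst mpoly_sum) (rule gid_sum)
qed

text \<open>Acyclicity of the Koszul complex of S, obtained by comparison with the residue field:
  adjoining all variables moves an entry of column p to column \<open>p + card (vars V)\<close>,
  which exceeds the last column unless p = 0, and the residue field lives in degree 0 only.\<close>

lemma knz_empty: "knz V ({} :: (int \<times> ('k::comm_ring_1) mpoly) set) p j \<longleftrightarrow> p = 0 \<and> j = 0"
proof
  assume nz: "knz V ({} :: (int \<times> 'k mpoly) set) p j"
  then have nz': "knz V (vgens (vars V) :: (int \<times> 'k mpoly) set) (p + card (vars V)) j"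
    using knz_vgens(2)[of "{}" "vars V"] finite_vars[OF finV] by auto
  then have "p = 0" using knz_bounds(2) by fastforce
  moreover have "j = 0"
  proof (rule ccontr)
    assume "j \<noteq> 0"
    then have "hom_part V j \<subseteq> gid V (vgens (vars V)) j" using knz_bounds(1)[OF nz] hom_part_vars[of j] by simp
    then have "c \<tau> \<in> gid V (vgens (vars V)) j"
      if "c \<in> kchain (vars V) (hom_part V) q (int q + j)" for q \<tau> and c :: "vname set \<Rightarrow> 'k mpoly"
      using kchain_val[OF that, of j \<tau>] by auto
    then have "kvan var (vars V) (hom_part V) (gid V (vgens (vars V) :: (int \<times> 'k mpoly) set)) q (int q + j)" for q
      unfolding kvan_def by (auto intro!: bexI[of _ 0] kchain_zero[OF gsub_hom_part])
    then show False using nz' unfolding knz_def by blast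
  qed
  ultimately show "p = 0 \<and> j = 0" by simp
next
  assume "p = 0 \<and> j = 0"
  moreover have "knz V ({} :: (int \<times> 'k mpoly) set) 0 0"
  proof (rule ccontr)
    assume "\<not> ?thesis"
    then have v: "kvan var (vars V) (hom_part V) (gid V ({} :: (int \<times> 'k mpoly) set)) 0 0" by (simp add: knz_def)
    define c :: "vname set \<Rightarrow> 'k mpoly" where "c = (\<lambda>\<sigma>. if \<sigma> = {} then 1 else 0)"
    have c: "c \<in> kchain (vars V) (hom_part V) 0 0"
      using finite_vars[OF finV] by (auto simp: kchain_def c_def hom_part_def dest: finite_subset)
    have "kdiff var (vars V) c \<tau> = 0" for \<tau> by (simp add: kdiff_def c_def)
    then obtain b where b: "b \<in> kchain (vars V) (hom_part V) (Suc 0) 0"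
      and cb: "\<And>\<tau>. c \<tau> - kdiff var (vars V) b \<tau> = 0"
      using v c unfolding kvan_def by fastforce
    have "b = 0" using hom_part_neg[of "-1" _ V] kchain_val[OF b, of "-1"] by (auto simp: fun_eq_iff)
    then show False using cb[of "{}"] by (simp add: c_def)
  qed
  ultimately show "knz V ({} :: (int \<times> 'k mpoly) set) p j" by simp
qed

text \<open>Two ideals that agree modulo variables not occurring in the generators of the smaller one:
  the map \<open>Tor(S/(G)) \<rightarrow> Tor(S/(G, Z))\<close> is injective and factors through \<open>Tor(S/(G'))\<close>.\<close>

lemma knz_between:
  assumes G: "hom_gens V G" and z: "z \<in> vars V" "w \<in> vars V" "z \<noteq> w"
    and fr: "free_of z G" "free_of w G"
    and sub: "\<And>d. gid V G d \<subseteq> gid V G' d" "\<And>d. gid V G' d \<subseteq> gid V (G \<union> vgens {z} \<union> vgens {w}) d"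
    and nz: "knz V G p j"
  shows "knz V G' p j"
proof (rule ccontr)
  assume "\<not> knz V G' p j"
  then have v: "kvan var (vars V) (hom_part V) (gid V G') p (int p + j)" by (simp add: knz_def)
  have G1: "hom_gens V (G \<union> vgens {z})" using G z hom_gens_vgens[of "{z}" V] by auto
  have fr1: "free_of w (G \<union> vgens {z})" using fr z free_of_vgens[of w "{z}"] by auto
  have "kvan var (vars V) (hom_part V) (gid V G) p (int p + j)"
    unfolding kvan_def
  proof (intro ballI impI)
    fix c assume c: "c \<in> kchain (vars V) (hom_part V) p (int p + j)"
      and dc: "\<forall>\<tau>. kdiff var (vars V) c \<tau> \<in> gid V G (int p + j - int p + 1)"
    have dc1: "kdiff var (vars V) c \<tau> \<in> gid V (G \<union> vgens {z}) (int p + j - int p + 1)" for \<tau>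
      using dc gid_mono[of G "G \<union> vgens {z}"] by blast
    \<comment> \<open>A primitive modulo G' is a primitive modulo (G, z, w); the two variables are
      then removed one after the other.\<close>
    obtain b where b: "b \<in> kchain (vars V) (hom_part V) (Suc p) (int p + j)"
      and cb: "\<And>\<tau>. c \<tau> - kdiff var (vars V) b \<tau> \<in> gid V (G \<union> vgens {z} \<union> vgens {w}) (int p + j - int p)"
      using v c dc sub unfolding kvan_def by (meson subsetD)
    obtain b' where b': "b' \<in> kchain (vars V) (hom_part V) (Suc p) (int p + j)"
      and cb': "\<And>\<tau>. c \<tau> - kdiff var (vars V) b' \<tau> \<in> gid V (G \<union> vgens {z}) (int p + j - int p)"
      using kboundary_lift[OF finite_vars[OF finV] gsub_hom_part gsub_gid gid_hom_part[OF G1] z(2) gid_var[OF z(2)] _ c dc1 b cb]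
        var_regular_free_of[OF fr1] unfolding var_regular_def by blast
    show "\<exists>b\<in>kchain (vars V) (hom_part V) (Suc p) (int p + j). \<forall>\<tau>. c \<tau> - kdiff var (vars V) b \<tau> \<in> gid V G (int p + j - int p)"
      using kboundary_lift[OF finite_vars[OF finV] gsub_hom_part gsub_gid gid_hom_part[OF G] z(1) gid_var[OF z(1)] _ c _ b' cb']
        dc var_regular_free_of[OF fr(1)] unfolding var_regular_def by blast
  qed
  then show False using nz by (simp add: knz_def)
qed

end

section \<open>Acyclic hypergraphs\<close>

text \<open>\<open>berge\<close> describes the hypergraphs whose incidence graph is a forest. The pair \<open>hpd\<close>, \<open>hrow\<close> will
  be the position of the extremal Betti number in the last column of the Betti table. The petals at
  \<open>v\<close> are the edges that stop the deletion of an inner vertex \<open>v\<close> from lowering \<open>hrow\<close>, which changes by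
  the number of petals minus 2.\<close>

definition berge :: "'a set set \<Rightarrow> bool" where
  "berge \<B> \<longleftrightarrow> finite \<B> \<and> (\<forall>B\<in>\<B>. finite B \<and> 2 \<le> card B) \<and>
     (\<forall>\<C>\<subseteq>\<B>. \<C> \<noteq> {} \<longrightarrow> 1 + (\<Sum>B\<in>\<C>. card B - 1) \<le> card (\<Union>\<C>))"

definition hpd :: "'a set set \<Rightarrow> nat" where
  "hpd \<B> = (\<Sum>B\<in>\<B>. card B - 1)"

definition hdeg :: "'a set set \<Rightarrow> 'a \<Rightarrow> nat" where
  "hdeg \<B> v = card {B \<in> \<B>. v \<in> B}"

definition hinner :: "'a set set \<Rightarrow> 'a set" where
  "hinner \<B> = {v. 2 \<le> hdeg \<B> v}"

definition hrow :: "'a set set \<Rightarrow> int" where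
  "hrow \<B> = int (card (hinner \<B>)) + int (card (\<Union>\<B>)) - int (hpd \<B>)"

definition petals :: "'a set set \<Rightarrow> 'a \<Rightarrow> 'a set set" where
  "petals \<B> v = {B \<in> \<B>. v \<in> B \<and> (3 \<le> card B \<or> (\<exists>u. B = {v, u} \<and> 3 \<le> hdeg \<B> u))}"

text \<open>The maximal cliques after the neighbourhood of v has been completed to a clique.\<close>

definition hmerge :: "'a \<Rightarrow> 'a set set \<Rightarrow> 'a set set" where
  "hmerge v \<B> = insert (\<Union>{B \<in> \<B>. v \<in> B}) {B \<in> \<B>. v \<notin> B}"

text \<open>An edge that shrinks to one vertex is dropped, so a vertex whose only edge was
  \<open>{v, u}\<close> leaves the union together with v.\<close>

definition hdel :: "'a \<Rightarrow> 'a set set \<Rightarrow> 'a set set" where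
  "hdel v \<B> = (\<lambda>B. B - {v}) ` {B \<in> \<B>. 2 \<le> card (B - {v})}"

lemma bergeD:
  assumes "berge \<B>"
  shows "finite \<B>" "\<And>B. B \<in> \<B> \<Longrightarrow> finite B" "\<And>B. B \<in> \<B> \<Longrightarrow> 2 \<le> card B"
    "\<And>\<C>. \<C> \<subseteq> \<B> \<Longrightarrow> \<C> \<noteq> {} \<Longrightarrow> 1 + hpd \<C> \<le> card (\<Union>\<C>)" "finite (\<Union>\<B>)"
  using assms by (auto simp: berge_def hpd_def)

lemma hdeg_pos_iff: "finite \<B> \<Longrightarrow> 0 < hdeg \<B> v \<longleftrightarrow> v \<in> \<Union>\<B>"
  by (auto simp: hdeg_def card_gt_0_iff)

lemma hinner_sub:
  assumes "finite \<B>"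
  shows "hinner \<B> \<subseteq> \<Union>\<B>"
proof
  fix v assume "v \<in> hinner \<B>"
  then have "0 < hdeg \<B> v" by (simp add: hinner_def)
  then show "v \<in> \<Union>\<B>" unfolding hdeg_pos_iff[OF assms] .
qed

lemma finite_hinner: "berge \<B> \<Longrightarrow> finite (hinner \<B>)"
  by (rule finite_subset[OF hinner_sub bergeD(5)]) (auto dest: bergeD(1))

lemma petals_le_hdeg: "finite \<B> \<Longrightarrow> card (petals \<B> v) \<le> hdeg \<B> v"
  unfolding petals_def hdeg_def by (rule card_mono) auto

text \<open>In a \<open>berge\<close> hypergraph the inequality is an equality, and it characterises the connected
  subfamilies.\<close>

definition tree_like :: "'a set set \<Rightarrow> bool" where
  "tree_like \<C> \<longleftrightarrow> \<C> \<noteq> {} \<and> card (\<Union>\<C>) \<le> 1 + hpd \<C>"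

text \<open>An edge D outside the family that shares two vertices with it would add at most
  \<open>card D - 2\<close> vertices but \<open>card D - 1\<close> to \<open>hpd\<close>, against
  the forest inequality.\<close>

lemma tree_like_meet:
  assumes b: "berge \<B>" and C: "\<C> \<subseteq> \<B>" "tree_like \<C>" and D: "D \<in> \<B>"
    and xy: "x \<in> D" "y \<in> D" "x \<in> \<Union>\<C>" "y \<in> \<Union>\<C>" "x \<noteq> y"
  shows "D \<in> \<C>"
proof (rule ccontr)
  assume n: "D \<notin> \<C>"
  have fin: "finite \<C>" "finite (\<Union>\<C>)" "finite D" "2 \<le> card D"
    using bergeD(1-3,5)[OF b] C(1) D finite_subset[of \<C> \<B>] finite_subset[of "\<Union>\<C>" "\<Union>\<B>"]
    by (auto simp del: finite_Union)
  have "1 + hpd (insert D \<C>) \<le> card (\<Union>(insert D \<C>))"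
    by (rule bergeD(4)[OF b]) (use C D in auto)
  moreover have "hpd (insert D \<C>) = card D - 1 + hpd \<C>"
    using fin n by (simp add: hpd_def)
  moreover have "card (\<Union>(insert D \<C>)) + card (D \<inter> \<Union>\<C>) = card D + card (\<Union>\<C>)"
    using card_Un_Int[OF fin(3,2)] by simp
  moreover have "card {x, y} \<le> card (D \<inter> \<Union>\<C>)"
    by (rule card_mono) (use fin xy in auto)
  moreover have "card (\<Union>\<C>) \<le> 1 + hpd \<C>" using C by (simp add: tree_like_def)
  ultimately show False using fin(4) xy(5) by simp
qed

lemma tree_like_single: "berge \<B> \<Longrightarrow> B \<in> \<B> \<Longrightarrow> tree_like {B}"
  using bergeD(3)[of \<B> B] by (simp add: tree_like_def hpd_def)

text \<open>A new edge that meets the family adds at most \<open>card D - 1\<close>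
  vertices.\<close>

lemma tree_like_insert:
  assumes b: "berge \<B>" and C: "\<C> \<subseteq> \<B>" "tree_like \<C>" and D: "D \<in> \<B>" "D \<inter> \<Union>\<C> \<noteq> {}"
  shows "tree_like (insert D \<C>)"
proof (cases "D \<in> \<C>")
  case False
  have fin: "finite \<C>" "finite (\<Union>\<C>)" "finite D" "2 \<le> card D"
    using bergeD(1-3,5)[OF b] C(1) D finite_subset[of \<C> \<B>] finite_subset[of "\<Union>\<C>" "\<Union>\<B>"]
    by (auto simp del: finite_Union)
  have "hpd (insert D \<C>) = card D - 1 + hpd \<C>"
    using fin False by (simp add: hpd_def)
  moreover have "card (\<Union>(insert D \<C>)) + card (D \<inter> \<Union>\<C>) = card D + card (\<Union>\<C>)"
    using card_Un_Int[OF fin(3,2)] by simp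
  moreover have "card (D \<inter> \<Union>\<C>) > 0" using fin D by (simp add: card_gt_0_iff)
  ultimately show ?thesis using C fin(4) by (simp add: tree_like_def)
qed (use C in \<open>simp add: insert_absorb\<close>)

lemma berge_linear:
  assumes "berge \<B>" "B \<in> \<B>" "B' \<in> \<B>" "x \<in> B" "y \<in> B" "x \<in> B'" "y \<in> B'" "x \<noteq> y"
  shows "B = B'"
  using tree_like_meet[OF assms(1) _ tree_like_single[OF assms(1,2)] assms(3), of x y] assms by auto

section \<open>Merging and deleting at a vertex of an acyclic hypergraph\<close>

context
  fixes \<B> :: "'a set set" and v :: 'a
  assumes b: "berge \<B>" and v: "v \<in> \<Union>\<B>"
begin

abbreviation "star_set \<equiv> \<Union>{B \<in> \<B>. v \<in> B}"

text \<open>The union bound gives \<le>, the forest inequality for the edges at v gives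
  \<ge>.\<close>

lemma card_star_set: "card star_set = 1 + hpd {B \<in> \<B>. v \<in> B}"
proof (rule antisym)
  have fin: "finite {B \<in> \<B>. v \<in> B}" using bergeD[OF b] by simp
  have "star_set = insert v (\<Union>B\<in>{B \<in> \<B>. v \<in> B}. B - {v})" using v by auto
  moreover have "finite (\<Union>B\<in>{B \<in> \<B>. v \<in> B}. B - {v})" using fin bergeD(2)[OF b] by auto
  ultimately have "card star_set \<le> Suc (card (\<Union>B\<in>{B \<in> \<B>. v \<in> B}. B - {v}))"
    by (simp only: card_insert_if) simp
  also have "card (\<Union>B\<in>{B \<in> \<B>. v \<in> B}. B - {v}) \<le> (\<Sum>B\<in>{B \<in> \<B>. v \<in> B}. card (B - {v}))"
    by (rule card_UN_le[OF fin])
  also have "\<dots> = hpd {B \<in> \<B>. v \<in> B}"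
    unfolding hpd_def using bergeD[OF b] by (intro sum.cong) auto
  finally show "card star_set \<le> 1 + hpd {B \<in> \<B>. v \<in> B}" by simp
  show "1 + hpd {B \<in> \<B>. v \<in> B} \<le> card star_set"
    by (rule bergeD(4)[OF b]) (use v in auto)
qed

lemma star_set_notin: "star_set \<notin> {B \<in> \<B>. v \<notin> B}"
  using v by auto

lemma Union_merge: "\<Union>(hmerge v \<B>) = \<Union>\<B>"
  by (auto simp: hmerge_def)

lemma hpd_split: "hpd \<B> = hpd {B \<in> \<B>. v \<in> B} + hpd {B \<in> \<B>. v \<notin> B}"
proof -
  have "\<B> = {B \<in> \<B>. v \<in> B} \<union> {B \<in> \<B>. v \<notin> B}" by auto
  then have "hpd \<B> = sum (\<lambda>B. card B - 1) ({B \<in> \<B>. v \<in> B} \<union> {B \<in> \<B>. v \<notin> B})"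
    by (simp add: hpd_def)
  then show ?thesis
    unfolding hpd_def by (subst (asm) sum.union_disjoint) (use bergeD(1)[OF b] in auto)
qed

lemma hpd_merge: "hpd (hmerge v \<B>) = hpd \<B>"
proof -
  have "hpd (hmerge v \<B>) = card star_set - 1 + hpd {B \<in> \<B>. v \<notin> B}"
    unfolding hpd_def hmerge_def by (rule sum.insert) (use star_set_notin bergeD(1)[OF b] in simp_all)
  then show ?thesis unfolding hpd_split card_star_set by simp
qed

lemma finite_star_set: "finite star_set"
  by (rule finite_subset[OF _ bergeD(5)[OF b]]) auto

lemma star_set_ge2: "2 \<le> card star_set"
proof -
  obtain B where B: "B \<in> \<B>" "v \<in> B" using v by auto
  then have "card B \<le> card star_set" by (intro card_mono[OF finite_star_set]) auto
  then show ?thesis using bergeD(3)[OF b B(1)] by simp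
qed

text \<open>In a subfamily that contains the merged edge, this edge can be replaced by all edges at
  v: the union is unchanged, \<open>hpd\<close> is unchanged by \<open>card_star_set\<close>, and
  the result is a subfamily of \<open>\<B>\<close>.\<close>

lemma berge_merge: "berge (hmerge v \<B>)"
  unfolding berge_def
proof (intro conjI ballI allI impI)
  show "finite (hmerge v \<B>)" using bergeD[OF b] by (simp add: hmerge_def)
  fix B assume "B \<in> hmerge v \<B>"
  then have "B = star_set \<or> B \<in> \<B>" by (auto simp: hmerge_def)
  then show "finite B" "2 \<le> card B" using finite_star_set star_set_ge2 bergeD[OF b] by auto
next
  fix \<C> assume C: "\<C> \<subseteq> hmerge v \<B>" "\<C> \<noteq> {}"
  show "1 + (\<Sum>B\<in>\<C>. card B - 1) \<le> card (\<Union>\<C>)"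
  proof (cases "star_set \<in> \<C>")
    case False
    then have "\<C> \<subseteq> \<B>" using C by (auto simp: hmerge_def)
    then show ?thesis using bergeD(4)[OF b _ C(2)] by (simp add: hpd_def)
  next
    case True
    let ?D = "\<C> - {star_set}" and ?E = "{B \<in> \<B>. v \<in> B}"
    have D: "?D \<subseteq> {B \<in> \<B>. v \<notin> B}" using C by (auto simp: hmerge_def)
    have fin: "finite ?D" "finite ?E" using D bergeD(1)[OF b] finite_subset by fastforce+
    have "hpd \<C> = card star_set - 1 + hpd ?D"
      unfolding hpd_def using fin True by (simp add: sum.remove)
    also have "\<dots> = hpd ?E + hpd ?D" using card_star_set by simp
    also have "\<dots> = hpd (?E \<union> ?D)"
      unfolding hpd_def by (rule sum.union_disjoint[symmetric]) (use fin D in auto)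
    finally have "1 + hpd \<C> \<le> card (\<Union>(?E \<union> ?D))"
      using bergeD(4)[OF b, of "?E \<union> ?D"] D v by auto
    moreover have "\<Union>(?E \<union> ?D) = \<Union>\<C>" using True by auto
    ultimately show ?thesis by (simp add: hpd_def)
  qed
qed

lemma block_at: 
  assumes "u \<in> star_set" "u \<noteq> v"
  obtains B0 where "B0 \<in> \<B>" "v \<in> B0" "u \<in> B0" "\<And>B. B \<in> \<B> \<Longrightarrow> v \<in> B \<Longrightarrow> u \<in> B \<Longrightarrow> B = B0"
proof -
  obtain B0 where B0: "B0 \<in> \<B>" "v \<in> B0" "u \<in> B0" using assms by blast
  show ?thesis
    by (rule that[OF B0]) (rule berge_linear[OF b _ B0(1), of _ v u]; use B0 assms in simp)
qed

text \<open>A vertex of the star other than v shares exactly one edge with v, by linearity, and this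
  edge is traded for the merged one.\<close>

lemma hdeg_merge: "hdeg (hmerge v \<B>) u = (if u = v then 1 else hdeg \<B> u)"
proof (cases "u = v")
  case True
  have "{B \<in> hmerge v \<B>. v \<in> B} = {star_set}" using v by (auto simp: hmerge_def)
  then show ?thesis using True by (simp add: hdeg_def)
next
  case False
  have fin: "finite {B \<in> \<B>. v \<notin> B \<and> u \<in> B}" using bergeD[OF b] by simp
  show ?thesis
  proof (cases "u \<in> star_set")
    case True
    obtain B0 where B0: "B0 \<in> \<B>" "v \<in> B0" "u \<in> B0" "\<And>B. B \<in> \<B> \<Longrightarrow> v \<in> B \<Longrightarrow> u \<in> B \<Longrightarrow> B = B0"
      using block_at[OF True False] by blast
    have 1: "{B \<in> hmerge v \<B>. u \<in> B} = insert star_set {B \<in> \<B>. v \<notin> B \<and> u \<in> B}"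
      using True by (auto simp: hmerge_def)
    have 2: "{B \<in> \<B>. u \<in> B} = insert B0 {B \<in> \<B>. v \<notin> B \<and> u \<in> B}"
      using B0 by blast
    have "star_set \<notin> {B \<in> \<B>. v \<notin> B \<and> u \<in> B}" "B0 \<notin> {B \<in> \<B>. v \<notin> B \<and> u \<in> B}" using v B0(2) by auto
    then show ?thesis using False fin unfolding hdeg_def 1 2 by simp
  next
    case F: False
    have "{B \<in> hmerge v \<B>. u \<in> B} = {B \<in> \<B>. u \<in> B}"
      using F by (auto simp: hmerge_def)
    then show ?thesis using False by (simp add: hdeg_def)
  qed
qed

lemma hinner_merge: "hinner (hmerge v \<B>) = hinner \<B> - {v}"
  by (auto simp: hinner_def hdeg_merge)

lemma hrow_merge:
  assumes "v \<in> hinner \<B>"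
  shows "hrow (hmerge v \<B>) = hrow \<B> - 1"
proof -
  have "card (hinner \<B>) = Suc (card (hinner (hmerge v \<B>)))"
    unfolding hinner_merge using card_Suc_Diff1[OF finite_hinner[OF b] assms] by simp
  then show ?thesis by (simp add: hrow_def Union_merge hpd_merge)
qed

lemma star_set_ge3:
  assumes "v \<in> hinner \<B>"
  shows "3 \<le> card star_set"
proof -
  have fin: "finite {B \<in> \<B>. v \<in> B}" using bergeD[OF b] by simp
  have "(\<Sum>B\<in>{B \<in> \<B>. v \<in> B}. 1) \<le> hpd {B \<in> \<B>. v \<in> B}"
    unfolding hpd_def by (rule sum_mono) (use bergeD(3)[OF b] in fastforce)
  then show ?thesis using assms by (simp add: card_star_set hinner_def hdeg_def)
qed

lemma inj_del: "inj_on (\<lambda>B. B - {v}) {B \<in> \<B>. 2 \<le> card (B - {v})}"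
proof (rule inj_onI)
  fix B B' assume B: "B \<in> {B \<in> \<B>. 2 \<le> card (B - {v})}" "B' \<in> {B \<in> \<B>. 2 \<le> card (B - {v})}"
    and eq: "B - {v} = B' - {v}"
  have "\<exists>x y. x \<in> B - {v} \<and> y \<in> B - {v} \<and> x \<noteq> y"
  proof (rule ccontr)
    assume "\<not> ?thesis"
    then have "card (B - {v}) \<le> 1" by (metis card_le_Suc0_iff_eq card.infinite One_nat_def zero_le_one)
    then show False using B by simp
  qed
  then obtain x y where "x \<in> B - {v}" "y \<in> B - {v}" "x \<noteq> y" by blast
  then show "B = B'" using berge_linear[OF b, of B B' x y] B eq by auto
qed

text \<open>Every edge through v loses one from its weight while the union loses only v, so a single
  such edge already pays for the lost vertex.\<close>

lemma berge_del: "berge (hdel v \<B>)"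
  unfolding berge_def
proof (intro conjI ballI allI impI)
  show "finite (hdel v \<B>)" using bergeD[OF b] by (simp add: hdel_def)
  fix B assume "B \<in> hdel v \<B>"
  then show "finite B" "2 \<le> card B" using bergeD[OF b] by (auto simp: hdel_def)
next
  fix \<C> assume C: "\<C> \<subseteq> hdel v \<B>" "\<C> \<noteq> {}"
  define \<D> where "\<D> = {B \<in> \<B>. 2 \<le> card (B - {v}) \<and> B - {v} \<in> \<C>}"
  have fin: "finite \<D>" using bergeD[OF b] by (simp add: \<D>_def)
  have im: "\<C> = (\<lambda>B. B - {v}) ` \<D>" using C by (auto simp: \<D>_def hdel_def)
  have inj: "inj_on (\<lambda>B. B - {v}) \<D>" using inj_del by (rule inj_on_subset) (auto simp: \<D>_def)
  have U: "\<Union>\<C> = \<Union>\<D> - {v}" unfolding im by auto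
  have finU: "finite (\<Union>\<D>)" using fin bergeD[OF b] by (auto simp: \<D>_def)
  have S: "(\<Sum>B\<in>\<C>. card B - 1) + card {B \<in> \<D>. v \<in> B} = hpd \<D>"
  proof -
    have "(\<Sum>B\<in>\<C>. card B - 1) = (\<Sum>B\<in>\<D>. card (B - {v}) - 1)"
      unfolding im by (subst sum.reindex[OF inj]) simp
    moreover have "card {B \<in> \<D>. v \<in> B} = (\<Sum>B\<in>\<D>. if v \<in> B then 1 else 0)"
      using fin by (simp add: sum.If_cases Int_def)
    moreover have "(\<Sum>B\<in>\<D>. card (B - {v}) - 1) + (\<Sum>B\<in>\<D>. if v \<in> B then 1 else 0) = hpd \<D>"
      unfolding hpd_def sum.distrib[symmetric]
      by (intro sum.cong refl) (auto simp: \<D>_def)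
    ultimately show ?thesis by simp
  qed
  have D: "1 + hpd \<D> \<le> card (\<Union>\<D>)"
  proof (rule bergeD(4)[OF b])
    show "\<D> \<subseteq> \<B>" by (auto simp: \<D>_def)
    show "\<D> \<noteq> {}" using C(2) im by (metis image_empty)
  qed
  show "1 + (\<Sum>B\<in>\<C>. card B - 1) \<le> card (\<Union>\<C>)"
  proof (cases "v \<in> \<Union>\<D>")
    case True
    then have "card {B \<in> \<D>. v \<in> B} > 0" using fin by (auto simp: card_gt_0_iff)
    then show ?thesis using S D True finU by (simp add: U card_Diff_singleton)
  next
    case False
    then show ?thesis using S D by (simp add: U)
  qed
qed

text \<open>Each edge at v loses one from its weight. This includes the edges \<open>{v, u}\<close>
  that are dropped: they had weight 1, and dropping them removes exactly that.\<close>

lemma hpd_del: "hpd (hdel v \<B>) + hdeg \<B> v = hpd \<B>"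
proof -
  have fin: "finite \<B>" using bergeD[OF b] by simp
  have "hpd (hdel v \<B>) = (\<Sum>B\<in>{B \<in> \<B>. 2 \<le> card (B - {v})}. card (B - {v}) - 1)"
    unfolding hpd_def hdel_def by (subst sum.reindex[OF inj_del]) simp
  also have "\<dots> = (\<Sum>B\<in>\<B>. card (B - {v}) - 1)"
    using fin by (intro sum.mono_neutral_left) auto
  finally have 1: "hpd (hdel v \<B>) = (\<Sum>B\<in>\<B>. card (B - {v}) - 1)" .
  have 2: "hdeg \<B> v = (\<Sum>B\<in>\<B>. if v \<in> B then 1 else 0)"
    using fin by (simp add: hdeg_def sum.If_cases Int_def)
  have "(\<Sum>B\<in>\<B>. card (B - {v}) - 1) + (\<Sum>B\<in>\<B>. if v \<in> B then 1 else 0) = hpd \<B>"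
    unfolding hpd_def sum.distrib[symmetric]
    using bergeD(2,3)[OF b] by (intro sum.cong refl) (fastforce simp: card_Diff_singleton_if)
  then show ?thesis using 1 2 by simp
qed

lemma hdeg_del: "hdeg (hdel v \<B>) u = (if u = v then 0 else hdeg \<B> u - (if {v, u} \<in> \<B> then 1 else 0))"
proof (cases "u = v")
  case True
  then have "{B \<in> hdel v \<B>. u \<in> B} = {}" by (auto simp: hdel_def)
  then show ?thesis unfolding hdeg_def using True by (simp only: card.empty refl if_True)
next
  case False
  have "{B \<in> hdel v \<B>. u \<in> B} = (\<lambda>B. B - {v}) ` {B \<in> \<B>. 2 \<le> card (B - {v}) \<and> u \<in> B}"
    using False by (auto simp: hdel_def)
  then have "hdeg (hdel v \<B>) u = card {B \<in> \<B>. 2 \<le> card (B - {v}) \<and> u \<in> B}"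
    unfolding hdeg_def by (simp only:) (rule card_image, rule inj_on_subset[OF inj_del], auto)
  also have "{B \<in> \<B>. 2 \<le> card (B - {v}) \<and> u \<in> B} = {B \<in> \<B>. u \<in> B} - {{v, u}}"
  proof -
    have "2 \<le> card (B - {v}) \<longleftrightarrow> B \<noteq> {v, u}" if B: "B \<in> \<B>" "u \<in> B" for B
    proof
      assume "2 \<le> card (B - {v})"
      then show "B \<noteq> {v, u}" using False by (auto simp: card_insert_if)
    next
      assume n: "B \<noteq> {v, u}"
      show "2 \<le> card (B - {v})"
      proof (cases "v \<in> B")
        case True
        then have "{v, u} \<subset> B" using n B by auto
        then have "card {v, u} < card B" using bergeD(2)[OF b B(1)] by (rule psubset_card_mono[rotated])
        then show ?thesis using False True bergeD(2)[OF b B(1)] by (simp add: card_Diff_singleton)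
      qed (use bergeD(3)[OF b B(1)] in simp)
    qed
    then show ?thesis by auto
  qed
  finally show ?thesis using False bergeD(1)[OF b] by (simp add: hdeg_def card_Diff_singleton_if)
qed

text \<open>An edge at v that is no petal is \<open>{v, u}\<close> with u in one or two edges. In
  the first case u leaves the vertex set (\<open>A 1\<close>), in the second it stops being inner
  (\<open>A 2\<close>). By \<open>hpd_del\<close>, \<open>hpd\<close> drops by
  \<open>hdeg \<B> v\<close>, which exceeds these two losses together by the number of petals; the
  remaining terms come from v itself.\<close>

lemma hrow_del:
  "hrow (hdel v \<B>) = hrow \<B> - (if v \<in> hinner \<B> then 1 else 0) - 1 + int (card (petals \<B> v))"
proof -
  define A where "A = (\<lambda>i. {u. u \<noteq> v \<and> {v, u} \<in> \<B> \<and> hdeg \<B> u = i})"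
  have fin: "finite \<B>" "finite (\<Union>\<B>)" "finite (hinner \<B>)" using bergeD[OF b] finite_hinner[OF b] by auto
  have Asub: "A i \<subseteq> \<Union>\<B> - {v}" for i by (auto simp: A_def)
  have finA: "finite (A i)" for i using Asub fin finite_subset by (metis finite_Diff)
  have pos: "hdeg \<B> u > 0" if "{v, u} \<in> \<B>" for u using that hdeg_pos_iff[OF fin(1), of u] by auto
  have hi: "hinner (hdel v \<B>) = (hinner \<B> - {v}) - A 2"
    by (auto simp: hinner_def hdeg_del A_def split: if_splits)
  have A2: "A 2 \<subseteq> hinner \<B> - {v}" by (auto simp: A_def hinner_def)
  have 1: "int (card (hinner (hdel v \<B>))) =
      int (card (hinner \<B>)) - (if v \<in> hinner \<B> then 1 else 0) - int (card (A 2))"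
  proof -
    have "card (A 2) \<le> card (hinner \<B> - {v})" by (rule card_mono[OF _ A2]) (use fin in simp)
    moreover have "int (card (hinner \<B> - {v})) = int (card (hinner \<B>)) - (if v \<in> hinner \<B> then 1 else 0)"
      using card_Suc_Diff1[OF fin(3), of v] by (auto simp: card_Diff_singleton_if)
    ultimately show ?thesis
      unfolding hi card_Diff_subset[OF finA A2] by simp
  qed
  have finD: "finite (hdel v \<B>)" using bergeD(1)[OF berge_del] .
  have "\<Union>(hdel v \<B>) = (\<Union>\<B> - {v}) - A 1"
  proof (rule Set.set_eqI)
    fix u
    have "u \<in> \<Union>(hdel v \<B>) \<longleftrightarrow> 0 < hdeg (hdel v \<B>) u" using hdeg_pos_iff[OF finD] by simp
    also have "\<dots> \<longleftrightarrow> u \<noteq> v \<and> 0 < hdeg \<B> u \<and> \<not> ({v, u} \<in> \<B> \<and> hdeg \<B> u = 1)"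
      using pos[of u] by (auto simp: hdeg_del)
    also have "\<dots> \<longleftrightarrow> u \<in> (\<Union>\<B> - {v}) - A 1" unfolding hdeg_pos_iff[OF fin(1)] by (auto simp: A_def)
    finally show "u \<in> \<Union>(hdel v \<B>) \<longleftrightarrow> u \<in> (\<Union>\<B> - {v}) - A 1" .
  qed
  then have 2: "int (card (\<Union>(hdel v \<B>))) = int (card (\<Union>\<B>)) - 1 - int (card (A 1))"
  proof -
    assume *: "\<Union>(hdel v \<B>) = (\<Union>\<B> - {v}) - A 1"
    have "card (A 1) \<le> card (\<Union>\<B> - {v})" by (rule card_mono[OF _ Asub]) (use fin in auto)
    moreover have "card (\<Union>\<B>) = Suc (card (\<Union>\<B> - {v}))" using card_Suc_Diff1[OF fin(2) v] by simp
    ultimately show ?thesis unfolding * card_Diff_subset[OF finA Asub] by simp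
  qed
  have 3: "hdeg \<B> v = card (petals \<B> v) + card (A 1) + card (A 2)"
  proof -
    let ?f = "\<lambda>u. {v, u}"
    have inj: "inj_on ?f (A 1 \<union> A 2)" by (auto simp: inj_on_def A_def doubleton_eq_iff)
    have eq: "{B \<in> \<B>. v \<in> B} - petals \<B> v = ?f ` (A 1 \<union> A 2)"
    proof (intro equalityI subsetI)
      fix B assume B: "B \<in> {B \<in> \<B>. v \<in> B} - petals \<B> v"
      then have "card B = 2" using bergeD(3)[OF b, of B] by (auto simp: petals_def)
      then obtain u where u: "B = {v, u}" "u \<noteq> v" using B by (auto simp: card_2_iff doubleton_eq_iff)
      then have "\<not> 3 \<le> hdeg \<B> u" using B by (auto simp: petals_def)
      moreover have "hdeg \<B> u > 0" using B u pos by auto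
      ultimately have "hdeg \<B> u = 1 \<or> hdeg \<B> u = 2" by auto
      then show "B \<in> ?f ` (A 1 \<union> A 2)" using B u by (auto simp: A_def)
    next
      fix B assume "B \<in> ?f ` (A 1 \<union> A 2)"
      then obtain u where u: "B = {v, u}" "u \<noteq> v" "B \<in> \<B>" "hdeg \<B> u \<le> 2" by (auto simp: A_def)
      then show "B \<in> {B \<in> \<B>. v \<in> B} - petals \<B> v" by (auto simp: petals_def doubleton_eq_iff)
    qed
    have sub: "petals \<B> v \<subseteq> {B \<in> \<B>. v \<in> B}" by (auto simp: petals_def)
    have fS: "finite {B \<in> \<B>. v \<in> B}" using fin(1) by simp
    have "card {B \<in> \<B>. v \<in> B} = card (petals \<B> v) + card (?f ` (A 1 \<union> A 2))"
      using card_Diff_subset[OF finite_subset[OF sub fS] sub] card_mono[OF fS sub] unfolding eq by simp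
    also have "card (?f ` (A 1 \<union> A 2)) = card (A 1) + card (A 2)"
      by (subst card_image[OF inj], rule card_Un_disjoint[OF finA finA]) (auto simp: A_def)
    finally show ?thesis by (simp add: hdeg_def)
  qed
  show ?thesis unfolding hrow_def 1 2 using 3 hpd_del by (auto simp: hrow_def)
qed

text \<open>Deletion creates no petals: degrees do not grow, and a two-element edge that has lost v
  had three elements, so it came from a petal.\<close>

lemma petals_del: "card (petals (hdel v \<B>) u) \<le> card (petals \<B> u)"
proof (cases "u = v")
  case True
  then have "petals (hdel v \<B>) u = {}" by (auto simp: petals_def hdel_def)
  then show ?thesis by simp
next
  case False
  have "petals (hdel v \<B>) u \<subseteq> (\<lambda>B. B - {v}) ` petals \<B> u"
  proof
    fix D assume D: "D \<in> petals (hdel v \<B>) u"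
    then obtain B where B: "B \<in> \<B>" "D = B - {v}" "u \<in> B" by (auto simp: petals_def hdel_def)
    have fB: "finite B" using bergeD[OF b] B by auto
    have "card D \<le> card B" using B fB by (auto intro: card_mono)
    moreover have "3 \<le> card B \<or> (\<exists>w. B = {u, w} \<and> 3 \<le> hdeg \<B> w)" if w: "D = {u, w}" "3 \<le> hdeg (hdel v \<B>) w" for w
    proof (cases "v \<in> B")
      case True
      have "u \<noteq> w" using w D bergeD(3)[OF berge_del, of D] by (auto simp: petals_def)
      then have "card B = 3" using True B w fB by (metis card_2_iff card_Suc_Diff1 eval_nat_numeral(3))
      then show ?thesis by simp
    next
      case False
      then have "B = {u, w}" using B w by auto
      then show ?thesis using w by (auto simp: hdeg_del split: if_splits)
    qed
    ultimately have "B \<in> petals \<B> u" using D B by (auto simp: petals_def)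
    then show "D \<in> (\<lambda>B. B - {v}) ` petals \<B> u" using B by auto
  qed
  moreover have "finite (petals \<B> u)" using bergeD[OF b] by (simp add: petals_def)
  ultimately show ?thesis by (meson card_image_le card_mono finite_imageI order_trans)
qed

text \<open>An edge \<open>{u, v}\<close> grows by the merge and becomes a petal at u. If v lies in
  three edges, it was a petal at u before; this is the reason for the hypothesis. At v itself only
  the merged edge remains, hence the 1.\<close>

lemma petals_merge:
  assumes d: "3 \<le> hdeg \<B> v"
  shows "card (petals (hmerge v \<B>) u) \<le> max 1 (card (petals \<B> u))"
proof (cases "u = v")
  case True
  then show ?thesis using petals_le_hdeg[OF bergeD(1)[OF berge_merge], of u] by (simp add: hdeg_merge)
next
  case False
  have fin: "finite (petals \<B> u)" using bergeD[OF b] by (simp add: petals_def)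
  have hdw: "w \<noteq> v" if "B = {u, w}" "v \<notin> B" for B w using that by auto
  let ?f = "\<lambda>B. if v \<in> B then star_set else B"
  have "petals (hmerge v \<B>) u \<subseteq> ?f ` petals \<B> u"
  proof
    fix D assume D: "D \<in> petals (hmerge v \<B>) u"
    show "D \<in> ?f ` petals \<B> u"
    proof (cases "v \<in> D")
      case True
      then have DM: "D = star_set" "u \<in> star_set" using D by (auto simp: petals_def hmerge_def)
      then obtain B0 where B0: "B0 \<in> \<B>" "v \<in> B0" "u \<in> B0" by blast
      have "B0 \<in> petals \<B> u"
      proof (cases "B0 = {u, v}")
        case True
        then show ?thesis using B0 d by (auto simp: petals_def)
      next
        case F: False
        then have "{u, v} \<subset> B0" using B0 by auto
        then have "card {u, v} < card B0" using bergeD(2)[OF b B0(1)] by (rule psubset_card_mono[rotated])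
        then show ?thesis using B0 False by (simp add: petals_def)
      qed
      then show ?thesis using DM B0 by force
    next
      case F: False
      then have "D \<in> \<B>" using D v by (auto simp: petals_def hmerge_def)
      then have "D \<in> petals \<B> u" using D F hdw[of D] by (auto simp: petals_def hdeg_merge split: if_splits)
      then show ?thesis using F by force
    qed
  qed
  then have "card (petals (hmerge v \<B>) u) \<le> card (petals \<B> u)"
    using fin by (meson card_image_le card_mono finite_imageI order_trans)
  then show ?thesis by simp
qed

end

section \<open>Binomial edge ideals of hypergraphs\<close>

definition edge_poly :: "nat \<Rightarrow> nat \<Rightarrow> ('k::comm_ring_1) mpoly" where
  "edge_poly i j = var (X i) * var (Y j) - var (X j) * var (Y i)"

definition hgens :: "nat set set \<Rightarrow> (int \<times> ('k::comm_ring_1) mpoly) set" where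
  "hgens \<B> = {(2, edge_poly i j) | i j. \<exists>B\<in>\<B>. i \<in> B \<and> j \<in> B}"

abbreviation xm :: "nat \<Rightarrow> vname \<Rightarrow>\<^sub>0 nat" where "xm i \<equiv> single (X i) 1"
abbreviation ym :: "nat \<Rightarrow> vname \<Rightarrow>\<^sub>0 nat" where "ym i \<equiv> single (Y i) 1"

lemma edge_poly_single: "edge_poly i j = single (xm i + ym j) 1 - single (xm j + ym i) 1"
  by (simp add: edge_poly_def var_def mult_single)

lemma edge_poly_same [simp]: "edge_poly i i = 0"
  by (simp add: edge_poly_def)

lemma single_edge: "single m c * edge_poly i j = single (m + xm i + ym j) c - single (m + xm j + ym i) c"
  by (simp add: edge_poly_single right_diff_distrib mult_single add.assoc)

lemma hgensI: "B \<in> \<B> \<Longrightarrow> i \<in> B \<Longrightarrow> j \<in> B \<Longrightarrow> (2, edge_poly i j) \<in> hgens \<B>"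
  by (auto simp: hgens_def)

lemma hgensE:
  assumes "(e, g) \<in> hgens \<B>"
  obtains i j B where "e = 2" "g = edge_poly i j" "B \<in> \<B>" "i \<in> B" "j \<in> B"
  using assms by (auto simp: hgens_def)

lemma hgens_empty [simp]: "hgens {} = {}"
  by (auto simp: hgens_def)

lemma edge_hom_part: "i \<in> V \<Longrightarrow> j \<in> V \<Longrightarrow> edge_poly i j \<in> hom_part V 2"
  unfolding edge_poly_single by (intro hom_part_diff hom_part_single) (auto simp: keys_add_nat)

lemma hom_gens_hgens: "\<Union>\<B> \<subseteq> V \<Longrightarrow> hom_gens V (hgens \<B>)"
  by (auto simp: hom_gens_def hgens_def intro!: edge_hom_part)

lemma keys_edge_poly: "keys (edge_poly i j) \<subseteq> {xm i + ym j, xm j + ym i}"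
  unfolding edge_poly_single by (rule order_trans[OF keys_diff]) auto

lemma free_of_hgens:
  fixes G :: "(int \<times> ('k::comm_ring_1) mpoly) set"
  assumes v: "v \<notin> \<Union>\<B>" and G: "G = hgens \<B>"
  shows "free_of (X v) G" "free_of (Y v) G"
proof -
  have "z \<notin> keys m" if eg: "(e, g) \<in> G" and m: "m \<in> keys g" and z: "z = X v \<or> z = Y v" for e g m z
  proof -
    obtain i j B where g: "g = edge_poly i j" "B \<in> \<B>" "i \<in> B" "j \<in> B"
      using eg unfolding G hgens_def by blast
    then have "i \<noteq> v" "j \<noteq> v" using v by auto
    moreover have "m \<in> {xm i + ym j, xm j + ym i}"
      using m keys_edge_poly unfolding g(1) by blast
    ultimately show ?thesis using z by (auto simp: keys_add_nat)
  qed
  then show "free_of (X v) G" "free_of (Y v) G" unfolding free_of_def by fast+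
qed

lemma gid_var_mult: "z \<in> Z \<Longrightarrow> p \<in> hom_part V (d - 1) \<Longrightarrow> var z * p \<in> gid V (vgens Z) d"
  using gid_mult_hom[OF gid_gen[of 1 "var z" "vgens Z" V], of p "d - 1" d]
  by (auto simp: vgens_def mult.commute)

lemma edge_in_vgens:
  assumes "i \<in> V" "j \<in> V" and "(X i \<in> Z \<or> Y j \<in> Z) \<and> (X j \<in> Z \<or> Y i \<in> Z)"
  shows "edge_poly i j \<in> gid V (vgens Z) 2"
proof -
  have "var (X a) * var (Y b) \<in> gid V (vgens Z) 2" if "a \<in> V" "b \<in> V" "X a \<in> Z \<or> Y b \<in> Z" for a b
    using that gid_var_mult[of "X a" Z "var (Y b)" V 2] gid_var_mult[of "Y b" Z "var (X a)" V 2]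
      var_hom_part[of "X a" V] var_hom_part[of "Y b" V]
    by (auto simp: mult.commute)
  then show ?thesis using assms unfolding edge_poly_def by (intro gid_diff) auto
qed

section \<open>Ohtani's decomposition and its Mayer--Vietoris terms\<close>

lemma edge_in_del:
  assumes "B \<in> \<B>" "finite B" "i \<in> B" "j \<in> B" "\<Union>\<B> \<subseteq> V" "v \<in> V"
  shows "edge_poly i j \<in> gid V (hgens (hdel v \<B>) \<union> vgens {X v, Y v}) 2"
proof -
  have ij: "i \<in> V" "j \<in> V" using assms by auto
  consider "i = v \<or> j = v" | "i = j" | "i \<noteq> v" "j \<noteq> v" "i \<noteq> j" by blast
  then show ?thesis
  proof cases
    case 1
    then have "edge_poly i j \<in> gid V (vgens {X v, Y v}) 2" using ij by (intro edge_in_vgens) auto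
    then show ?thesis using gid_mono by blast
  next
    case 3
    have "card {i, j} \<le> card (B - {v})" by (rule card_mono) (use 3 assms in auto)
    then have "B - {v} \<in> hdel v \<B>" using 3 assms by (auto simp: hdel_def)
    then have "(2, edge_poly i j) \<in> hgens (hdel v \<B>)" by (rule hgensI) (use 3 assms in auto)
    then show ?thesis by (intro gid_gen) auto
  qed (simp add: gid.zero)
qed

lemma gid_hdel_sub: "gid V (hgens (hdel v \<B>)) d \<subseteq> gid V (hgens \<B>) d"
  by (rule gid_mono) (auto simp: hgens_def hdel_def)

lemma gid_sub_hdel:
  assumes "\<And>B. B \<in> \<B> \<Longrightarrow> finite B" "\<Union>\<B> \<subseteq> V" "v \<in> V"
  shows "gid V (hgens \<B>) d \<subseteq> gid V (hgens (hdel v \<B>) \<union> vgens {X v, Y v}) d"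
  by (rule gid_trans) (auto elim!: hgensE intro!: edge_in_del assms)

text \<open>The projection onto the monomials divisible by x_v or y_v. It fixes the ideal (x_v, y_v)
  and leaves exactly the monomials to which the multiplication identities for v apply.\<close>

definition vpart :: "nat \<Rightarrow> ('k::comm_ring_1) mpoly \<Rightarrow> 'k mpoly" where
  "vpart v = lin (\<lambda>m. if X v \<in> keys m \<or> Y v \<in> keys m then single m 1 else 0)"

lemma vpart_single: "vpart v (single m c) = (if X v \<in> keys m \<or> Y v \<in> keys m then single m c else 0)"
  by (simp add: vpart_def mult_single)

lemma vpart_vgens: "q \<in> gid V (vgens {X v, Y v}) d \<Longrightarrow> vpart v q = q"
proof (induction q rule: gid.induct)
  case (step p e g m c)
  then obtain z where z: "g = var z" "z = X v \<or> z = Y v" by (auto simp: vgens_def)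
  have "vpart v (single m c * g) = single m c * g"
    using z(2) by (auto simp: z(1) single_mult_var vpart_single keys_add_nat)
  then show ?case using step by (simp add: vpart_def lin_add)
qed (simp add: vpart_def)

text \<open>Multiplying by \<open>x\<^sub>v\<close> or \<open>y\<^sub>v\<close> moves the generators added by merging into the smaller ideal:
  \<open>x\<^sub>v f\<^sub>i\<^sub>j = x\<^sub>i f\<^sub>v\<^sub>j - x\<^sub>j f\<^sub>v\<^sub>i\<close> and \<open>y\<^sub>v f\<^sub>i\<^sub>j = y\<^sub>j f\<^sub>i\<^sub>v - y\<^sub>i f\<^sub>j\<^sub>v\<close>.\<close>

lemma vpart_merge:
  assumes g: "g \<in> gid V (hgens (hmerge v \<B>)) d" and U: "\<Union>\<B> \<subseteq> V"
  shows "vpart v g \<in> gid V (hgens \<B>) d"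
  using g unfolding vpart_def
proof (rule lin_gid, goal_cases)
  case (3 e g m c)
  obtain i j D where ij: "e = 2" "g = edge_poly i j" "D \<in> hmerge v \<B>" "i \<in> D" "j \<in> D"
    using 3(1) by (rule hgensE)
  have deg: "int (total_degree m) + 2 = d" using 3 ij by simp
  have D: "D \<in> \<B> \<or> D = \<Union>{B \<in> \<B>. v \<in> B}" using ij by (auto simp: hmerge_def)
  have mem: "single n c * edge_poly a b \<in> gid V (hgens \<B>) d"
    if "keys n \<subseteq> vars V" "int (total_degree n) + 2 = d" "B \<in> \<B>" "a \<in> B" "b \<in> B" for n a b B
    by (rule gid_base[OF hgensI]) (use that in auto)
  \<comment> \<open>The two monomials of a multiple of f_ij contain a variable of v either both or
    not at all, so the multiple is kept or killed as a whole.\<close>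
  let ?t = "v = i \<or> v = j \<or> X v \<in> keys m \<or> Y v \<in> keys m"
  have "vpart v (single m c * g) = (if ?t then single m c * g else 0)"
    unfolding ij(2) single_edge by (auto simp: vpart_def lin_diff mult_single keys_add_nat)
  moreover have "single m c * g \<in> gid V (hgens \<B>) d" if t: ?t
  proof (cases "\<exists>B\<in>\<B>. i \<in> B \<and> j \<in> B")
    case True
    then show ?thesis using mem[OF 3(2) deg] ij(2) by auto
  next
    case False
    \<comment> \<open>The pair has been created by the merge: i and j lie with v in two different
      edges. Neither of them is v, for otherwise one edge would contain both.\<close>
    then obtain B1 B2 where B: "B1 \<in> \<B>" "v \<in> B1" "i \<in> B1" "B2 \<in> \<B>" "v \<in> B2" "j \<in> B2" using D ij by blast
    then have "v \<noteq> i" "v \<noteq> j" using False by auto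
    have V: "i \<in> V" "j \<in> V" using B U by auto
    then consider "X v \<in> keys m" | "Y v \<in> keys m" using t \<open>v \<noteq> i\<close> \<open>v \<noteq> j\<close> by blast
    then show ?thesis
    proof cases
      case 1
      define n where "n = m - xm v"
      have m: "m = xm v + n" using sub_add_key[OF 1] by (simp add: n_def)
      have n: "keys n \<subseteq> vars V" "int (total_degree n) + 3 = d"
        using 3(2) deg by (auto simp: m keys_add_nat)
      have "single m c * g = single (n + xm i) c * edge_poly v j - single (n + xm j) c * edge_poly v i"
        unfolding ij(2) m single_edge by (simp add: add.assoc add.commute add.left_commute)
      also have "\<dots> \<in> gid V (hgens \<B>) d"
        by (rule gid_diff; rule mem[OF _ _ B(4)] mem[OF _ _ B(1)]; use n V B in \<open>simp add: keys_add_nat\<close>)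
      finally show ?thesis .
    next
      case 2
      define n where "n = m - ym v"
      have m: "m = ym v + n" using sub_add_key[OF 2] by (simp add: n_def)
      have n: "keys n \<subseteq> vars V" "int (total_degree n) + 3 = d"
        using 3(2) deg by (auto simp: m keys_add_nat)
      have "single m c * g = single (n + ym j) c * edge_poly i v - single (n + ym i) c * edge_poly j v"
        unfolding ij(2) m single_edge by (simp add: add.assoc add.commute add.left_commute)
      also have "\<dots> \<in> gid V (hgens \<B>) d"
        by (rule gid_diff; rule mem[OF _ _ B(1)] mem[OF _ _ B(4)]; use n V B in \<open>simp add: keys_add_nat\<close>)
      finally show ?thesis .
    qed
  qed
  ultimately show ?case by (simp add: vpart_def gid.zero)
qed (auto intro: gid_add gid.zero)

text \<open>Ohtani's lemma \<open>J\<^sub>G = J\<^bsub>G\<^sub>v\<^esub> \<inter> ((x\<^sub>v, y\<^sub>v) + J\<^bsub>G - v\<^esub>)\<close>.\<close>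

lemma gid_hgens_inter:
  assumes fin: "\<And>B. B \<in> \<B> \<Longrightarrow> finite B" and U: "\<Union>\<B> \<subseteq> V" and v: "v \<in> V"
  shows "gid V (hgens \<B>) d =
    gid V (hgens (hmerge v \<B>)) d \<inter> gid V (hgens (hdel v \<B>) \<union> vgens {X v, Y v}) d"
proof (intro equalityI subsetI IntI)
  have le: "gid V (hgens \<B>) d \<subseteq> gid V (hgens (hmerge v \<B>)) d"
    by (rule gid_mono) (auto simp: hgens_def hmerge_def)
  {
    fix g assume g: "g \<in> gid V (hgens \<B>) d"
    then show "g \<in> gid V (hgens (hmerge v \<B>)) d" using le by blast
    show "g \<in> gid V (hgens (hdel v \<B>) \<union> vgens {X v, Y v}) d" using g gid_sub_hdel[OF fin U v] by blast
  }
  fix g assume g: "g \<in> gid V (hgens (hmerge v \<B>)) d \<inter> gid V (hgens (hdel v \<B>) \<union> vgens {X v, Y v}) d"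
  then have "g \<in> gid V (hgens (hdel v \<B>) \<union> vgens {X v, Y v}) d" by simp
  \<comment> \<open>Since r lies in the ideal of \<open>\<B>\<close>, so does g once q does. Now q =
    g - r lies in the merged ideal, and q equals its own \<open>vpart\<close>, which
    \<open>vpart_merge\<close> places in the ideal of \<open>\<B>\<close>.\<close>
  then obtain r q where r: "r \<in> gid V (hgens (hdel v \<B>)) d" and q: "q \<in> gid V (vgens {X v, Y v}) d" and rq: "g = r + q"
    unfolding gid_union by blast
  have rB: "r \<in> gid V (hgens \<B>) d" using r gid_hdel_sub by blast
  then have "g - r \<in> gid V (hgens (hmerge v \<B>)) d" using g le by (intro gid_diff) auto
  then have "vpart v q \<in> gid V (hgens \<B>) d" using vpart_merge[OF _ U] rq by simp
  then show "g \<in> gid V (hgens \<B>) d" using rB rq vpart_vgens[OF q] by (simp add: gid_add)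
qed

text \<open>The third Mayer--Vietoris term. Modulo x_v and y_v the merged ideal becomes that of the
  merged hypergraph without v, and it contains the binomials of \<open>hdel v \<B>\<close>, as each
  edge of \<open>\<B>\<close> lies in an edge of the merge.\<close>

lemma gid_hgens_sum:
  assumes fin: "\<And>B. B \<in> \<B> \<Longrightarrow> finite B" "finite \<B>" and U: "\<Union>\<B> \<subseteq> V" and v: "v \<in> V"
  shows "gid V (hgens (hmerge v \<B>) \<union> (hgens (hdel v \<B>) \<union> vgens {X v, Y v})) d =
    gid V (hgens (hdel v (hmerge v \<B>)) \<union> vgens {X v, Y v}) d" (is "?L = ?R")
proof
  have finM: "finite B" if "B \<in> hmerge v \<B>" for B using that fin by (auto simp: hmerge_def)
  have UM: "\<Union>(hmerge v \<B>) \<subseteq> V" using U by (auto simp: hmerge_def)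
  have edge: "edge_poly i j \<in> gid V (hgens (hdel v (hmerge v \<B>)) \<union> vgens {X v, Y v}) 2"
    if "D \<in> hmerge v \<B>" "i \<in> D" "j \<in> D" for i j D
    by (rule edge_in_del[OF that(1) finM[OF that(1)] that(2,3) UM v])
  show "?L \<subseteq> ?R"
  proof (rule gid_trans)
    fix e g assume "(e, g) \<in> hgens (hmerge v \<B>) \<union> (hgens (hdel v \<B>) \<union> vgens {X v, Y v})"
    then consider "(e, g) \<in> hgens (hmerge v \<B>)" | "(e, g) \<in> hgens (hdel v \<B>)" | "(e, g) \<in> vgens {X v, Y v}" by blast
    then show "g \<in> gid V (hgens (hdel v (hmerge v \<B>)) \<union> vgens {X v, Y v}) e"
    proof cases
      case 1
      then show ?thesis by (rule hgensE) (use edge in auto)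
    next
      case 2
      then obtain i j D where D: "e = 2" "g = edge_poly i j" "D \<in> hdel v \<B>" "i \<in> D" "j \<in> D" by (rule hgensE)
      then obtain B where B: "B \<in> \<B>" "i \<in> B" "j \<in> B" by (auto simp: hdel_def)
      then have "\<exists>D\<in>hmerge v \<B>. i \<in> D \<and> j \<in> D" by (cases "v \<in> B") (auto simp: hmerge_def)
      then show ?thesis using edge D by auto
    qed (auto intro: gid_gen)
  qed
  show "?R \<subseteq> ?L"
  proof (rule gid_mono)
    have "hgens (hdel v (hmerge v \<B>)) \<subseteq> hgens (hmerge v \<B>)" by (auto simp: hgens_def hdel_def)
    then show "hgens (hdel v (hmerge v \<B>)) \<union> vgens {X v, Y v} \<subseteq>
      hgens (hmerge v \<B>) \<union> (hgens (hdel v \<B>) \<union> vgens {X v, Y v})" by blast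
  qed
qed

section \<open>An isolated clique: regularity of x_u and a decomposition of (J, x_u)\<close>

text \<open>On the quotient by the ideal of a clique \<open>C\<close>, division by \<open>x\<^sub>u\<close> also applies to monomials
  containing \<open>x\<^sub>i y\<^sub>u\<close>, which is congruent to \<open>x\<^sub>u y\<^sub>i\<close>.\<close>

definition cdiv :: "nat set \<Rightarrow> nat \<Rightarrow> (vname \<Rightarrow>\<^sub>0 nat) \<Rightarrow> ('k::comm_ring_1) mpoly" where
  "cdiv C u m =
     (if X u \<in> keys m then single (m - xm u) 1
      else if Y u \<in> keys m \<and> (\<exists>i. i \<in> C \<and> X i \<in> keys m)
      then (let i = (LEAST i. i \<in> C \<and> X i \<in> keys m) in single (m - ym u - xm i + ym i) 1)
      else 0)"

lemma add_sub_single: "(n + single z 1) - single z 1 = (n :: 'a \<Rightarrow>\<^sub>0 nat)"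
  by simp

context
  fixes V :: "nat set" and \<B> :: "nat set set" and C :: "nat set" and u :: nat
  assumes U: "\<Union>\<B> \<subseteq> V" and C: "C \<in> \<B>" and u: "u \<in> C" and disj: "\<And>D. D \<in> \<B> \<Longrightarrow> D \<noteq> C \<Longrightarrow> D \<inter> C = {}"
begin

text \<open>The index chosen by \<open>LEAST\<close> does not matter modulo the ideal: replacing any
  x_i y_u with i in C by y_i gives the same result up to a multiple of some f_ab with a and b in
  C.\<close>

lemma cdiv_swap:
  assumes i: "i \<in> C" and n: "keys n \<subseteq> vars V" and d: "int (total_degree n) + 1 = d"
  shows "cdiv C u (n + xm i + ym u) - single (n + ym i) (1::'k::comm_ring_1) \<in> gid V (hgens \<B>) d"
proof -
  have mem: "single k 1 * edge_poly a b \<in> gid V (hgens \<B> :: (int \<times> 'k mpoly) set) d"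
    if "keys k \<subseteq> vars V" "int (total_degree k) + 2 = d" "a \<in> C" "b \<in> C" for k a b
    by (rule gid_base[OF hgensI[OF C]]) (use that in auto)
  show ?thesis
  proof (cases "i = u")
    case True
    have "n + xm u + ym u - xm u = n + ym u"
      using add_sub_single[of "n + ym u" "X u"] by (simp add: ac_simps)
    then have "cdiv C u (n + xm i + ym u) = single (n + ym i) (1::'k)"
      by (simp add: cdiv_def True keys_add_nat)
    then show ?thesis by (simp add: gid.zero)
  next
    case iu: False
    show ?thesis
    proof (cases "X u \<in> keys n")
      case True
      define k where "k = n - xm u"
      have nk: "n = xm u + k" using sub_add_key[OF True] by (simp add: k_def)
      have "n + xm i + ym u - xm u = k + xm i + ym u"
        using add_sub_single[of "k + xm i + ym u" "X u"] by (simp add: nk ac_simps)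
      then have "cdiv C u (n + xm i + ym u) - single (n + ym i) 1 = single k 1 * (edge_poly i u :: 'k mpoly)"
        using True unfolding single_edge by (simp add: cdiv_def keys_add_nat nk ac_simps)
      then show ?thesis using mem[of k i u] n d i u by (simp add: nk keys_add_nat)
    next
      case False
      define i0 where "i0 = (LEAST j. j \<in> C \<and> X j \<in> keys (n + xm i + ym u))"
      have i0: "i0 \<in> C \<and> X i0 \<in> keys (n + xm i + ym u)"
        unfolding i0_def by (rule LeastI[of _ i]) (use i in \<open>simp add: keys_add_nat\<close>)
      have eq: "cdiv C u (n + xm i + ym u) = single (n + xm i - xm i0 + ym i0) (1::'k)"
      proof -
        have "X u \<notin> keys (n + xm i + ym u)" "Y u \<in> keys (n + xm i + ym u)"
          "\<exists>j. j \<in> C \<and> X j \<in> keys (n + xm i + ym u)"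
          using False iu i0 by (auto simp: keys_add_nat)
        then have "cdiv C u (n + xm i + ym u) = single (n + xm i + ym u - ym u - xm i0 + ym i0) (1::'k)"
          by (simp only: cdiv_def if_False if_True Let_def i0_def[symmetric] simp_thms)
        then show ?thesis by (simp only: add_sub_single)
      qed
      show ?thesis
      proof (cases "i0 = i")
        case True
        show ?thesis unfolding eq True add_sub_single by (simp add: gid.zero)
      next
        case i0i: False
        then have 1: "X i0 \<in> keys n" using i0 by (auto simp: keys_add_nat)
        define k where "k = n - xm i0"
        have nk: "n = xm i0 + k" using sub_add_key[OF 1] by (simp add: k_def)
        have sub: "n + xm i - xm i0 = k + xm i"
          using add_sub_single[of "k + xm i" "X i0"] by (simp add: nk ac_simps)
        have "cdiv C u (n + xm i + ym u) - single (n + ym i) 1 = single k 1 * (edge_poly i i0 :: 'k mpoly)"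
          unfolding single_edge eq sub by (simp add: nk ac_simps)
        then show ?thesis using mem[of k i i0] n d i i0 by (simp add: nk keys_add_nat)
      qed
    qed
  qed
qed

text \<open>Division takes congruent values on the two monomials of a generator. If D is not C, or
  x_u divides m, then the same factor is replaced in both. In the remaining cases D = C, and
  \<open>cdiv_swap\<close> handles the factors y_u; if y_u is absent as well, both values are
  zero.\<close>

lemma cdiv_edge:
  assumes D: "D \<in> \<B>" "a \<in> D" "b \<in> D" and m: "keys m \<subseteq> vars V" and d: "int (total_degree m) + 1 = d"
  shows "cdiv C u (m + xm a + ym b) - cdiv C u (m + xm b + ym a) \<in> gid V (hgens \<B> :: (int \<times> 'k::comm_ring_1 mpoly) set) d"
proof -
  have mem: "single k 1 * edge_poly a b \<in> gid V (hgens \<B> :: (int \<times> 'k mpoly) set) d"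
    if "keys k \<subseteq> vars V" "int (total_degree k) + 2 = d" for k
    by (rule gid_base[OF hgensI[OF D]]) (use that in auto)
  have V: "a \<in> V" "b \<in> V" "u \<in> V" using U D C u by auto
  have atu: "cdiv C u (m + xm a + ym u) - cdiv C u (m + xm u + ym a) \<in> gid V (hgens \<B> :: (int \<times> 'k mpoly) set) d"
    if "a \<in> C" for a
  proof -
    have "m + xm u + ym a - xm u = m + ym a"
      using add_sub_single[of "m + ym a" "X u"] by (simp add: ac_simps)
    then have "cdiv C u (m + xm u + ym a) = single (m + ym a) (1::'k)" by (simp add: cdiv_def keys_add_nat)
    then show ?thesis using cdiv_swap[OF that m d, where 'k = 'k] by simp
  qed
  consider "D = C" "b = u" | "D = C" "a = u" | "a \<noteq> u" "b \<noteq> u" using disj[OF D(1)] D u by blast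
  then show ?thesis
  proof cases
    case 1
    then show ?thesis using atu[of a] D by simp
  next
    case 2
    then show ?thesis using gid_uminus[OF atu[of b]] D by simp
  next
    case 3
    show ?thesis
    proof (cases "X u \<in> keys m")
      case True
      define k where "k = m - xm u"
      have mk: "m = xm u + k" using sub_add_key[OF True] by (simp add: k_def)
      have "m + xm i + ym j - xm u = k + xm i + ym j" for i j
        using add_sub_single[of "k + xm i + ym j" "X u"] by (simp add: mk ac_simps)
      then have "cdiv C u (m + xm a + ym b) - cdiv C u (m + xm b + ym a) = single k 1 * (edge_poly a b :: 'k mpoly)"
        using True by (simp add: cdiv_def keys_add_nat single_edge)
      then show ?thesis using mem[of k] m d by (simp add: mk keys_add_nat)
    next
      case nX: False
      show ?thesis
      proof (cases "Y u \<in> keys m")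
        case False
        then have "cdiv C u (m + xm a + ym b) = (0::'k mpoly)" "cdiv C u (m + xm b + ym a) = (0::'k mpoly)"
          using nX 3 by (auto simp: cdiv_def keys_add_nat)
        then show ?thesis by (simp add: gid.zero)
      next
        case Yu: True
        define n where "n = m - ym u"
        have mn: "m = n + ym u" using sub_add_key[OF Yu] by (simp add: n_def add.commute)
        have n: "keys n \<subseteq> vars V" "int (total_degree n) + 2 = d"
          using m d by (auto simp: mn keys_add_nat)
        show ?thesis
        proof (cases "D = C")
          case True
          have e: "m + xm a + ym b = n + ym b + xm a + ym u" "m + xm b + ym a = n + ym a + xm b + ym u"
            by (simp_all add: mn ac_simps)
          have "cdiv C u (n + ym b + xm a + ym u) - single (n + ym b + ym a) (1::'k) \<in> gid V (hgens \<B>) d"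
            by (rule cdiv_swap) (use n D True V in \<open>auto simp: keys_add_nat\<close>)
          moreover have "cdiv C u (n + ym a + xm b + ym u) - single (n + ym a + ym b) (1::'k) \<in> gid V (hgens \<B>) d"
            by (rule cdiv_swap) (use n D True V in \<open>auto simp: keys_add_nat\<close>)
          ultimately have "(cdiv C u (n + ym b + xm a + ym u) - single (n + ym b + ym a) (1::'k)) -
              (cdiv C u (n + ym a + xm b + ym u) - single (n + ym a + ym b) (1::'k)) \<in> gid V (hgens \<B>) d"
            by (rule gid_diff)
          moreover have "n + ym b + ym a = n + ym a + ym b" by (simp add: ac_simps)
          ultimately show ?thesis unfolding e by (simp del: One_nat_def)
        next
          case DC: False
          then have nC: "a \<notin> C" "b \<notin> C" using disj[OF D(1)] D by auto
          have ex: "(i \<in> C \<and> X i \<in> keys (m + xm a + ym b)) = (i \<in> C \<and> X i \<in> keys m)"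
            "(i \<in> C \<and> X i \<in> keys (m + xm b + ym a)) = (i \<in> C \<and> X i \<in> keys m)" for i
            using nC by (auto simp: keys_add_nat)
          have nX': "X u \<notin> keys (m + xm a + ym b)" "X u \<notin> keys (m + xm b + ym a)"
            using nX 3 by (auto simp: keys_add_nat)
          have Yu': "Y u \<in> keys (m + xm a + ym b)" "Y u \<in> keys (m + xm b + ym a)"
            using Yu by (auto simp: keys_add_nat)
          show ?thesis
          proof (cases "\<exists>i. i \<in> C \<and> X i \<in> keys m")
            case False
            then have "cdiv C u (m + xm a + ym b) = (0::'k mpoly)" "cdiv C u (m + xm b + ym a) = (0::'k mpoly)"
              using nX' ex unfolding cdiv_def by auto
            then show ?thesis by (simp add: gid.zero)
          next
            case True
            define i where "i = (LEAST i. i \<in> C \<and> X i \<in> keys m)"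
            have i: "i \<in> C \<and> X i \<in> keys m" unfolding i_def by (rule LeastI_ex) (rule True)
            then have "X i \<in> keys n" by (auto simp: mn keys_add_nat)
            define k where "k = n - xm i"
            have nk: "n = k + xm i" using sub_add_key[OF \<open>X i \<in> keys n\<close>] by (simp add: k_def add.commute)
            have mk: "m = k + xm i + ym u" by (simp add: mn nk)
            have sub: "m + xm p + ym q - ym u - xm i + ym i = (k + ym i) + xm p + ym q" for p q
            proof -
              have "m + xm p + ym q = (k + xm p + ym q + xm i) + ym u" by (simp add: mk ac_simps)
              then have "m + xm p + ym q - ym u = k + xm p + ym q + xm i" by (simp only: add_sub_single)
              then have "m + xm p + ym q - ym u - xm i = k + xm p + ym q" by (simp only: add_sub_single)
              then show ?thesis by (simp add: ac_simps)
            qed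
            have "cdiv C u (m + xm a + ym b) = single ((k + ym i) + xm a + ym b) (1::'k)"
              "cdiv C u (m + xm b + ym a) = single ((k + ym i) + xm b + ym a) (1::'k)"
              unfolding cdiv_def ex using nX' Yu' True by (simp_all add: i_def[symmetric] Let_def sub[simplified])
            then have "cdiv C u (m + xm a + ym b) - cdiv C u (m + xm b + ym a) = single (k + ym i) 1 * (edge_poly a b :: 'k mpoly)"
              by (simp add: single_edge)
            moreover have "i \<in> V" using i U C by auto
            ultimately show ?thesis using mem[of "k + ym i"] n by (simp add: nk keys_add_nat)
          qed
        qed
      qed
    qed
  qed
qed

text \<open>\<open>cdiv\<close> undoes multiplication by x_u and preserves the ideal.\<close>

lemma var_regular_clique: "var_regular V (X u) (hgens \<B> :: (int \<times> 'k::comm_ring_1 mpoly) set)"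
  unfolding var_regular_def
proof (intro allI ballI impI)
  fix d and s :: "'k mpoly"
  assume "var (X u) * s \<in> gid V (hgens \<B>) (d + 1)"
  then have "lin (cdiv C u) (var (X u) * s) \<in> gid V (hgens \<B>) d"
  proof (rule lin_gid, goal_cases)
    case (3 e g m c)
    obtain a b D where g: "e = 2" "g = edge_poly a b" "D \<in> \<B>" "a \<in> D" "b \<in> D"
      using 3(1) by (rule hgensE)
    have "lin (cdiv C u) (single m c * g) = single 0 c * (cdiv C u (m + xm a + ym b) - cdiv C u (m + xm b + ym a))"
      by (simp add: g single_edge lin_diff right_diff_distrib)
    also have "\<dots> \<in> gid V (hgens \<B>) d"
      by (rule gid_mult_single[OF cdiv_edge[OF g(3-5) 3(2) refl]]) (use 3 g in auto)
    finally show ?case .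
  qed (auto intro: gid_add gid.zero)
  moreover have "lin (cdiv C u) (var (X u) * s) = s"
    by (rule lin_var_mult_eq) (simp add: cdiv_def keys_add_nat)
  ultimately show "s \<in> gid V (hgens \<B>) d" by simp
qed

text \<open>On the generators x_i with i in C this is the identity y_u x_i = f_iu + y_i x_u.\<close>

lemma gid_Y_mult:
  assumes "s \<in> gid V (hgens (\<B> - {C}) \<union> vgens (X ` C)) d"
  shows "var (Y u) * s \<in> gid V (hgens \<B> \<union> vgens {X u}) (d + 1)"
  using assms
proof (induction s rule: gid.induct)
  case (step p e g m c)
  have V: "u \<in> V" using U C u by auto
  have "var (Y u) * (single m c * g) \<in> gid V (hgens \<B> \<union> vgens {X u}) (d + 1)"
  proof (cases "(e, g) \<in> hgens (\<B> - {C})")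
    case True
    then have "(e, g) \<in> hgens \<B> \<union> vgens {X u}" by (auto simp: hgens_def)
    then have "single (ym u + m) c * g \<in> gid V (hgens \<B> \<union> vgens {X u}) (d + 1)"
      by (rule gid_base) (use step V in \<open>auto simp: keys_add_nat\<close>)
    then show ?thesis by (simp add: var_mult_single flip: mult.assoc)
  next
    case False
    then obtain i where i: "i \<in> C" "g = var (X i)" "e = 1" using step by (auto simp: vgens_def)
    then have iV: "i \<in> V" using U C by auto
    have "single m c * edge_poly i u \<in> gid V (hgens \<B> \<union> vgens {X u}) (d + 1)"
      by (rule gid_base[of 2]) (use step i u C in \<open>auto intro!: hgensI\<close>)
    moreover have "single (m + ym i) c * var (X u) \<in> gid V (hgens \<B> \<union> vgens {X u}) (d + 1)"
      by (rule gid_base[of 1]) (use step i iV in \<open>auto simp: keys_add_nat vgens_def\<close>)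
    moreover have "var (Y u) * (single m c * g) = single m c * edge_poly i u + single (m + ym i) c * var (X u)"
      unfolding i single_edge single_mult_var var_mult_single by (simp add: add.assoc add.commute add.left_commute)
    ultimately show ?thesis by (simp add: gid_add)
  qed
  then show ?case using step by (simp add: distrib_left gid_add)
qed (simp add: gid.zero)

text \<open>Once x_u is set to zero, f_iu becomes x_i y_u for i in C, so either y_u or all x_i
  vanish. For the nontrivial inclusion g = a + y_u s with a in the left-hand side; y_u occurs in no
  generator of the second ideal, so it can be cancelled there, and \<open>gid_Y_mult\<close> brings
  y_u s back.\<close>

lemma gid_clique_inter:
  assumes fin: "\<And>B. B \<in> \<B> \<Longrightarrow> finite B"
  shows "gid V (hgens \<B> \<union> vgens {X u}) d =
    gid V (hgens (hdel u \<B>) \<union> vgens {X u, Y u}) d \<inter> gid V (hgens (\<B> - {C}) \<union> vgens (X ` C)) d"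
proof (intro equalityI subsetI IntI)
  have V: "u \<in> V" using U C u by auto
  have edge2: "edge_poly i j \<in> gid V (hgens (\<B> - {C}) \<union> vgens (X ` C)) 2" if "B \<in> \<B>" "i \<in> B" "j \<in> B" for B i j
  proof (cases "B = C")
    case True
    then have "edge_poly i j \<in> gid V (vgens (X ` C)) 2" using that U by (intro edge_in_vgens) auto
    then show ?thesis using gid_mono by blast
  next
    case False
    then show ?thesis by (intro gid_gen UnI1 hgensI[of B]) (use that in auto)
  qed
  have le1: "gid V (hgens \<B> \<union> vgens {X u}) d \<subseteq> gid V (hgens (hdel u \<B>) \<union> vgens {X u, Y u}) d"
  proof (rule gid_trans)
    fix e g assume "(e, g) \<in> hgens \<B> \<union> vgens {X u}"
    then consider "(e, g) \<in> hgens \<B>" | "(e, g) \<in> vgens {X u, Y u}" by (auto simp: vgens_def)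
    then show "g \<in> gid V (hgens (hdel u \<B>) \<union> vgens {X u, Y u}) e"
    proof cases
      case 1
      then show ?thesis by (rule hgensE) (use edge_in_del[OF _ fin _ _ U V] in blast)
    qed (auto intro: gid_gen)
  qed
  have le2: "gid V (hgens \<B> \<union> vgens {X u}) d \<subseteq> gid V (hgens (\<B> - {C}) \<union> vgens (X ` C)) d"
  proof (rule gid_trans)
    fix e g assume "(e, g) \<in> hgens \<B> \<union> vgens {X u}"
    then consider "(e, g) \<in> hgens \<B>" | "(e, g) \<in> vgens (X ` C)" using u by (auto simp: vgens_def)
    then show "g \<in> gid V (hgens (\<B> - {C}) \<union> vgens (X ` C)) e"
    proof cases
      case 1
      then show ?thesis by (rule hgensE) (use edge2 in blast)
    qed (auto intro: gid_gen)
  qed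
  {
    fix g assume "g \<in> gid V (hgens \<B> \<union> vgens {X u}) d"
    then show "g \<in> gid V (hgens (hdel u \<B>) \<union> vgens {X u, Y u}) d"
      "g \<in> gid V (hgens (\<B> - {C}) \<union> vgens (X ` C)) d" using le1 le2 by blast+
  }
  fix g assume g: "g \<in> gid V (hgens (hdel u \<B>) \<union> vgens {X u, Y u}) d \<inter> gid V (hgens (\<B> - {C}) \<union> vgens (X ` C)) d"
  have Yu: "Y u \<in> vars V" using V by simp
  have "hgens (hdel u \<B>) \<union> vgens {X u, Y u} = (hgens (hdel u \<B>) \<union> vgens {X u}) \<union> vgens {Y u}"
    by (auto simp: vgens_def)
  then have "g \<in> gid V ((hgens (hdel u \<B>) \<union> vgens {X u}) \<union> vgens {Y u}) d" using g by (metis IntE)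
  then obtain a s where a: "a \<in> gid V (hgens (hdel u \<B>) \<union> vgens {X u}) d"
    and s: "s \<in> hom_part V (d - 1)" and as: "g = a + var (Y u) * s"
    using gid_var[OF Yu] by blast
  have "hgens (hdel u \<B>) \<subseteq> hgens \<B>" by (auto simp: hgens_def hdel_def)
  then have a': "a \<in> gid V (hgens \<B> \<union> vgens {X u}) d"
    using a gid_mono[of "hgens (hdel u \<B>) \<union> vgens {X u}" "hgens \<B> \<union> vgens {X u}"] by blast
  then have "g - a \<in> gid V (hgens (\<B> - {C}) \<union> vgens (X ` C)) d" using le2 g by (intro gid_diff) auto
  then have "var (Y u) * s \<in> gid V (hgens (\<B> - {C}) \<union> vgens (X ` C)) (d - 1 + 1)" by (simp add: as)
  moreover have "var_regular V (Y u) (hgens (\<B> - {C}) \<union> vgens (X ` C))"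
  proof (rule var_regular_free_of)
    have "u \<notin> \<Union>(\<B> - {C})" using disj u by blast
    then show "free_of (Y u) (hgens (\<B> - {C}) \<union> vgens (X ` C))"
      using free_of_hgens(2)[OF _ refl] free_of_vgens[of "Y u" "X ` C"] by auto
  qed
  ultimately have "s \<in> gid V (hgens (\<B> - {C}) \<union> vgens (X ` C)) (d - 1)"
    using s unfolding var_regular_def by blast
  then have "var (Y u) * s \<in> gid V (hgens \<B> \<union> vgens {X u}) d" using gid_Y_mult[of s "d - 1"] by simp
  then show "g \<in> gid V (hgens \<B> \<union> vgens {X u}) d" using a' as by (simp add: gid_add)
qed

text \<open>The binomials of C lie in the ideal of the x_i with i in C, so C drops out of the
  sum.\<close>

lemma gid_clique_sum:
  "gid V ((hgens (hdel u \<B>) \<union> vgens {X u, Y u}) \<union> (hgens (\<B> - {C}) \<union> vgens (X ` C))) d =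
    gid V (hgens (\<B> - {C}) \<union> vgens (insert (Y u) (X ` C))) d" (is "?L = ?R")
proof
  show "?L \<subseteq> ?R"
  proof (rule gid_trans)
    fix e g assume eg: "(e, g) \<in> (hgens (hdel u \<B>) \<union> vgens {X u, Y u}) \<union> (hgens (\<B> - {C}) \<union> vgens (X ` C))"
    show "g \<in> gid V (hgens (\<B> - {C}) \<union> vgens (insert (Y u) (X ` C))) e"
    proof (cases "(e, g) \<in> hgens (hdel u \<B>)")
      case True
      then obtain i j D where D: "e = 2" "g = edge_poly i j" "D \<in> hdel u \<B>" "i \<in> D" "j \<in> D" by (rule hgensE)
      then obtain B where B: "B \<in> \<B>" "i \<in> B" "j \<in> B" by (auto simp: hdel_def)
      show ?thesis
      proof (cases "B = C")
        case True
        then have "edge_poly i j \<in> gid V (vgens (insert (Y u) (X ` C))) 2" using B U by (intro edge_in_vgens) auto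
        then show ?thesis using D gid_mono by blast
      next
        case False
        then show ?thesis unfolding D by (intro gid_gen UnI1 hgensI[of B]) (use B in auto)
      qed
    next
      case False
      then show ?thesis using eg u by (intro gid_gen) (auto simp: vgens_def)
    qed
  qed
  show "?R \<subseteq> ?L" by (rule gid_mono) (auto simp: vgens_def)
qed

end

section \<open>The Betti numbers of acyclic hypergraphs\<close>

lemma berge_subset: "berge \<B> \<Longrightarrow> \<C> \<subseteq> \<B> \<Longrightarrow> berge \<C>"
  unfolding berge_def by (meson finite_subset subset_trans subset_iff)

lemma Union_hdel: "\<Union>(hdel v \<B>) \<subseteq> \<Union>\<B> - {v}"
  by (auto simp: hdel_def)

context
  fixes V :: "nat set"
  assumes finV: "finite V"
begin

lemma knz_hgens_vgens:
  fixes G :: "(int \<times> ('k::comm_ring_1) mpoly) set"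
  assumes "\<Union>\<B> \<subseteq> V" "Z \<subseteq> vars V" "G = hgens \<B>" "\<And>i. X i \<in> Z \<or> Y i \<in> Z \<Longrightarrow> i \<notin> \<Union>\<B>"
  shows "knz V (G \<union> vgens Z) p j \<Longrightarrow> \<exists>q\<le>p. p \<le> q + card Z \<and> knz V G q j"
    and "knz V G q j \<Longrightarrow> knz V (G \<union> vgens Z) (q + card Z) j"
proof -
  have fr: "free_of z G" if "z \<in> Z" for z
    using free_of_hgens[OF _ assms(3)] assms(4) that by (cases z) auto
  have hg: "hom_gens V G" using assms(1) by (simp add: assms(3) hom_gens_hgens)
  show "knz V (G \<union> vgens Z) p j \<Longrightarrow> \<exists>q\<le>p. p \<le> q + card Z \<and> knz V G q j"
    "knz V G q j \<Longrightarrow> knz V (G \<union> vgens Z) (q + card Z) j"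
    using knz_vgens[OF finV hg assms(2) fr] by blast+
qed

lemma knz_hdel_vgens:
  fixes G :: "(int \<times> ('k::comm_ring_1) mpoly) set"
  assumes U: "\<Union>\<B> \<subseteq> V" and v: "v \<in> V" and G: "G = hgens (hdel v \<B>)"
  shows "knz V (G \<union> vgens {X v, Y v}) p j \<Longrightarrow> \<exists>q\<le>p. p \<le> q + 2 \<and> knz V G q j"
    and "knz V G q j \<Longrightarrow> knz V (G \<union> vgens {X v, Y v}) (q + 2) j"
proof -
  have 1: "\<Union>(hdel v \<B>) \<subseteq> V" using U Union_hdel[of v \<B>] by blast
  have 2: "{X v, Y v} \<subseteq> vars V" using v by simp
  have 3: "i \<notin> \<Union>(hdel v \<B>)" if "X i \<in> {X v, Y v} \<or> Y i \<in> {X v, Y v}" for i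
    using that Union_hdel[of v \<B>] by auto
  show "knz V (G \<union> vgens {X v, Y v}) p j \<Longrightarrow> \<exists>q\<le>p. p \<le> q + 2 \<and> knz V G q j"
    using knz_hgens_vgens(1)[OF 1 2 G 3, of p j] by simp
  show "knz V G q j \<Longrightarrow> knz V (G \<union> vgens {X v, Y v}) (q + 2) j"
    using knz_hgens_vgens(2)[OF 1 2 G 3, of q j] by simp
qed

text \<open>Disjoint cliques, the base of the main induction. Since x_u is regular, the table of J
  is read off from that of (J, x_u), and this ideal is an intersection whose Mayer--Vietoris terms
  come from the hypergraph without u and the one without the whole clique C, both of smaller
  \<open>hpd\<close>.\<close>

lemma knz_disjoint:
  assumes "berge \<B>" "hinner \<B> = {}" "\<Union>\<B> \<subseteq> V"
  shows "(\<forall>p j. knz V (hgens \<B> :: (int \<times> ('k::comm_ring_1) mpoly) set) p j \<longrightarrow> p \<le> hpd \<B> \<and> j \<le> hrow \<B>) \<and>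
    knz V (hgens \<B> :: (int \<times> 'k mpoly) set) (hpd \<B>) (hrow \<B>)"
  using assms
proof (induction "hpd \<B>" arbitrary: \<B> rule: less_induct)
  case less
  note b = less.prems(1) and inn = less.prems(2) and U = less.prems(3)
  show ?case
  proof (cases "\<B> = {}")
    case True
    have "hinner ({}::nat set set) = {}" by (auto simp: hinner_def hdeg_def)
    then show ?thesis using True knz_empty[OF finV, where 'k = 'k] by (simp add: hpd_def hrow_def)
  next
    case False
    then obtain C where C: "C \<in> \<B>" by blast
    then obtain u where u: "u \<in> C" using bergeD(3)[OF b C] by fastforce
    have finB: "\<And>B. B \<in> \<B> \<Longrightarrow> finite B" using bergeD(2)[OF b] .
    have uU: "u \<in> \<Union>\<B>" and uV: "u \<in> V" using C u U by auto
    have deg1: "hdeg \<B> w \<le> 1" for w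
    proof -
      have "w \<notin> hinner \<B>" using inn by simp
      then show ?thesis by (simp add: hinner_def)
    qed
    have disj: "D \<inter> C = {}" if D: "D \<in> \<B>" "D \<noteq> C" for D
    proof (rule ccontr)
      assume "D \<inter> C \<noteq> {}"
      then obtain w where w: "w \<in> D" "w \<in> C" by blast
      have "card {C, D} \<le> hdeg \<B> w"
        unfolding hdeg_def by (rule card_mono) (use w D C bergeD(1)[OF b] in auto)
      then show False using deg1[of w] D by simp
    qed
    have du: "hdeg \<B> u = 1" using deg1[of u] uU hdeg_pos_iff[OF bergeD(1)[OF b], of u] by simp
    define h f c where "h = hpd \<B>" and "f = hrow \<B>" and "c = card C"
    have c2: "2 \<le> c" using bergeD(3)[OF b C] by (simp add: c_def)
    have finC: "finite C" using finB C .
    let ?D = "hdel u \<B>"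
    have bD: "berge ?D" by (rule berge_del[OF b uU])
    have hD: "hpd ?D + 1 = h" using hpd_del[OF b uU] du by (simp add: h_def)
    have fD: "hrow ?D \<le> f"
      using hrow_del[OF b uU] petals_le_hdeg[OF bergeD(1)[OF b], of u] inn by (simp add: f_def du)
    have "hdeg ?D w \<le> 1" for w using deg1[of w] by (simp add: hdeg_del[OF b uU])
    then have iD: "hinner ?D = {}" by (auto simp: hinner_def) (metis Suc_1 not_less_eq_eq One_nat_def)
    have UD: "\<Union>?D \<subseteq> V" using U Union_hdel[of u \<B>] by blast
    have IHD: "knz V (hgens ?D :: (int \<times> 'k mpoly) set) p j \<Longrightarrow> p \<le> hpd ?D \<and> j \<le> hrow ?D" for p j
      using less.hyps[OF _ bD iD UD] hD by (auto simp: h_def)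
    let ?R = "\<B> - {C}"
    have bR: "berge ?R" by (rule berge_subset[OF b]) auto
    have hR: "hpd ?R + (c - 1) = h"
      using sum.remove[OF bergeD(1)[OF b] C, of "\<lambda>B. card B - 1"] by (simp add: hpd_def h_def c_def)
    have degR: "hdeg ?R w \<le> 1" for w
    proof -
      have "hdeg ?R w \<le> hdeg \<B> w" unfolding hdeg_def by (rule card_mono) (use bergeD(1)[OF b] in auto)
      then show ?thesis using deg1[of w] by simp
    qed
    have iR: "hinner ?R = {}" using degR by (auto simp: hinner_def) (metis Suc_1 not_less_eq_eq One_nat_def)
    have UR: "\<Union>?R \<subseteq> V" using U by auto
    have "\<Union>\<B> = C \<union> \<Union>?R" "C \<inter> \<Union>?R = {}" using C disj by auto
    then have "card (\<Union>\<B>) = c + card (\<Union>?R)"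
      using card_Un_disjoint[OF finC bergeD(5)[OF bR]] by (simp add: c_def)
    \<comment> \<open>For disjoint cliques \<open>hrow\<close> is their number, and C is
      gone.\<close>
    then have fR: "hrow ?R = f - 1" using hR c2 by (simp add: hrow_def f_def inn iR h_def of_nat_diff)
    have IHR: "knz V (hgens ?R :: (int \<times> 'k mpoly) set) p j \<Longrightarrow> p \<le> hpd ?R \<and> j \<le> f - 1" for p j
      using less.hyps[OF _ bR iR UR] hR c2 by (auto simp: h_def fR)
    have IHRt: "knz V (hgens ?R :: (int \<times> 'k mpoly) set) (hpd ?R) (f - 1)"
      using less.hyps[OF _ bR iR UR] hR c2 by (auto simp: h_def fR)
    let ?G = "hgens \<B> :: (int \<times> 'k mpoly) set"
    let ?G1 = "hgens ?D \<union> vgens {X u, Y u} :: (int \<times> 'k mpoly) set"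
    let ?G2 = "hgens ?R \<union> vgens (X ` C) :: (int \<times> 'k mpoly) set"
    let ?G3 = "hgens ?R \<union> vgens (insert (Y u) (X ` C)) :: (int \<times> 'k mpoly) set"
    have G1: "p \<le> h + 1 \<and> j \<le> f" if nz: "knz V ?G1 p j" for p j
    proof -
      obtain q where "q \<le> p" "p \<le> q + 2" "knz V (hgens ?D :: (int \<times> 'k mpoly) set) q j"
        using knz_hdel_vgens(1)[OF U uV refl nz] by blast
      then show ?thesis using IHD[of q j] hD fD by auto
    qed
    have nR: "w \<notin> \<Union>?R" if "w \<in> C" for w using disj that by blast
    have CV: "C \<subseteq> V" using C U by auto
    have cX: "card (X ` C) = c" by (simp add: card_image inj_on_def c_def)
    have cY: "card (insert (Y u) (X ` C)) = c + 1" using finC cX by (simp add: card_insert_if image_iff)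
    have G2: "p \<le> h + 1 \<and> j \<le> f - 1" if nz: "knz V ?G2 p j" for p j
    proof -
      have 1: "X ` C \<subseteq> vars V" using CV by auto
      have 2: "i \<notin> \<Union>?R" if "X i \<in> X ` C \<or> Y i \<in> X ` C" for i
      proof (rule nR)
        show "i \<in> C" using that by auto
      qed
      obtain q where "q \<le> p" "p \<le> q + c" "knz V (hgens ?R :: (int \<times> 'k mpoly) set) q j"
        using knz_hgens_vgens(1)[OF UR 1 refl 2 nz] unfolding cX by blast
      then show ?thesis using IHR[of q j] hR c2 by auto
    qed
    have sub3: "insert (Y u) (X ` C) \<subseteq> vars V" using CV uV by auto
    have nR3: "i \<notin> \<Union>?R" if "X i \<in> insert (Y u) (X ` C) \<or> Y i \<in> insert (Y u) (X ` C)" for i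
    proof (rule nR)
      show "i \<in> C" using that u by auto
    qed
    have G3: "p \<le> h + 2 \<and> j \<le> f - 1" if nz: "knz V ?G3 p j" for p j
    proof -
      obtain q where "q \<le> p" "p \<le> q + (c + 1)" "knz V (hgens ?R :: (int \<times> 'k mpoly) set) q j"
        using knz_hgens_vgens(1)[OF UR sub3 refl nR3 nz] unfolding cY by blast
      then show ?thesis using IHR[of q j] hR c2 by auto
    qed
    \<comment> \<open>The corner without C, moved by the c + 1 adjoined variables: (h - (c - 1)) +
      (c + 1) = h + 2.\<close>
    have G3t: "knz V ?G3 (Suc (h + 1)) (f - 1)"
    proof -
      have "knz V ?G3 (hpd ?R + (c + 1)) (f - 1)"
        using knz_hgens_vgens(2)[OF UR sub3 refl nR3 IHRt] cY by simp
      moreover have "hpd ?R + (c + 1) = Suc (h + 1)" using hR c2 by simp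
      ultimately show ?thesis by simp
    qed
    have hg1: "hom_gens V ?G1" using uV hom_gens_hgens[OF UD] unfolding hom_gens_simps
      by (intro conjI hom_gens_vgens) auto
    have hg2: "hom_gens V ?G2" using CV hom_gens_hgens[OF UR] unfolding hom_gens_simps
      by (intro conjI hom_gens_vgens) auto
    have int: "gid V (?G \<union> vgens {X u}) d = gid V ?G1 d \<inter> gid V ?G2 d" for d
      by (rule gid_clique_inter[OF U C u disj finB])
    have sum: "knz V (?G1 \<union> ?G2) p j \<longleftrightarrow> knz V ?G3 p j" for p j
      by (rule knz_cong, rule gid_clique_sum[OF U C u disj])
    note iff = knz_var_iff[OF finV hom_gens_hgens[OF U] _ var_regular_clique[OF U C u disj], where 'a = 'k]
    have Xu: "X u \<in> vars V" using uV by simp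
    have GX: "p \<le> h + 1 \<and> j \<le> f" if nz: "knz V (?G \<union> vgens {X u}) p j" for p j
      using knz_inter[OF finV hg1 hg2 int nz] G1[of p j] G2[of p j] G3[of "Suc p" "j - 1"] unfolding sum by auto
    \<comment> \<open>Every entry of J reappears one column to the right in (J, x_u), whose last
      column is at most h + 1.\<close>
    have G: "p \<le> h \<and> j \<le> f" if nz: "knz V ?G p j" for p j
      using GX[of "Suc p" j] iff[OF Xu, of "Suc p" j] nz by auto
    \<comment> \<open>Both ideals end in column h + 1 at the latest, so the entry of their sum in
      column h + 2 can only come from the intersection.\<close>
    have "knz V (?G \<union> vgens {X u}) (h + 1) f"
      using knz_sum[OF finV hg1 hg2 int, of "h + 1" "f - 1"] G3t G1[of "Suc (h + 1)" "f - 1"] G2[of "Suc (h + 1)" "f - 1"]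
      unfolding sum by auto
    \<comment> \<open>Column h + 1 of J is zero, so the entry of (J, x_u) found there is the moved
      copy of one in column h of J.\<close>
    then have "knz V ?G h f" using iff[OF Xu, of "h + 1" f] G[of "h + 1" f] by auto
    then show ?thesis using G by (auto simp: h_def f_def)
  qed
qed

text \<open>The parts have to be carried through the induction together. The first three locate the
  corner, the unspecific bound on the rows is what the existence of resolutions will rest on, and
  the last part gives uniqueness of the extremal entry.\<close>

lemma knz_berge:
  assumes "berge \<B>" "\<Union>\<B> \<subseteq> V"
  shows "(\<forall>p j. knz V (hgens \<B> :: (int \<times> ('k::comm_ring_1) mpoly) set) p j \<longrightarrow> p \<le> hpd \<B>) \<and>
    knz V (hgens \<B> :: (int \<times> 'k mpoly) set) (hpd \<B>) (hrow \<B>) \<and>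
    (\<forall>j. knz V (hgens \<B> :: (int \<times> 'k mpoly) set) (hpd \<B>) j \<longrightarrow> j \<le> hrow \<B>) \<and>
    (\<exists>r. \<forall>p j. knz V (hgens \<B> :: (int \<times> 'k mpoly) set) p j \<longrightarrow> j \<le> r) \<and>
    ((\<forall>v. card (petals \<B> v) \<le> 2) \<longrightarrow>
      (\<forall>p j. knz V (hgens \<B> :: (int \<times> 'k mpoly) set) p j \<longrightarrow> j \<le> hrow \<B>))" (is "?P \<B>")
  using assms
proof (induction "card (hinner \<B>)" arbitrary: \<B> rule: less_induct)
  case less
  note b = less.prems(1) and U = less.prems(2)
  show ?case
  proof (cases "hinner \<B> = {}")
    case True
    then show ?thesis using knz_disjoint[OF b True U, where 'k = 'k] by auto
  next
    case False
    \<comment> \<open>A vertex in at least three edges is preferred, as \<open>petals_merge\<close>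
      requires one for the merge to keep the bound on petals. If there is none, all degrees and
      hence all numbers of petals are at most 2.\<close>
    obtain v where v: "v \<in> hinner \<B>" "3 \<le> hdeg \<B> v \<or> (\<forall>w. hdeg \<B> w \<le> 2)"
    proof (cases "\<exists>v. 3 \<le> hdeg \<B> v")
      case True
      then obtain v where "3 \<le> hdeg \<B> v" by blast
      then show ?thesis by (intro that[of v]) (simp_all add: hinner_def)
    next
      case F: False
      then have "\<forall>w. hdeg \<B> w \<le> 2" by (metis Suc_1 eval_nat_numeral(3) not_less_eq_eq)
      then show ?thesis using that False by blast
    qed
    have vU: "v \<in> \<Union>\<B>" using v hinner_sub[OF bergeD(1)[OF b]] by blast
    have vV: "v \<in> V" using vU U by auto
    have finB: "\<And>B. B \<in> \<B> \<Longrightarrow> finite B" using bergeD(2)[OF b] .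
    have d2: "2 \<le> hdeg \<B> v" using v by (simp add: hinner_def)
    let ?M = "hmerge v \<B>" and ?D = "hdel v \<B>"
    let ?E = "hdel v ?M"
    have bM: "berge ?M" by (rule berge_merge[OF b vU])
    have UM: "\<Union>?M = \<Union>\<B>" by (rule Union_merge[OF b vU])
    have vM: "v \<in> \<Union>?M" using vU UM by simp
    have bD: "berge ?D" by (rule berge_del[OF b vU])
    have bE: "berge ?E" by (rule berge_del[OF bM vM])
    have UMV: "\<Union>?M \<subseteq> V" using UM U by simp
    have UD: "\<Union>?D \<subseteq> V" using U Union_hdel[of v \<B>] by blast
    have UE: "\<Union>?E \<subseteq> V" using UMV Union_hdel[of v ?M] by blast
    have fin: "finite (hinner \<B>)" by (rule finite_hinner[OF b])
    have iM: "hinner ?M \<subseteq> hinner \<B> - {v}" using hinner_merge[OF b vU] by simp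
    have iD: "hinner ?D \<subseteq> hinner \<B> - {v}" by (auto simp: hinner_def hdeg_del[OF b vU] split: if_splits)
    have iE: "hinner ?E \<subseteq> hinner \<B> - {v}"
    proof -
      have "hinner ?E \<subseteq> hinner ?M" by (auto simp: hinner_def hdeg_del[OF bM vM] split: if_splits)
      then show ?thesis using iM by blast
    qed
    have small: "card S < card (hinner \<B>)" if "S \<subseteq> hinner \<B> - {v}" for S
      by (rule psubset_card_mono[OF fin]) (use that v in auto)
    note IHM = less.hyps[OF small[OF iM] bM UMV] and IHD = less.hyps[OF small[OF iD] bD UD]
      and IHE = less.hyps[OF small[OF iE] bE UE]
    define h f where "h = hpd \<B>" and "f = hrow \<B>"
    have hM: "hpd ?M = h" using hpd_merge[OF b vU] by (simp add: h_def)
    have fM: "hrow ?M = f - 1" using hrow_merge[OF b vU v(1)] by (simp add: f_def)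
    have hD: "hpd ?D + hdeg \<B> v = h" using hpd_del[OF b vU] by (simp add: h_def)
    have fD: "hrow ?D = f - 2 + int (card (petals \<B> v))"
      using hrow_del[OF b vU] v(1) by (simp add: f_def)
    have dM: "hdeg ?M v = 1" using hdeg_merge[OF b vU, of v] by simp
    have hE: "hpd ?E + 1 = h" using hpd_del[OF bM vM] dM hM by simp
    \<comment> \<open>The merged edge has at least three vertices and is the only one at v. So v is
      not inner in the merge and has exactly one petal there, and deleting it leaves
      \<open>hrow\<close> unchanged.\<close>
    have "\<Union>{B \<in> \<B>. v \<in> B} \<in> petals ?M v"
      using star_set_ge3[OF b vU v(1)] vU by (auto simp: petals_def hmerge_def)
    moreover have "finite (petals ?M v)" using bergeD(1)[OF bM] by (simp add: petals_def)
    ultimately have "0 < card (petals ?M v)" by (auto simp: card_gt_0_iff)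
    then have "card (petals ?M v) = 1"
      using petals_le_hdeg[OF bergeD(1)[OF bM], of v] dM by simp
    moreover have "v \<notin> hinner ?M" using dM by (simp add: hinner_def)
    ultimately have fE: "hrow ?E = f - 1" using hrow_del[OF bM vM] fM by simp
    let ?G = "hgens \<B> :: (int \<times> 'k mpoly) set"
    let ?GM = "hgens ?M :: (int \<times> 'k mpoly) set"
    let ?GD = "hgens ?D \<union> vgens {X v, Y v} :: (int \<times> 'k mpoly) set"
    let ?GE = "hgens ?E \<union> vgens {X v, Y v} :: (int \<times> 'k mpoly) set"
    have hgM: "hom_gens V ?GM" by (rule hom_gens_hgens[OF UMV])
    have hgD: "hom_gens V ?GD" using vV hom_gens_hgens[OF UD] unfolding hom_gens_simps
      by (intro conjI hom_gens_vgens) auto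
    have int: "gid V ?G d = gid V ?GM d \<inter> gid V ?GD d" for d
      by (rule gid_hgens_inter[OF finB U vV])
    have sum: "knz V (?GM \<union> ?GD) p j \<longleftrightarrow> knz V ?GE p j" for p j
      by (rule knz_cong, rule gid_hgens_sum[OF finB bergeD(1)[OF b] U vV])
    have vD: "\<exists>q\<le>p. p \<le> q + 2 \<and> knz V (hgens ?D :: (int \<times> 'k mpoly) set) q j" if nz: "knz V ?GD p j" for p j
      using knz_hdel_vgens(1)[OF U vV refl nz] .
    have vE: "\<exists>q\<le>p. p \<le> q + 2 \<and> knz V (hgens ?E :: (int \<times> 'k mpoly) set) q j" if nz: "knz V ?GE p j" for p j
      using knz_hdel_vgens(1)[OF UMV vV refl nz] .
    have pM: "p \<le> h" if nz: "knz V ?GM p j" for p j using IHM nz hM by blast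
    \<comment> \<open>Deletion lowers \<open>hpd\<close> by the degree of v, which is at least 2,
      and the two adjoined variables give back 2; so this term does not go beyond column h.\<close>
    have pD: "p + hdeg \<B> v \<le> h + 2" if nz: "knz V ?GD p j" for p j
    proof -
      obtain q where "p \<le> q + 2" "knz V (hgens ?D :: (int \<times> 'k mpoly) set) q j" using vD[OF nz] by blast
      moreover have "q \<le> hpd ?D" using IHD calculation(2) by blast
      ultimately show ?thesis using hD by simp
    qed
    have pE: "p \<le> h + 1" if nz: "knz V ?GE p j" for p j
    proof -
      obtain q where "p \<le> q + 2" "knz V (hgens ?E :: (int \<times> 'k mpoly) set) q j" using vE[OF nz] by blast
      moreover have "q \<le> hpd ?E" using IHE calculation(2) by blast
      ultimately show ?thesis using hE by simp
    qed
    note split = knz_inter[OF finV hgM hgD int]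
    have 1: "p \<le> h" if nz: "knz V ?G p j" for p j
      using split[OF nz] pM[of p j] pD[of p j] pE[of "Suc p" "j - 1"] d2 unfolding sum by auto
    \<comment> \<open>The corner of \<open>?E\<close> in column h - 1 is moved by x_v and y_v to
      column h + 1, beyond the last columns of the other two terms.\<close>
    have top: "knz V ?GE (Suc h) (f - 1)"
    proof -
      have "knz V (hgens ?E :: (int \<times> 'k mpoly) set) (hpd ?E) (f - 1)" using IHE fE by simp
      then have "knz V ?GE (hpd ?E + 2) (f - 1)" by (rule knz_hdel_vgens(2)[OF UMV vV refl])
      then show ?thesis using hE by (metis add_2_eq_Suc' Suc_eq_plus1)
    qed
    have 2: "knz V ?G h f"
      using knz_sum[OF finV hgM hgD int, of h "f - 1"] top pM[of "Suc h" "f - 1"] pD[of "Suc h" "f - 1"] d2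
      unfolding sum by auto
    have jE: "j \<le> f - 1" if nz: "knz V ?GE (Suc h) j" for j
    proof -
      obtain q where q: "Suc h \<le> q + 2" "knz V (hgens ?E :: (int \<times> 'k mpoly) set) q j" using vE[OF nz] by blast
      moreover have "q \<le> hpd ?E" using IHE q(2) by blast
      ultimately have "q = hpd ?E" using hE by simp
      then show ?thesis using IHE q(2) fE by auto
    qed
    have pet: "card (petals \<B> v) \<le> hdeg \<B> v" by (rule petals_le_hdeg[OF bergeD(1)[OF b]])
    \<comment> \<open>Column h is reached only if v lies in exactly two edges; then v has at most
      two petals, and \<open>hrow ?D\<close> is at most f.\<close>
    have jD: "j \<le> f" if nz: "knz V ?GD h j" for j
    proof -
      obtain q where q: "h \<le> q + 2" "knz V (hgens ?D :: (int \<times> 'k mpoly) set) q j" using vD[OF nz] by blast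
      moreover have "q \<le> hpd ?D" using IHD q(2) by blast
      ultimately have "q = hpd ?D" "hdeg \<B> v = 2" using hD d2 by auto
      then have "j \<le> hrow ?D" using IHD q(2) by auto
      then show ?thesis using fD pet \<open>hdeg \<B> v = 2\<close> by simp
    qed
    have jM: "j \<le> f - 1" if nz: "knz V ?GM h j" for j using IHM nz hM fM by auto
    have 3: "j \<le> f" if nz: "knz V ?G h j" for j
      using split[OF nz] jE[of "j - 1"] jD[of j] jM[of j] unfolding sum by auto
    obtain rM where rM: "\<And>p j. knz V ?GM p j \<Longrightarrow> j \<le> rM" using IHM by auto
    obtain rD where rD: "\<And>p j. knz V (hgens ?D :: (int \<times> 'k mpoly) set) p j \<Longrightarrow> j \<le> rD" using IHD by auto
    obtain rE where rE: "\<And>p j. knz V (hgens ?E :: (int \<times> 'k mpoly) set) p j \<Longrightarrow> j \<le> rE" using IHE by auto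
    have rD': "j \<le> rD" if nz: "knz V ?GD p j" for p j using vD[OF nz] rD by blast
    have rE': "j \<le> rE" if nz: "knz V ?GE p j" for p j using vE[OF nz] rE by blast
    have 4: "j \<le> max rM (max rD (rE + 1))" if nz: "knz V ?G p j" for p j
      using split[OF nz] rM[of p j] rD'[of p j] rE'[of "Suc p" "j - 1"] unfolding sum by auto
    have 5: "j \<le> f" if ff: "\<forall>w. card (petals \<B> w) \<le> 2" and nz0: "knz V ?G p j" for p j
    proof -
      have ffM: "card (petals ?M w) \<le> 2" for w
      proof (cases "3 \<le> hdeg \<B> v")
        case True
        then show ?thesis using petals_merge[OF b vU True, of w] ff[rule_format, of w] by simp
      next
        case False
        then have "hdeg \<B> w \<le> 2" using v(2) by blast
        then have "hdeg ?M w \<le> 2" by (simp add: hdeg_merge[OF b vU])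
        then show ?thesis using petals_le_hdeg[OF bergeD(1)[OF bM], of w] by simp
      qed
      have ffD: "card (petals ?D w) \<le> 2" for w
        using petals_del[OF b vU, of w] ff[rule_format, of w] by simp
      have ffE: "card (petals ?E w) \<le> 2" for w
        using petals_del[OF bM vM, of w] ffM[of w] by simp
      have M: "j \<le> f - 1" if nz: "knz V ?GM p j" for p j using IHM ffM nz fM by auto
      have D: "j \<le> f" if nz: "knz V ?GD p j" for p j
      proof -
        obtain q where "knz V (hgens ?D :: (int \<times> 'k mpoly) set) q j" using vD[OF nz] by blast
        then have "j \<le> hrow ?D" using IHD ffD by blast
        then show ?thesis using fD ff[rule_format, of v] by simp
      qed
      have E: "j \<le> f - 1" if nz: "knz V ?GE p j" for p j
      proof -
        obtain q where "knz V (hgens ?E :: (int \<times> 'k mpoly) set) q j" using vE[OF nz] by blast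
        then show ?thesis using IHE ffE fE by auto
      qed
      show ?thesis
        using split[OF nz0] M[of p j] D[of p j] E[of "Suc p" "j - 1"] unfolding sum by auto
    qed
    show ?thesis
      using 1 2 3 4 5 unfolding h_def f_def by blast
  qed
qed

text \<open>Deleting a vertex with at least three petals increases \<open>hrow\<close>.\<close>

lemma knz_flower:
  assumes b: "berge \<B>" and U: "\<Union>\<B> \<subseteq> V" and v: "3 \<le> card (petals \<B> v)"
  shows "\<exists>p j. hrow \<B> < j \<and> knz V (hgens \<B> :: (int \<times> ('k::comm_ring_1) mpoly) set) p j"
proof -
  have "petals \<B> v \<noteq> {}" using v by auto
  then have vU: "v \<in> \<Union>\<B>" by (auto simp: petals_def)
  then have vV: "v \<in> V" using U by auto
  let ?D = "hdel v \<B>"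
  have bD: "berge ?D" by (rule berge_del[OF b vU])
  have UD: "\<Union>?D \<subseteq> V" "v \<notin> \<Union>?D" using U Union_hdel[of v \<B>] by blast+
  have "3 \<le> hdeg \<B> v" using v petals_le_hdeg[OF bergeD(1)[OF b], of v] by simp
  then have "hrow \<B> < hrow ?D" using hrow_del[OF b vU] v by (simp add: hinner_def)
  moreover have "knz V (hgens ?D :: (int \<times> 'k mpoly) set) (hpd ?D) (hrow ?D)"
    using knz_berge[OF bD UD(1), where 'k = 'k] by blast
  then have "knz V (hgens \<B> :: (int \<times> 'k mpoly) set) (hpd ?D) (hrow ?D)"
  proof (rule knz_between[OF finV hom_gens_hgens[OF UD(1)], rotated -1])
    show "X v \<in> vars V" "Y v \<in> vars V" "X v \<noteq> Y v" using vV by auto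
    show "free_of (X v) (hgens ?D :: (int \<times> 'k mpoly) set)" "free_of (Y v) (hgens ?D :: (int \<times> 'k mpoly) set)"
      using free_of_hgens[OF UD(2) refl] by auto
    have *: "hgens ?D \<union> vgens {X v} \<union> vgens {Y v} = hgens ?D \<union> (vgens {X v, Y v} :: (int \<times> 'k mpoly) set)"
      by (auto simp: vgens_def)
    show "gid V (hgens ?D) d \<subseteq> gid V (hgens \<B>) d" for d by (rule gid_hdel_sub)
    show "gid V (hgens \<B> :: (int \<times> 'k mpoly) set) d \<subseteq> gid V (hgens ?D \<union> vgens {X v} \<union> vgens {Y v}) d" for d
      unfolding * by (rule gid_sub_hdel[OF bergeD(2)[OF b] U vV])
  qed
  ultimately show ?thesis by blast
qed

end

section \<open>Homogeneous components\<close>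

definition hcomp :: "int \<Rightarrow> ('k::comm_ring_1) mpoly \<Rightarrow> 'k mpoly" where
  "hcomp d = lin (\<lambda>m. if int (total_degree m) = d then single m 1 else 0)"

lemma hcomp_diff: "hcomp d (p - q) = hcomp d p - hcomp d q"
  and hcomp_sum: "hcomp d (sum f I) = (\<Sum>i\<in>I. hcomp d (f i))"
  and hcomp_0 [simp]: "hcomp d 0 = 0"
  by (simp_all add: hcomp_def lin_diff lin_sum)

lemma carrier_iff: "p \<in> carrier (poly_ring V) \<longleftrightarrow> (\<forall>m\<in>keys p. keys m \<subseteq> vars V)"
  by (simp add: poly_ring_def vars_def)

lemma carrier_0: "0 \<in> carrier (poly_ring V)"
  by (simp add: carrier_iff)

lemma carrier_add: "p \<in> carrier (poly_ring V) \<Longrightarrow> q \<in> carrier (poly_ring V) \<Longrightarrow> p + q \<in> carrier (poly_ring V)"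
  using Poly_Mapping.keys_add[of p q] by (auto simp: carrier_iff)

lemma carrier_mult: "p \<in> carrier (poly_ring V) \<Longrightarrow> q \<in> carrier (poly_ring V) \<Longrightarrow> p * q \<in> carrier (poly_ring V)"
  using keys_mult[of p q] by (fastforce simp: carrier_iff keys_add_nat)

lemma carrier_single: "keys m \<subseteq> vars V \<Longrightarrow> single m c \<in> carrier (poly_ring V)"
  by (simp add: carrier_iff)

lemma hom_part_carrier: "p \<in> hom_part V d \<Longrightarrow> p \<in> carrier (poly_ring V)"
  by (simp add: hom_part_iff)

lemma hom_part_sum: "(\<And>i. i \<in> I \<Longrightarrow> f i \<in> hom_part V d) \<Longrightarrow> sum f I \<in> hom_part V d"
  by (induction I rule: infinite_finite_induct) (auto intro: hom_part_add)

lemma hcomp_hom_part: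
  assumes "p \<in> carrier (poly_ring V)"
  shows "hcomp d p \<in> hom_part V d"
  unfolding hcomp_def lin_def
  by (rule hom_part_sum) (use assms in \<open>auto simp: mult_single carrier_iff intro!: hom_part_single\<close>)

lemma hcomp_homogeneous:
  assumes "homogeneous p e"
  shows "hcomp d p = (if d = e then p else 0)"
proof -
  have "hcomp d p = (\<Sum>m\<in>keys p. if d = e then single m (lookup p m) else 0)"
    unfolding hcomp_def lin_def
    by (rule sum.cong) (use assms in \<open>auto simp: homogeneous_def mult_single\<close>)
  then show ?thesis by (simp flip: mpoly_sum)
qed

lemma hcomp_hom_part_eq: "p \<in> hom_part V d \<Longrightarrow> hcomp d p = p"
  using hcomp_homogeneous[of p d d] by (simp add: hom_part_iff)

definition degs :: "('k::comm_ring_1) mpoly \<Rightarrow> int set" where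
  "degs p = (\<lambda>m. int (total_degree m)) ` keys p"

lemma finite_degs [simp]: "finite (degs p)"
  by (simp add: degs_def)

lemma hcomp_decompose:
  assumes "finite D" "degs p \<subseteq> D"
  shows "p = (\<Sum>d\<in>D. hcomp d p)"
proof -
  have "(\<Sum>d\<in>D. hcomp d p) = (\<Sum>m\<in>keys p. \<Sum>d\<in>D. if int (total_degree m) = d then single m (lookup p m) else 0)"
    unfolding hcomp_def lin_def
    by (subst sum.swap) (intro sum.cong refl, simp add: mult_single)
  also have "\<dots> = (\<Sum>m\<in>keys p. single m (lookup p m))"
    using assms by (intro sum.cong refl) (auto simp: degs_def)
  also have "\<dots> = p" by (simp flip: mpoly_sum)
  finally show ?thesis by simp
qed

lemma homogeneous_mult: "homogeneous a e \<Longrightarrow> homogeneous b d \<Longrightarrow> homogeneous (a * b) (e + d)"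
  using keys_mult[of a b] by (fastforce simp: homogeneous_def)

lemma homogeneous_hcomp: "homogeneous (hcomp d p) d"
proof -
  \<comment> \<open>\<open>homogeneous\<close> does not refer to a vertex set, so all variables can
    be allowed.\<close>
  have "z \<in> vars UNIV" for z by (cases z) auto
  then have "p \<in> carrier (poly_ring UNIV)" by (auto simp: carrier_iff)
  then show ?thesis using hcomp_hom_part[of p UNIV d] by (simp add: hom_part_iff)
qed

lemma hcomp_mult:
  assumes "homogeneous a e"
  shows "hcomp d (a * b) = a * hcomp (d - e) b"
proof -
  \<comment> \<open>The degree d - e is inserted so that the sum contains its only possible
    contribution even when b has no monomial of this degree.\<close>
  let ?D = "insert (d - e) (degs b)"
  have "hcomp d (a * b) = hcomp d (a * (\<Sum>d'\<in>?D. hcomp d' b))"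
    using hcomp_decompose[of ?D b] by (metis finite_degs finite_insert subset_insertI)
  also have "\<dots> = (\<Sum>d'\<in>?D. hcomp d (a * hcomp d' b))" by (simp add: sum_distrib_left hcomp_sum del: sum.insert_if)
  also have "\<dots> = (\<Sum>d'\<in>?D. if d' = d - e then a * hcomp d' b else 0)"
  proof (rule sum.cong[OF refl])
    fix d'
    have "hcomp d (a * hcomp d' b) = (if d = e + d' then a * hcomp d' b else 0)"
      by (rule hcomp_homogeneous[OF homogeneous_mult[OF assms homogeneous_hcomp]])
    then show "hcomp d (a * hcomp d' b) = (if d' = d - e then a * hcomp d' b else 0)" by auto
  qed
  also have "\<dots> = a * hcomp (d - e) b" by (simp add: sum.If_cases)
  finally show ?thesis .
qed

section \<open>Graded free modules\<close>

text \<open>The degree d part of the free module whose k-th basis element has degree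
  \<open>s k\<close>.\<close>

definition fgr :: "nat set \<Rightarrow> nat \<Rightarrow> (nat \<Rightarrow> int) \<Rightarrow> int \<Rightarrow> (nat \<Rightarrow> ('k::comm_ring_1) mpoly) set" where
  "fgr V r s d = {f. \<forall>k. f k \<in> hom_part V (d - s k) \<and> (r \<le> k \<longrightarrow> f k = 0)}"

text \<open>Vectors form a product ring in which a constant vector acts as a scalar. In this way the
  Koszul results, formulated for subsets of a commutative ring, apply to free modules.\<close>

definition vvar :: "vname \<Rightarrow> nat \<Rightarrow> ('k::comm_ring_1) mpoly" where
  "vvar z = (\<lambda>_. var z)"

definition vcomp :: "(nat \<Rightarrow> int) \<Rightarrow> int \<Rightarrow> (nat \<Rightarrow> ('k::comm_ring_1) mpoly) \<Rightarrow> nat \<Rightarrow> 'k mpoly" where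
  "vcomp s d f = (\<lambda>k. hcomp (d - s k) (f k))"

definition hmat :: "nat set \<Rightarrow> nat \<Rightarrow> (nat \<Rightarrow> int) \<Rightarrow> nat \<Rightarrow> (nat \<Rightarrow> int) \<Rightarrow> (nat \<Rightarrow> nat \<Rightarrow> ('k::comm_ring_1) mpoly) \<Rightarrow> bool" where
  "hmat V r s r' s' A \<longleftrightarrow>
     (\<forall>k l. if k < r \<and> l < r' then A k l \<in> hom_part V (s' l - s k) else A k l = 0)"

lemma sum_fun_at: "(\<Sum>i\<in>I. f i) x = (\<Sum>i\<in>I. f i x)"
  by (induction I rule: infinite_finite_induct) auto

lemma fgr_sub_free_mod: "fgr V r s d \<subseteq> free_mod V r"
  by (auto simp: fgr_def free_mod_def intro: hom_part_carrier)

lemma gsub_fgr: "gsub vvar (vars V) (fgr V r s :: int \<Rightarrow> (nat \<Rightarrow> ('k::comm_ring_1) mpoly) set)"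
proof -
  have "var z * f \<in> hom_part V (d + 1 - e)" if "z \<in> vars V" "f \<in> hom_part V (d - e)" for z d e and f :: "'k mpoly"
    using hom_part_mult[OF var_hom_part[OF that(1)] that(2)] by (simp add: algebra_simps)
  then show ?thesis unfolding gsub_def by (auto simp: fgr_def vvar_def intro: hom_part_diff)
qed

lemma mat_app_add: "mat_app c A (f + g) = mat_app c A f + mat_app c A g"
  by (simp add: mat_app_def fun_eq_iff algebra_simps sum.distrib)

lemma mat_app_0 [simp]: "mat_app c A 0 = 0"
  by (simp add: mat_app_def fun_eq_iff)

lemma mat_app_diff:
  fixes f g :: "nat \<Rightarrow> 'r::comm_ring_1"
  shows "mat_app c A (f - g) = mat_app c A f - mat_app c A g"
  by (simp add: mat_app_def fun_eq_iff algebra_simps sum_subtractf)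

lemma mat_app_sum: "mat_app c A (\<Sum>i\<in>I. f i) = (\<Sum>i\<in>I. mat_app c A (f i))"
  by (induction I rule: infinite_finite_induct)
    (simp_all only: sum.insert sum.empty sum.infinite mat_app_add mat_app_0 simp_thms)

lemma mat_app_scale:
  fixes f :: "nat \<Rightarrow> 'r::comm_ring_1"
  shows "mat_app c A (\<lambda>k. q * f k) = (\<lambda>k. q * mat_app c A f k)"
  by (simp add: mat_app_def fun_eq_iff sum_distrib_left ac_simps)

lemma mat_app_vvar: "mat_app c A (vvar z * f) = vvar z * mat_app c A f"
  using mat_app_scale[of c A "var z" f] by (simp add: vvar_def times_fun_def)

lemma mat_app_fgr:
  assumes A: "hmat V r s r' s' A" and f: "f \<in> fgr V r' s' d"
  shows "mat_app r' A f \<in> fgr V r s d"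
proof -
  have "mat_app r' A f k \<in> hom_part V (d - s k)" for k
    unfolding mat_app_def
  proof (rule hom_part_sum)
    fix l assume l: "l \<in> {..<r'}"
    have fl: "f l \<in> hom_part V (d - s' l)" using f by (simp add: fgr_def)
    show "A k l * f l \<in> hom_part V (d - s k)"
    proof (cases "k < r")
      case True
      then have "A k l \<in> hom_part V (s' l - s k)" using A l by (auto simp: hmat_def split: if_splits)
      from hom_part_mult[OF this fl] show ?thesis by simp
    next
      case False
      then have "A k l = 0" using A by (auto simp: hmat_def split: if_splits)
      then show ?thesis by simp
    qed
  qed
  moreover have "mat_app r' A f k = 0" if "r \<le> k" for k
  proof -
    have "A k l = 0" for l using A that by (auto simp: hmat_def split: if_splits)
    then show ?thesis by (simp add: mat_app_def)
  qed
  ultimately show ?thesis by (simp add: fgr_def)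
qed

lemma vcomp_mat_app:
  assumes A: "hmat V r s r' s' A"
  shows "mat_app r' A (vcomp s' d f) = vcomp s d (mat_app r' A f)"
proof
  fix k
  have "A k l * hcomp (d - s' l) (f l) = hcomp (d - s k) (A k l * f l)" if "l < r'" for l
  proof (cases "k < r")
    case True
    then have "homogeneous (A k l) (s' l - s k)" using A that by (auto simp: hmat_def hom_part_iff split: if_splits)
    from hcomp_mult[OF this, of "d - s k" "f l"] show ?thesis by simp
  next
    case False
    then have "A k l = 0" using A by (auto simp: hmat_def split: if_splits)
    then show ?thesis by simp
  qed
  then show "mat_app r' A (vcomp s' d f) k = vcomp s d (mat_app r' A f) k"
    by (simp add: mat_app_def vcomp_def hcomp_sum)
qed

lemma vcomp_fgr: "f \<in> free_mod V r \<Longrightarrow> vcomp s d f \<in> fgr V r s d"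
  by (auto simp: free_mod_def fgr_def vcomp_def intro: hcomp_hom_part)

lemma vcomp_id: "f \<in> fgr V r s d \<Longrightarrow> vcomp s d f = f"
  by (auto simp: fgr_def vcomp_def fun_eq_iff intro: hcomp_hom_part_eq)

lemma vcomp_0 [simp]: "vcomp s d 0 = 0"
  by (simp add: vcomp_def fun_eq_iff)

lemma vcomp_decompose:
  assumes "f \<in> free_mod V r"
  obtains D where "finite D" "f = (\<Sum>d\<in>D. vcomp s d f)"
proof -
  define D where "D = (\<Union>k<r. (\<lambda>e. e + s k) ` degs (f k))"
  have fin: "finite D" by (simp add: D_def)
  have "f k = (\<Sum>d\<in>D. vcomp s d f) k" for k
  proof -
    have "(\<Sum>d\<in>D. vcomp s d f) k = (\<Sum>d\<in>D. hcomp (d - s k) (f k))"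
      by (simp add: sum_fun_at vcomp_def)
    also have "\<dots> = (\<Sum>e\<in>(\<lambda>d. d - s k) ` D. hcomp e (f k))"
      by (subst sum.reindex) (auto simp: inj_on_def)
    also have "\<dots> = f k"
    proof (cases "k < r")
      case True
      have "degs (f k) \<subseteq> (\<lambda>d. d - s k) ` D" using True by (force simp: D_def)
      then show ?thesis using hcomp_decompose[of "(\<lambda>d. d - s k) ` D" "f k"] fin by simp
    next
      case False
      then have "f k = 0" using assms by (simp add: free_mod_def)
      then show ?thesis by simp
    qed
    finally show ?thesis by simp
  qed
  then show ?thesis using that fin by blast
qed

lemma free_mod_sum: "(\<And>i. i \<in> I \<Longrightarrow> f i \<in> free_mod V r) \<Longrightarrow> sum f I \<in> free_mod V r"
  by (induction I rule: infinite_finite_induct) (auto simp: free_mod_def carrier_0 intro: carrier_add)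

definition homog_ideal :: "nat set \<Rightarrow> ('k::comm_ring_1) mpoly set \<Rightarrow> bool" where
  "homog_ideal V I \<longleftrightarrow> I \<subseteq> carrier (poly_ring V) \<and> 0 \<in> I \<and> (\<forall>p\<in>I. \<forall>q\<in>I. p - q \<in> I) \<and>
     (\<forall>p\<in>I. \<forall>q\<in>carrier (poly_ring V). q * p \<in> I) \<and> (\<forall>p\<in>I. \<forall>d. hcomp d p \<in> I)"

lemma homog_idealD:
  assumes "homog_ideal V I"
  shows "I \<subseteq> carrier (poly_ring V)" "0 \<in> I" "\<And>p q. p \<in> I \<Longrightarrow> q \<in> I \<Longrightarrow> p - q \<in> I"
    "\<And>p q. p \<in> I \<Longrightarrow> q \<in> carrier (poly_ring V) \<Longrightarrow> q * p \<in> I" "\<And>p d. p \<in> I \<Longrightarrow> hcomp d p \<in> I"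
  using assms by (auto simp: homog_ideal_def)

lemma homog_ideal_sum:
  assumes "homog_ideal V I" "\<And>i. i \<in> A \<Longrightarrow> f i \<in> I"
  shows "sum f A \<in> I"
proof -
  have add: "p + q \<in> I" if "p \<in> I" "q \<in> I" for p q
    using homog_idealD(3)[OF assms(1) that(1) homog_idealD(3)[OF assms(1) homog_idealD(2)[OF assms(1)] that(2)]] by simp
  show ?thesis using assms(2)
    by (induction A rule: infinite_finite_induct) (auto intro: add homog_idealD(2)[OF assms(1)])
qed

definition igr :: "nat set \<Rightarrow> ('k::comm_ring_1) mpoly set \<Rightarrow> int \<Rightarrow> 'k mpoly set" where
  "igr V I d = I \<inter> hom_part V d"

lemma gsub_igr:
  assumes "homog_ideal V I"
  shows "gsub var (vars V) (igr V I)"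
  unfolding gsub_def
proof (intro allI conjI ballI)
  fix d z p q
  show "0 \<in> igr V I d" using homog_idealD(2)[OF assms] by (simp add: igr_def)
  show "p \<in> igr V I d \<Longrightarrow> q \<in> igr V I d \<Longrightarrow> p - q \<in> igr V I d"
    using homog_idealD(3)[OF assms] hom_part_diff by (auto simp: igr_def)
  show "z \<in> vars V \<Longrightarrow> p \<in> igr V I d \<Longrightarrow> var z * p \<in> igr V I (d + 1)"
    using homog_idealD(4)[OF assms, of p "var z"] hom_part_mult[of "var z" V 1 p d] hom_part_carrier[of "var z" V 1]
      var_hom_part[of z V] by (auto simp: igr_def add.commute)
qed

definition augm :: "('k::comm_ring_1) free_cpx \<Rightarrow> (nat \<Rightarrow> 'k mpoly) \<Rightarrow> 'k mpoly" where
  "augm F f = (\<Sum>k<rk F 0. f k * aug F k)"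

text \<open>The degreewise form of \<open>graded_free_resolution\<close>. Koszul homology is handled
  one internal degree at a time, and exactness is stated here accordingly.\<close>

definition gres :: "nat set \<Rightarrow> ('k::comm_ring_1) mpoly set \<Rightarrow> 'k free_cpx \<Rightarrow> bool" where
  "gres V I F \<longleftrightarrow>
     (\<forall>k<rk F 0. aug F k \<in> hom_part V (shift F 0 k)) \<and>
     (\<forall>i. hmat V (rk F i) (shift F i) (rk F (Suc i)) (shift F (Suc i)) (bd F i)) \<and>
     (\<forall>d. \<forall>s\<in>hom_part V d. \<exists>f\<in>fgr V (rk F 0) (shift F 0) d. s - augm F f \<in> I) \<and>
     (\<forall>d. {f \<in> fgr V (rk F 0) (shift F 0) d. augm F f \<in> I} =
        mat_app (rk F 1) (bd F 0) ` fgr V (rk F 1) (shift F 1) d) \<and>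
     (\<forall>i d. {f \<in> fgr V (rk F (Suc i)) (shift F (Suc i)) d. mat_app (rk F (Suc i)) (bd F i) f = 0} =
        mat_app (rk F (Suc (Suc i))) (bd F (Suc i)) ` fgr V (rk F (Suc (Suc i))) (shift F (Suc (Suc i))) d)"

lemma augm_sum: "augm F (\<Sum>i\<in>I. f i) = (\<Sum>i\<in>I. augm F (f i))"
  unfolding augm_def sum_fun_at sum_distrib_right by (rule sum.swap)

lemma augm_vcomp:
  assumes "\<And>k. k < rk F 0 \<Longrightarrow> homogeneous (aug F k) (shift F 0 k)"
  shows "augm F (vcomp (shift F 0) d f) = hcomp d (augm F f)"
  unfolding augm_def hcomp_sum vcomp_def
  by (intro sum.cong refl) (use hcomp_mult[OF assms] in \<open>simp add: mult.commute\<close>)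

lemma augm_hom_part:
  assumes "\<And>k. k < rk F 0 \<Longrightarrow> aug F k \<in> hom_part V (shift F 0 k)" "f \<in> fgr V (rk F 0) (shift F 0) d"
  shows "augm F f \<in> hom_part V d"
  unfolding augm_def
proof (rule hom_part_sum)
  fix k assume "k \<in> {..<rk F 0}"
  then show "f k * aug F k \<in> hom_part V d"
    using hom_part_mult[of "f k" V "d - shift F 0 k" "aug F k" "shift F 0 k"] assms by (auto simp: fgr_def)
qed

text \<open>Both sides are sums of their graded parts, and a homogeneous matrix commutes with taking
  components; so the equality can be tested degree by degree.\<close>

lemma vector_exact_iff:
  assumes A: "hmat V r s r' s' A" and Z0: "Z \<subseteq> free_mod V r"
    and Zv: "\<And>f d. f \<in> Z \<Longrightarrow> vcomp s d f \<in> Z" and Zs: "\<And>f (D :: int set). (\<And>d. d \<in> D \<Longrightarrow> f d \<in> Z) \<Longrightarrow> sum f D \<in> Z"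
  shows "Z = mat_app r' A ` free_mod V r' \<longleftrightarrow> (\<forall>d. Z \<inter> fgr V r s d = mat_app r' A ` fgr V r' s' d)"
proof (intro iffI allI equalityI subsetI)
  fix d f assume Z: "Z = mat_app r' A ` free_mod V r'" and f: "f \<in> Z \<inter> fgr V r s d"
  then obtain u where u: "u \<in> free_mod V r'" "f = mat_app r' A u" by auto
  have "f = mat_app r' A (vcomp s' d u)" using f u vcomp_id[of f V r s d] by (simp add: vcomp_mat_app[OF A])
  then show "f \<in> mat_app r' A ` fgr V r' s' d" using vcomp_fgr[OF u(1)] by blast
next
  fix d f assume "Z = mat_app r' A ` free_mod V r'" "f \<in> mat_app r' A ` fgr V r' s' d"
  then show "f \<in> Z \<inter> fgr V r s d" using fgr_sub_free_mod mat_app_fgr[OF A] by blast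
next
  fix f assume ex: "\<forall>d. Z \<inter> fgr V r s d = mat_app r' A ` fgr V r' s' d" and f: "f \<in> Z"
  then have fm: "f \<in> free_mod V r" using Z0 by blast
  then obtain D where D: "finite D" "f = (\<Sum>d\<in>D. vcomp s d f)" by (rule vcomp_decompose)
  have "\<exists>u\<in>fgr V r' s' d. vcomp s d f = mat_app r' A u" for d
    using ex Zv[OF f, of d] vcomp_fgr[OF fm, of s d] by blast
  then obtain u where u: "\<And>d. u d \<in> fgr V r' s' d \<and> vcomp s d f = mat_app r' A (u d)" by metis
  have "f = mat_app r' A (\<Sum>d\<in>D. u d)" using D(2) u by (simp add: mat_app_sum)
  moreover have "(\<Sum>d\<in>D. u d) \<in> free_mod V r'" using u fgr_sub_free_mod by (intro free_mod_sum) blast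
  ultimately show "f \<in> mat_app r' A ` free_mod V r'" by blast
next
  fix f assume ex: "\<forall>d. Z \<inter> fgr V r s d = mat_app r' A ` fgr V r' s' d" and "f \<in> mat_app r' A ` free_mod V r'"
  then obtain u where u: "u \<in> free_mod V r'" "f = mat_app r' A u" by auto
  obtain D where D: "finite D" "u = (\<Sum>d\<in>D. vcomp s' d u)" using u(1) by (rule vcomp_decompose)
  have "f = (\<Sum>d\<in>D. mat_app r' A (vcomp s' d u))" using D(2) u(2) mat_app_sum by metis
  moreover have "mat_app r' A (vcomp s' d u) \<in> Z" for d using ex vcomp_fgr[OF u(1)] by blast
  ultimately show "f \<in> Z" using Zs by simp
qed

lemma gres_iff:
  fixes F :: "('k::comm_ring_1) free_cpx"
  assumes I: "homog_ideal V I"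
  shows "graded_free_resolution V I F \<longleftrightarrow> gres V I F"
proof -
  let ?C1 = "\<forall>k<rk F 0. aug F k \<in> carrier (poly_ring V) \<and> homogeneous (aug F k) (shift F 0 k)"
  let ?C2 = "\<forall>i k l. if k < rk F i \<and> l < rk F (Suc i)
        then bd F i k l \<in> carrier (poly_ring V) \<and>
             homogeneous (bd F i k l) (shift F (Suc i) l - shift F i k)
        else bd F i k l = 0"
  have c1: "?C1 \<longleftrightarrow> (\<forall>k<rk F 0. aug F k \<in> hom_part V (shift F 0 k))" by (simp add: hom_part_iff)
  have c2: "?C2 \<longleftrightarrow> (\<forall>i. hmat V (rk F i) (shift F i) (rk F (Suc i)) (shift F (Suc i)) (bd F i))"
    unfolding hmat_def hom_part_iff by (rule refl)
  {
    assume h1: ?C1 and h2: ?C2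
    have hm: "hmat V (rk F i) (shift F i) (rk F (Suc i)) (shift F (Suc i)) (bd F i)" for i using h2 c2 by blast
    have hm0: "hmat V (rk F 0) (shift F 0) (rk F 1) (shift F 1) (bd F 0)" using hm[of 0] by simp
    have av: "augm F (vcomp (shift F 0) d f) = hcomp d (augm F f)" for d f
      using h1 by (intro augm_vcomp) auto
    have c3: "(\<forall>s\<in>carrier (poly_ring V). \<exists>f\<in>free_mod V (rk F 0). s - augm F f \<in> I) \<longleftrightarrow>
        (\<forall>d. \<forall>s\<in>hom_part V d. \<exists>f\<in>fgr V (rk F 0) (shift F 0) d. s - augm F f \<in> I)"
    proof (intro iffI allI ballI)
      fix d and s :: "'k mpoly" assume h: "\<forall>s\<in>carrier (poly_ring V). \<exists>f\<in>free_mod V (rk F 0). s - augm F f \<in> I" and s: "s \<in> hom_part V d"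
      then obtain f where f: "f \<in> free_mod V (rk F 0)" "s - augm F f \<in> I" using hom_part_carrier by blast
      have "hcomp d (s - augm F f) \<in> I" using homog_idealD(5)[OF I f(2)] .
      then have "s - augm F (vcomp (shift F 0) d f) \<in> I" by (simp add: hcomp_diff av hcomp_hom_part_eq[OF s])
      then show "\<exists>f\<in>fgr V (rk F 0) (shift F 0) d. s - augm F f \<in> I" using vcomp_fgr[OF f(1)] by blast
    next
      fix s :: "'k mpoly" assume h: "\<forall>d. \<forall>s\<in>hom_part V d. \<exists>f\<in>fgr V (rk F 0) (shift F 0) d. s - augm F f \<in> I"
        and s: "s \<in> carrier (poly_ring V)"
      have "\<exists>f\<in>fgr V (rk F 0) (shift F 0) d. hcomp d s - augm F f \<in> I" for d using h hcomp_hom_part[OF s] by blast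
      then obtain f where f: "\<And>d. f d \<in> fgr V (rk F 0) (shift F 0) d \<and> hcomp d s - augm F (f d) \<in> I" by metis
      have "s - augm F (\<Sum>d\<in>degs s. f d) = (\<Sum>d\<in>degs s. hcomp d s - augm F (f d))"
        using hcomp_decompose[of "degs s" s] by (simp add: augm_sum sum_subtractf)
      also have "\<dots> \<in> I" using f by (intro homog_ideal_sum[OF I]) auto
      finally have "s - augm F (\<Sum>d\<in>degs s. f d) \<in> I" .
      moreover have "(\<Sum>d\<in>degs s. f d) \<in> free_mod V (rk F 0)" using f fgr_sub_free_mod by (intro free_mod_sum) blast
      ultimately show "\<exists>f\<in>free_mod V (rk F 0). s - augm F f \<in> I" by blast
    qed
    have eq0: "{f \<in> fgr V (rk F 0) (shift F 0) d. augm F f \<in> I} =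
        {f \<in> free_mod V (rk F 0). augm F f \<in> I} \<inter> fgr V (rk F 0) (shift F 0) d" for d
      using fgr_sub_free_mod by blast
    have c4: "{f \<in> free_mod V (rk F 0). augm F f \<in> I} = mat_app (rk F 1) (bd F 0) ` free_mod V (rk F 1) \<longleftrightarrow>
        (\<forall>d. {f \<in> fgr V (rk F 0) (shift F 0) d. augm F f \<in> I} =
          mat_app (rk F 1) (bd F 0) ` fgr V (rk F 1) (shift F 1) d)"
      unfolding eq0
    proof (rule vector_exact_iff[OF hm0])
      fix f d assume f: "f \<in> {f \<in> free_mod V (rk F 0). augm F f \<in> I}"
      then show "vcomp (shift F 0) d f \<in> {f \<in> free_mod V (rk F 0). augm F f \<in> I}"
        using vcomp_fgr[of f V "rk F 0" "shift F 0" d] fgr_sub_free_mod av homog_idealD(5)[OF I] by fastforce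
    next
      fix f and D :: "int set" assume "\<And>d. d \<in> D \<Longrightarrow> f d \<in> {f \<in> free_mod V (rk F 0). augm F f \<in> I}"
      then show "sum f D \<in> {f \<in> free_mod V (rk F 0). augm F f \<in> I}"
        by (auto intro!: free_mod_sum homog_ideal_sum[OF I] simp: augm_sum)
    qed auto
    have eqS: "{f \<in> fgr V (rk F (Suc i)) (shift F (Suc i)) d. mat_app (rk F (Suc i)) (bd F i) f = 0} =
        {f \<in> free_mod V (rk F (Suc i)). mat_app (rk F (Suc i)) (bd F i) f = 0} \<inter> fgr V (rk F (Suc i)) (shift F (Suc i)) d" for i d
      using fgr_sub_free_mod by blast
    have c5: "{f \<in> free_mod V (rk F (Suc i)). mat_app (rk F (Suc i)) (bd F i) f = 0}
         = mat_app (rk F (Suc (Suc i))) (bd F (Suc i)) ` free_mod V (rk F (Suc (Suc i))) \<longleftrightarrow>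
        (\<forall>d. {f \<in> fgr V (rk F (Suc i)) (shift F (Suc i)) d. mat_app (rk F (Suc i)) (bd F i) f = 0} =
        mat_app (rk F (Suc (Suc i))) (bd F (Suc i)) ` fgr V (rk F (Suc (Suc i))) (shift F (Suc (Suc i))) d)" for i
      unfolding eqS
    proof (rule vector_exact_iff[OF hm[of "Suc i"]])
      fix f d assume f: "f \<in> {f \<in> free_mod V (rk F (Suc i)). mat_app (rk F (Suc i)) (bd F i) f = 0}"
      then show "vcomp (shift F (Suc i)) d f \<in> {f \<in> free_mod V (rk F (Suc i)). mat_app (rk F (Suc i)) (bd F i) f = 0}"
        using vcomp_fgr[of f V "rk F (Suc i)" "shift F (Suc i)" d] fgr_sub_free_mod vcomp_mat_app[OF hm[of i]] by fastforce
    next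
      fix f and D :: "int set"
      assume "\<And>d. d \<in> D \<Longrightarrow> f d \<in> {f \<in> free_mod V (rk F (Suc i)). mat_app (rk F (Suc i)) (bd F i) f = 0}"
      then show "sum f D \<in> {f \<in> free_mod V (rk F (Suc i)). mat_app (rk F (Suc i)) (bd F i) f = 0}"
        by (auto intro!: free_mod_sum sum.neutral simp: mat_app_sum)
    qed auto
    note c3 c4 c5
  }
  note eqs = this
  show ?thesis
  \<comment> \<open>If the matrices are not homogeneous, both sides are false; this is why the
    equivalences above may assume homogeneity.\<close>
  proof (cases "?C1 \<and> ?C2")
    case True
    then have h: ?C1 ?C2 by blast+
    show ?thesis
      unfolding graded_free_resolution_def gres_def augm_def[symmetric] c1[symmetric] c2[symmetric]
        eqs(1)[OF h] eqs(2)[OF h] eqs(3)[OF h] using h by (simp only: simp_thms)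
  next
    case False
    then show ?thesis unfolding graded_free_resolution_def gres_def c1[symmetric] c2[symmetric] by argo
  qed
qed

section \<open>Tor from a resolution and from the Koszul complex\<close>

text \<open>The degree d part of m A, where m is the ideal generated by the variables.\<close>

definition mspan :: "(vname \<Rightarrow> 'm::comm_ring_1) \<Rightarrow> vname set \<Rightarrow> (int \<Rightarrow> 'm set) \<Rightarrow> int \<Rightarrow> 'm set" where
  "mspan \<xi> W A d = {x. \<exists>g. (\<forall>z\<in>W. g z \<in> A (d - 1)) \<and> x = (\<Sum>z\<in>W. \<xi> z * g z)}"

context
  fixes \<xi> :: "vname \<Rightarrow> 'm::comm_ring_1" and W :: "vname set"
  assumes finW: "finite W"
begin

lemma kdiff_chain1:
  assumes "b \<in> kchain W A (Suc 0) d"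
  shows "kdiff \<xi> W b = (\<lambda>\<tau>. if \<tau> = {} then \<Sum>z\<in>W. \<xi> z * b {z} else 0)"
proof
  fix \<tau>
  show "kdiff \<xi> W b \<tau> = (if \<tau> = {} then \<Sum>z\<in>W. \<xi> z * b {z} else 0)"
  proof (cases "\<tau> = {}")
    case True
    then show ?thesis by (simp add: kdiff_def ksgn_def)
  next
    case False
    have "\<not> (\<tau> \<subseteq> W \<and> Suc (card \<tau>) = Suc 0)"
      using False finite_subset[OF _ finW] by auto
    then show ?thesis using kdiff_supp[OF finW assms, of \<tau>] False by simp
  qed
qed

lemma chain1_exists:
  assumes A: "gsub \<xi> W A" and x: "x \<in> mspan \<xi> W A d"
  obtains b where "b \<in> kchain W A (Suc 0) d" "kdiff \<xi> W b = (\<lambda>\<tau>. if \<tau> = {} then x else 0)"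
proof -
  obtain g where g: "\<And>z. z \<in> W \<Longrightarrow> g z \<in> A (d - 1)" "x = (\<Sum>z\<in>W. \<xi> z * g z)"
    using x by (auto simp: mspan_def)
  define b where "b = (\<lambda>\<sigma>. if \<exists>z\<in>W. \<sigma> = {z} then g (the_elem \<sigma>) else 0)"
  have bz: "b {z} = g z" if "z \<in> W" for z using that by (simp add: b_def)
  have b: "b \<in> kchain W A (Suc 0) d"
  proof (rule kchainI)
    show "b \<sigma> \<in> A (d - int (Suc 0))" for \<sigma>
    proof (cases "\<exists>z\<in>W. \<sigma> = {z}")
      case True
      then show ?thesis using g(1) bz by auto
    next
      case False
      then show ?thesis using gsub_0[OF A] by (simp add: b_def)
    qed
    show "b \<sigma> = 0" if "\<not> (\<sigma> \<subseteq> W \<and> card \<sigma> = Suc 0)" for \<sigma>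
    proof -
      have "\<not> (\<exists>z\<in>W. \<sigma> = {z})" using that by auto
      then show ?thesis by (simp add: b_def)
    qed
  qed
  have "(\<Sum>z\<in>W. \<xi> z * b {z}) = x" unfolding g(2) by (rule sum.cong) (simp_all add: bz)
  then have "kdiff \<xi> W b = (\<lambda>\<tau>. if \<tau> = {} then x else 0)" unfolding kdiff_chain1[OF b] by (simp only:)
  then show ?thesis by (rule that[OF b])
qed

lemma chain1_mspan:
  assumes "b \<in> kchain W A (Suc 0) d"
  shows "(\<Sum>z\<in>W. \<xi> z * b {z}) \<in> mspan \<xi> W A d"
  using kchain_val[OF assms, of "d - 1"] unfolding mspan_def
  by (intro CollectI exI[of _ "\<lambda>z. b {z}"]) simp

text \<open>H_1(F/Z) is the kernel of Z/mZ -> F/mF.\<close>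

lemma kvan_quotient_1:
  assumes F: "gsub \<xi> W F" and Z: "gsub \<xi> W Z" and sub: "\<And>d. Z d \<subseteq> F d"
    and acyclic: "kvan \<xi> W F (\<lambda>_. {0}) (Suc 0) d"
  shows "kvan \<xi> W F Z (Suc 0) d \<longleftrightarrow> (\<forall>x\<in>Z d. x \<in> mspan \<xi> W F d \<longrightarrow> x \<in> mspan \<xi> W Z d)"
  unfolding kvan_quotient_acyclic[OF finW F Z sub acyclic]
proof (intro iffI ballI impI)
  fix x assume r: "\<forall>b\<in>kchain W F (Suc 0) d. (\<forall>\<tau>. kdiff \<xi> W b \<tau> \<in> Z (d - int 0)) \<longrightarrow>
       (\<exists>a\<in>kchain W Z (Suc 0) d. kdiff \<xi> W a = kdiff \<xi> W b)" and x: "x \<in> Z d" "x \<in> mspan \<xi> W F d"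
  obtain b where b: "b \<in> kchain W F (Suc 0) d" "kdiff \<xi> W b = (\<lambda>\<tau>. if \<tau> = {} then x else 0)"
    using chain1_exists[OF F x(2)] by blast
  have "\<forall>\<tau>. kdiff \<xi> W b \<tau> \<in> Z (d - int 0)" using b(2) x(1) gsub_0[OF Z] by simp
  then obtain a where a: "a \<in> kchain W Z (Suc 0) d" "kdiff \<xi> W a = kdiff \<xi> W b" using r b(1) by blast
  have "kdiff \<xi> W a {} = x" using a(2) b(2) by simp
  then show "x \<in> mspan \<xi> W Z d" using chain1_mspan[OF a(1)] kdiff_chain1[OF a(1)] by simp
next
  fix b assume r: "\<forall>x\<in>Z d. x \<in> mspan \<xi> W F d \<longrightarrow> x \<in> mspan \<xi> W Z d"
    and b: "b \<in> kchain W F (Suc 0) d" and db: "\<forall>\<tau>. kdiff \<xi> W b \<tau> \<in> Z (d - int 0)"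
  let ?x = "\<Sum>z\<in>W. \<xi> z * b {z}"
  have "?x \<in> Z d" using db[rule_format, of "{}"] by (simp add: kdiff_chain1[OF b])
  then have "?x \<in> mspan \<xi> W Z d" using r chain1_mspan[OF b] by blast
  then obtain a where "a \<in> kchain W Z (Suc 0) d" "kdiff \<xi> W a = (\<lambda>\<tau>. if \<tau> = {} then ?x else 0)"
    using chain1_exists[OF Z] by blast
  then show "\<exists>a\<in>kchain W Z (Suc 0) d. kdiff \<xi> W a = kdiff \<xi> W b" unfolding kdiff_chain1[OF b] by blast
qed

text \<open>H_0(A/B) is A/(B + mA).\<close>

lemma kvan_0_iff:
  assumes A: "gsub \<xi> W A" and B: "gsub \<xi> W B"
  shows "kvan \<xi> W A B 0 d \<longleftrightarrow> (\<forall>x\<in>A d. \<exists>y\<in>mspan \<xi> W A d. x - y \<in> B d)"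
proof (intro iffI ballI)
  fix x assume v: "kvan \<xi> W A B 0 d" and x: "x \<in> A d"
  define c where "c = (\<lambda>\<sigma> :: vname set. if \<sigma> = {} then x else 0)"
  have c: "c \<in> kchain W A 0 d"
    using x gsub_0[OF A] finite_subset[OF _ finW] by (auto simp: kchain_def c_def)
  have "kdiff \<xi> W c \<tau> = 0" for \<tau> by (simp add: kdiff_def c_def)
  then have "\<forall>\<tau>. kdiff \<xi> W c \<tau> \<in> B (d - int 0 + 1)" using gsub_0[OF B] by simp
  then obtain b where b: "b \<in> kchain W A (Suc 0) d" "\<forall>\<tau>. c \<tau> - kdiff \<xi> W b \<tau> \<in> B (d - int 0)"
    using v c unfolding kvan_def by blast
  have "x - (\<Sum>z\<in>W. \<xi> z * b {z}) \<in> B d"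
    using b(2)[rule_format, of "{}"] by (simp add: c_def kdiff_chain1[OF b(1)])
  then show "\<exists>y\<in>mspan \<xi> W A d. x - y \<in> B d" using chain1_mspan[OF b(1)] by blast
next
  assume r: "\<forall>x\<in>A d. \<exists>y\<in>mspan \<xi> W A d. x - y \<in> B d"
  show "kvan \<xi> W A B 0 d"
    unfolding kvan_def
  proof (intro ballI impI)
    fix c assume c: "c \<in> kchain W A 0 d"
    have c0: "c \<sigma> = 0" if "\<sigma> \<noteq> {}" for \<sigma>
    proof (rule kchain_supp[OF c])
      show "\<not> (\<sigma> \<subseteq> W \<and> card \<sigma> = 0)" using that finite_subset[OF _ finW, of \<sigma>] by auto
    qed
    have "c {} \<in> A d" using kchain_val[OF c, of d "{}"] by simp
    then obtain y where y: "y \<in> mspan \<xi> W A d" "c {} - y \<in> B d" using r by blast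
    obtain b where b: "b \<in> kchain W A (Suc 0) d" "kdiff \<xi> W b = (\<lambda>\<tau>. if \<tau> = {} then y else 0)"
      using chain1_exists[OF A y(1)] by blast
    have "\<forall>\<tau>. c \<tau> - kdiff \<xi> W b \<tau> \<in> B (d - int 0)" using y(2) c0 gsub_0[OF B] by (simp add: b(2))
    then show "\<exists>b\<in>kchain W A (Suc 0) d. \<forall>\<tau>. c \<tau> - kdiff \<xi> W b \<tau> \<in> B (d - int 0)" using b(1) by blast
  qed
qed

end

section \<open>Reduction of free modules modulo the ideal of the variables\<close>

definition cst :: "(nat \<Rightarrow> ('k::comm_ring_1) mpoly) \<Rightarrow> nat \<Rightarrow> 'k" where
  "cst f = (\<lambda>k. lookup (f k) 0)"

text \<open>A section of \<open>cst\<close>, used to lift elements of F tensor K to F.\<close>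

definition emb :: "(nat \<Rightarrow> 'k) \<Rightarrow> nat \<Rightarrow> ('k::comm_ring_1) mpoly" where
  "emb v = (\<lambda>k. single 0 (v k))"

lemma cst_emb [simp]: "cst (emb v) = v"
  by (simp add: cst_def emb_def)

lemma add_eq_0_nat_map: "a + b = 0 \<longleftrightarrow> a = 0 \<and> b = (0 :: 'a \<Rightarrow>\<^sub>0 nat)"
  by (metis Un_empty keys_add_nat keys_eq_empty keys_zero)

lemma lookup_mult_0: "lookup (p * q) 0 = lookup p 0 * lookup (q :: ('k::comm_ring_1) mpoly) 0"
proof -
  have "p * q = (\<Sum>m\<in>keys p. single m (lookup p m)) * (\<Sum>n\<in>keys q. single n (lookup q n))"
    using mpoly_sum[of p] mpoly_sum[of q] by metis
  also have "\<dots> = (\<Sum>m\<in>keys p. \<Sum>n\<in>keys q. single (m + n) (lookup p m * lookup q n))"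
    by (simp add: sum_product mult_single)
  finally have "lookup (p * q) 0 = (\<Sum>m\<in>keys p. \<Sum>n\<in>keys q. (if n = 0 then (if m = 0 then lookup p m * lookup q n else 0) else 0))"
    by (simp add: lookup_sum lookup_single when_def add_eq_0_nat_map if_distrib cong: if_cong sum.cong)
       (intro sum.cong refl, auto)
  also have "\<dots> = (\<Sum>m\<in>keys p. if m = 0 then lookup p m * lookup q 0 else 0)"
    by (intro sum.cong refl) (auto simp: in_keys_iff)
  also have "\<dots> = lookup p 0 * lookup q 0" by (auto simp: in_keys_iff)
  finally show ?thesis .
qed

lemma cst_mat_app: "cst (mat_app r' A f) = mat_app r' (\<lambda>k l. lookup (A k l) 0) (cst f)"
  by (simp add: cst_def mat_app_def lookup_sum lookup_mult_0)

lemma cst_diff: "cst (f - g) = cst f - cst g"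
  by (simp add: cst_def fun_eq_iff lookup_minus)

lemma total_degree_eq_0: "total_degree m = 0 \<longleftrightarrow> m = 0"
proof
  assume "total_degree m = 0"
  then have "\<forall>z\<in>keys m. lookup m z = 0" by (simp add: total_degree_def)
  then have "lookup m z = 0" for z by (cases "z \<in> keys m") (auto simp: in_keys_iff)
  then show "m = 0" by (intro poly_mapping_eqI) simp
qed simp

lemma lookup_var_0 [simp]: "lookup (var z) 0 = 0"
proof -
  have "single z 1 \<noteq> (0 :: vname \<Rightarrow>\<^sub>0 nat)" by (metis total_degree_0 total_degree_single zero_neq_one)
  then show ?thesis by (simp add: var_def lookup_single when_def)
qed

lemma gid_vgens_sum:
  assumes "finite Z" "x \<in> gid V (vgens Z) e"
  shows "\<exists>g. (\<forall>z. g z \<in> hom_part V (e - 1)) \<and> x = (\<Sum>z\<in>Z. var z * g z)"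
  using assms(2)
proof (induction x rule: gid.induct)
  case zero
  show ?case by (intro exI[of _ "\<lambda>_. 0"]) simp
next
  case (step p e' g m c)
  then obtain q where q: "\<And>z. q z \<in> hom_part V (e - 1)" "p = (\<Sum>z\<in>Z. var z * q z)" by blast
  obtain w where w: "w \<in> Z" "g = var w" "e' = 1" using step by (auto simp: vgens_def)
  have mm: "single m c \<in> hom_part V (e - 1)" using step w by (intro hom_part_single) auto
  let ?q = "\<lambda>z. q z + (if z = w then single m c else 0)"
  have "?q z \<in> hom_part V (e - 1)" for z using q(1) mm by (auto intro: hom_part_add)
  moreover have "(\<Sum>z\<in>Z. var z * ?q z) = p + single m c * g"
  proof -
    have "(\<Sum>z\<in>Z. var z * ?q z) = (\<Sum>z\<in>Z. var z * q z) + (\<Sum>z\<in>Z. if z = w then var z * single m c else 0)"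
      unfolding sum.distrib[symmetric] by (intro sum.cong refl) (simp add: distrib_left)
    also have "(\<Sum>z\<in>Z. if z = w then var z * single m c else 0) = var w * single m c"
      using w assms(1) by simp
    finally show ?thesis using q w by (simp add: mult.commute)
  qed
  ultimately show ?case by (intro exI[of _ ?q]) auto
qed

context
  fixes V :: "nat set"
  assumes finV: "finite V"
begin

lemma hom_part_cst0:
  assumes x: "x \<in> hom_part V e" and c: "lookup x 0 = 0"
  shows "\<exists>g. (\<forall>z. g z \<in> hom_part V (e - 1)) \<and> x = (\<Sum>z\<in>vars V. var z * g z)"
proof (cases "e > 0")
  case True
  then show ?thesis using gid_vgens_sum[OF finite_vars[OF finV]] hom_part_vars[OF finV True] x by blast
next
  case False
  have "x = 0"
  proof (rule ccontr)
    assume "x \<noteq> 0"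
    then obtain m where m: "m \<in> keys x" using keys_eq_empty[of x] by blast
    then have "int (total_degree m) = e" using x by (auto simp: hom_part_def)
    then have "m = 0" using False total_degree_eq_0[of m] by simp
    then show False using m c by (simp add: in_keys_iff)
  qed
  then show ?thesis by (intro exI[of _ "\<lambda>_. 0"]) simp
qed

text \<open>A homogeneous polynomial of positive degree always lies in m; so only coefficients of
  degree 0 can obstruct, and they are their constant terms.\<close>

lemma mspan_fgr_iff:
  assumes x: "x \<in> fgr V r s d"
  shows "x \<in> mspan vvar (vars V) (fgr V r s) d \<longleftrightarrow> cst x = 0"
proof
  assume "x \<in> mspan vvar (vars V) (fgr V r s) d"
  then obtain g where "x = (\<Sum>z\<in>vars V. vvar z * g z)" by (auto simp: mspan_def)
  then have "x k = (\<Sum>z\<in>vars V. var z * g z k)" for k by (simp add: sum_fun_at vvar_def)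
  then show "cst x = 0" by (simp add: cst_def fun_eq_iff lookup_sum lookup_mult_0)
next
  assume c: "cst x = 0"
  have "\<exists>g. (\<forall>z. g z \<in> hom_part V (d - s k - 1)) \<and> x k = (\<Sum>z\<in>vars V. var z * g z) \<and> (r \<le> k \<longrightarrow> g = (\<lambda>_. 0))" for k
  proof (cases "r \<le> k")
    case True
    then have "x k = 0" using x by (simp add: fgr_def)
    then show ?thesis by (intro exI[of _ "\<lambda>_. 0"]) simp
  next
    case False
    have "lookup (x k) 0 = 0" using c by (auto simp: cst_def fun_eq_iff)
    then show ?thesis using hom_part_cst0[of "x k" "d - s k"] x False by (auto simp: fgr_def)
  qed
  then obtain g where g: "\<And>k. (\<forall>z. g k z \<in> hom_part V (d - s k - 1)) \<and> x k = (\<Sum>z\<in>vars V. var z * g k z) \<and> (r \<le> k \<longrightarrow> g k = (\<lambda>_. 0))"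
    using choice[of "\<lambda>k g. (\<forall>z. g z \<in> hom_part V (d - s k - 1)) \<and> x k = (\<Sum>z\<in>vars V. var z * g z) \<and> (r \<le> k \<longrightarrow> g = (\<lambda>_. 0))"]
    by blast
  have "g k z \<in> hom_part V (d - 1 - s k)" for k z
  proof -
    have "d - s k - 1 = d - 1 - s k" by simp
    then show ?thesis using conjunct1[OF g[of k]] by metis
  qed
  moreover have "g k z = 0" if "r \<le> k" for k z
  proof -
    have "g k = (\<lambda>_. 0)" using g[of k] that by blast
    then show ?thesis by simp
  qed
  ultimately have 1: "(\<lambda>k. g k z) \<in> fgr V r s (d - 1)" for z by (simp add: fgr_def)
  have 2: "x = (\<Sum>z\<in>vars V. vvar z * (\<lambda>k. g k z))"
  proof
    fix k
    have "x k = (\<Sum>z\<in>vars V. var z * g k z)" using g[of k] by blast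
    then show "x k = (\<Sum>z\<in>vars V. vvar z * (\<lambda>k. g k z)) k" by (simp add: sum_fun_at vvar_def)
  qed
  show "x \<in> mspan vvar (vars V) (fgr V r s) d"
    unfolding mspan_def using 1 2 by (intro CollectI exI[of _ "\<lambda>z k. g k z"]) simp
qed

lemma ksgn_fun_at: "(ksgn z \<tau> :: nat \<Rightarrow> ('k::comm_ring_1) mpoly) k = ksgn z \<tau>"
  by (cases "even (card {u \<in> \<tau>. vord u < vord z})") (simp_all add: ksgn_def)

text \<open>The Koszul complex of a free module is a direct sum of shifted copies of that of S,
  whose acyclicity is \<open>knz_empty\<close>.\<close>

lemma acyclic_fgr: "kvan vvar (vars V) (fgr V r s) (\<lambda>_. {0 :: nat \<Rightarrow> ('k::comm_ring_1) mpoly}) (Suc p) d"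
  unfolding kvan_def
proof (intro ballI impI)
  let ?W = "vars V"
  fix c :: "vname set \<Rightarrow> nat \<Rightarrow> 'k mpoly"
  assume c: "c \<in> kchain ?W (fgr V r s) (Suc p) d" and dc: "\<forall>\<tau>. kdiff vvar ?W c \<tau> \<in> {0}"
  have at: "kdiff vvar ?W b \<tau> k = kdiff var ?W (\<lambda>\<sigma>. b \<sigma> k) \<tau>" for b :: "vname set \<Rightarrow> nat \<Rightarrow> 'k mpoly" and \<tau> k
    by (simp add: kdiff_def sum_fun_at ksgn_fun_at vvar_def)
  have "\<exists>b\<in>kchain ?W (hom_part V) (Suc (Suc p)) (d - s k). \<forall>\<tau>. c \<tau> k = kdiff var ?W b \<tau>" for k
  proof -
    have ck: "(\<lambda>\<sigma>. c \<sigma> k) \<in> kchain ?W (hom_part V) (Suc p) (d - s k)"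
    proof (rule kchainI)
      have "d - s k - int (Suc p) = d - int (Suc p) - s k" by simp
      then show "c \<sigma> k \<in> hom_part V (d - s k - int (Suc p))" for \<sigma>
        using kchain_val[OF c refl, of \<sigma>] by (simp only: fgr_def) auto
      show "c \<sigma> k = 0" if "\<not> (\<sigma> \<subseteq> ?W \<and> card \<sigma> = Suc p)" for \<sigma>
        using kchain_supp[OF c that] by simp
    qed
    \<comment> \<open>The degree is written as the column plus the row, the form in which
      \<open>knz\<close> speaks about it.\<close>
    have v: "kvan var ?W (hom_part V) (gid V ({} :: (int \<times> 'k mpoly) set)) (Suc p) (int (Suc p) + (d - s k - int (Suc p)))"
      using knz_empty[OF finV, where 'k = 'k] unfolding knz_def by blast
    then have v': "kvan var ?W (hom_part V) (\<lambda>_. {0 :: 'k mpoly}) (Suc p) (d - s k)"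
    proof -
      have e: "gid V ({} :: (int \<times> 'k mpoly) set) = (\<lambda>_. {0})" by (simp add: fun_eq_iff)
      show ?thesis using v unfolding e by simp
    qed
    have "\<forall>\<tau>. kdiff var ?W (\<lambda>\<sigma>. c \<sigma> k) \<tau> \<in> {0}"
      unfolding at[symmetric] using dc by simp
    then obtain b where b: "b \<in> kchain ?W (hom_part V) (Suc (Suc p)) (d - s k)" "\<forall>\<tau>. c \<tau> k - kdiff var ?W b \<tau> \<in> {0}"
      using v' ck unfolding kvan_def by blast
    then show ?thesis by (intro bexI[of _ b]) simp_all
  qed
  then obtain b where b: "\<And>k. b k \<in> kchain ?W (hom_part V) (Suc (Suc p)) (d - s k) \<and> (\<forall>\<tau>. c \<tau> k = kdiff var ?W (b k) \<tau>)"
    by metis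
  define b' where "b' = (\<lambda>\<sigma> k. if k < r then b k \<sigma> else 0)"
  have "b' \<in> kchain ?W (fgr V r s) (Suc (Suc p)) d"
  proof (rule kchainI)
    fix \<sigma>
    have "d - s k - int (Suc (Suc p)) = d - int (Suc (Suc p)) - s k" for k by simp
    then have "b k \<sigma> \<in> hom_part V (d - int (Suc (Suc p)) - s k)" for k
      using kchain_val[OF conjunct1[OF b[of k]] refl, of \<sigma>] by metis
    then show "b' \<sigma> \<in> fgr V r s (d - int (Suc (Suc p)))" by (simp add: fgr_def b'_def)
    show "b' \<sigma> = 0" if "\<not> (\<sigma> \<subseteq> ?W \<and> card \<sigma> = Suc (Suc p))"
    proof
      fix k
      have "b k \<sigma> = 0" by (rule kchain_supp[OF conjunct1[OF b[of k]] that])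
      then show "b' \<sigma> k = 0 k" by (simp add: b'_def)
    qed
  qed
  moreover have "c \<tau> - kdiff vvar ?W b' \<tau> = 0" for \<tau>
  proof
    fix k
    show "(c \<tau> - kdiff vvar ?W b' \<tau>) k = 0 k"
    proof (cases "k < r")
      case True
      then have "(\<lambda>\<sigma>. b' \<sigma> k) = b k" by (simp add: b'_def fun_eq_iff)
      then show ?thesis using b[of k] by (simp add: at)
    next
      case False
      then have "c \<tau> k = 0" using kchain_val[OF c refl, of \<tau>] by (simp add: fgr_def)
      moreover have "(\<lambda>\<sigma>. b' \<sigma> k) = (\<lambda>_. 0)" using False by (simp add: b'_def fun_eq_iff)
      ultimately show ?thesis by (simp add: at)
    qed
  qed
  ultimately show "\<exists>b\<in>kchain ?W (fgr V r s) (Suc (Suc p)) d. \<forall>\<tau>. c \<tau> - kdiff vvar ?W b \<tau> \<in> {0}" by auto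
qed

end

section \<open>Syzygy modules of a resolution\<close>

definition kerf :: "nat set \<Rightarrow> nat \<Rightarrow> (nat \<Rightarrow> int) \<Rightarrow> (nat \<Rightarrow> nat \<Rightarrow> ('k::comm_ring_1) mpoly) \<Rightarrow> int \<Rightarrow> (nat \<Rightarrow> 'k mpoly) set" where
  "kerf V r s A d = {f \<in> fgr V r s d. mat_app r A f = 0}"

lemma gsub_kerf: "gsub vvar (vars V) (kerf V r s A)"
  unfolding gsub_def
proof (intro allI conjI ballI)
  fix d z f g
  show "0 \<in> kerf V r s A d" by (simp add: kerf_def gsub_0[OF gsub_fgr])
  show "f \<in> kerf V r s A d \<Longrightarrow> g \<in> kerf V r s A d \<Longrightarrow> f - g \<in> kerf V r s A d"
    by (simp add: kerf_def mat_app_diff gsub_diff[OF gsub_fgr])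
  show "z \<in> vars V \<Longrightarrow> f \<in> kerf V r s A d \<Longrightarrow> vvar z * f \<in> kerf V r s A (d + 1)"
    by (simp add: kerf_def mat_app_vvar gsub_mult[OF gsub_fgr])
qed

lemma kerf_sub: "kerf V r s A d \<subseteq> fgr V r s d"
  by (auto simp: kerf_def)

context
  fixes V :: "nat set"
  assumes finV: "finite V"
begin

text \<open>A free module modulo the kernel of a matrix is isomorphic to the image of this
  matrix.\<close>

lemma kvan_image:
  fixes A :: "nat \<Rightarrow> nat \<Rightarrow> ('k::comm_ring_1) mpoly"
  assumes Z: "gsub vvar (vars V) Z" and im: "\<And>d. Z d = mat_app r A ` fgr V r s d"
  shows "kvan vvar (vars V) (fgr V r s) (kerf V r s A) p d \<longleftrightarrow> kvan vvar (vars V) Z (\<lambda>_. {0}) p d"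
proof (rule kvan_iso[OF finite_vars[OF finV] gsub_fgr gsub_kerf Z gsub_zero, where \<phi> = "mat_app r A"])
  fix d a
  show "a \<in> fgr V r s d \<Longrightarrow> mat_app r A a \<in> Z d" by (simp add: im)
  show "a \<in> Z d \<Longrightarrow> \<exists>b\<in>fgr V r s d. a - mat_app r A b \<in> {0}" by (auto simp: im)
  show "a \<in> fgr V r s d \<Longrightarrow> mat_app r A a \<in> {0} \<longleftrightarrow> a \<in> kerf V r s A d" by (simp add: kerf_def)
qed (simp_all add: mat_app_add mat_app_vvar)

text \<open>The syzygies of \<open>F/Z\<close> from an acyclic cover \<open>F' \<rightarrow> Z\<close>.\<close>

lemma kvan_syzygy:
  fixes A :: "nat \<Rightarrow> nat \<Rightarrow> ('k::comm_ring_1) mpoly"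
  assumes Z: "gsub vvar (vars V) Z" and sub: "\<And>d. Z d \<subseteq> fgr V r0 s0 d"
    and im: "\<And>d. Z d = mat_app r A ` fgr V r s d"
  shows "kvan vvar (vars V) (fgr V r0 s0) Z (Suc (Suc p)) d \<longleftrightarrow>
    kvan vvar (vars V) (fgr V r s) (kerf V r s A) (Suc p) d"
  unfolding kvan_sub_acyclic[OF finite_vars[OF finV] gsub_fgr Z sub acyclic_fgr[OF finV]]
  by (rule kvan_image[OF Z im, symmetric])

lemma kvan_fgr_1_iff:
  assumes Z: "gsub vvar (vars V) Z" and sub: "\<And>d. Z d \<subseteq> fgr V r s d"
  shows "kvan vvar (vars V) (fgr V r s) Z (Suc 0) d \<longleftrightarrow>
    (\<forall>x\<in>Z d. cst x = 0 \<longrightarrow> x \<in> mspan vvar (vars V) Z d)"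
  unfolding kvan_quotient_1[OF finite_vars[OF finV] gsub_fgr Z sub acyclic_fgr[OF finV]]
  using mspan_fgr_iff[OF finV] sub by blast

text \<open>The syzygy module inside F_i: the kernel of the augmentation modulo I for i = 0, and of
  the differential otherwise. By exactness it is the image of F_(i+1), see
  \<open>zfam_im\<close>.\<close>

definition zfam :: "('k::comm_ring_1) mpoly set \<Rightarrow> 'k free_cpx \<Rightarrow> nat \<Rightarrow> int \<Rightarrow> (nat \<Rightarrow> 'k mpoly) set" where
  "zfam I F i = (case i of 0 \<Rightarrow> (\<lambda>d. {f \<in> fgr V (rk F 0) (shift F 0) d. augm F f \<in> I})
     | Suc j \<Rightarrow> kerf V (rk F i) (shift F i) (bd F j))"

context
  fixes I :: "('k::comm_ring_1) mpoly set" and F :: "'k free_cpx"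
  assumes I: "homog_ideal V I" and F: "gres V I F"
begin

abbreviation Fg :: "nat \<Rightarrow> int \<Rightarrow> (nat \<Rightarrow> 'k mpoly) set" where
  "Fg i \<equiv> fgr V (rk F i) (shift F i)"
abbreviation "bdm i \<equiv> mat_app (rk F (Suc i)) (bd F i)"

lemma aug_hom: "k < rk F 0 \<Longrightarrow> aug F k \<in> hom_part V (shift F 0 k)"
  and aug_onto: "s \<in> hom_part V d \<Longrightarrow> \<exists>f\<in>Fg 0 d. s - augm F f \<in> I"
  using F by (auto simp: gres_def)

lemma zfam_im: "zfam I F i d = bdm i ` Fg (Suc i) d"
  using F by (cases i) (auto simp: gres_def zfam_def kerf_def)

lemma zfam_Suc: "zfam I F (Suc i) = kerf V (rk F (Suc i)) (shift F (Suc i)) (bd F i)"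
  by (simp add: zfam_def)

lemma zfam_sub: "zfam I F i d \<subseteq> Fg i d"
  by (cases i) (auto simp: zfam_def kerf_def)

lemma augm_add: "augm F (f + g) = augm F f + augm F g"
  by (simp add: augm_def distrib_right sum.distrib)

lemma augm_vvar: "augm F (vvar z * f) = var z * augm F f"
  by (simp add: augm_def vvar_def sum_distrib_left mult.assoc)

lemma gsub_zfam: "gsub vvar (vars V) (zfam I F i)"
proof (cases i)
  case 0
  have diff: "augm F (f - g) = augm F f - augm F g" for f g
    by (simp add: augm_def left_diff_distrib sum_subtractf)
  have "gsub vvar (vars V) (\<lambda>d. {f \<in> Fg 0 d. augm F f \<in> I})"
    unfolding gsub_def
  proof (intro allI conjI ballI)
    fix d z f g
    show "0 \<in> {f \<in> Fg 0 d. augm F f \<in> I}"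
      using homog_idealD(2)[OF I] by (simp add: augm_def gsub_0[OF gsub_fgr])
    show "f \<in> {f \<in> Fg 0 d. augm F f \<in> I} \<Longrightarrow> g \<in> {f \<in> Fg 0 d. augm F f \<in> I} \<Longrightarrow> f - g \<in> {f \<in> Fg 0 d. augm F f \<in> I}"
      using homog_idealD(3)[OF I] by (simp add: diff gsub_diff[OF gsub_fgr])
    show "z \<in> vars V \<Longrightarrow> f \<in> {f \<in> Fg 0 d. augm F f \<in> I} \<Longrightarrow> vvar z * f \<in> {f \<in> Fg 0 (d + 1). augm F f \<in> I}"
      by (simp add: augm_vvar gsub_mult[OF gsub_fgr] homog_idealD(4)[OF I] hom_part_carrier[OF var_hom_part])
  qed
  then show ?thesis using 0 by (simp add: zfam_def)
qed (simp add: zfam_def gsub_kerf)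

lemma kvan_augm:
  "kvan vvar (vars V) (Fg 0) (zfam I F 0) p d \<longleftrightarrow> kvan var (vars V) (hom_part V) (igr V I) p d"
proof (rule kvan_iso[OF finite_vars[OF finV] gsub_fgr gsub_zfam gsub_hom_part gsub_igr[OF I], where \<phi> = "augm F"])
  fix d a
  show h: "a \<in> Fg 0 d \<Longrightarrow> augm F a \<in> hom_part V d" by (rule augm_hom_part[OF aug_hom])
  show "a \<in> Fg 0 d \<Longrightarrow> augm F a \<in> igr V I d \<longleftrightarrow> a \<in> zfam I F 0 d"
    using h by (auto simp: igr_def zfam_def)
next
  fix d and s :: "'k mpoly" assume s: "s \<in> hom_part V d"
  then obtain f where f: "f \<in> Fg 0 d" "s - augm F f \<in> I" using aug_onto by blast
  then show "\<exists>f\<in>Fg 0 d. s - augm F f \<in> igr V I d"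
    using s augm_hom_part[OF aug_hom f(1)] by (auto simp: igr_def intro: hom_part_diff)
qed (simp_all add: augm_add augm_vvar)

text \<open>Iterated dimension shift: H_(p+1) of S/I becomes H_1 of F_p/Z_p, which can be read off
  from constant terms.\<close>

lemma kvan_shift_all:
  "kvan vvar (vars V) (Fg 0) (zfam I F 0) (Suc p) d \<longleftrightarrow> kvan vvar (vars V) (Fg p) (zfam I F p) (Suc 0) d"
proof -
  \<comment> \<open>Each shift moves the starting index, so the induction is over all starting
    indices i.\<close>
  have "kvan vvar (vars V) (Fg i) (zfam I F i) (Suc p) d \<longleftrightarrow> kvan vvar (vars V) (Fg (i + p)) (zfam I F (i + p)) (Suc 0) d" for i
  proof (induction p arbitrary: i)
    case (Suc p)
    have "kvan vvar (vars V) (Fg i) (zfam I F i) (Suc (Suc p)) d \<longleftrightarrow>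
        kvan vvar (vars V) (Fg (Suc i)) (zfam I F (Suc i)) (Suc p) d"
      unfolding zfam_Suc by (rule kvan_syzygy[OF gsub_zfam zfam_sub zfam_im])
    then show ?case using Suc.IH[of "Suc i"] by simp
  qed simp
  from this[of 0] show ?thesis by simp
qed

lemma emb_Fg: "v \<in> tensor_part F i d \<Longrightarrow> emb v \<in> Fg i d"
  unfolding tensor_part_def emb_def fgr_def
proof (intro CollectI allI conjI impI)
  fix k assume v: "v \<in> {v. \<forall>k. v k \<noteq> 0 \<longrightarrow> k < rk F i \<and> shift F i k = d}"
  show "single 0 (v k) \<in> hom_part V (d - shift F i k)"
    using v by (cases "v k = 0") (auto intro: hom_part_single)
  show "rk F i \<le> k \<Longrightarrow> single 0 (v k) = 0" using v by (cases "v k = 0") auto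
qed

lemma cst_Fg:
  assumes "f \<in> Fg i d"
  shows "cst f \<in> tensor_part F i d"
proof -
  have "k < rk F i \<and> shift F i k = d" if "lookup (f k) 0 \<noteq> 0" for k
  proof
    show "k < rk F i" using assms that by (cases "k < rk F i") (auto simp: fgr_def)
    have "0 \<in> keys (f k)" using that by (simp add: in_keys_iff)
    then have "int (total_degree 0) = d - shift F i k" using assms by (force simp: fgr_def hom_part_def)
    then show "shift F i k = d" by simp
  qed
  then show ?thesis by (simp add: tensor_part_def cst_def)
qed

lemma cst_bdm: "cst (bdm i f) = tensor_bd F i (cst f)"
  by (simp add: cst_mat_app tensor_bd_def)

text \<open>m Z_i is the image of m F_(i+1), because Z_i is the image of F_(i+1).\<close>

lemma mspan_zfamD:
  assumes "x \<in> mspan vvar (vars V) (zfam I F i) d"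
  obtains u where "u \<in> mspan vvar (vars V) (Fg (Suc i)) d" "x = bdm i u" "u \<in> Fg (Suc i) d" "cst u = 0"
proof -
  obtain g where g: "\<forall>z\<in>vars V. g z \<in> zfam I F i (d - 1)" "x = (\<Sum>z\<in>vars V. vvar z * g z)"
    using assms by (auto simp: mspan_def)
  have "\<exists>u. u \<in> Fg (Suc i) (d - 1) \<and> g z = bdm i u" if "z \<in> vars V" for z
    using g(1) that unfolding zfam_im by blast
  then obtain u where u: "\<And>z. z \<in> vars V \<Longrightarrow> u z \<in> Fg (Suc i) (d - 1) \<and> g z = bdm i (u z)" by metis
  let ?u = "\<Sum>z\<in>vars V. vvar z * u z"
  have 1: "?u \<in> mspan vvar (vars V) (Fg (Suc i)) d" using u by (auto simp: mspan_def)
  have "bdm i ?u = (\<Sum>z\<in>vars V. vvar z * bdm i (u z))" by (simp only: mat_app_sum mat_app_vvar)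
  also have "\<dots> = x" unfolding g(2) by (rule sum.cong) (simp_all add: u)
  finally have 2: "x = bdm i ?u" by simp
  have "vvar z * u z \<in> Fg (Suc i) d" if "z \<in> vars V" for z
    using gsub_mult[OF gsub_fgr that conjunct1[OF u[OF that]]] by simp
  then have 3: "?u \<in> Fg (Suc i) d" by (rule gsub_sum[OF gsub_fgr])
  then have "cst ?u = 0" using 1 mspan_fgr_iff[OF finV] by blast
  then show ?thesis using that 1 2 3 by blast
qed

lemma mspan_zfamI:
  assumes "u \<in> Fg (Suc i) d" "cst u = 0"
  shows "bdm i u \<in> mspan vvar (vars V) (zfam I F i) d"
proof -
  have "u \<in> mspan vvar (vars V) (Fg (Suc i)) d" using assms mspan_fgr_iff[OF finV] by blast
  then obtain g where g: "\<forall>z\<in>vars V. g z \<in> Fg (Suc i) (d - 1)" "u = (\<Sum>z\<in>vars V. vvar z * g z)"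
    by (auto simp: mspan_def)
  have "bdm i u = (\<Sum>z\<in>vars V. vvar z * bdm i (g z))" unfolding g(2) by (simp only: mat_app_sum mat_app_vvar)
  moreover have "\<forall>z\<in>vars V. bdm i (g z) \<in> zfam I F i (d - 1)" using g(1) unfolding zfam_im by blast
  ultimately show ?thesis unfolding mspan_def by (intro CollectI exI[of _ "\<lambda>z. bdm i (g z)"] conjI)
qed

text \<open>Both sides say that Z_i meets m F_i only in m Z_i. A cycle of F_(i+1) tensor K lifts to
  some u with image in m F_i. This image lies in m Z_i if and only if u becomes a syzygy after a
  change within m F_(i+1), which means that the cycle is a boundary.\<close>

lemma tor_Suc_iff:
  "tensor_cycles F (Suc i) d \<subseteq> tensor_boundaries F (Suc i) d \<longleftrightarrow>
    (\<forall>x\<in>zfam I F i d. cst x = 0 \<longrightarrow> x \<in> mspan vvar (vars V) (zfam I F i) d)"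
proof (intro iffI ballI impI subsetI)
  fix x assume sub: "tensor_cycles F (Suc i) d \<subseteq> tensor_boundaries F (Suc i) d"
    and x: "x \<in> zfam I F i d" "cst x = 0"
  obtain u where u: "u \<in> Fg (Suc i) d" "x = bdm i u" using x(1) unfolding zfam_im by blast
  have "cst u \<in> tensor_cycles F (Suc i) d"
    using cst_Fg[OF u(1)] x(2) by (simp add: tensor_cycles_def u(2) cst_bdm)
  then obtain y where y: "y \<in> tensor_part F (Suc (Suc i)) d" "cst u = tensor_bd F (Suc i) y"
    using sub by (auto simp: tensor_boundaries_def)
  let ?w = "bdm (Suc i) (emb y)"
  have w: "?w \<in> zfam I F (Suc i) d" unfolding zfam_im using emb_Fg[OF y(1)] by blast
  have bw: "bdm i ?w = 0" using w unfolding zfam_Suc by (simp add: kerf_def)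
  have "u - ?w \<in> Fg (Suc i) d" using gsub_diff[OF gsub_fgr u(1)] zfam_sub w by blast
  moreover have "cst (u - ?w) = 0" by (simp add: cst_diff cst_bdm y(2))
  ultimately have "bdm i (u - ?w) \<in> mspan vvar (vars V) (zfam I F i) d" by (rule mspan_zfamI)
  then show "x \<in> mspan vvar (vars V) (zfam I F i) d" by (simp add: mat_app_diff bw u(2))
next
  fix v assume r: "\<forall>x\<in>zfam I F i d. cst x = 0 \<longrightarrow> x \<in> mspan vvar (vars V) (zfam I F i) d"
    and v: "v \<in> tensor_cycles F (Suc i) d"
  have vp: "v \<in> tensor_part F (Suc i) d" "tensor_bd F i v = 0" using v by (auto simp: tensor_cycles_def)
  let ?x = "bdm i (emb v)"
  have "?x \<in> zfam I F i d" unfolding zfam_im using emb_Fg[OF vp(1)] by blast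
  moreover have "cst ?x = 0" by (simp add: cst_bdm vp(2))
  ultimately obtain u where u: "?x = bdm i u" "u \<in> Fg (Suc i) d" "cst u = 0"
    using r mspan_zfamD by metis
  have "emb v - u \<in> zfam I F (Suc i) d"
    unfolding zfam_Suc kerf_def using gsub_diff[OF gsub_fgr emb_Fg[OF vp(1)] u(2)] by (simp add: mat_app_diff u(1))
  then obtain y where y: "y \<in> Fg (Suc (Suc i)) d" "emb v - u = bdm (Suc i) y" unfolding zfam_im by blast
  have "v = cst (emb v - u)" by (simp add: cst_diff u(3))
  also have "\<dots> = tensor_bd F (Suc i) (cst y)" by (simp add: y(2) cst_bdm)
  finally show "v \<in> tensor_boundaries F (Suc i) d" using cst_Fg[OF y(1)] by (auto simp: tensor_boundaries_def)
qed

lemma tor_0_iff: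
  "tensor_cycles F 0 d \<subseteq> tensor_boundaries F 0 d \<longleftrightarrow>
    (\<forall>x\<in>Fg 0 d. \<exists>y\<in>mspan vvar (vars V) (Fg 0) d. x - y \<in> zfam I F 0 d)"
proof (intro iffI ballI subsetI)
  fix x assume sub: "tensor_cycles F 0 d \<subseteq> tensor_boundaries F 0 d" and x: "x \<in> Fg 0 d"
  have "cst x \<in> tensor_cycles F 0 d" using cst_Fg[OF x] by (simp add: tensor_cycles_def)
  then obtain y where y: "y \<in> tensor_part F (Suc 0) d" "cst x = tensor_bd F 0 y"
    using sub by (auto simp: tensor_boundaries_def)
  let ?w = "bdm 0 (emb y)"
  have w: "?w \<in> zfam I F 0 d" unfolding zfam_im using emb_Fg[OF y(1)] by blast
  have xw: "x - ?w \<in> Fg 0 d" using gsub_diff[OF gsub_fgr x] zfam_sub w by blast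
  moreover have "cst (x - ?w) = 0" by (simp add: cst_diff cst_bdm y(2))
  ultimately have "x - ?w \<in> mspan vvar (vars V) (Fg 0) d" using mspan_fgr_iff[OF finV] by blast
  then show "\<exists>y\<in>mspan vvar (vars V) (Fg 0) d. x - y \<in> zfam I F 0 d" using w by (intro bexI[of _ "x - ?w"]) simp
next
  fix v assume r: "\<forall>x\<in>Fg 0 d. \<exists>y\<in>mspan vvar (vars V) (Fg 0) d. x - y \<in> zfam I F 0 d"
    and "v \<in> tensor_cycles F 0 d"
  then have v: "v \<in> tensor_part F 0 d" by (simp add: tensor_cycles_def)
  then obtain y where y: "y \<in> mspan vvar (vars V) (Fg 0) d" "emb v - y \<in> zfam I F 0 d"
    using r emb_Fg by blast
  have "emb v - (emb v - y) \<in> Fg 0 d" using gsub_diff[OF gsub_fgr emb_Fg[OF v]] zfam_sub y(2) by blast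
  then have "cst y = 0" using y(1) mspan_fgr_iff[OF finV, of y] by simp
  obtain w where w: "w \<in> Fg (Suc 0) d" "emb v - y = bdm 0 w" using y(2) unfolding zfam_im by blast
  have "v = cst (emb v - y)" by (simp add: cst_diff \<open>cst y = 0\<close>)
  also have "\<dots> = tensor_bd F 0 (cst w)" unfolding w(2) cst_bdm ..
  finally show "v \<in> tensor_boundaries F 0 d" using cst_Fg[OF w(1)] by (auto simp: tensor_boundaries_def)
qed

text \<open>The balance of Tor, for vanishing: the dimension shift leads both computations to the
  same condition on constant terms.\<close>

theorem tor_vanishes_iff:
  "tensor_cycles F p d \<subseteq> tensor_boundaries F p d \<longleftrightarrow> kvan var (vars V) (hom_part V) (igr V I) p d"
proof (cases p)
  case 0
  show ?thesis
    unfolding 0 tor_0_iff kvan_augm[symmetric] kvan_0_iff[OF finite_vars[OF finV] gsub_fgr gsub_zfam] ..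
next
  case (Suc i)
  show ?thesis
    unfolding Suc tor_Suc_iff kvan_augm[symmetric] kvan_shift_all kvan_fgr_1_iff[OF gsub_zfam zfam_sub] ..
qed

lemma tensor_boundaries_sub: "tensor_boundaries F p d \<subseteq> tensor_cycles F p d"
proof
  fix v assume "v \<in> tensor_boundaries F p d"
  then obtain y where y: "y \<in> tensor_part F (Suc p) d" "v = tensor_bd F p y" by (auto simp: tensor_boundaries_def)
  let ?w = "bdm p (emb y)"
  have w: "?w \<in> zfam I F p d" unfolding zfam_im using emb_Fg[OF y(1)] by blast
  have v: "v = cst ?w" by (simp add: cst_bdm y(2))
  have "v \<in> tensor_part F p d" using cst_Fg w zfam_sub v by blast
  moreover have "tensor_bd F i v = 0" if "p = Suc i" for i
  proof -
    have "bdm i ?w = 0" using w unfolding that zfam_Suc by (simp add: kerf_def)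
    then have "cst (bdm i ?w) = 0" by (simp add: cst_def fun_eq_iff)
    then show ?thesis by (simp add: cst_bdm v that)
  qed
  ultimately show "v \<in> tensor_cycles F p d" by (simp add: tensor_cycles_def)
qed

end

end

section \<open>Existence of graded free resolutions\<close>

definition vscale :: "'k::field \<Rightarrow> (nat \<Rightarrow> 'k mpoly) \<Rightarrow> nat \<Rightarrow> 'k mpoly" where
  "vscale c f = (\<lambda>k. single 0 c * f k)"

lemma vector_space_vscale: "vector_space (vscale :: 'k::field \<Rightarrow> _)"
  by unfold_locales (simp_all add: vscale_def fun_eq_iff algebra_simps single_add mult_single flip: mult.assoc)

lemma finite_monomials:
  assumes W: "finite W"
  shows "finite {m :: vname \<Rightarrow>\<^sub>0 nat. keys m \<subseteq> W \<and> total_degree m = n}" (is "finite ?M")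
proof -
  have le: "lookup m z \<le> total_degree m" for m z
  proof (cases "z \<in> keys m")
    case True
    then show ?thesis unfolding total_degree_def by (intro member_le_sum) auto
  qed (simp add: in_keys_iff)
  have "lookup ` ?M \<subseteq> {f. \<forall>x. (x \<in> W \<longrightarrow> f x \<in> {..n}) \<and> (x \<notin> W \<longrightarrow> f x = 0)}"
    using le by (auto simp: in_keys_iff)
  moreover have "finite {f. \<forall>x. (x \<in> W \<longrightarrow> f x \<in> {..n}) \<and> (x \<notin> W \<longrightarrow> f x = (0::nat))}"
    by (rule finite_set_of_finite_funs[OF W]) simp
  ultimately have "finite (lookup ` ?M)" by (rule finite_subset)
  then show ?thesis by (rule finite_imageD) (auto simp: inj_on_def poly_mapping_eqI)
qed

lemma subspace_finite_basis:
  fixes scale :: "'k::field \<Rightarrow> 'v::ab_group_add \<Rightarrow> 'v"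
  assumes "vector_space scale" "finite T" "Z \<subseteq> module.span scale T"
  shows "\<exists>S. finite S \<and> S \<subseteq> Z \<and> Z \<subseteq> module.span scale S"
proof -
  interpret vector_space scale by fact
  obtain B where B: "B \<subseteq> Z" "independent B" "Z \<subseteq> span B" by (rule basis_exists)
  have "finite B" using independent_span_bound[OF assms(2) B(2)] B(1) assms(3) by blast
  then show ?thesis using B by blast
qed

text \<open>\<open>betti\<close> is a difference of dimensions. All dimensions are finite here, and
  a vector of C outside B extends a basis of B to a larger independent set.\<close>

lemma dim_diff_nonzero_iff:
  fixes scale :: "'k::field \<Rightarrow> 'v::ab_group_add \<Rightarrow> 'v"
  assumes "vector_space scale" "finite T" "C \<subseteq> module.span scale T" "B \<subseteq> C" "module.subspace scale B"
  shows "vector_space.dim scale C - vector_space.dim scale B \<noteq> 0 \<longleftrightarrow> \<not> C \<subseteq> B"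
proof -
  interpret vector_space scale by fact
  have "dim B < dim C" if n: "\<not> C \<subseteq> B"
  proof -
    obtain x where x: "x \<in> C" "x \<notin> B" using n by blast
    obtain b where b: "b \<subseteq> B" "independent b" "B \<subseteq> span b" "card b = dim B" by (rule basis_exists)
    obtain c where c: "c \<subseteq> C" "independent c" "C \<subseteq> span c" "card c = dim C" by (rule basis_exists)
    have fc: "finite c" using independent_span_bound[OF assms(2) c(2)] c(1) assms(3) by blast
    have "span b \<subseteq> B" by (rule span_minimal[OF b(1) assms(5)])
    then have ind: "independent (insert x b)" and xb: "x \<notin> b" using x b by (auto simp: independent_insert)
    have "insert x b \<subseteq> span c" using x b(1) assms(4) c(3) by blast
    then have "finite (insert x b) \<and> card (insert x b) \<le> card c" by (rule independent_span_bound[OF fc ind])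
    then show ?thesis using b(4) c(4) xb card_insert_disjoint[of b x] by auto
  qed
  then show ?thesis
  proof (cases "C \<subseteq> B")
    case True
    then have "C = B" using assms(4) by blast
    then show ?thesis by simp
  next
    case False
    then show ?thesis using \<open>\<not> C \<subseteq> B \<Longrightarrow> dim B < dim C\<close> by simp
  qed
qed

definition scale_closed :: "(int \<Rightarrow> (nat \<Rightarrow> ('k::field) mpoly) set) \<Rightarrow> bool" where
  "scale_closed Z \<longleftrightarrow> (\<forall>d c. \<forall>f\<in>Z d. vscale c f \<in> Z d)"

text \<open>In each column the Koszul homology is zero in all high degrees. In column 0 of a module
  this amounts to generation in bounded degree; the higher columns carry the condition over to the
  syzygies.\<close>

definition evvan :: "nat set \<Rightarrow> (int \<Rightarrow> (nat \<Rightarrow> ('k::field) mpoly) set) \<Rightarrow> (int \<Rightarrow> (nat \<Rightarrow> 'k mpoly) set) \<Rightarrow> bool" where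
  "evvan V A B \<longleftrightarrow> (\<forall>p. \<exists>D. \<forall>d\<ge>D. kvan vvar (vars V) A B p d)"

lemma scale_fgr: "f \<in> fgr V r s d \<Longrightarrow> vscale c f \<in> fgr V r s d"
proof -
  assume f: "f \<in> fgr V r s d"
  have "single 0 c * f k \<in> hom_part V (d - s k)" for k
    using hom_part_mult[of "single 0 c" V 0 "f k" "d - s k"] f hom_part_single[of 0 V 0 c] by (simp add: fgr_def)
  then show ?thesis using f by (simp add: fgr_def vscale_def)
qed

lemma scale_closed_kerf: "scale_closed (kerf V r s A)"
  unfolding scale_closed_def kerf_def using scale_fgr
  by (auto simp: vscale_def mat_app_scale) (simp add: fun_eq_iff)

context
  fixes V :: "nat set"
  assumes finV: "finite V"
begin

lemma fgr_finite_span: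
  "\<exists>T. finite T \<and> fgr V r s d \<subseteq> module.span (vscale :: 'k::field \<Rightarrow> _) T"
proof -
  interpret vector_space "vscale :: 'k \<Rightarrow> _" by (rule vector_space_vscale)
  define e :: "nat \<Rightarrow> (vname \<Rightarrow>\<^sub>0 nat) \<Rightarrow> nat \<Rightarrow> 'k mpoly" where "e = (\<lambda>k m k'. if k' = k then single m 1 else 0)"
  define M where "M = (\<lambda>k. {m. keys m \<subseteq> vars V \<and> total_degree m = nat (d - s k)})"
  define T where "T = (\<Union>k<r. e k ` M k)"
  have "finite T" unfolding T_def M_def using finite_monomials[OF finite_vars[OF finV]] by auto
  moreover have "f \<in> span T" if f: "f \<in> fgr V r s d" for f
  proof -
    have "f = (\<Sum>k<r. \<Sum>m\<in>keys (f k). vscale (lookup (f k) m) (e k m))"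
    proof
      fix k'
      have "(\<Sum>k<r. \<Sum>m\<in>keys (f k). vscale (lookup (f k) m) (e k m)) k' =
          (\<Sum>k<r. if k = k' then \<Sum>m\<in>keys (f k). single m (lookup (f k) m) else 0)"
        unfolding sum_fun_at by (intro sum.cong refl) (auto simp: vscale_def e_def mult_single)
      also have "\<dots> = (if k' < r then f k' else 0)" by (simp flip: mpoly_sum)
      also have "\<dots> = f k'" using f by (auto simp: fgr_def)
      finally show "f k' = (\<Sum>k<r. \<Sum>m\<in>keys (f k). vscale (lookup (f k) m) (e k m)) k'" by simp
    qed
    moreover have "vscale (lookup (f k) m) (e k m) \<in> span T" if "k < r" "m \<in> keys (f k)" for k m
    proof -
      have "keys m \<subseteq> vars V" "int (total_degree m) = d - s k" using f that by (auto simp: fgr_def hom_part_def)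
      then have "m \<in> M k" by (simp add: M_def)
      then have "e k m \<in> T" using that by (auto simp: T_def)
      then show ?thesis by (intro span_scale span_base)
    qed
    ultimately show ?thesis by (metis (no_types, lifting) lessThan_iff span_sum)
  qed
  ultimately show ?thesis by blast
qed

text \<open>Monomials are built up one variable at a time, starting from scalars.\<close>

lemma scale_closed_mult:
  assumes Z: "gsub vvar (vars V) Z" "scale_closed Z" and f: "f \<in> Z e" and p: "p \<in> hom_part V a"
  shows "(\<lambda>k. p * f k) \<in> Z (e + a)"
proof -
  have mon: "(\<lambda>k. single m c * f k) \<in> Z (e + int n)" if "keys m \<subseteq> vars V" "total_degree m = n" for m c n
    using that
  proof (induction n arbitrary: m)
    case 0
    then have "m = 0" using total_degree_eq_0 by simp
    then show ?case using Z(2) f by (simp add: scale_closed_def vscale_def)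
  next
    case (Suc n)
    then have "m \<noteq> 0" using total_degree_eq_0 by auto
    then obtain z where z: "z \<in> keys m" using keys_eq_empty[of m] by blast
    let ?m = "m - single z 1"
    have m: "single z 1 + ?m = m" by (rule sub_add_key[OF z])
    have "(\<lambda>k. single ?m c * f k) \<in> Z (e + int n)"
      using Suc.prems keys_sub[of m "single z 1"] total_degree_sub_key[OF z] by (intro Suc.IH) auto
    then have "vvar z * (\<lambda>k. single ?m c * f k) \<in> Z (e + int n + 1)" using Suc.prems z by (intro gsub_mult[OF Z(1)]) auto
    moreover have "vvar z * (\<lambda>k. single ?m c * f k) = (\<lambda>k. single m c * f k)"
      using var_mult_single[of z ?m c] m by (simp add: fun_eq_iff vvar_def flip: mult.assoc)
    ultimately show ?case by (simp add: ac_simps)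
  qed
  have "(\<lambda>k. p * f k) = (\<Sum>m\<in>keys p. (\<lambda>k. single m (lookup p m) * f k))"
  proof
    fix k
    have "p * f k = (\<Sum>m\<in>keys p. single m (lookup p m)) * f k" using mpoly_sum[of p] by metis
    then show "p * f k = (\<Sum>m\<in>keys p. (\<lambda>k. single m (lookup p m) * f k)) k"
      by (simp add: sum_fun_at sum_distrib_right)
  qed
  also have "\<dots> \<in> Z (e + a)"
  proof (rule gsub_sum[OF Z(1)])
    fix m assume "m \<in> keys p"
    then have "keys m \<subseteq> vars V" "int (total_degree m) = a" using p by (auto simp: hom_part_def)
    then show "(\<lambda>k. single m (lookup p m) * f k) \<in> Z (e + a)" using mon[of m "total_degree m"] by simp
  qed
  finally show ?thesis .
qed

text \<open>Graded Nakayama: below \<open>d0\<close> the module is zero, from degree D on each part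
  is m times the previous one, and the finitely many degrees in between are
  finite-dimensional.\<close>

lemma generators_exist:
  fixes Z :: "int \<Rightarrow> (nat \<Rightarrow> ('k::field) mpoly) set"
  assumes Z: "gsub vvar (vars V) Z" "scale_closed Z" and sub: "\<And>d. Z d \<subseteq> fgr V r s d"
    and ev: "\<And>d. d \<ge> D \<Longrightarrow> kvan vvar (vars V) Z (\<lambda>_. {0}) 0 d"
  shows "\<exists>r' s' A. hmat V r s r' s' A \<and> (\<forall>d. Z d = mat_app r' A ` fgr V r' s' d)"
proof -
  interpret vector_space "vscale :: 'k \<Rightarrow> _" by (rule vector_space_vscale)
  have subsp: "subspace (Z d)" for d
    using gsub_0[OF Z(1)] gsub_add[OF Z(1)] Z(2) by (auto simp: subspace_def scale_closed_def)
  define d0 where "d0 = Min (insert 0 (s ` {..<r}))"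
  have low: "Z d = {0}" if "d < d0" for d
  proof -
    have "f = 0" if f: "f \<in> Z d" for f
    proof
      fix k
      show "f k = 0 k"
      proof (cases "k < r")
        case True
        then have "d0 \<le> s k" unfolding d0_def by (intro Min_le) auto
        then have "d - s k < 0" using \<open>d < d0\<close> by simp
        moreover have "f \<in> fgr V r s d" using sub f by blast
        then have "f k \<in> hom_part V (d - s k)" by (simp add: fgr_def)
        ultimately show ?thesis using hom_part_neg[of "d - s k" "f k" V] by simp
      next
        case False
        have "f \<in> fgr V r s d" using sub f by blast
        then show ?thesis using False by (simp add: fgr_def)
      qed
    qed
    then show ?thesis using gsub_0[OF Z(1)] by blast
  qed
  have "\<exists>S. finite S \<and> S \<subseteq> Z d \<and> Z d \<subseteq> span S" for d
    using fgr_finite_span[of r s d, where 'k = 'k] subspace_finite_basis[OF vector_space_vscale, of _ "Z d"] sub[of d] by blast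
  then obtain S where S: "\<And>d. finite (S d)" "\<And>d. S d \<subseteq> Z d" "\<And>d. Z d \<subseteq> span (S d)" by metis
  have "finite (SIGMA d:{d0..<D}. S d)" using S(1) by auto
  \<comment> \<open>One generator for each basis vector in the degrees from \<open>d0\<close> to D -
    1, listed together with its degree.\<close>
  then obtain ps where ps: "set ps = (SIGMA d:{d0..<D}. S d)" using finite_list by blast
  define r' where "r' = length ps"
  define s' where "s' = (\<lambda>l. fst (ps ! l))"
  define g where "g = (\<lambda>l. snd (ps ! l))"
  define A where "A = (\<lambda>k l. if l < r' then g l k else 0)"
  have g: "g l \<in> Z (s' l)" if "l < r'" for l
  proof -
    have "ps ! l \<in> set ps" using that by (simp add: r'_def)
    then show ?thesis unfolding ps s'_def g_def using S(2) by (cases "ps ! l") auto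
  qed
  have hm: "hmat V r s r' s' A"
    unfolding hmat_def
  proof (intro allI)
    fix k l
    show "if k < r \<and> l < r' then A k l \<in> hom_part V (s' l - s k) else A k l = 0"
    proof (cases "l < r'")
      case True
      then have "g l \<in> fgr V r s (s' l)" using g sub by blast
      then show ?thesis using True by (auto simp: A_def fgr_def)
    qed (simp add: A_def)
  qed
  have le: "mat_app r' A f \<in> Z d" if f: "f \<in> fgr V r' s' d" for f d
  proof -
    have "mat_app r' A f = (\<Sum>l<r'. (\<lambda>k. f l * g l k))"
      by (auto simp: mat_app_def fun_eq_iff sum_fun_at A_def mult.commute intro!: sum.cong)
    also have "\<dots> \<in> Z d"
    proof (rule gsub_sum[OF Z(1)])
      fix l assume l: "l \<in> {..<r'}"
      then have "(\<lambda>k. f l * g l k) \<in> Z (s' l + (d - s' l))"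
        using f g by (intro scale_closed_mult[OF Z]) (auto simp: fgr_def)
      then show "(\<lambda>k. f l * g l k) \<in> Z d" by simp
    qed
    finally show ?thesis .
  qed
  let ?IM = "\<lambda>d. mat_app r' A ` fgr V r' s' d"
  have IM0: "0 \<in> ?IM d" for d using gsub_0[OF gsub_fgr, of V r' s' d] mat_app_0[of r' A] by (metis imageI)
  have IMadd: "x + y \<in> ?IM d" if xy: "x \<in> ?IM d" "y \<in> ?IM d" for x y d
  proof -
    obtain a b where ab: "a \<in> fgr V r' s' d" "b \<in> fgr V r' s' d" "x = mat_app r' A a" "y = mat_app r' A b" using xy by blast
    then have "x + y = mat_app r' A (a + b)" by (simp add: mat_app_add)
    then show ?thesis using gsub_add[OF gsub_fgr ab(1,2)] by blast
  qed
  have IMscale: "vscale c x \<in> ?IM d" if x: "x \<in> ?IM d" for c x d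
  proof -
    obtain a where a: "a \<in> fgr V r' s' d" "x = mat_app r' A a" using x by blast
    then have "vscale c x = mat_app r' A (vscale c a)" by (simp add: vscale_def mat_app_scale)
    then show ?thesis using scale_fgr[OF a(1)] by blast
  qed
  have IMvar: "vvar z * x \<in> ?IM (d + 1)" if z: "z \<in> vars V" and x: "x \<in> ?IM d" for z x d
  proof -
    obtain a where a: "a \<in> fgr V r' s' d" "x = mat_app r' A a" using x by blast
    then have "vvar z * x = mat_app r' A (vvar z * a)" by (simp add: mat_app_vvar)
    then show ?thesis using gsub_mult[OF gsub_fgr z a(1)] by blast
  qed
  have IMsp: "subspace (?IM d)" for d using IM0 IMadd IMscale by (auto simp: subspace_def)
  have mid: "Z d \<subseteq> ?IM d" if d: "d0 \<le> d" "d < D" for d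
  proof -
    have "S d \<subseteq> ?IM d"
    proof
      fix x assume x: "x \<in> S d"
      then have "(d, x) \<in> set ps" using d ps by auto
      then obtain l where l: "l < r'" "ps ! l = (d, x)" by (auto simp: in_set_conv_nth r'_def)
      let ?e = "\<lambda>l'. if l' = l then 1 else (0 :: 'k mpoly)"
      have "?e \<in> fgr V r' s' d" using l hom_part_single[of 0 V 0 1] by (auto simp: fgr_def s'_def)
      moreover have "mat_app r' A ?e = x"
      proof
        fix k
        have "mat_app r' A ?e k = (\<Sum>l'<r'. if l' = l then A k l' else 0)"
          unfolding mat_app_def by (rule sum.cong) auto
        also have "\<dots> = x k" using l by (simp add: A_def g_def)
        finally show "mat_app r' A ?e k = x k" .
      qed
      ultimately show "x \<in> ?IM d" by blast
    qed
    then show ?thesis using span_minimal[OF _ IMsp] S(3) by blast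
  qed
  \<comment> \<open>The induction starts in degree \<open>max D d0 - 1\<close>, which is covered by
    \<open>mid\<close>, or by \<open>low\<close> if D \<le> \<open>d0\<close>.\<close>
  have high: "Z (max D d0 + int n - 1) \<subseteq> ?IM (max D d0 + int n - 1)" for n
  proof (induction n)
    case 0
    show ?case
    proof (cases "D \<le> d0")
      case True
      then show ?thesis using low[of "max D d0 - 1"] IM0 by simp
    next
      case False
      then show ?thesis using mid[of "max D d0 - 1"] by simp
    qed
  next
    case (Suc n)
    let ?d = "max D d0 + int n"
    have "Z ?d \<subseteq> ?IM ?d"
    proof
      fix x assume x: "x \<in> Z ?d"
      have "kvan vvar (vars V) Z (\<lambda>_. {0}) 0 ?d" by (rule ev) simp
      then have "\<exists>y\<in>mspan vvar (vars V) Z ?d. x - y \<in> {0}"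
        unfolding kvan_0_iff[OF finite_vars[OF finV] Z(1) gsub_zero] using x by blast
      then have "x \<in> mspan vvar (vars V) Z ?d" by auto
      then obtain h where h: "\<forall>z\<in>vars V. h z \<in> Z (?d - 1)" "x = (\<Sum>z\<in>vars V. vvar z * h z)"
        by (auto simp: mspan_def)
      have "vvar z * h z \<in> ?IM ?d" if "z \<in> vars V" for z
      proof -
        have "h z \<in> ?IM (?d - 1)" using h(1) that Suc.IH by (auto simp: algebra_simps)
        then show ?thesis using IMvar[OF that, of "h z" "?d - 1"] by simp
      qed
      then show "x \<in> ?IM ?d" unfolding h(2) by (rule subspace_sum[OF IMsp])
    qed
    then show ?case by (simp add: algebra_simps)
  qed
  have ge: "Z d \<subseteq> ?IM d" for d
  proof -
    consider "d < d0" | "d0 \<le> d" "d < D" | "max D d0 \<le> d" by linarith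
    then show ?thesis
    proof cases
      case 1
      then show ?thesis using low IM0 by simp
    next
      case 2
      then show ?thesis by (rule mid)
    next
      case 3
      then show ?thesis using high[of "nat (d + 1 - max D d0)"] by simp
    qed
  qed
  have "Z d = ?IM d" for d using ge le by blast
  then show ?thesis using hm by blast
qed

text \<open>Columns above 0 follow by dimension shift. For column 0: in degrees beyond all shifts F
  has no constant terms, so Z lies in m F, and vanishing of H_1(F/Z) gives Z = m Z there.\<close>

lemma evvan_sub:
  fixes Z :: "int \<Rightarrow> (nat \<Rightarrow> ('k::field) mpoly) set"
  assumes Z: "gsub vvar (vars V) Z" and sub: "\<And>d. Z d \<subseteq> fgr V r s d"
    and ev: "evvan V (fgr V r s) Z"
  shows "evvan V Z (\<lambda>_. {0})"
  unfolding evvan_def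
proof
  fix p
  show "\<exists>D. \<forall>d\<ge>D. kvan vvar (vars V) Z (\<lambda>_. {0}) p d"
  proof (cases p)
    case (Suc q)
    obtain D where "\<forall>d\<ge>D. kvan vvar (vars V) (fgr V r s) Z (Suc (Suc q)) d" using ev by (auto simp: evvan_def)
    then show ?thesis
      unfolding Suc kvan_sub_acyclic[OF finite_vars[OF finV] gsub_fgr Z sub acyclic_fgr[OF finV]] by blast
  next
    case 0
    obtain D where D: "\<forall>d\<ge>D. kvan vvar (vars V) (fgr V r s) Z (Suc 0) d" using ev by (auto simp: evvan_def)
    define E where "E = Max (insert D ((\<lambda>k. s k + 1) ` {..<r}))"
    have "kvan vvar (vars V) Z (\<lambda>_. {0}) 0 d" if d: "d \<ge> E" for d
      unfolding kvan_0_iff[OF finite_vars[OF finV] Z gsub_zero]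
    proof
      fix x assume x: "x \<in> Z d"
      have "D \<le> E" unfolding E_def by (rule Max_ge) auto
      then have v: "kvan vvar (vars V) (fgr V r s) Z (Suc 0) d" using D d by simp
      have "lookup (x k) 0 = 0" for k
      proof (cases "k < r")
        case True
        then have "s k + 1 \<le> E" unfolding E_def by (intro Max_ge) auto
        then have pos: "d - s k \<noteq> 0" using d by simp
        have "0 \<notin> keys (x k)"
        proof
          assume "0 \<in> keys (x k)"
          moreover have "x \<in> fgr V r s d" using x sub by blast
          ultimately have "int (total_degree 0) = d - s k" by (force simp: fgr_def hom_part_def)
          then show False using pos by simp
        qed
        then show ?thesis by (simp add: in_keys_iff)
      next
        case False
        moreover have "x \<in> fgr V r s d" using x sub by blast
        ultimately have "x k = 0" by (simp add: fgr_def)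
        then show ?thesis by simp
      qed
      then have "cst x = 0" by (simp add: cst_def fun_eq_iff)
      then have "x \<in> mspan vvar (vars V) Z d" using v x unfolding kvan_fgr_1_iff[OF finV Z sub] by blast
      then show "\<exists>y\<in>mspan vvar (vars V) Z d. x - y \<in> {0}" by (intro bexI[of _ x]) simp_all
    qed
    then show ?thesis using 0 by blast
  qed
qed

text \<open>One step of the resolution: a finite free cover of Z whose kernel satisfies the
  finiteness condition again.\<close>

lemma syzygy_step:
  fixes Z :: "int \<Rightarrow> (nat \<Rightarrow> ('k::field) mpoly) set"
  assumes Z: "gsub vvar (vars V) Z" "scale_closed Z" and sub: "\<And>d. Z d \<subseteq> fgr V r s d"
    and ev: "evvan V Z (\<lambda>_. {0})"
  shows "\<exists>r' s' A. hmat V r s r' s' A \<and> (\<forall>d. Z d = mat_app r' A ` fgr V r' s' d) \<and> evvan V (kerf V r' s' A) (\<lambda>_. {0})"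
proof -
  obtain D where "\<forall>d\<ge>D. kvan vvar (vars V) Z (\<lambda>_. {0}) 0 d" using ev by (auto simp: evvan_def)
  then obtain r' s' A where hm: "hmat V r s r' s' A" and im: "\<And>d. Z d = mat_app r' A ` fgr V r' s' d"
    using generators_exist[OF Z sub, of D] by blast
  have "evvan V (fgr V r' s') (kerf V r' s' A)"
    using ev unfolding evvan_def kvan_image[OF finV Z(1) im] .
  then have "evvan V (kerf V r' s' A) (\<lambda>_. {0})" by (rule evvan_sub[OF gsub_kerf kerf_sub])
  then show ?thesis using hm im by blast
qed

text \<open>S covers S/I, and from there on the syzygy modules are covered one after another by
  dependent choice.\<close>

lemma gres_exists:
  fixes I :: "('k::field) mpoly set"
  assumes I: "homog_ideal V I"
    and ev: "\<forall>p. \<exists>D. \<forall>d\<ge>D. kvan var (vars V) (hom_part V) (igr V I) p d"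
  shows "\<exists>F. gres V I F"
proof -
  let ?s0 = "\<lambda>_::nat. 0::int"
  define Z0 where "Z0 = (\<lambda>d. {f \<in> fgr V 1 ?s0 d. f 0 \<in> I})"
  have gZ0: "gsub vvar (vars V) Z0"
    unfolding gsub_def
  proof (intro allI conjI ballI)
    fix d z f g
    show "0 \<in> Z0 d" using homog_idealD(2)[OF I] by (simp add: Z0_def gsub_0[OF gsub_fgr])
    show "f \<in> Z0 d \<Longrightarrow> g \<in> Z0 d \<Longrightarrow> f - g \<in> Z0 d"
      using homog_idealD(3)[OF I] by (simp add: Z0_def gsub_diff[OF gsub_fgr])
    show "z \<in> vars V \<Longrightarrow> f \<in> Z0 d \<Longrightarrow> vvar z * f \<in> Z0 (d + 1)"
      by (simp add: Z0_def vvar_def[of z] gsub_mult[OF gsub_fgr, unfolded vvar_def] homog_idealD(4)[OF I] hom_part_carrier[OF var_hom_part])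
  qed
  have sZ0: "scale_closed Z0"
    unfolding scale_closed_def Z0_def
  proof (intro allI ballI CollectI conjI)
    fix d c f assume "f \<in> {f \<in> fgr V 1 ?s0 d. f 0 \<in> I}"
    then have f: "f \<in> fgr V 1 ?s0 d" "f 0 \<in> I" by auto
    show "vscale c f \<in> fgr V 1 ?s0 d" by (rule scale_fgr[OF f(1)])
    show "vscale c f 0 \<in> I"
      unfolding vscale_def by (rule homog_idealD(4)[OF I f(2)]) (simp add: carrier_single)
  qed
  have subZ0: "Z0 d \<subseteq> fgr V 1 ?s0 d" for d by (auto simp: Z0_def)
  have "kvan vvar (vars V) (fgr V 1 ?s0) Z0 p d \<longleftrightarrow> kvan var (vars V) (hom_part V) (igr V I) p d" for p d
  proof (rule kvan_iso[OF finite_vars[OF finV] gsub_fgr gZ0 gsub_hom_part gsub_igr[OF I], where \<phi> = "\<lambda>f. f 0"])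
    fix d and f :: "nat \<Rightarrow> 'k mpoly"
    show "f \<in> fgr V 1 ?s0 d \<Longrightarrow> f 0 \<in> hom_part V d" by (auto simp: fgr_def)
    show "f \<in> fgr V 1 ?s0 d \<Longrightarrow> f 0 \<in> igr V I d \<longleftrightarrow> f \<in> Z0 d" by (auto simp: igr_def Z0_def fgr_def)
  next
    fix d and p :: "'k mpoly" assume "p \<in> hom_part V d"
    then have "(\<lambda>k. if k = 0 then p else 0) \<in> fgr V 1 ?s0 d" by (auto simp: fgr_def)
    then show "\<exists>f\<in>fgr V 1 ?s0 d. p - f 0 \<in> igr V I d"
      using gsub_0[OF gsub_igr[OF I]] by (intro bexI) auto
  qed (simp_all add: vvar_def)
  then have "evvan V (fgr V 1 ?s0) Z0" using ev by (simp add: evvan_def)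
  then have "evvan V Z0 (\<lambda>_. {0})" by (rule evvan_sub[OF gZ0 subZ0])
  then obtain r1 s1 A1 where 1: "hmat V 1 ?s0 r1 s1 A1" "\<And>d. Z0 d = mat_app r1 A1 ` fgr V r1 s1 d"
    "evvan V (kerf V r1 s1 A1) (\<lambda>_. {0})" using syzygy_step[OF gZ0 sZ0 subZ0] by blast
  \<comment> \<open>The clause for n = 0 ties the chosen sequence to the cover of \<open>Z0\<close>
    just obtained.\<close>
  let ?P = "\<lambda>(n::nat) (r, s, A). evvan V (kerf V r s A) (\<lambda>_. {0}) \<and> (n = 0 \<longrightarrow> r = r1 \<and> s = s1 \<and> A = A1)"
  let ?Q = "\<lambda>(n::nat) (r, s, A) (r', s', A'). hmat V r s r' s' A' \<and> (\<forall>d. kerf V r s A d = mat_app r' A' ` fgr V r' s' d)"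
  have "\<exists>f. \<forall>n. ?P n (f n) \<and> ?Q n (f n) (f (Suc n))"
  proof (rule dependent_nat_choice)
    show "\<exists>x. ?P 0 x" using 1(3) by (intro exI[of _ "(r1, s1, A1)"]) simp
    fix x n assume "?P n x"
    then obtain r s A where x: "x = (r, s, A)" "evvan V (kerf V r s A) (\<lambda>_. {0})" by (cases x) auto
    obtain r' s' A' where "hmat V r s r' s' A'" "\<forall>d. kerf V r s A d = mat_app r' A' ` fgr V r' s' d"
      "evvan V (kerf V r' s' A') (\<lambda>_. {0})"
      using syzygy_step[OF gsub_kerf scale_closed_kerf kerf_sub x(2)] by blast
    then show "\<exists>y. ?P (Suc n) y \<and> ?Q n x y" by (intro exI[of _ "(r', s', A')"]) (simp add: x(1))
  qed
  then obtain f where f: "\<forall>n. ?P n (f n) \<and> ?Q n (f n) (f (Suc n))" by (rule exE)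
  define R where "R = (\<lambda>n. fst (f n))"
  define S where "S = (\<lambda>n. fst (snd (f n)))"
  define B where "B = (\<lambda>n. snd (snd (f n)))"
  have fe: "f n = (R n, S n, B n)" for n by (simp add: R_def S_def B_def)
  have f0: "R 0 = r1" "S 0 = s1" "B 0 = A1" using f[rule_format, of 0] by (simp_all add: fe)
  have step: "hmat V (R n) (S n) (R (Suc n)) (S (Suc n)) (B (Suc n))"
    "kerf V (R n) (S n) (B n) d = mat_app (R (Suc n)) (B (Suc n)) ` fgr V (R (Suc n)) (S (Suc n)) d" for n d
    using f[rule_format, of n] by (simp_all add: fe)
  \<comment> \<open>F_0 is S itself, so the n-th chosen module becomes F_(n+1).\<close>
  define F :: "'k free_cpx" where
    "F = \<lparr>rk = (\<lambda>i. case i of 0 \<Rightarrow> 1 | Suc n \<Rightarrow> R n), shift = (\<lambda>i. case i of 0 \<Rightarrow> ?s0 | Suc n \<Rightarrow> S n),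
      aug = (\<lambda>_. 1), bd = B\<rparr>"
  have augF: "augm F f = f 0" for f by (simp add: augm_def F_def)
  have "gres V I F"
    unfolding gres_def
  proof (intro conjI allI impI ballI)
    show "aug F k \<in> hom_part V (shift F 0 k)" for k by (simp add: F_def hom_part_def)
    show "hmat V (rk F i) (shift F i) (rk F (Suc i)) (shift F (Suc i)) (bd F i)" for i
      using 1(1) step(1) f0 by (cases i) (simp_all add: F_def)
    fix d
    show "\<exists>f\<in>fgr V (rk F 0) (shift F 0) d. p - augm F f \<in> I" if "p \<in> hom_part V d" for p
      by (rule bexI[of _ "\<lambda>k. if k = 0 then p else 0"])
        (unfold augF, use that homog_idealD(2)[OF I] in \<open>auto simp: F_def fgr_def\<close>)
    show "{f \<in> fgr V (rk F 0) (shift F 0) d. augm F f \<in> I} = mat_app (rk F 1) (bd F 0) ` fgr V (rk F 1) (shift F 1) d"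
      using 1(2)[of d] f0 unfolding augF by (simp add: F_def Z0_def)
    show "{f \<in> fgr V (rk F (Suc i)) (shift F (Suc i)) d. mat_app (rk F (Suc i)) (bd F i) f = 0} =
        mat_app (rk F (Suc (Suc i))) (bd F (Suc i)) ` fgr V (rk F (Suc (Suc i))) (shift F (Suc (Suc i))) d" for i
      using step(2)[of i d] by (simp add: F_def kerf_def)
  qed
  then show ?thesis by blast
qed

text \<open>The definition of \<open>betti\<close> speaks of a resolution given by
  \<open>SOME\<close>; vanishing in high degrees guarantees that there is one.\<close>

theorem betti_nonzero_iff:
  fixes I :: "('k::field) mpoly set"
  assumes I: "homog_ideal V I"
    and ev: "\<forall>p. \<exists>D. \<forall>d\<ge>D. kvan var (vars V) (hom_part V) (igr V I) p d"
  shows "betti V I p d \<noteq> 0 \<longleftrightarrow> \<not> kvan var (vars V) (hom_part V) (igr V I) p d"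
proof -
  define F where "F = (SOME F. graded_free_resolution V I F)"
  have "graded_free_resolution V I F"
    unfolding F_def by (rule someI_ex) (use gres_exists[OF I ev] gres_iff[OF I] in blast)
  then have F: "gres V I F" using gres_iff[OF I] by blast
  interpret vector_space "fscale :: 'k \<Rightarrow> _" by (rule vector_space_fscale)
  define T :: "(nat \<Rightarrow> 'k) set" where "T = (\<lambda>k k'. if k' = k then 1 else 0) ` {..<rk F p}"
  have "v \<in> span T" if v: "v \<in> tensor_part F p d" for v
  proof -
    have "v = (\<Sum>k<rk F p. fscale (v k) (\<lambda>k'. if k' = k then 1 else 0))"
    proof
      fix k'
      have "(\<Sum>k<rk F p. fscale (v k) (\<lambda>k'. if k' = k then 1 else 0)) k' = (\<Sum>k<rk F p. if k = k' then v k else 0)"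
        unfolding sum_fun_at by (intro sum.cong refl) (auto simp: fscale_def)
      also have "\<dots> = v k'" using v by (auto simp: tensor_part_def)
      finally show "v k' = (\<Sum>k<rk F p. fscale (v k) (\<lambda>k'. if k' = k then 1 else 0)) k'" by simp
    qed
    also have "\<dots> \<in> span T" by (intro span_sum span_scale span_base) (auto simp: T_def)
    finally show ?thesis .
  qed
  then have sp: "tensor_cycles F p d \<subseteq> span T" by (auto simp: tensor_cycles_def)
  have part: "subspace (tensor_part F i d)" for i
    unfolding subspace_def by (auto simp: tensor_part_def fscale_def) (metis add.right_neutral)+
  have bdl: "tensor_bd F p (x + y) = tensor_bd F p x + tensor_bd F p y" "tensor_bd F p (fscale c x) = fscale c (tensor_bd F p x)" for x y c
    by (simp_all add: tensor_bd_def mat_app_add fscale_def mat_app_scale)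
  have sb: "subspace (tensor_boundaries F p d)"
    unfolding subspace_def
  proof (intro conjI ballI allI)
    show "0 \<in> tensor_boundaries F p d"
      using subspace_0[OF part[of "Suc p"]] unfolding tensor_boundaries_def
      by (intro image_eqI[of _ _ 0]) (simp_all add: tensor_bd_def)
    show "x + y \<in> tensor_boundaries F p d" if xy: "x \<in> tensor_boundaries F p d" "y \<in> tensor_boundaries F p d" for x y
    proof -
      obtain a b where "a \<in> tensor_part F (Suc p) d" "b \<in> tensor_part F (Suc p) d" "x = tensor_bd F p a" "y = tensor_bd F p b"
        using xy by (auto simp: tensor_boundaries_def)
      then show ?thesis unfolding tensor_boundaries_def
        by (intro image_eqI[of _ _ "a + b"] subspace_add[OF part]) (simp_all add: bdl)
    qed
    show "fscale c x \<in> tensor_boundaries F p d" if x: "x \<in> tensor_boundaries F p d" for c x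
    proof -
      obtain a where "a \<in> tensor_part F (Suc p) d" "x = tensor_bd F p a"
        using x by (auto simp: tensor_boundaries_def)
      then show ?thesis unfolding tensor_boundaries_def
        by (intro image_eqI[of _ _ "fscale c a"] subspace_scale[OF part]) (simp_all add: bdl)
    qed
  qed
  have "finite T" by (simp add: T_def)
  then show ?thesis
    using dim_diff_nonzero_iff[OF vector_space_fscale _ sp tensor_boundaries_sub[OF finV I F] sb]
      tor_vanishes_iff[OF finV I F, of p d]
    by (simp add: betti_def F_def[symmetric] Let_def)
qed

end

section \<open>Block graphs\<close>

abbreviation adj :: "'a graph \<Rightarrow> 'a \<Rightarrow> 'a \<Rightarrow> bool" where
  "adj G u v \<equiv> {u, v} \<in> eset G"

text \<open>The bound on the size excludes the maximal clique formed by an isolated vertex, which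
  would be an edge of weight 0 in the hypergraph.\<close>

definition blocks :: "'a graph \<Rightarrow> 'a set set" where
  "blocks G = {B. max_clique G B \<and> 2 \<le> card B}"

lemma vset_induced [simp]: "vset (induced G W) = vset G \<inter> W"
  and adj_induced: "adj (induced G W) u v \<longleftrightarrow> adj G u v \<and> u \<in> W \<and> v \<in> W"
  by (auto simp: induced_def)

lemma simple_induced: "simple_graph G \<Longrightarrow> simple_graph (induced G W)"
  by (auto simp: simple_graph_def induced_def)

lemma subgraph_induced: "simple_graph G \<Longrightarrow> subgraph (induced G W) G"
  using simple_induced[of G W] by (auto simp: subgraph_def induced_def)

lemma induced_induced: "induced (induced G U) W = induced G (U \<inter> W)"
  by (auto simp: induced_def)

lemma clique_induced: "clique (induced G P) W \<longleftrightarrow> clique G W \<and> W \<subseteq> P"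
  by (auto simp: clique_def adj_induced)

section \<open>Reachability, components and cutpoints\<close>

lemma reach_iff: "(u, v) \<in> reach G \<longleftrightarrow> u \<in> vset G \<and> v \<in> vset G \<and> (u, v) \<in> {(a, b). adj G a b}\<^sup>*"
  by (simp add: reach_def)

lemma reach_refl: "u \<in> vset G \<Longrightarrow> (u, u) \<in> reach G"
  by (simp add: reach_def)

lemma reach_trans: "(u, v) \<in> reach G \<Longrightarrow> (v, w) \<in> reach G \<Longrightarrow> (u, w) \<in> reach G"
  by (auto simp: reach_def)

lemma reach_sym: "(u, v) \<in> reach G \<Longrightarrow> (v, u) \<in> reach G"
proof -
  have "sym {(a, b). adj G a b}" by (auto simp: sym_def insert_commute)
  then have "sym ({(a, b). adj G a b}\<^sup>*)" by (rule sym_rtrancl)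
  then show "(u, v) \<in> reach G \<Longrightarrow> (v, u) \<in> reach G" by (auto simp: reach_def sym_def)
qed

lemma reach_adj: "u \<in> vset G \<Longrightarrow> v \<in> vset G \<Longrightarrow> adj G u v \<Longrightarrow> (u, v) \<in> reach G"
  by (auto simp: reach_def)

lemma num_components_le_1:
  assumes "\<And>u v. u \<in> vset G \<Longrightarrow> v \<in> vset G \<Longrightarrow> (u, v) \<in> reach G"
  shows "num_components G \<le> 1"
proof -
  have "reach G `` {x} = vset G" if "x \<in> vset G" for x
    using assms that by (auto simp: reach_iff)
  then have "vset G // reach G \<subseteq> {vset G}" by (auto simp: quotient_def)
  then have "card (vset G // reach G) \<le> card {vset G}" by (rule card_mono[rotated]) simp
  then show ?thesis by (simp add: num_components_def)
qed

lemma num_components_connected: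
  assumes "connected_graph G"
  shows "num_components G = 1"
proof -
  have "reach G `` {x} = vset G" if "x \<in> vset G" for x
    using assms that by (auto simp: connected_graph_def reach_iff)
  then have "vset G // reach G = {vset G}"
    using assms by (auto simp: quotient_def connected_graph_def)
  then show ?thesis by (simp add: num_components_def)
qed

lemma num_components_ge_2:
  assumes "finite (vset G)" "a \<in> vset G" "b \<in> vset G" "(a, b) \<notin> reach G"
  shows "2 \<le> num_components G"
proof -
  have "reach G `` {a} \<noteq> reach G `` {b}" using assms reach_refl[of b G] by auto
  then have "card {reach G `` {a}, reach G `` {b}} = 2" by simp
  moreover have "{reach G `` {a}, reach G `` {b}} \<subseteq> vset G // reach G" using assms by (auto simp: quotient_def)
  moreover have "finite (vset G // reach G)"
    by (rule finite_subset[of _ "Pow (vset G)"]) (use assms(1) in \<open>auto simp: quotient_def reach_def\<close>)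
  ultimately show ?thesis unfolding num_components_def by (metis card_mono)
qed

lemma not_cutpointI:
  assumes "connected_graph H" and "\<And>u w. u \<in> vset H - {v} \<Longrightarrow> w \<in> vset H - {v} \<Longrightarrow> (u, w) \<in> reach (induced H (vset H - {v}))"
  shows "\<not> cutpoint H v"
proof -
  have "num_components (induced H (vset H - {v})) \<le> 1"
    by (rule num_components_le_1) (use assms(2) in auto)
  then show ?thesis using num_components_connected[OF assms(1)] by (simp add: cutpoint_def)
qed

section \<open>The maximal cliques of a block graph form an acyclic hypergraph\<close>

context
  fixes G :: "'a graph"
  assumes simp: "simple_graph G"
begin

lemma finite_vset: "finite (vset G)"
  using simp by (simp add: simple_graph_def)

lemma adjD: "adj G u v \<Longrightarrow> u \<in> vset G \<and> v \<in> vset G \<and> u \<noteq> v"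
  using simp by (fastforce simp: simple_graph_def)

lemma max_clique_extend:
  assumes "clique G W"
  obtains B where "max_clique G B" "W \<subseteq> B"
proof -
  let ?P = "\<lambda>B. clique G B \<and> W \<subseteq> B"
  have "card B < Suc (card (vset G))" if "?P B" for B
    using that card_mono[OF finite_vset, of B] by (auto simp: clique_def)
  then obtain B where B: "?P B" "\<And>B'. ?P B' \<Longrightarrow> card B' \<le> card B"
    using ex_has_greatest_nat[of ?P W card "Suc (card (vset G))"] assms by (metis order_refl less_imp_le)
  have "max_clique G B"
    unfolding max_clique_def
  proof (intro conjI allI impI)
    fix W' assume W': "clique G W' \<and> B \<subseteq> W'"
    then have "card W' \<le> card B" using B by blast
    moreover have "finite W'" using W' finite_vset finite_subset by (auto simp: clique_def)
    ultimately show "W' = B" using W' card_seteq by blast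
  qed (use B in blast)
  then show ?thesis using that B by blast
qed

lemma adj_block: "adj G u v \<Longrightarrow> \<exists>B\<in>blocks G. u \<in> B \<and> v \<in> B"
proof -
  assume a: "adj G u v"
  then have "clique G {u, v}" using adjD[OF a] by (auto simp: clique_def insert_commute)
  then obtain B where B: "max_clique G B" "{u, v} \<subseteq> B" by (rule max_clique_extend)
  have "finite B" using B finite_vset finite_subset by (auto simp: max_clique_def clique_def)
  then have "card {u, v} \<le> card B" using B by (intro card_mono)
  then show ?thesis using B adjD[OF a] by (auto simp: blocks_def)
qed

lemma block_adj: "B \<in> blocks G \<Longrightarrow> u \<in> B \<Longrightarrow> v \<in> B \<Longrightarrow> u \<noteq> v \<Longrightarrow> adj G u v"
  by (auto simp: blocks_def max_clique_def clique_def)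

lemma adj_iff: "adj G u v \<longleftrightarrow> u \<noteq> v \<and> (\<exists>B\<in>blocks G. u \<in> B \<and> v \<in> B)"
  using adj_block block_adj adjD by blast

lemma blocks_sub: "B \<in> blocks G \<Longrightarrow> B \<subseteq> vset G"
  and blocks_card: "B \<in> blocks G \<Longrightarrow> 2 \<le> card B"
  by (auto simp: blocks_def max_clique_def clique_def)

lemma finite_block: "B \<in> blocks G \<Longrightarrow> finite B"
  using blocks_sub finite_vset finite_subset by blast

lemma finite_blocks: "finite (blocks G)"
  by (rule finite_subset[of _ "Pow (vset G)"]) (use blocks_sub finite_vset in auto)

text \<open>If the vertices reached from a touched only a proper subfamily, some vertex outside Q
  would lie both in this subfamily and in the rest; it would be reached as well, since the members
  are cliques.\<close>

lemma reach_family: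
  fixes Q :: "'a set"
  assumes C: "\<C> \<subseteq> blocks G"
    and meet: "\<And>\<C>1. \<C>1 \<subseteq> \<C> \<Longrightarrow> \<C>1 \<noteq> {} \<Longrightarrow> \<C>1 \<noteq> \<C> \<Longrightarrow> \<exists>x\<in>\<Union>\<C>1 \<inter> \<Union>(\<C> - \<C>1). x \<notin> Q"
    and ab: "a \<in> \<Union>\<C> - Q" "b \<in> \<Union>\<C> - Q"
  shows "(a, b) \<in> reach (induced G (\<Union>\<C> - Q))"
proof -
  let ?H = "induced G (\<Union>\<C> - Q)"
  have vH: "vset ?H = \<Union>\<C> - Q" using C blocks_sub by auto
  define R where "R = {x. (a, x) \<in> reach ?H}"
  have aR: "a \<in> R" using ab vH reach_refl[of a ?H] by (simp add: R_def)
  have RU: "R \<subseteq> \<Union>\<C> - Q" using vH by (auto simp: R_def reach_iff)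
  have ext: "y \<in> R" if "B \<in> \<C>" "x \<in> B" "x \<in> R" "y \<in> B" "y \<notin> Q" for B x y
  proof (cases "x = y")
    case False
    have "adj G x y" using block_adj[of B x y] that C False by blast
    moreover have "x \<in> \<Union>\<C> - Q" "y \<in> \<Union>\<C> - Q" using that RU by auto
    ultimately have "(x, y) \<in> reach ?H" using vH by (intro reach_adj) (auto simp: adj_induced)
    then show ?thesis using that(3) reach_trans[of a x ?H y] by (simp add: R_def)
  qed (use that in simp)
  define \<C>1 where "\<C>1 = {B \<in> \<C>. B \<inter> R \<noteq> {}}"
  have "\<C>1 = \<C>"
  proof (rule ccontr)
    assume n: "\<C>1 \<noteq> \<C>"
    have "\<C>1 \<noteq> {}" using aR ab by (auto simp: \<C>1_def)
    then obtain x where x: "x \<in> \<Union>\<C>1" "x \<in> \<Union>(\<C> - \<C>1)" "x \<notin> Q" using meet[of \<C>1] n by (auto simp: \<C>1_def)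
    then obtain B1 y where B1: "B1 \<in> \<C>" "x \<in> B1" "y \<in> B1" "y \<in> R" by (auto simp: \<C>1_def)
    then have "x \<in> R" using ext x(3) by blast
    then show False using x(2) by (auto simp: \<C>1_def)
  qed
  moreover obtain B where "B \<in> \<C>" "b \<in> B" using ab by auto
  ultimately obtain y where "y \<in> B" "y \<in> R" by (auto simp: \<C>1_def)
  then have "b \<in> R" using ext \<open>B \<in> \<C>\<close> \<open>b \<in> B\<close> ab by blast
  then show ?thesis by (simp add: R_def)
qed

text \<open>Among the connected subgraphs without cutpoint that contain H, one with the largest
  number of vertices and edges together is a block, because any proper extension raises this
  number.\<close>

lemma block_exists:
  assumes H: "subgraph H G" "connected_graph H" "\<nexists>v. cutpoint H v"
  obtains B where "block G B" "subgraph H B"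
proof -
  let ?P = "\<lambda>B. subgraph B G \<and> connected_graph B \<and> (\<nexists>v. cutpoint B v) \<and> subgraph H B"
  let ?m = "\<lambda>B :: 'a graph. card (vset B) + card (eset B)"
  have finE: "finite (eset G)"
    by (rule finite_subset[of _ "Pow (vset G)"]) (use simp in \<open>auto simp: simple_graph_def\<close>)
  have "?m B < Suc (?m G)" if "?P B" for B
    using that card_mono[OF finite_vset, of "vset B"] card_mono[OF finE, of "eset B"] by (auto simp: subgraph_def)
  moreover have "?P H" using H by (auto simp: subgraph_def)
  ultimately obtain B where B: "?P B" "\<And>B'. ?P B' \<Longrightarrow> ?m B' \<le> ?m B"
    using ex_has_greatest_nat[of ?P H ?m "Suc (?m G)"] by (metis order_refl less_imp_le)
  have "block G B"
    unfolding block_def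
  proof (intro conjI allI impI)
    fix B' :: "'a graph" assume B': "subgraph B' G \<and> connected_graph B' \<and> (\<nexists>v. cutpoint B' v) \<and> subgraph B B'"
    then have "?P B'" using B(1) by (auto simp: subgraph_def)
    then have le: "?m B' \<le> ?m B" using B(2) by blast
    have fin: "finite (vset B')" "finite (eset B')" using B' finite_vset finE finite_subset by (auto simp: subgraph_def)
    have sub: "vset B \<subseteq> vset B'" "eset B \<subseteq> eset B'" using B' by (auto simp: subgraph_def)
    then have "card (vset B) \<le> card (vset B')" "card (eset B) \<le> card (eset B')" using fin card_mono by blast+
    then have "vset B' = vset B" "eset B' = eset B"
      using le sub fin card_seteq[OF fin(1) sub(1)] card_seteq[OF fin(2) sub(2)] by auto
    then show "B' = B" by (cases B, cases B') simp
  qed (use B(1) in auto)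
  then show ?thesis using that B(1) by blast
qed

text \<open>A smallest family of cliques that violates the forest inequality has a union which is
  connected and has no cutpoint. The union therefore lies in a block, hence is a clique, and
  maximality makes every member equal to it. But a single clique satisfies the inequality.\<close>

lemma berge_blocks:
  assumes bg: "block_graph G"
  shows "berge (blocks G)"
proof (rule ccontr)
  assume "\<not> berge (blocks G)"
  then have "\<exists>\<C>. \<C> \<subseteq> blocks G \<and> \<C> \<noteq> {} \<and> \<not> 1 + hpd \<C> \<le> card (\<Union>\<C>)"
    using finite_blocks finite_block blocks_card unfolding berge_def hpd_def by blast
  then obtain \<C> where C: "\<C> \<subseteq> blocks G" "\<C> \<noteq> {}" "\<not> 1 + hpd \<C> \<le> card (\<Union>\<C>)"
    and min: "\<And>\<D>. \<D> \<subseteq> blocks G \<Longrightarrow> \<D> \<noteq> {} \<Longrightarrow> \<not> 1 + hpd \<D> \<le> card (\<Union>\<D>) \<Longrightarrow> card \<C> \<le> card \<D>"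
    using ex_has_least_nat[of "\<lambda>\<C>. \<C> \<subseteq> blocks G \<and> \<C> \<noteq> {} \<and> \<not> 1 + hpd \<C> \<le> card (\<Union>\<C>)" _ card] by metis
  have finC: "finite \<C>" using C finite_blocks finite_subset by blast
  have ok: "1 + hpd \<D> \<le> card (\<Union>\<D>)" if D: "\<D> \<subseteq> \<C>" "\<D> \<noteq> {}" "\<D> \<noteq> \<C>" for \<D>
  proof (rule ccontr)
    assume "\<not> ?thesis"
    then have "card \<C> \<le> card \<D>" using min[of \<D>] D C by blast
    then show False using D card_seteq[OF finC D(1)] by blast
  qed
  \<comment> \<open>Inclusion-exclusion: both parts satisfy the inequality and the whole family
    violates it, so the parts share at least two vertices. One of them survives the removal of any
    vertex.\<close>
  have two: "2 \<le> card (\<Union>\<D> \<inter> \<Union>(\<C> - \<D>))" if D: "\<D> \<subseteq> \<C>" "\<D> \<noteq> {}" "\<D> \<noteq> \<C>" for \<D>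
  proof -
    have fin: "finite (\<Union>\<D>)" "finite (\<Union>(\<C> - \<D>))" using D(1) C(1) blocks_sub by (auto intro!: finite_subset[OF _ finite_vset])
    have "1 + hpd \<D> \<le> card (\<Union>\<D>)" using ok D by blast
    moreover have "1 + hpd (\<C> - \<D>) \<le> card (\<Union>(\<C> - \<D>))" by (rule ok) (use D in auto)
    moreover have "hpd \<C> = hpd (\<C> - \<D>) + hpd \<D>" unfolding hpd_def by (rule sum.subset_diff[OF D(1) finC])
    moreover have "card (\<Union>\<D>) + card (\<Union>(\<C> - \<D>)) = card (\<Union>\<D> \<union> \<Union>(\<C> - \<D>)) + card (\<Union>\<D> \<inter> \<Union>(\<C> - \<D>))"
      by (rule card_Un_Int[OF fin])
    moreover have "\<Union>\<D> \<union> \<Union>(\<C> - \<D>) = \<Union>\<C>" using D by auto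
    ultimately show ?thesis using C(3) by simp
  qed
  have meet: "\<exists>x\<in>\<Union>\<D> \<inter> \<Union>(\<C> - \<D>). x \<notin> {v}" if D: "\<D> \<subseteq> \<C>" "\<D> \<noteq> {}" "\<D> \<noteq> \<C>" for \<D> v
  proof (rule ccontr)
    assume "\<not> ?thesis"
    then have "\<Union>\<D> \<inter> \<Union>(\<C> - \<D>) \<subseteq> {v}" by blast
    then have "card (\<Union>\<D> \<inter> \<Union>(\<C> - \<D>)) \<le> card {v}" by (rule card_mono[rotated]) simp
    then show False using two[OF D] by simp
  qed
  let ?H = "induced G (\<Union>\<C>)"
  have vH: "vset ?H = \<Union>\<C>" using C blocks_sub by auto
  have "\<Union>\<C> \<noteq> {}" using C(1,2) blocks_card by fastforce
  then have conn: "connected_graph ?H"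
    unfolding connected_graph_def vH
  proof (intro conjI ballI)
    fix u v assume "u \<in> \<Union>\<C>" "v \<in> \<Union>\<C>"
    then have "(u, v) \<in> reach (induced G (\<Union>\<C> - {}))"
      by (intro reach_family[OF C(1)]) (use meet in \<open>blast+\<close>)
    then show "(u, v) \<in> reach ?H" by simp
  qed
  have nocut: "\<not> cutpoint ?H v" for v
  proof (rule not_cutpointI[OF conn])
    fix u w assume uw: "u \<in> vset ?H - {v}" "w \<in> vset ?H - {v}"
    have eq: "induced ?H (vset ?H - {v}) = induced G (\<Union>\<C> - {v})"
      unfolding vH induced_induced by (rule arg_cong[of _ _ "induced G"]) auto
    show "(u, w) \<in> reach (induced ?H (vset ?H - {v}))"
      unfolding eq by (rule reach_family[OF C(1) meet]) (use uw vH in auto)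
  qed
  obtain B where B: "block G B" "subgraph ?H B"
    using block_exists[OF subgraph_induced[OF simp] conn] nocut by blast
  have "clique B (vset B)" using bg B(1) by (simp add: block_graph_def)
  moreover have "subgraph B G" using B(1) by (simp add: block_def)
  moreover have "\<Union>\<C> \<subseteq> vset B" using B(2) vH by (simp add: subgraph_def)
  ultimately have cl: "clique G (\<Union>\<C>)"
    unfolding clique_def subgraph_def by (meson subset_iff)
  have "D = \<Union>\<C>" if "D \<in> \<C>" for D
  proof -
    have "max_clique G D" using that C by (auto simp: blocks_def)
    then show ?thesis using cl that by (auto simp: max_clique_def)
  qed
  then obtain D where D: "\<C> = {D}" using C(2) by blast
  then have "2 \<le> card D" using C(1) blocks_card by blast
  then show False using C(3) unfolding D hpd_def by simp
qed

section \<open>Branches at a vertex and the forbidden induced subgraphs\<close>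

context
  assumes bg: "block_graph G"
begin

text \<open>Along a walk from a that avoids v, the cliques used form together with B1 a tree-like
  family in which B1 is the only clique at v. If the walk reached b, then B2 would meet this family
  in v and b and belong to it by \<open>tree_like_meet\<close>.\<close>

lemma separation:
  assumes B: "B1 \<in> blocks G" "B2 \<in> blocks G" "B1 \<noteq> B2" "v \<in> B1" "v \<in> B2" "a \<in> B1" "a \<noteq> v" "b \<in> B2" "b \<noteq> v"
  shows "(a, b) \<notin> reach (induced G (vset G - {v}))"
proof
  let ?H = "induced G (vset G - {v})"
  define good where "good = (\<lambda>x. \<exists>\<C>\<subseteq>(blocks G). tree_like \<C> \<and> B1 \<in> \<C> \<and> x \<in> \<Union>\<C> \<and> (\<forall>D\<in>\<C>. v \<in> D \<longrightarrow> D = B1))"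
  assume "(a, b) \<in> reach ?H"
  then have "(a, b) \<in> {(x, y). adj ?H x y}\<^sup>*" by (simp add: reach_iff)
  then have "good b"
  proof (induction rule: rtrancl_induct)
    case base
    show ?case unfolding good_def using tree_like_single[OF berge_blocks[OF bg] B(1)] B by (intro exI[of _ "{B1}"]) auto
  next
    case (step x y)
    then obtain \<C> where C: "\<C> \<subseteq> blocks G" "tree_like \<C>" "B1 \<in> \<C>" "x \<in> \<Union>\<C>" "\<And>D. D \<in> \<C> \<Longrightarrow> v \<in> D \<Longrightarrow> D = B1"
      by (auto simp: good_def)
    have xy: "adj G x y" "x \<noteq> v" "y \<noteq> v" using step(2) by (auto simp: adj_induced)
    obtain D where D: "D \<in> blocks G" "x \<in> D" "y \<in> D" using adj_block[OF xy(1)] by blast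
    have "D = B1" if "v \<in> D"
    proof -
      have "D \<in> \<C>" by (rule tree_like_meet[OF berge_blocks[OF bg] C(1,2) D(1) that D(2)]) (use C(3,4) B(4) xy(2) in auto)
      then show ?thesis using C(5) that by blast
    qed
    then have "\<forall>D'\<in>insert D \<C>. v \<in> D' \<longrightarrow> D' = B1" using C(5) by blast
    moreover have "tree_like (insert D \<C>)"
      by (rule tree_like_insert[OF berge_blocks[OF bg] C(1,2) D(1)]) (use C(4) D(2) in auto)
    moreover have "insert D \<C> \<subseteq> blocks G" "B1 \<in> insert D \<C>" "y \<in> \<Union>(insert D \<C>)" using C(1,3) D by auto
    ultimately show ?case unfolding good_def by blast
  qed
  then obtain \<C> where C: "\<C> \<subseteq> blocks G" "tree_like \<C>" "B1 \<in> \<C>" "b \<in> \<Union>\<C>" "\<And>D. D \<in> \<C> \<Longrightarrow> v \<in> D \<Longrightarrow> D = B1"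
    by (auto simp: good_def)
  have "B2 \<in> \<C>" by (rule tree_like_meet[OF berge_blocks[OF bg] C(1,2) B(2,5,8)]) (use C(3,4) B(4,9) in auto)
  then show False using C(5) B by blast
qed

text \<open>The portion of the branch at v through B in which triangles and forks are found: B
  without v, and the cliques that touch B away from v.\<close>

definition side :: "'a \<Rightarrow> 'a set \<Rightarrow> 'a set" where
  "side v B = {x. x \<noteq> v \<and> (\<exists>D\<in>blocks G. x \<in> D \<and> (D = B \<or> (v \<notin> D \<and> D \<inter> B \<noteq> {})))}"

lemma side_reach:
  assumes B: "B \<in> blocks G" "v \<in> B" and x: "x \<in> side v B"
  shows "\<exists>a\<in>B - {v}. (a, x) \<in> reach (induced G (vset G - {v}))"
proof -
  let ?H = "induced G (vset G - {v})"
  obtain D where D: "x \<noteq> v" "D \<in> blocks G" "x \<in> D" "D = B \<or> (v \<notin> D \<and> D \<inter> B \<noteq> {})" using x by (auto simp: side_def)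
  have xH: "x \<in> vset ?H" using D blocks_sub by auto
  show ?thesis
  proof (cases "D = B")
    case True
    then show ?thesis using D reach_refl[OF xH] by blast
  next
    case False
    then obtain a where a: "a \<in> D" "a \<in> B" "v \<notin> D" using D by auto
    have aH: "a \<in> vset ?H" "a \<noteq> v" using a D blocks_sub by auto
    have "(a, x) \<in> reach ?H"
    proof (cases "a = x")
      case True
      then show ?thesis using reach_refl[OF xH] by simp
    next
      case F: False
      have "adj G a x" by (rule block_adj[OF D(2) a(1) D(3) F])
      then show ?thesis using aH xH by (intro reach_adj) (auto simp: adj_induced)
    qed
    then show ?thesis using a aH by blast
  qed
qed

text \<open>A common vertex of two sides, or an edge between them, would connect the two cliques in
  G - v, contrary to \<open>separation\<close>.\<close>

lemma side_cross:
  assumes B: "B1 \<in> blocks G" "B2 \<in> blocks G" "B1 \<noteq> B2" "v \<in> B1" "v \<in> B2" and x: "x \<in> side v B1" and y: "y \<in> side v B2"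
  shows "x \<noteq> y \<and> \<not> adj G x y"
proof -
  let ?H = "induced G (vset G - {v})"
  obtain a where a: "a \<in> B1 - {v}" "(a, x) \<in> reach ?H" using side_reach[OF B(1,4) x] by blast
  obtain b where b: "b \<in> B2 - {v}" "(b, y) \<in> reach ?H" using side_reach[OF B(2,5) y] by blast
  have "(x, y) \<notin> reach ?H"
  proof
    assume "(x, y) \<in> reach ?H"
    then have "(a, b) \<in> reach ?H" using a(2) b(2) reach_trans reach_sym by metis
    then show False using separation[OF B, of a b] a b by blast
  qed
  moreover have "x \<in> vset ?H" "y \<in> vset ?H" using a(2) b(2) by (auto simp: reach_iff)
  ultimately show ?thesis using reach_refl[of x ?H] reach_adj[of x ?H y] by (auto simp: adj_induced)
qed

definition tri :: "'a \<Rightarrow> 'a set \<Rightarrow> 'a \<Rightarrow> 'a \<Rightarrow> bool" where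
  "tri v B a b \<longleftrightarrow> distinct [v, a, b] \<and> {a, b} \<subseteq> side v B \<and> adj G v a \<and> adj G v b \<and> adj G a b"

definition fork :: "'a \<Rightarrow> 'a set \<Rightarrow> 'a \<Rightarrow> 'a \<Rightarrow> 'a \<Rightarrow> bool" where
  "fork v B w l l' \<longleftrightarrow> distinct [v, w, l, l'] \<and> {w, l, l'} \<subseteq> side v B \<and> adj G v w \<and> adj G w l \<and> adj G w l' \<and>
     \<not> adj G v l \<and> \<not> adj G v l' \<and> \<not> adj G l l'"

lemma other_point:
  assumes "B \<in> blocks G"
  shows "\<exists>x\<in>B. x \<noteq> u"
proof (rule ccontr)
  assume "\<not> ?thesis"
  then have "B \<subseteq> {u}" by blast
  then have "card B \<le> card {u}" by (rule card_mono[rotated]) simp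
  then show False using blocks_card[OF assms] by simp
qed

lemma two_blocks_nonadj:
  assumes D: "D1 \<in> blocks G" "D2 \<in> blocks G" "D1 \<noteq> D2" "u \<in> D1" "u \<in> D2" "x \<in> D1" "x \<noteq> u" "y \<in> D2" "y \<noteq> u"
  shows "x \<noteq> y \<and> \<not> adj G x y"
proof -
  have "x \<in> side u D1" "y \<in> side u D2" using D by (auto simp: side_def)
  then show ?thesis using side_cross[OF D(1-5)] by blast
qed

text \<open>A clique with three vertices gives a triangle at v. If the petal is
  \<open>{v, w}\<close>, then w lies in two further cliques, and a vertex from each of them gives a
  fork.\<close>

lemma petal_branch:
  assumes "B \<in> petals (blocks G) v"
  shows "(\<exists>a b. tri v B a b) \<or> (\<exists>w l l'. fork v B w l l')"
proof -
  have B: "B \<in> blocks G" "v \<in> B" using assms by (auto simp: petals_def)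
  show ?thesis
  proof (cases "3 \<le> card B")
    case True
    then have "2 \<le> card (B - {v})" using B finite_block by (simp add: card_Diff_singleton)
    then obtain a b where ab: "a \<in> B - {v}" "b \<in> B - {v}" "a \<noteq> b"
      by (metis card_le_Suc0_iff_eq finite_Diff finite_block[OF B(1)] not_less_eq_eq numeral_2_eq_2)
    have "tri v B a b" unfolding tri_def side_def using ab B block_adj[OF B(1)] by auto
    then show ?thesis by blast
  next
    case False
    then obtain w where w: "B = {v, w}" "3 \<le> hdeg (blocks G) w" using assms by (auto simp: petals_def)
    have vw: "v \<noteq> w" using w blocks_card[OF B(1)] by auto
    have "2 \<le> card ({D \<in> blocks G. w \<in> D} - {B})"
      using w B finite_blocks by (simp add: hdeg_def card_Diff_singleton)
    moreover have fin: "finite ({D \<in> blocks G. w \<in> D} - {B})" using finite_blocks by simp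
    ultimately obtain D1 D2 where D: "D1 \<in> blocks G" "w \<in> D1" "D1 \<noteq> B" "D2 \<in> blocks G" "w \<in> D2" "D2 \<noteq> B" "D1 \<noteq> D2"
      using card_le_Suc0_iff_eq[OF fin] by (metis (no_types, lifting) Diff_iff insert_iff mem_Collect_eq not_less_eq_eq numeral_2_eq_2)
    obtain l where l: "l \<in> D1" "l \<noteq> w" using other_point[OF D(1)] by blast
    obtain l' where l': "l' \<in> D2" "l' \<noteq> w" using other_point[OF D(4)] by blast
    have vB: "v \<in> B" "w \<in> B" using w by auto
    have n1: "v \<noteq> l \<and> \<not> adj G v l" by (rule two_blocks_nonadj[OF B(1) D(1) _ vB(2) D(2) vB(1) vw l]) (use D in auto)
    have n2: "v \<noteq> l' \<and> \<not> adj G v l'" by (rule two_blocks_nonadj[OF B(1) D(4) _ vB(2) D(5) vB(1) vw l']) (use D in auto)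
    have n3: "l \<noteq> l' \<and> \<not> adj G l l'" by (rule two_blocks_nonadj[OF D(1,4,7,2,5) l l'])
    have nv: "v \<notin> D1" "v \<notin> D2"
      using n1 n2 block_adj[OF D(1), of v l] block_adj[OF D(4), of v l'] l l' by auto
    have "fork v B w l l'"
      unfolding fork_def side_def
      using n1 n2 n3 l l' vw vB nv D B block_adj[OF B(1), of v w] block_adj[OF D(1), of w l] block_adj[OF D(4), of w l'] by auto
    then show ?thesis by blast
  qed
qed

lemma contains_induced_iff:
  "contains_induced G T \<longleftrightarrow> (\<exists>f. inj_on f (vset T) \<and> f ` vset T \<subseteq> vset G \<and>
     (\<forall>u\<in>vset T. \<forall>v\<in>vset T. adj T u v \<longleftrightarrow> adj G (f u) (f v)))"
proof
  assume "contains_induced G T"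
  then obtain W g where W: "W \<subseteq> vset G" and g: "bij_betw g W (vset T)"
    "\<And>u v. u \<in> W \<Longrightarrow> v \<in> W \<Longrightarrow> adj (induced G W) u v \<longleftrightarrow> adj T (g u) (g v)"
    unfolding contains_induced_def graph_iso_def by (auto simp: Int_absorb1)
  let ?f = "inv_into W g"
  have f: "bij_betw ?f (vset T) W" by (rule bij_betw_inv_into[OF g(1)])
  have gf: "g (?f x) = x" if "x \<in> vset T" for x using bij_betw_inv_into_right[OF g(1) that] .
  have fW: "?f x \<in> W" if "x \<in> vset T" for x using f that by (auto simp: bij_betw_def)
  have "adj T u v \<longleftrightarrow> adj G (?f u) (?f v)" if "u \<in> vset T" "v \<in> vset T" for u v
    using g(2)[OF fW[OF that(1)] fW[OF that(2)]] fW[OF that(1)] fW[OF that(2)] that by (simp add: gf adj_induced)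
  then show "\<exists>f. inj_on f (vset T) \<and> f ` vset T \<subseteq> vset G \<and>
     (\<forall>u\<in>vset T. \<forall>v\<in>vset T. adj T u v \<longleftrightarrow> adj G (f u) (f v))"
    using f W by (intro exI[of _ ?f]) (auto simp: bij_betw_def)
next
  assume "\<exists>f. inj_on f (vset T) \<and> f ` vset T \<subseteq> vset G \<and>
     (\<forall>u\<in>vset T. \<forall>v\<in>vset T. adj T u v \<longleftrightarrow> adj G (f u) (f v))"
  then obtain f where f: "inj_on f (vset T)" "f ` vset T \<subseteq> vset G"
    "\<And>u v. u \<in> vset T \<Longrightarrow> v \<in> vset T \<Longrightarrow> adj T u v \<longleftrightarrow> adj G (f u) (f v)" by blast
  let ?W = "f ` vset T" and ?g = "inv_into (vset T) f"
  have bij: "bij_betw f (vset T) ?W" using f(1) by (simp add: bij_betw_def)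
  have "adj (induced G ?W) x y \<longleftrightarrow> adj T (?g x) (?g y)" if xy: "x \<in> ?W" "y \<in> ?W" for x y
  proof -
    obtain u v where "x = f u" "u \<in> vset T" "y = f v" "v \<in> vset T" using xy by blast
    then show ?thesis using f(3)[of u v] f(1) by (simp add: adj_induced)
  qed
  moreover have "vset (induced G ?W) = ?W" using f(2) by auto
  ultimately have "graph_iso (induced G ?W) T"
    unfolding graph_iso_def using bij_betw_inv_into[OF bij] by (intro exI[of _ ?g]) simp
  then show "contains_induced G T" unfolding contains_induced_def using f(2) by blast
qed

lemma tri_petal:
  assumes "adj G v a" "adj G v b" "adj G a b"
  shows "\<exists>B\<in>petals (blocks G) v. a \<in> B"
proof -
  have d: "v \<noteq> a" "v \<noteq> b" "a \<noteq> b" "v \<in> vset G" "a \<in> vset G" "b \<in> vset G" using assms adjD by blast+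
  then have "clique G {v, a, b}" using assms by (auto simp: clique_def insert_commute)
  then obtain B where B: "max_clique G B" "{v, a, b} \<subseteq> B" by (rule max_clique_extend)
  have "finite B" using B finite_vset finite_subset by (auto simp: max_clique_def clique_def)
  then have "card {v, a, b} \<le> card B" using B by (intro card_mono)
  then have "3 \<le> card B" using d by simp
  then show ?thesis using B by (intro bexI[of _ B]) (auto simp: petals_def blocks_def)
qed

text \<open>The non-adjacencies force the edges from w to v, l and l' into three different cliques,
  so w has degree at least 3 in the hypergraph.\<close>

lemma fork_petal:
  assumes a: "adj G v w" "adj G w l" "adj G w l'" and n: "\<not> adj G v l" "\<not> adj G v l'" "\<not> adj G l l'"
    and d: "v \<noteq> l" "v \<noteq> l'" "l \<noteq> l'"
  shows "\<exists>B\<in>petals (blocks G) v. w \<in> B"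
proof -
  obtain B where B: "B \<in> blocks G" "v \<in> B" "w \<in> B" using adj_block[OF a(1)] by blast
  obtain D1 where D1: "D1 \<in> blocks G" "w \<in> D1" "l \<in> D1" using adj_block[OF a(2)] by blast
  obtain D2 where D2: "D2 \<in> blocks G" "w \<in> D2" "l' \<in> D2" using adj_block[OF a(3)] by blast
  have ne: "B \<noteq> D1" "B \<noteq> D2" "D1 \<noteq> D2"
    using block_adj[OF B(1), of v l] block_adj[OF B(1), of v l'] block_adj[OF D1(1), of l l'] n d B D1 D2 by auto
  have "card {B, D1, D2} \<le> hdeg (blocks G) w"
    unfolding hdeg_def by (rule card_mono) (use finite_blocks B D1 D2 in auto)
  then have h: "3 \<le> hdeg (blocks G) w" using ne by simp
  have "B \<in> petals (blocks G) v"
  proof (cases "3 \<le> card B")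
    case False
    then have "card B = 2" using blocks_card[OF B(1)] by simp
    moreover have "v \<noteq> w" using adjD[OF a(1)] by blast
    ultimately have "B = {v, w}" using B by (auto simp: card_2_iff)
    then show ?thesis using B h by (auto simp: petals_def)
  qed (use B in \<open>simp add: petals_def\<close>)
  then show ?thesis using B by blast
qed

lemma three_petals:
  assumes "B1 \<in> petals (blocks G) v" "B2 \<in> petals (blocks G) v" "B3 \<in> petals (blocks G) v" "x \<in> B1" "y \<in> B2" "z \<in> B3"
    and "x \<noteq> y" "x \<noteq> z" "y \<noteq> z" "\<not> adj G x y" "\<not> adj G x z" "\<not> adj G y z"
  shows "3 \<le> card (petals (blocks G) v)"
proof -
  have B: "B1 \<in> blocks G" "B2 \<in> blocks G" "B3 \<in> blocks G" using assms by (auto simp: petals_def)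
  have "B1 \<noteq> B2" "B1 \<noteq> B3" "B2 \<noteq> B3"
    using block_adj[OF B(1), of x y] block_adj[OF B(1), of x z] block_adj[OF B(2), of y z] assms by auto
  moreover have "card {B1, B2, B3} \<le> card (petals (blocks G) v)"
    by (rule card_mono) (use finite_blocks assms in \<open>auto simp: petals_def\<close>)
  ultimately show ?thesis by simp
qed

end

end

context
  fixes G :: "'a graph"
  assumes simp: "simple_graph G" and bg: "block_graph G"
begin

lemma not_loop [simp]: "{x} \<notin> eset G"
  using simp by (auto simp: simple_graph_def)

lemma contains_inducedI:
  fixes xs :: "'a list" and T :: "nat graph"
  assumes "distinct xs" "set xs \<subseteq> vset G" "vset T = {0..n}" "length xs = Suc n"
    and "\<forall>i\<in>{0..n}. \<forall>j\<in>{0..n}. adj T i j \<longleftrightarrow> adj G (xs ! i) (xs ! j)"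
  shows "contains_induced G T"
  unfolding contains_induced_iff[OF simp bg]
proof (intro exI[of _ "nth xs"] conjI)
  show "inj_on ((!) xs) (vset T)" by (rule inj_on_nth[OF assms(1)]) (use assms in auto)
  show "(!) xs ` vset T \<subseteq> vset G" using assms(2-4) by (auto simp: subset_iff)
  show "\<forall>u\<in>vset T. \<forall>v\<in>vset T. adj T u v \<longleftrightarrow> adj G (xs ! u) (xs ! v)" using assms(3,5) by simp
qed

lemma tri_facts:
  assumes "tri G v B a b"
  shows "v \<noteq> a" "v \<noteq> b" "a \<noteq> b" "adj G v a" "adj G v b" "adj G a b" "adj G a v" "adj G b v" "adj G b a"
    "a \<in> vset G" "b \<in> vset G" "{a, b} \<subseteq> side G v B"
  using assms adjD[OF simp, of v a] adjD[OF simp, of v b] unfolding tri_def[OF simp bg] by (auto simp: insert_commute)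

lemma fork_facts:
  assumes "fork G v B w l l'"
  shows "v \<noteq> w" "v \<noteq> l" "v \<noteq> l'" "w \<noteq> l" "w \<noteq> l'" "l \<noteq> l'"
    "adj G v w" "adj G w v" "adj G w l" "adj G l w" "adj G w l'" "adj G l' w"
    "\<not> adj G v l" "\<not> adj G l v" "\<not> adj G v l'" "\<not> adj G l' v" "\<not> adj G l l'" "\<not> adj G l' l"
    "w \<in> vset G" "l \<in> vset G" "l' \<in> vset G" "{w, l, l'} \<subseteq> side G v B"
  using assms adjD[OF simp, of v w] adjD[OF simp, of w l] adjD[OF simp, of w l'] unfolding fork_def[OF simp bg]
  by (auto simp: insert_commute)

context
  fixes v :: 'a and B1 B2 B3 :: "'a set"
  assumes B: "B1 \<in> blocks G" "B2 \<in> blocks G" "B3 \<in> blocks G" "v \<in> B1" "v \<in> B2" "v \<in> B3" "B1 \<noteq> B2" "B1 \<noteq> B3" "B2 \<noteq> B3"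
begin

lemma center_in_vset: "v \<in> vset G"
  using blocks_sub[OF simp B(1)] B(4) by blast

lemma branches_not_adj:
  "P \<subseteq> side G v B1 \<Longrightarrow> Q \<subseteq> side G v B2 \<Longrightarrow> \<forall>x\<in>P. \<forall>y\<in>Q. x \<noteq> y \<and> \<not> adj G x y \<and> \<not> adj G y x"
  "P \<subseteq> side G v B1 \<Longrightarrow> Q \<subseteq> side G v B3 \<Longrightarrow> \<forall>x\<in>P. \<forall>y\<in>Q. x \<noteq> y \<and> \<not> adj G x y \<and> \<not> adj G y x"
  "P \<subseteq> side G v B2 \<Longrightarrow> Q \<subseteq> side G v B3 \<Longrightarrow> \<forall>x\<in>P. \<forall>y\<in>Q. x \<noteq> y \<and> \<not> adj G x y \<and> \<not> adj G y x"
proof -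
  have *: "x \<noteq> y \<and> \<not> adj G x y \<and> \<not> adj G y x"
    if "C \<in> blocks G" "D \<in> blocks G" "C \<noteq> D" "v \<in> C" "v \<in> D" "x \<in> side G v C" "y \<in> side G v D" for x y C D
    using side_cross[OF simp bg that] by (simp add: insert_commute[of y x])
  show "P \<subseteq> side G v B1 \<Longrightarrow> Q \<subseteq> side G v B2 \<Longrightarrow> \<forall>x\<in>P. \<forall>y\<in>Q. x \<noteq> y \<and> \<not> adj G x y \<and> \<not> adj G y x"
    using *[OF B(1,2,7,4,5)] by (meson subsetD)
  show "P \<subseteq> side G v B1 \<Longrightarrow> Q \<subseteq> side G v B3 \<Longrightarrow> \<forall>x\<in>P. \<forall>y\<in>Q. x \<noteq> y \<and> \<not> adj G x y \<and> \<not> adj G y x"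
    using *[OF B(1,3,8,4,6)] by (meson subsetD)
  show "P \<subseteq> side G v B2 \<Longrightarrow> Q \<subseteq> side G v B3 \<Longrightarrow> \<forall>x\<in>P. \<forall>y\<in>Q. x \<noteq> y \<and> \<not> adj G x y \<and> \<not> adj G y x"
    using *[OF B(2,3,9,5,6)] by (meson subsetD)
qed

text \<open>The list enumerates the vertices in the order of the labels of \<open>T0\<close>, so
  that \<open>nth\<close> is the embedding. Adjacency within a branch is given by
  \<open>tri_facts\<close>, non-adjacency between branches by \<open>branches_not_adj\<close>; the
  other three graphs are treated in the same way.\<close>

lemma T0_from:
  assumes "tri G v B1 a1 b1" "tri G v B2 a2 b2" "tri G v B3 a3 b3"
  shows "contains_induced G T0"
proof -
  note f = tri_facts[OF assms(1)] tri_facts[OF assms(2)] tri_facts[OF assms(3)]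
  note c = branches_not_adj(1)[OF tri_facts(12)[OF assms(1)] tri_facts(12)[OF assms(2)], simplified] branches_not_adj(2)[OF tri_facts(12)[OF assms(1)] tri_facts(12)[OF assms(3)], simplified] branches_not_adj(3)[OF tri_facts(12)[OF assms(2)] tri_facts(12)[OF assms(3)], simplified]
  have eq: "{0..6::nat} = {0,1,2,3,4,5,6}" by auto
  show ?thesis
  proof (rule contains_inducedI[of "[v, a1, b1, a2, b2, a3, b3]" _ 6])
    show "distinct [v, a1, b1, a2, b2, a3, b3]" by (simp add: f c)
    show "set [v, a1, b1, a2, b2, a3, b3] \<subseteq> vset G" by (simp add: f center_in_vset)
    show "\<forall>i\<in>{0..6}. \<forall>j\<in>{0..6}. adj T0 i j \<longleftrightarrow> adj G ([v, a1, b1, a2, b2, a3, b3] ! i) ([v, a1, b1, a2, b2, a3, b3] ! j)"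
      unfolding eq T0_def by (simp add: doubleton_eq_iff f c)
  qed (simp_all add: T0_def)
qed

lemma T1_from:
  assumes "tri G v B1 a1 b1" "tri G v B2 a2 b2" "fork G v B3 w l l'"
  shows "contains_induced G T1"
proof -
  note f = tri_facts[OF assms(1)] tri_facts[OF assms(2)] fork_facts[OF assms(3)]
  note c = branches_not_adj(1)[OF tri_facts(12)[OF assms(1)] tri_facts(12)[OF assms(2)], simplified] branches_not_adj(2)[OF tri_facts(12)[OF assms(1)] fork_facts(22)[OF assms(3)], simplified] branches_not_adj(3)[OF tri_facts(12)[OF assms(2)] fork_facts(22)[OF assms(3)], simplified]
  have eq: "{0..7::nat} = {0,1,2,3,4,5,6,7}" by auto
  show ?thesis
  proof (rule contains_inducedI[of "[v, a1, b1, a2, b2, w, l, l']" _ 7])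
    show "distinct [v, a1, b1, a2, b2, w, l, l']" by (simp add: f c)
    show "set [v, a1, b1, a2, b2, w, l, l'] \<subseteq> vset G" by (simp add: f center_in_vset)
    show "\<forall>i\<in>{0..7}. \<forall>j\<in>{0..7}. adj T1 i j \<longleftrightarrow> adj G ([v, a1, b1, a2, b2, w, l, l'] ! i) ([v, a1, b1, a2, b2, w, l, l'] ! j)"
      unfolding eq T1_def by (simp add: doubleton_eq_iff f c)
  qed (simp_all add: T1_def)
qed

lemma T2_from:
  assumes "tri G v B1 a1 b1" "fork G v B2 w1 l1 l1'" "fork G v B3 w2 l2 l2'"
  shows "contains_induced G T2"
proof -
  note f = tri_facts[OF assms(1)] fork_facts[OF assms(2)] fork_facts[OF assms(3)]
  note c = branches_not_adj(1)[OF tri_facts(12)[OF assms(1)] fork_facts(22)[OF assms(2)], simplified] branches_not_adj(2)[OF tri_facts(12)[OF assms(1)] fork_facts(22)[OF assms(3)], simplified] branches_not_adj(3)[OF fork_facts(22)[OF assms(2)] fork_facts(22)[OF assms(3)], simplified]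
  have eq: "{0..8::nat} = {0,1,2,3,4,5,6,7,8}" by auto
  show ?thesis
  proof (rule contains_inducedI[of "[v, a1, b1, w1, l1, l1', w2, l2, l2']" _ 8])
    show "distinct [v, a1, b1, w1, l1, l1', w2, l2, l2']" by (simp add: f c)
    show "set [v, a1, b1, w1, l1, l1', w2, l2, l2'] \<subseteq> vset G" by (simp add: f center_in_vset)
    show "\<forall>i\<in>{0..8}. \<forall>j\<in>{0..8}. adj T2 i j \<longleftrightarrow>
        adj G ([v, a1, b1, w1, l1, l1', w2, l2, l2'] ! i) ([v, a1, b1, w1, l1, l1', w2, l2, l2'] ! j)"
      unfolding eq T2_def by (simp add: doubleton_eq_iff f c)
  qed (simp_all add: T2_def)
qed

lemma T3_from:
  assumes "fork G v B1 w1 l1 l1'" "fork G v B2 w2 l2 l2'" "fork G v B3 w3 l3 l3'"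
  shows "contains_induced G T3"
proof -
  note f = fork_facts[OF assms(1)] fork_facts[OF assms(2)] fork_facts[OF assms(3)]
  note c = branches_not_adj(1)[OF fork_facts(22)[OF assms(1)] fork_facts(22)[OF assms(2)], simplified] branches_not_adj(2)[OF fork_facts(22)[OF assms(1)] fork_facts(22)[OF assms(3)], simplified] branches_not_adj(3)[OF fork_facts(22)[OF assms(2)] fork_facts(22)[OF assms(3)], simplified]
  have eq: "{0..9::nat} = {0,1,2,3,4,5,6,7,8,9}" by auto
  show ?thesis
  proof (rule contains_inducedI[of "[v, w1, l1, l1', w2, l2, l2', w3, l3, l3']" _ 9])
    show "distinct [v, w1, l1, l1', w2, l2, l2', w3, l3, l3']" by (simp add: f c)
    show "set [v, w1, l1, l1', w2, l2, l2', w3, l3, l3'] \<subseteq> vset G" by (simp add: f center_in_vset)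
    show "\<forall>i\<in>{0..9}. \<forall>j\<in>{0..9}. adj T3 i j \<longleftrightarrow>
        adj G ([v, w1, l1, l1', w2, l2, l2', w3, l3, l3'] ! i) ([v, w1, l1, l1', w2, l2, l2', w3, l3, l3'] ! j)"
      unfolding eq T3_def by (simp add: doubleton_eq_iff f c)
  qed (simp_all add: T3_def)
qed

end

lemma petals_contains:
  assumes "3 \<le> card (petals (blocks G) v)"
  shows "\<exists>T\<in>{T0, T1, T2, T3}. contains_induced G T"
proof -
  obtain S where S: "S \<subseteq> petals (blocks G) v" "card S = 3" using obtain_subset_with_card_n[OF assms] by metis
  then obtain B1 B2 B3 where B: "S = {B1, B2, B3}" "B1 \<noteq> B2" "B1 \<noteq> B3" "B2 \<noteq> B3" by (auto simp: card_3_iff)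
  have p: "B1 \<in> petals (blocks G) v" "B2 \<in> petals (blocks G) v" "B3 \<in> petals (blocks G) v" using S B by auto
  then have m: "B1 \<in> blocks G" "B2 \<in> blocks G" "B3 \<in> blocks G" "v \<in> B1" "v \<in> B2" "v \<in> B3" by (auto simp: petals_def)
  note n = B(2-4) B(2-4)[symmetric]
  let ?t = "\<lambda>B. \<exists>a b. tri G v B a b" and ?f = "\<lambda>B. \<exists>w l l'. fork G v B w l l'"
  have br: "?t B1 \<or> ?f B1" "?t B2 \<or> ?f B2" "?t B3 \<or> ?f B3"
    using petal_branch[OF simp bg p(1)] petal_branch[OF simp bg p(2)] petal_branch[OF simp bg p(3)] by blast+
  \<comment> \<open>The branches are permuted in each case so that the triangles come before the
    forks.\<close>
  consider "?t B1" "?t B2" "?t B3"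
    | "?t B1" "?t B2" "?f B3"
    | "?t B1" "?f B2" "?t B3"
    | "?f B1" "?t B2" "?t B3"
    | "?t B1" "?f B2" "?f B3"
    | "?f B1" "?t B2" "?f B3"
    | "?f B1" "?f B2" "?t B3"
    | "?f B1" "?f B2" "?f B3"
    using br by argo
  then show ?thesis
  proof cases
    case 1
    then have "contains_induced G T0" using T0_from[OF m(1,2,3,4,5,6) n(1,2,3)] by blast
    then show ?thesis by simp
  next
    case 2
    then have "contains_induced G T1" using T1_from[OF m(1,2,3,4,5,6) n(1,2,3)] by blast
    then show ?thesis by simp
  next
    case 3
    then have "contains_induced G T1" using T1_from[OF m(1,3,2,4,6,5) n(2,1,6)] by blast
    then show ?thesis by simp
  next
    case 4
    then have "contains_induced G T1" using T1_from[OF m(2,3,1,5,6,4) n(3,4,5)] by blast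
    then show ?thesis by simp
  next
    case 5
    then have "contains_induced G T2" using T2_from[OF m(1,2,3,4,5,6) n(1,2,3)] by blast
    then show ?thesis by simp
  next
    case 6
    then have "contains_induced G T2" using T2_from[OF m(2,1,3,5,4,6) n(4,3,2)] by blast
    then show ?thesis by simp
  next
    case 7
    then have "contains_induced G T2" using T2_from[OF m(3,1,2,6,4,5) n(5,6,1)] by blast
    then show ?thesis by simp
  next
    case 8
    then have "contains_induced G T3" using T3_from[OF m(1,2,3,4,5,6) n(1,2,3)] by blast
    then show ?thesis by simp
  qed
qed

lemma contains_petals:
  assumes "T \<in> {T0, T1, T2, T3}" "contains_induced G T"
  shows "\<exists>v. 3 \<le> card (petals (blocks G) v)"
proof -
  obtain f where inj: "inj_on f (vset T)"
    and f: "\<And>u v. u \<in> vset T \<Longrightarrow> v \<in> vset T \<Longrightarrow> adj G (f u) (f v) \<longleftrightarrow> adj T u v"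
    using assms(2) unfolding contains_induced_iff[OF simp bg] by blast
  have ne: "f u \<noteq> f v" if "u \<in> vset T" "v \<in> vset T" "u \<noteq> v" for u v using inj that by (auto simp: inj_on_def)
  have tri: "\<exists>B\<in>petals (blocks G) (f 0). f a \<in> B"
    if "0 \<in> vset T" "a \<in> vset T" "b \<in> vset T" "adj T 0 a" "adj T 0 b" "adj T a b" for a b
    by (rule tri_petal[OF simp bg, of _ _ "f b"]) (use that f in auto)
  have fork: "\<exists>B\<in>petals (blocks G) (f 0). f w \<in> B"
    if "0 \<in> vset T" "w \<in> vset T" "l \<in> vset T" "l' \<in> vset T" "adj T 0 w" "adj T w l" "adj T w l'"
      "\<not> adj T 0 l" "\<not> adj T 0 l'" "\<not> adj T l l'" "0 \<noteq> l" "0 \<noteq> l'" "l \<noteq> l'" for w l l'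
    by (rule fork_petal[OF simp bg, of _ _ "f l" "f l'"]) (use that f ne in auto)
  have three: "\<exists>v. 3 \<le> card (petals (blocks G) v)"
    if ex: "\<exists>B\<in>petals (blocks G) (f 0). f x \<in> B" "\<exists>B\<in>petals (blocks G) (f 0). f y \<in> B" "\<exists>B\<in>petals (blocks G) (f 0). f z \<in> B"
      and xyz: "x \<in> vset T" "y \<in> vset T" "z \<in> vset T" "x \<noteq> y" "x \<noteq> z" "y \<noteq> z" "\<not> adj T x y" "\<not> adj T x z" "\<not> adj T y z" for x y z
  proof -
    obtain B1 B2 B3 where B: "B1 \<in> petals (blocks G) (f 0)" "B2 \<in> petals (blocks G) (f 0)" "B3 \<in> petals (blocks G) (f 0)"
      "f x \<in> B1" "f y \<in> B2" "f z \<in> B3" using ex by blast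
    have "3 \<le> card (petals (blocks G) (f 0))"
      by (rule three_petals[OF simp bg B]) (use xyz f ne in auto)
    then show ?thesis by blast
  qed
  consider "T = T0" | "T = T1" | "T = T2" | "T = T3" using assms(1) by auto
  then show ?thesis
  proof cases
    case 1
    show ?thesis
      by (rule three[OF tri[of 1 2] tri[of 3 4] tri[of 5 6]]) (simp_all add: 1 T0_def doubleton_eq_iff)
  next
    case 2
    show ?thesis
      by (rule three[OF tri[of 1 2] tri[of 3 4] fork[of 5 6 7]]) (simp_all add: 2 T1_def doubleton_eq_iff)
  next
    case 3
    show ?thesis
      by (rule three[OF tri[of 1 2] fork[of 3 4 5] fork[of 6 7 8]]) (simp_all add: 3 T2_def doubleton_eq_iff)
  next
    case 4
    show ?thesis
      by (rule three[OF fork[of 1 2 3] fork[of 4 5 6] fork[of 7 8 9]]) (simp_all add: 4 T3_def doubleton_eq_iff)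
  qed
qed

lemma contains_iff_petals:
  "(\<forall>T\<in>{T0, T1, T2, T3}. \<not> contains_induced G T) \<longleftrightarrow> (\<forall>v. card (petals (blocks G) v) \<le> 2)"
proof -
  have "(\<exists>T\<in>{T0, T1, T2, T3}. contains_induced G T) \<longleftrightarrow> (\<exists>v. 3 \<le> card (petals (blocks G) v))"
    using petals_contains contains_petals by blast
  moreover have "3 \<le> n \<longleftrightarrow> \<not> n \<le> 2" for n :: nat by auto
  ultimately show ?thesis by blast
qed

end

text \<open>A walk through a vertex of L can take the edge between its two neighbours instead. This
  serves for removing all vertices of degree 1 at once and for removing one vertex with complete
  neighbourhood.\<close>

lemma reach_remove_simplicial:
  assumes simp: "simple_graph H" and L: "L \<subseteq> vset H"
    and cl: "\<And>l x y. l \<in> L \<Longrightarrow> adj H l x \<Longrightarrow> adj H l y \<Longrightarrow> x \<noteq> y \<Longrightarrow> adj H x y"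
    and indep: "\<And>l x. l \<in> L \<Longrightarrow> adj H l x \<Longrightarrow> x \<notin> L"
    and ab: "(a, b) \<in> reach H" "a \<notin> L" "b \<notin> L"
  shows "(a, b) \<in> reach (induced H (vset H - L))"
proof -
  let ?H = "induced H (vset H - L)"
  have st: "(x, y) \<in> reach ?H" if "adj H x y" "x \<notin> L" "y \<notin> L" for x y
    using that adjD[OF simp that(1)] by (intro reach_adj) (auto simp: adj_induced)
  have "(a, b) \<in> {(x, y). adj H x y}\<^sup>*" using ab(1) by (simp add: reach_iff)
  \<comment> \<open>The second half of the invariant keeps the neighbour outside L from which the
    walk has entered L.\<close>
  then have "(b \<notin> L \<longrightarrow> (a, b) \<in> reach ?H) \<and> (b \<in> L \<longrightarrow> (\<exists>u. adj H u b \<and> u \<notin> L \<and> (a, u) \<in> reach ?H))"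
  proof (induction rule: rtrancl_induct)
    case base
    have "a \<in> vset ?H" using ab by (auto simp: reach_iff)
    then have "(a, a) \<in> reach ?H" by (simp add: reach_iff)
    then show ?case using ab(2) by simp
  next
    case (step y z)
    have yz: "adj H y z" using step(2) by simp
    show ?case
    proof (cases "y \<in> L")
      case False
      then have ay: "(a, y) \<in> reach ?H" using step.IH by blast
      show ?thesis
      proof (cases "z \<in> L")
        case True
        then show ?thesis using ay yz False by blast
      next
        case F: False
        then show ?thesis using reach_trans[OF ay st[OF yz False F]] by blast
      qed
    next
      case True
      then obtain u where u: "adj H u y" "u \<notin> L" "(a, u) \<in> reach ?H" using step.IH by blast
      have zL: "z \<notin> L" using indep[OF True yz] .
      have "(a, z) \<in> reach ?H"
      proof (cases "u = z")
        case False
        have "adj H u z" by (rule cl[OF True _ yz False]) (use u(1) in \<open>simp add: insert_commute\<close>)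
        then show ?thesis using reach_trans[OF u(3) st] u(2) zL by blast
      qed (use u in simp)
      then show ?thesis using zL by blast
    qed
  qed
  then show ?thesis using ab(3) by blast
qed

section \<open>Vertices of degree 1 and the graph that remains without them\<close>

context
  fixes G :: "'a graph"
  assumes simp: "simple_graph G" and bg: "block_graph G" and conn: "connected_graph G" and n2: "2 \<le> card (vset G)"
begin

lemma nbr_exists:
  assumes "v \<in> vset G"
  shows "\<exists>u. adj G v u"
proof -
  have "\<exists>w\<in>vset G. w \<noteq> v"
  proof (rule ccontr)
    assume "\<not> ?thesis"
    then have "vset G \<subseteq> {v}" by blast
    then have "card (vset G) \<le> card {v}" by (rule card_mono[rotated]) simp
    then show False using n2 by simp
  qed
  then obtain w where w: "w \<in> vset G" "w \<noteq> v" by blast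
  then have "(v, w) \<in> {(a, b). adj G a b}\<^sup>*" using conn assms by (auto simp: connected_graph_def reach_iff)
  then show ?thesis using w(2) by (cases rule: converse_rtranclE) auto
qed

lemma Union_blocks: "\<Union>(blocks G) = vset G"
  using blocks_sub[OF simp] nbr_exists adj_block[OF simp] by blast

lemma max_clique_at: "v \<in> W \<Longrightarrow> max_clique G W \<longleftrightarrow> W \<in> blocks G"
proof
  assume v: "v \<in> W" and W: "max_clique G W"
  then have vV: "v \<in> vset G" by (auto simp: max_clique_def clique_def)
  obtain u where u: "adj G v u" using nbr_exists[OF vV] by blast
  have fin: "finite W" using W finite_vset[OF simp] finite_subset by (auto simp: max_clique_def clique_def)
  have "\<not> W \<subseteq> {v}"
  proof
    assume "W \<subseteq> {v}"
    then have "W \<subseteq> {v, u}" by auto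
    moreover have "clique G {v, u}" using u adjD[OF simp u] by (auto simp: clique_def insert_commute)
    ultimately have "{v, u} = W" using W by (auto simp: max_clique_def)
    then show False using \<open>W \<subseteq> {v}\<close> adjD[OF simp u] by auto
  qed
  then obtain x where x: "x \<in> W" "x \<noteq> v" by auto
  have "card {v, x} \<le> card W" by (rule card_mono[OF fin]) (use x v in auto)
  then show "W \<in> blocks G" using W x by (simp add: blocks_def)
qed (simp add: blocks_def)

lemma max_cliques_at: "{W. max_clique G W \<and> v \<in> W} = {B \<in> blocks G. v \<in> B}"
  using max_clique_at by blast

lemma cdeg_eq: "cdeg G v = hdeg (blocks G) v"
  unfolding cdeg_def hdeg_def max_cliques_at ..

lemma num_inner_eq: "num_inner G = card (hinner (blocks G))"
proof -
  have "{v. inner_vertex G v} = hinner (blocks G)"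
    using hinner_sub[OF bergeD(1)[OF berge_blocks[OF simp bg]]] by (auto simp: inner_vertex_def cdeg_eq hinner_def Union_blocks)
  then show ?thesis by (simp add: num_inner_def)
qed

lemma vertex_degree_eq:
  assumes "v \<in> vset G"
  shows "vertex_degree G v = hpd {B \<in> blocks G. v \<in> B}"
proof -
  have vU: "v \<in> \<Union>(blocks G)" using assms Union_blocks by simp
  have "{u \<in> vset G. adj G u v} = \<Union>{B \<in> blocks G. v \<in> B} - {v}"
    using adj_iff[OF simp] blocks_sub[OF simp] by blast
  then have "vertex_degree G v = card (\<Union>{B \<in> blocks G. v \<in> B} - {v})" by (simp add: vertex_degree_def)
  moreover have "v \<in> \<Union>{B \<in> blocks G. v \<in> B}" using vU by blast
  ultimately show ?thesis using card_star_set[OF berge_blocks[OF simp bg] vU] finite_star_set[OF berge_blocks[OF simp bg] vU] by (simp add: card_Diff_singleton)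
qed

lemma leaf_block:
  assumes v: "v \<in> vset G" "vertex_degree G v = 1" and B: "B \<in> blocks G" "v \<in> B"
  shows "card B = 2" "hdeg (blocks G) v = 1"
proof -
  let ?S = "{B \<in> blocks G. v \<in> B}"
  have fin: "finite ?S" using bergeD(1)[OF berge_blocks[OF simp bg]] by simp
  have h: "hpd ?S = 1" using vertex_degree_eq[OF v(1)] v(2) by simp
  have "card ?S = (\<Sum>B\<in>?S. 1)" by simp
  also have "\<dots> \<le> hpd ?S" unfolding hpd_def by (rule sum_mono) (use bergeD(3)[OF berge_blocks[OF simp bg]] in fastforce)
  finally have le: "card ?S \<le> 1" using h by simp
  moreover have "B \<in> ?S" using B by simp
  ultimately have S: "?S = {B}" using card_le_Suc0_iff_eq[OF fin] by (auto simp: One_nat_def)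
  show "hdeg (blocks G) v = 1" unfolding hdeg_def S by simp
  show "card B = 2" using h bergeD(3)[OF berge_blocks[OF simp bg] B(1)] unfolding S by (simp add: hpd_def)
qed

lemma leafI:
  assumes v: "v \<in> vset G" "hdeg (blocks G) v = 1" and B: "B \<in> blocks G" "v \<in> B" "card B = 2"
  shows "vertex_degree G v = 1"
proof -
  have fin: "finite {B \<in> blocks G. v \<in> B}" using bergeD(1)[OF berge_blocks[OF simp bg]] by simp
  have "{B \<in> blocks G. v \<in> B} = {B}" using v(2) B fin unfolding hdeg_def by (metis (no_types, lifting) card_1_singletonE mem_Collect_eq singletonD)
  then show ?thesis using vertex_degree_eq[OF v(1)] B(3) by (simp add: hpd_def)
qed

text \<open>The set P of condition (iii).\<close>

definition core :: "'a set" where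
  "core = {v \<in> vset G. vertex_degree G v \<noteq> 1}"

lemma leaf_nbr_unique:
  assumes l: "l \<in> vset G" "l \<notin> core" and a: "adj G l x" "adj G l y"
  shows "x = y"
proof -
  have d: "vertex_degree G l = 1" using l by (simp add: core_def)
  obtain B where B: "B \<in> blocks G" "l \<in> B" "x \<in> B" using adj_block[OF simp a(1)] by blast
  obtain D where D: "D \<in> blocks G" "l \<in> D" "y \<in> D" using adj_block[OF simp a(2)] by blast
  have fin: "finite {B \<in> blocks G. l \<in> B}" using bergeD(1)[OF berge_blocks[OF simp bg]] by simp
  have "B = D" using leaf_block(2)[OF l(1) d B(1,2)] B D fin unfolding hdeg_def
    by (metis (no_types, lifting) card_1_singletonE mem_Collect_eq singletonD)
  then show ?thesis
    using leaf_block(1)[OF l(1) d B(1,2)] B D adjD[OF simp a(1)] adjD[OF simp a(2)] by (auto simp: card_2_iff)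
qed

lemma core_reach:
  assumes u: "u \<in> core" and w: "w \<in> core"
  shows "(u, w) \<in> reach (induced G core)"
proof -
  have eq: "vset G - (vset G - core) = core" by (auto simp: core_def)
  have "(u, w) \<in> reach (induced G (vset G - (vset G - core)))"
  proof (rule reach_remove_simplicial[OF simp])
    show "(u, w) \<in> reach G" using conn u w by (auto simp: connected_graph_def core_def)
    show "adj G x y" if "l \<in> vset G - core" "adj G l x" "adj G l y" "x \<noteq> y" for l x y
      using leaf_nbr_unique[of l x y] that by blast
    \<comment> \<open>Two adjacent vertices of degree 1 would form a whole component, but u lies in
      the core and G is connected.\<close>
    show "x \<notin> vset G - core" if l: "l \<in> vset G - core" "adj G l x" for l x
    proof
      assume x: "x \<in> vset G - core"
      have "(l, u) \<in> {(a, b). adj G a b}\<^sup>*" using conn l u by (auto simp: connected_graph_def reach_iff core_def)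
      then have "u \<in> {l, x}"
      proof (induction rule: rtrancl_induct)
        case (step y z)
        have yz: "adj G y z" using step(2) by simp
        have xl: "adj G x l" using l(2) by (simp add: insert_commute)
        show ?case
        proof (cases "y = l")
          case True
          have "x = z" by (rule leaf_nbr_unique[of l]) (use l yz True in simp_all)
          then show ?thesis by simp
        next
          case False
          then have "y = x" using step.IH by simp
          then have "l = z" using leaf_nbr_unique[of x l z] x xl yz by simp
          then show ?thesis by simp
        qed
      qed simp
      then show False using u l x by auto
    qed
  qed (use u w in auto)
  then show ?thesis unfolding eq .
qed

definition core_blocks :: "'a \<Rightarrow> 'a set set" where
  "core_blocks v = {B \<in> blocks G. v \<in> B \<and> B \<subseteq> core}"

text \<open>A clique with a vertex of degree 1 is a single edge, so it has room for at most one
  vertex of the core.\<close>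

lemma block_in_core:
  assumes B: "B \<in> blocks G" and xy: "x \<in> B" "y \<in> B" "x \<noteq> y" "x \<in> core" "y \<in> core"
  shows "B \<subseteq> core"
proof (rule ccontr)
  assume "\<not> B \<subseteq> core"
  then obtain l where l: "l \<in> B" "l \<notin> core" by blast
  then have lV: "l \<in> vset G" using blocks_sub[OF simp B] by blast
  then have "card B = 2" using leaf_block(1)[OF lV _ B l(1)] l(2) by (simp add: core_def)
  moreover have "card {l, x, y} \<le> card B"
    by (rule card_mono) (use l xy bergeD(2)[OF berge_blocks[OF simp bg] B] in auto)
  moreover have "l \<noteq> x" "l \<noteq> y" using l xy by blast+
  then have "card {l, x, y} = 3" using xy(3) by simp
  ultimately show False by simp
qed

lemma core_blocks_adj:
  assumes "adj (induced G core) v x"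
  shows "\<exists>B\<in>core_blocks v. x \<in> B"
proof -
  have a: "adj G v x" "v \<in> core" "x \<in> core" using assms by (auto simp: adj_induced)
  obtain B where B: "B \<in> blocks G" "v \<in> B" "x \<in> B" using adj_block[OF simp a(1)] by blast
  have "v \<noteq> x" using adjD[OF simp a(1)] by blast
  then have "B \<subseteq> core" using block_in_core[OF B(1), of v x] B a by blast
  then show ?thesis using B by (auto simp: core_blocks_def)
qed

text \<open>If no clique at v lies in the core, then \<open>{v}\<close> is a maximal clique of the
  core graph without being in \<open>core_blocks v\<close>; the second hypothesis excludes this
  case.\<close>

lemma max_clique_core:
  assumes v: "v \<in> core" and k: "core_blocks v \<noteq> {}"
  shows "{W. max_clique (induced G core) W \<and> v \<in> W} = core_blocks v"
proof (intro equalityI subsetI)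
  fix B assume "B \<in> core_blocks v"
  then have B: "B \<in> blocks G" "v \<in> B" "B \<subseteq> core" by (auto simp: core_blocks_def)
  then have "max_clique (induced G core) B"
    unfolding max_clique_def clique_induced by (auto simp: blocks_def max_clique_def)
  then show "B \<in> {W. max_clique (induced G core) W \<and> v \<in> W}" using B by simp
next
  fix W assume "W \<in> {W. max_clique (induced G core) W \<and> v \<in> W}"
  then have W: "max_clique (induced G core) W" "v \<in> W" by auto
  then have cW: "clique G W" "W \<subseteq> core" by (auto simp: max_clique_def clique_induced)
  obtain B' where B': "max_clique G B'" "W \<subseteq> B'" using max_clique_extend[OF simp cW(1)] by blast
  have bl: "B' \<in> blocks G" using max_clique_at[of v B'] B' W by blast
  have "\<exists>x\<in>W. x \<noteq> v"
  proof (rule ccontr)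
    assume "\<not> ?thesis"
    then have Wv: "W = {v}" using W by blast
    obtain B where B: "B \<in> blocks G" "v \<in> B" "B \<subseteq> core" using k by (auto simp: core_blocks_def)
    have "clique (induced G core) B" unfolding clique_induced using B by (auto simp: blocks_def max_clique_def)
    then have "B = W" using W(1) B Wv by (auto simp: max_clique_def)
    then show False using bergeD(3)[OF berge_blocks[OF simp bg] B(1)] Wv by simp
  qed
  then obtain x where x: "x \<in> W" "x \<noteq> v" by blast
  have "B' \<subseteq> core" by (rule block_in_core[OF bl, of x v]) (use x W B' cW in auto)
  then have "clique (induced G core) B'" unfolding clique_induced using bl by (auto simp: blocks_def max_clique_def)
  then have "B' = W" using W(1) B'(2) by (auto simp: max_clique_def)
  then show "W \<in> core_blocks v" using bl \<open>B' \<subseteq> core\<close> W by (simp add: core_blocks_def)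
qed

lemma finite_core_blocks: "finite (core_blocks v)"
  using bergeD(1)[OF berge_blocks[OF simp bg]] by (simp add: core_blocks_def)

lemma core_sub: "core \<subseteq> vset G"
  by (auto simp: core_def)

text \<open>Two cliques at v are separated by the removal of v. If there is at most one, the
  neighbours of v in the core are pairwise adjacent and v can be bypassed.\<close>

lemma cutpoint_core_iff:
  assumes v: "v \<in> core"
  shows "cutpoint (induced G core) v \<longleftrightarrow> 2 \<le> card (core_blocks v)"
proof
  let ?H = "induced G core"
  have vH: "vset ?H = core" using core_sub by auto
  have connH: "connected_graph ?H" unfolding connected_graph_def vH using core_reach v by blast
  {
    assume "2 \<le> card (core_blocks v)"
    then obtain B1 B2 where B: "B1 \<in> core_blocks v" "B2 \<in> core_blocks v" "B1 \<noteq> B2"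
      by (metis card_le_Suc0_iff_eq[OF finite_core_blocks] not_less_eq_eq numeral_2_eq_2)
    have B': "B1 \<in> blocks G" "B2 \<in> blocks G" "v \<in> B1" "v \<in> B2" "B1 \<subseteq> core" "B2 \<subseteq> core" using B by (auto simp: core_blocks_def)
    obtain x where x: "x \<in> B1" "x \<noteq> v" using other_point[OF simp bg B'(1)] by blast
    obtain y where y: "y \<in> B2" "y \<noteq> v" using other_point[OF simp bg B'(2)] by blast
    let ?K = "induced ?H (vset ?H - {v})"
    have K: "?K = induced G (core - {v})" unfolding vH induced_induced by (rule arg_cong[of _ _ "induced G"]) auto
    have "(x, y) \<notin> reach (induced G (vset G - {v}))"
      by (rule separation[OF simp bg B'(1,2) B(3) B'(3,4) x y])
    \<comment> \<open>Separation is known in G - v and passes to its subgraph on the core.\<close>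
    moreover have "{(a, b). adj (induced G (core - {v})) a b} \<subseteq> {(a, b). adj (induced G (vset G - {v})) a b}"
      using core_sub by (auto simp: adj_induced)
    then have "{(a, b). adj (induced G (core - {v})) a b}\<^sup>* \<subseteq> {(a, b). adj (induced G (vset G - {v})) a b}\<^sup>*"
      by (rule rtrancl_mono)
    ultimately have "(x, y) \<notin> reach ?K"
      unfolding K using core_sub by (auto simp: reach_iff)
    moreover have "x \<in> vset ?K" "y \<in> vset ?K" using x y B' core_sub by auto
    moreover have "finite (vset ?K)" using finite_vset[OF simp] by simp
    ultimately have "2 \<le> num_components ?K" by (intro num_components_ge_2)
    then show "cutpoint ?H v" using num_components_connected[OF connH] v vH by (simp add: cutpoint_def)
  }
  assume cut: "cutpoint ?H v"
  show "2 \<le> card (core_blocks v)"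
  proof (rule ccontr)
    assume "\<not> 2 \<le> card (core_blocks v)"
    then have one: "B = D" if "B \<in> core_blocks v" "D \<in> core_blocks v" for B D
      using that card_le_Suc0_iff_eq[OF finite_core_blocks, of v] by auto
    have "\<not> cutpoint ?H v"
    proof (rule not_cutpointI[OF connH])
      fix x y assume xy: "x \<in> vset ?H - {v}" "y \<in> vset ?H - {v}"
      show "(x, y) \<in> reach (induced ?H (vset ?H - {v}))"
      proof (rule reach_remove_simplicial[OF simple_induced[OF simp]])
        show "(x, y) \<in> reach ?H" using xy core_reach vH by blast
        show "adj ?H c d" if h: "l \<in> {v}" "adj ?H l c" "adj ?H l d" "c \<noteq> d" for l c d
        proof -
          obtain B where B: "B \<in> core_blocks v" "c \<in> B" using core_blocks_adj[of v c] h by blast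
          obtain D where D: "D \<in> core_blocks v" "d \<in> D" using core_blocks_adj[of v d] h by blast
          have "B = D" using one[OF B(1) D(1)] .
          then have "adj G c d" using block_adj[OF simp, of B c d] B D h(4) by (auto simp: core_blocks_def)
          then show ?thesis using h by (auto simp: adj_induced)
        qed
        show "c \<notin> {v}" if "l \<in> {v}" "adj ?H l c" for l c
          using that adjD[OF simple_induced[OF simp, of core]] by blast
      qed (use xy v vH in auto)
    qed
    then show False using cut by blast
  qed
qed

text \<open>The two parts are v together with everything reachable in G - v from the first clique,
  and the rest together with v. Each part keeps exactly one of the two cliques at v.\<close>

lemma decomposable_hdeg_2:
  assumes d: "hdeg (blocks G) v = 2"
  shows "decomposable G"
proof -
  have "card {B \<in> blocks G. v \<in> B} = 2" using d by (simp add: hdeg_def)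
  then obtain B1 B2 where S: "{B \<in> blocks G. v \<in> B} = {B1, B2}" "B1 \<noteq> B2" by (auto simp: card_2_iff)
  then have B: "B1 \<in> blocks G" "B2 \<in> blocks G" "v \<in> B1" "v \<in> B2" by blast+
  have vV: "v \<in> vset G" using blocks_sub[OF simp B(1)] B(3) by blast
  let ?H = "induced G (vset G - {v})"
  define R where "R = {x. \<exists>a\<in>B1 - {v}. (a, x) \<in> reach ?H}"
  have RV: "R \<subseteq> vset G - {v}" by (auto simp: R_def reach_iff)
  have B1R: "B1 - {v} \<subseteq> R"
  proof
    fix x assume x: "x \<in> B1 - {v}"
    then have "(x, x) \<in> reach ?H" using blocks_sub[OF simp B(1)] by (auto simp: reach_iff)
    then show "x \<in> R" using x by (auto simp: R_def)
  qed
  have B2R: "x \<notin> R" if "x \<in> B2" "x \<noteq> v" for x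
    using separation[OF simp bg B(1,2) S(2) B(3,4)] that by (auto simp: R_def)
  have closed: "y \<in> R" if "x \<in> R" "adj G x y" "y \<noteq> v" for x y
  proof -
    have "(x, y) \<in> reach ?H" using that RV adjD[OF simp that(2)] by (intro reach_adj) (auto simp: adj_induced)
    then show ?thesis using that(1) reach_trans by (force simp: R_def)
  qed
  have at_v: "B = B1 \<or> B = B2" if "B \<in> blocks G" "v \<in> B" for B using S(1) that by blast
  define V1 V2 where "V1 = insert v R" and "V2 = vset G - R"
  have V12: "V1 \<subseteq> vset G" "V2 \<subseteq> vset G" "v \<in> V1" "v \<in> V2" "V1 \<inter> V2 = {v}" "V1 \<union> V2 = vset G"
    using RV vV by (auto simp: V1_def V2_def)
  \<comment> \<open>A part that contains C - v and meets D only in v has C as its only maximal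
    clique at v.\<close>
  have sides: "{B \<in> blocks G. v \<in> B} = {C, D} \<Longrightarrow> C - {v} \<subseteq> U \<Longrightarrow> D \<inter> U = {v} \<Longrightarrow> v \<in> U \<Longrightarrow> U \<subseteq> vset G \<Longrightarrow> free_vertex (induced G U) v"
    for C D U
  proof -
    assume CD: "{B \<in> blocks G. v \<in> B} = {C, D}" and CU: "C - {v} \<subseteq> U" and DU: "D \<inter> U = {v}" and vU: "v \<in> U" "U \<subseteq> vset G"
    have C: "C \<in> blocks G" "v \<in> C" using CD by blast+
    have CU': "C \<subseteq> U" using CU vU by blast
    have clC: "clique (induced G U) C" unfolding clique_induced using C CU' by (auto simp: blocks_def max_clique_def)
    have sub: "W \<subseteq> C" if W: "clique (induced G U) W" "v \<in> W" for W
    proof -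
      have cW: "clique G W" "W \<subseteq> U" using W by (auto simp: clique_induced)
      obtain B where B: "max_clique G B" "W \<subseteq> B" using max_clique_extend[OF simp cW(1)] by blast
      then have "B \<in> {B \<in> blocks G. v \<in> B}" using max_clique_at[of v B] W(2) by blast
      then have "B = C \<or> B = D" unfolding CD by blast
      then show ?thesis
      proof
        assume "B = D"
        then have "W \<subseteq> D \<inter> U" using B(2) cW(2) by blast
        then show ?thesis unfolding DU using C(2) by blast
      qed (use B(2) in simp)
    qed
    have "{W. max_clique (induced G U) W \<and> v \<in> W} = {C}"
      using sub clC C(2) unfolding max_clique_def by blast
    then show ?thesis using vU by (simp add: free_vertex_def cdeg_def subset_iff)
  qed
  have f1: "free_vertex (induced G V1) v"
    by (rule sides[OF S(1)]) (use B1R B2R B V12 in \<open>auto simp: V1_def\<close>)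
  have f2: "free_vertex (induced G V2) v"
  proof (rule sides[of B2 B1])
    show "{B \<in> blocks G. v \<in> B} = {B2, B1}" using S(1) by blast
    show "B2 - {v} \<subseteq> V2" using B2R blocks_sub[OF simp B(2)] by (auto simp: V2_def)
    show "B1 \<inter> V2 = {v}" using B1R V12(4) B(3) by (auto simp: V2_def)
  qed (use V12 in auto)
  have one: "card (vset (induced G U)) \<noteq> 1" if "U \<subseteq> vset G" "x \<in> U" "x \<noteq> v" "v \<in> U" for U x
  proof
    assume "card (vset (induced G U)) = 1"
    then obtain z where "vset G \<inter> U = {z}" by (auto simp: card_1_singleton_iff)
    then show False using that by (metis Int_absorb1 singletonD)
  qed
  obtain x where x: "x \<in> B1" "x \<noteq> v" using other_point[OF simp bg B(1)] by blast
  obtain y where y: "y \<in> B2" "y \<noteq> v" using other_point[OF simp bg B(2)] by blast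
  have c1: "card (vset (induced G V1)) \<noteq> 1" by (rule one[OF V12(1) _ x(2) V12(3)]) (use x B1R in \<open>auto simp: V1_def\<close>)
  have c2: "card (vset (induced G V2)) \<noteq> 1"
    by (rule one[OF V12(2) _ y(2) V12(4)]) (use y B2R blocks_sub[OF simp B(2)] in \<open>auto simp: V2_def\<close>)
  have edges: "eset G = eset (induced G V1) \<union> eset (induced G V2)"
  proof (intro equalityI subsetI)
    fix e assume e: "e \<in> eset G"
    then have "card e = 2" using simp by (auto simp: simple_graph_def)
    then obtain p q where pq: "e = {p, q}" "p \<noteq> q" by (auto simp: card_2_iff)
    have key: "{p, q} \<subseteq> V1 \<or> {p, q} \<subseteq> V2" if a: "adj G p q" and pv: "p \<noteq> v" for p q
    proof (cases "q = v")
      case True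
      obtain B where B': "B \<in> blocks G" "p \<in> B" "q \<in> B" using adj_block[OF simp a] by blast
      then have "B = B1 \<or> B = B2" using at_v True by blast
      then show ?thesis using B' B1R B2R pv True V12 blocks_sub[OF simp B(2)] by (auto simp: V1_def V2_def)
    next
      case False
      have "q \<in> R \<longleftrightarrow> p \<in> R" using closed[of p q] closed[of q p] a pv False by (auto simp: insert_commute)
      then show ?thesis using adjD[OF simp a] by (auto simp: V1_def V2_def)
    qed
    have "{p, q} \<subseteq> V1 \<or> {p, q} \<subseteq> V2"
    proof (cases "p = v")
      case True
      then show ?thesis using key[of q p] e pq by (auto simp: insert_commute)
    next
      case False
      then show ?thesis using key[of p q] e pq by auto
    qed
    then show "e \<in> eset (induced G V1) \<union> eset (induced G V2)" using e pq by (auto simp: induced_def)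
  qed (auto simp: induced_def)
  show ?thesis
    unfolding decomposable_def
    by (intro exI[of _ "induced G V1"] exI[of _ "induced G V2"] exI[of _ v] conjI)
      (use subgraph_induced[OF simp] c1 c2 edges V12 f1 f2 in auto)
qed

text \<open>A vertex of degree 1 lies in one clique only, of size 2, so it lies in no petal at a
  core vertex. Conversely, let \<open>{v, u}\<close> be a clique in the core. Then u lies in more
  than one clique; two cliques would make G decomposable, so there are at least three.\<close>

lemma petals_eq_core_blocks:
  assumes indec: "\<not> decomposable G" and v: "v \<in> core"
  shows "petals (blocks G) v = core_blocks v"
proof (intro equalityI subsetI)
  fix B assume "B \<in> petals (blocks G) v"
  then have B: "B \<in> blocks G" "v \<in> B" "3 \<le> card B \<or> (\<exists>u. B = {v, u} \<and> 3 \<le> hdeg (blocks G) u)" by (auto simp: petals_def)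
  have "x \<in> core" if x: "x \<in> B" for x
  proof (rule ccontr)
    assume n: "x \<notin> core"
    have xV: "x \<in> vset G" using blocks_sub[OF simp B(1)] x by blast
    have dx: "vertex_degree G x = 1" using xV n by (simp add: core_def)
    have "card B = 2" "hdeg (blocks G) x = 1" using leaf_block[OF xV dx B(1) x] by auto
    then show False using B(3) x n v by auto
  qed
  then show "B \<in> core_blocks v" using B by (auto simp: core_blocks_def)
next
  fix B assume "B \<in> core_blocks v"
  then have B: "B \<in> blocks G" "v \<in> B" "B \<subseteq> core" by (auto simp: core_blocks_def)
  show "B \<in> petals (blocks G) v"
  proof (cases "3 \<le> card B")
    case True
    then show ?thesis using B by (simp add: petals_def)
  next
    case False
    then have c2: "card B = 2" using bergeD(3)[OF berge_blocks[OF simp bg] B(1)] by simp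
    then obtain u where u: "B = {v, u}" "u \<noteq> v" using B(2) by (auto simp: card_2_iff doubleton_eq_iff)
    have uP: "u \<in> core" "u \<in> vset G" using u B(3) core_sub by auto
    have "hdeg (blocks G) u \<noteq> 1" using leafI[OF uP(2) _ B(1) _ c2] uP u by (auto simp: core_def)
    moreover have "hdeg (blocks G) u \<noteq> 2" using decomposable_hdeg_2 indec by blast
    moreover have "0 < hdeg (blocks G) u" using hdeg_pos_iff[OF bergeD(1)[OF berge_blocks[OF simp bg]], of u] uP Union_blocks by simp
    ultimately show ?thesis using B u by (auto simp: petals_def)
  qed
qed

lemma cutpoints_iff_petals:
  assumes indec: "\<not> decomposable G"
  shows "(\<forall>v. cutpoint (induced G core) v \<longrightarrow> card {W. max_clique (induced G core) W \<and> v \<in> W} = 2) \<longleftrightarrow>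
    (\<forall>v. card (petals (blocks G) v) \<le> 2)"
proof (intro iffI allI impI)
  fix v assume h: "\<forall>v. cutpoint (induced G core) v \<longrightarrow> card {W. max_clique (induced G core) W \<and> v \<in> W} = 2"
  show "card (petals (blocks G) v) \<le> 2"
  proof (rule ccontr)
    assume n: "\<not> card (petals (blocks G) v) \<le> 2"
    then have "petals (blocks G) v \<noteq> {}" by auto
    then have vV: "v \<in> vset G" using Union_blocks by (auto simp: petals_def)
    \<comment> \<open>A vertex of degree 1 lies in one clique and cannot have three petals.\<close>
    have vP: "v \<in> core"
    proof (rule ccontr)
      assume "v \<notin> core"
      then have d: "vertex_degree G v = 1" using vV by (simp add: core_def)
      obtain B where "B \<in> blocks G" "v \<in> B" using \<open>petals (blocks G) v \<noteq> {}\<close> by (auto simp: petals_def)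
      then have "hdeg (blocks G) v = 1" using leaf_block(2)[OF vV d] by blast
      then show False using n petals_le_hdeg[OF bergeD(1)[OF berge_blocks[OF simp bg]], of v] by simp
    qed
    have k: "3 \<le> card (core_blocks v)" using n petals_eq_core_blocks[OF indec vP] by simp
    then have "cutpoint (induced G core) v" using cutpoint_core_iff[OF vP] by simp
    moreover have "core_blocks v \<noteq> {}" using k by auto
    ultimately show False using h max_clique_core[OF vP] k by auto
  qed
next
  fix v assume h: "\<forall>v. card (petals (blocks G) v) \<le> 2" and cut: "cutpoint (induced G core) v"
  then have vP: "v \<in> core" using core_sub by (auto simp: cutpoint_def)
  have k: "2 \<le> card (core_blocks v)" using cut cutpoint_core_iff[OF vP] by simp
  then have "core_blocks v \<noteq> {}" by auto
  moreover have "card (core_blocks v) \<le> 2" using h petals_eq_core_blocks[OF indec vP] by metis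
  ultimately show "card {W. max_clique (induced G core) W \<and> v \<in> W} = 2" using max_clique_core[OF vP] k by simp
qed

end

section \<open>Betti numbers of the binomial edge ideal of a block graph\<close>

lemma hcomp_mult_left:
  assumes "finite D" "degs q \<subseteq> D"
  shows "hcomp d (q * p) = (\<Sum>e\<in>D. hcomp e q * hcomp (d - e) p)"
proof -
  have "hcomp d (q * p) = hcomp d (\<Sum>e\<in>D. hcomp e q * p)"
    using hcomp_decompose[OF assms] by (metis sum_distrib_right)
  also have "\<dots> = (\<Sum>e\<in>D. hcomp e q * hcomp (d - e) p)"
    unfolding hcomp_sum by (rule sum.cong[OF refl]) (rule hcomp_mult[OF homogeneous_hcomp])
  finally show ?thesis .
qed

lemma poly_ring_sel:
  fixes p q :: "('k::comm_ring_1) mpoly"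
  shows "p \<otimes>\<^bsub>poly_ring V\<^esub> q = p * q" "p \<oplus>\<^bsub>poly_ring V\<^esub> q = p + q"
    "\<zero>\<^bsub>poly_ring V\<^esub> = (0 :: 'k mpoly)" "\<one>\<^bsub>poly_ring V\<^esub> = (1 :: 'k mpoly)"
  by (simp_all add: poly_ring_def)

lemma carrier_uminus: "p \<in> carrier (poly_ring V) \<Longrightarrow> - p \<in> carrier (poly_ring V)"
  by (simp add: carrier_iff keys_def)

text \<open>Translates the locale of ideals into closure conditions on sets of polynomials, the form
  used for \<open>homog_ideal\<close>.\<close>

lemma ideal_poly_ring_iff:
  fixes I :: "('k::comm_ring_1) mpoly set"
  shows "ideal I (poly_ring V) \<longleftrightarrow>
    I \<subseteq> carrier (poly_ring V) \<and> 0 \<in> I \<and> (\<forall>p\<in>I. \<forall>q\<in>I. p - q \<in> I) \<and>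
    (\<forall>p\<in>I. \<forall>q\<in>carrier (poly_ring V). q * p \<in> I)"
proof
  let ?S = "poly_ring V :: 'k mpoly ring"
  have cr: "cring ?S" by (rule cring_poly_ring)
  have inv: "\<ominus>\<^bsub>?S\<^esub> p = - p" if "p \<in> carrier ?S" for p
  proof -
    interpret cring ?S by (rule cr)
    have "(- p) \<oplus>\<^bsub>?S\<^esub> p = \<zero>\<^bsub>?S\<^esub>" by (simp add: poly_ring_sel)
    then show ?thesis using minus_equality[OF _ that carrier_uminus[OF that]] by simp
  qed
  {
    assume I: "ideal I ?S"
    interpret ideal I ?S by (rule I)
    have sub: "I \<subseteq> carrier ?S" using Icarr by blast
    moreover have "0 \<in> I" using additive_subgroup.zero_closed[OF is_additive_subgroup] unfolding poly_ring_sel .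
    moreover have "p - q \<in> I" if "p \<in> I" "q \<in> I" for p q
      using additive_subgroup.a_closed[OF is_additive_subgroup that(1)]
        additive_subgroup.a_inv_closed[OF is_additive_subgroup that(2)] inv[of q] sub that(2)
      by (fastforce simp: poly_ring_sel)
    moreover have "q * p \<in> I" if "p \<in> I" "q \<in> carrier ?S" for p q
      using I_l_closed[OF that] by (simp add: poly_ring_sel)
    ultimately show "I \<subseteq> carrier ?S \<and> 0 \<in> I \<and> (\<forall>p\<in>I. \<forall>q\<in>I. p - q \<in> I) \<and>
      (\<forall>p\<in>I. \<forall>q\<in>carrier ?S. q * p \<in> I)" by blast
  }
  assume h: "I \<subseteq> carrier ?S \<and> 0 \<in> I \<and> (\<forall>p\<in>I. \<forall>q\<in>I. p - q \<in> I) \<and>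
      (\<forall>p\<in>I. \<forall>q\<in>carrier ?S. q * p \<in> I)"
  then have sub: "I \<subseteq> carrier ?S" and z: "0 \<in> I" and d: "\<And>p q. p \<in> I \<Longrightarrow> q \<in> I \<Longrightarrow> p - q \<in> I"
    and m: "\<And>p q. p \<in> I \<Longrightarrow> q \<in> carrier ?S \<Longrightarrow> q * p \<in> I" by blast+
  have neg: "- p \<in> I" if "p \<in> I" for p using d[OF z that] by simp
  have add: "p + q \<in> I" if "p \<in> I" "q \<in> I" for p q using d[OF that(1) neg[OF that(2)]] by simp
  show "ideal I ?S"
  proof (rule idealI)
    show "ring ?S" using cr by (simp add: cring_def)
    show "subgroup I (add_monoid ?S)"
    proof (rule group.subgroupI)
      show "Group.group (add_monoid ?S)" by (rule abelian_group.a_group) (use cr in \<open>simp add: cring_def ring_def\<close>)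
      show "I \<subseteq> carrier (add_monoid ?S)" using sub by simp
      show "I \<noteq> {}" using z by blast
      show "inv\<^bsub>add_monoid ?S\<^esub> a \<in> I" if "a \<in> I" for a
        using neg[OF that] inv[of a] sub that unfolding a_inv_def by auto
      show "a \<otimes>\<^bsub>add_monoid ?S\<^esub> b \<in> I" if "a \<in> I" "b \<in> I" for a b
        using add[OF that] by (simp add: poly_ring_def)
    qed
    show "x \<otimes>\<^bsub>?S\<^esub> a \<in> I" if "a \<in> I" "x \<in> carrier ?S" for a x
      using m[OF that] by (simp add: poly_ring_sel)
    show "a \<otimes>\<^bsub>?S\<^esub> x \<in> I" if "a \<in> I" "x \<in> carrier ?S" for a x
      using m[OF that] by (simp add: poly_ring_sel mult.commute)
  qed
qed

context
  fixes G :: "nat graph"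
  assumes simp: "simple_graph G"
begin

lemma bei_ideal: "ideal (binomial_edge_ideal G :: ('k::comm_ring_1) mpoly set) (poly_ring (vset G))"
  and bei_gen: "i \<noteq> j \<Longrightarrow> adj G i j \<Longrightarrow> (edge_poly i j :: 'k mpoly) \<in> binomial_edge_ideal G"
  and bei_minimal: "ideal I (poly_ring (vset G)) \<Longrightarrow>
    (\<And>i j. adj G i j \<Longrightarrow> (edge_poly i j :: 'k mpoly) \<in> I) \<Longrightarrow> binomial_edge_ideal G \<subseteq> I"
proof -
  let ?V = "vset G" and ?J = "binomial_edge_ideal G :: 'k mpoly set"
  let ?S = "poly_ring (vset G) :: 'k mpoly ring"
  interpret cring ?S by (rule cring_poly_ring)
  let ?E = "{var (X i) * var (Y j) - var (X j) * var (Y i) | i j. adj G i j \<and> i < j} :: 'k mpoly set"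
  have E: "?E \<subseteq> carrier ?S"
  proof
    fix p assume "p \<in> ?E"
    then obtain i j where ij: "p = edge_poly i j" "adj G i j" by (auto simp: edge_poly_def)
    then have "i \<in> ?V" "j \<in> ?V" using adjD[OF simp ij(2)] by auto
    then show "p \<in> carrier ?S" unfolding ij(1) by (intro hom_part_carrier[OF edge_hom_part])
  qed
  show id: "ideal ?J ?S" unfolding binomial_edge_ideal_def by (rule genideal_ideal[OF E])
  have lt: "edge_poly i j \<in> ?J" if "adj G i j" "i < j" for i j
    using genideal_self[OF E] that unfolding binomial_edge_ideal_def edge_poly_def by blast
  have neg: "- p \<in> ?J" if "p \<in> ?J" for p
  proof -
    have "0 - p \<in> ?J" using id that unfolding ideal_poly_ring_iff by blast
    then show ?thesis by simp
  qed
  show "edge_poly i j \<in> ?J" if "i \<noteq> j" "adj G i j"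
  proof (cases "i < j")
    case True
    then show ?thesis using lt that by blast
  next
    case False
    then have "edge_poly j i \<in> ?J" using that by (intro lt) (auto simp: insert_commute)
    then have "- edge_poly j i \<in> ?J" by (rule neg)
    then show ?thesis by (simp add: edge_poly_def)
  qed
  show "binomial_edge_ideal G \<subseteq> I" if I: "ideal I ?S" "\<And>i j. adj G i j \<Longrightarrow> edge_poly i j \<in> I"
    unfolding binomial_edge_ideal_def
    by (rule genideal_minimal[OF I(1)]) (use I(2) in \<open>auto simp: edge_poly_def\<close>)
qed

text \<open>The polynomials all of whose components lie in the pieces \<open>gid\<close> form an
  ideal \<open>U\<close> that contains the generators. So it contains the generated ideal, which is
  therefore homogeneous with exactly these pieces.\<close>

lemma bei_graded:
  shows "homog_ideal (vset G) (binomial_edge_ideal G :: ('k::comm_ring_1) mpoly set)"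
    and "igr (vset G) (binomial_edge_ideal G) d = gid (vset G) (hgens (blocks G) :: (int \<times> 'k mpoly) set) d"
proof -
  let ?V = "vset G" and ?J = "binomial_edge_ideal G :: 'k mpoly set"
  let ?H = "hgens (blocks G) :: (int \<times> 'k mpoly) set"
  have sub: "\<Union>(blocks G) \<subseteq> ?V" using blocks_sub[OF simp] by blast
  define U where "U = {p \<in> carrier (poly_ring ?V). \<forall>d. hcomp d p \<in> gid ?V ?H d}"
  have J: "?J \<subseteq> carrier (poly_ring ?V)" "0 \<in> ?J" "\<And>p q. p \<in> ?J \<Longrightarrow> q \<in> ?J \<Longrightarrow> p - q \<in> ?J"
    "\<And>p q. p \<in> ?J \<Longrightarrow> q \<in> carrier (poly_ring ?V) \<Longrightarrow> q * p \<in> ?J"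
    using bei_ideal[where 'k='k] unfolding ideal_poly_ring_iff by blast+
  have "ideal U (poly_ring ?V)"
    unfolding ideal_poly_ring_iff
  proof (intro conjI ballI)
    show "U \<subseteq> carrier (poly_ring ?V)" by (auto simp: U_def)
    show "0 \<in> U" by (simp add: U_def carrier_0 gid.zero)
    show "p - q \<in> U" if "p \<in> U" "q \<in> U" for p q
    proof -
      have "p + - q \<in> carrier (poly_ring ?V)" using that by (intro carrier_add carrier_uminus) (auto simp: U_def)
      then show ?thesis using that by (auto simp: U_def hcomp_diff intro: gid_diff)
    qed
    show "q * p \<in> U" if p: "p \<in> U" and q: "q \<in> carrier (poly_ring ?V)" for p q
    proof -
      have "hcomp d (q * p) \<in> gid ?V ?H d" for d
        unfolding hcomp_mult_left[OF finite_degs subset_refl]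
        using p hcomp_hom_part[OF q] by (intro gid_sum gid_mult_hom) (auto simp: U_def)
      then show ?thesis using carrier_mult[OF q] p by (simp add: U_def)
    qed
  qed
  moreover have "edge_poly i j \<in> U" if a: "adj G i j" for i j
  proof -
    have ij: "i \<in> ?V" "j \<in> ?V" using adjD[OF simp a] by auto
    have hp: "(edge_poly i j :: 'k mpoly) \<in> hom_part ?V 2" by (rule edge_hom_part[OF ij])
    then have hom: "homogeneous (edge_poly i j :: 'k mpoly) 2" by (simp add: hom_part_iff)
    have "(2, edge_poly i j) \<in> ?H" using adj_block[OF simp a] by (auto simp: hgens_def)
    then have "(edge_poly i j :: 'k mpoly) \<in> gid ?V ?H 2" by (rule gid_gen)
    then show ?thesis using hom_part_carrier[OF hp] by (simp add: U_def hcomp_homogeneous[OF hom] gid.zero)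
  qed
  ultimately have JU: "?J \<subseteq> U" by (rule bei_minimal)
  have gJ: "gid ?V ?H d \<subseteq> ?J" for d
  proof
    fix p assume "p \<in> gid ?V ?H d"
    then show "p \<in> ?J"
    proof (induction p rule: gid.induct)
      case (step p e g m c)
      obtain i j B where ij: "g = edge_poly i j" "B \<in> blocks G" "i \<in> B" "j \<in> B"
        using step(2) by (auto simp: hgens_def)
      have "g \<in> ?J"
      proof (cases "i = j")
        case True
        then show ?thesis using J(2) ij(1) by (simp add: edge_poly_def)
      next
        case False
        then show ?thesis unfolding ij(1) using bei_gen[OF False block_adj[OF simp ij(2-4) False]] by blast
      qed
      then have "single m c * g \<in> ?J" using J(4) carrier_single[of m ?V c] step by blast
      moreover from this have "0 - single m c * g \<in> ?J" using J(2,3) by blast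
      ultimately have "p - (0 - single m c * g) \<in> ?J" using J(3) step.IH by blast
      then show ?case by simp
    qed (rule J(2))
  qed
  show "homog_ideal ?V ?J"
    unfolding homog_ideal_def
  proof (intro conjI ballI allI)
    show "hcomp d p \<in> ?J" if "p \<in> ?J" for p d
    proof -
      have "hcomp d p \<in> gid ?V ?H d" using that JU by (auto simp: U_def)
      then show ?thesis using gJ by blast
    qed
  qed (use J in blast)+
  show "igr ?V ?J d = gid ?V ?H d"
  proof
    show "igr ?V ?J d \<subseteq> gid ?V ?H d"
    proof
      fix p assume p: "p \<in> igr ?V ?J d"
      then have "hcomp d p \<in> gid ?V ?H d" using JU by (auto simp: igr_def U_def)
      moreover have "hcomp d p = p" using p hcomp_hom_part_eq[of p ?V d] by (simp add: igr_def)
      ultimately show "p \<in> gid ?V ?H d" by simp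
    qed
    show "gid ?V ?H d \<subseteq> igr ?V ?J d"
      using gJ[of d] gid_hom_part[OF hom_gens_hgens[OF sub], of d] unfolding igr_def by simp
  qed
qed

end

lemma betti_bei_iff:
  fixes G :: "nat graph"
  assumes simp: "simple_graph G" and bg: "block_graph G"
  shows "betti (vset G) (binomial_edge_ideal G :: ('k::field) mpoly set) p (int p + j) \<noteq> 0 \<longleftrightarrow>
    knz (vset G) (hgens (blocks G) :: (int \<times> 'k mpoly) set) p j"
proof -
  let ?V = "vset G" and ?J = "binomial_edge_ideal G :: 'k mpoly set"
  let ?H = "hgens (blocks G) :: (int \<times> 'k mpoly) set"
  have finV: "finite ?V" using simp by (simp add: simple_graph_def)
  have U: "\<Union>(blocks G) \<subseteq> ?V" using blocks_sub[OF simp] by blast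
  have eq: "igr ?V ?J = gid ?V ?H" using bei_graded(2)[OF simp] by blast
  \<comment> \<open>A bound on the rows makes every column vanish in high degrees, which is what
    \<open>betti_nonzero_iff\<close> asks for.\<close>
  obtain r where r: "\<And>p j. knz ?V ?H p j \<Longrightarrow> j \<le> r"
    using knz_berge[OF finV berge_blocks[OF simp bg] U, where 'k='k] by blast
  have "kvan var (vars ?V) (hom_part ?V) (gid ?V ?H) p d" if "int p + r + 1 \<le> d" for p d
    using r[of p "d - int p"] that by (fastforce simp: knz_def)
  then have ev: "\<forall>p. \<exists>D. \<forall>d\<ge>D. kvan var (vars ?V) (hom_part ?V) (igr ?V ?J) p d"
    unfolding eq by blast
  show ?thesis
    using betti_nonzero_iff[OF finV bei_graded(1)[OF simp] ev] unfolding knz_def eq .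
qed

text \<open>If the last column of a bounded Betti table has its lowest nonzero entry in row \<open>f\<close>, then
  that entry is extremal, and any nonzero entry below row \<open>f\<close> yields a second extremal one:
  the last entry of the lowest nonzero row.\<close>

lemma unique_extremal_iff:
  fixes \<beta> :: "nat \<Rightarrow> int \<Rightarrow> bool"
  assumes p: "\<And>p j. \<beta> p j \<Longrightarrow> p \<le> h" and hf: "\<beta> h f" and col: "\<And>j. \<beta> h j \<Longrightarrow> j \<le> f"
    and r: "\<And>p j. \<beta> p j \<Longrightarrow> j \<le> r"
  shows "(\<exists>!(p, j). \<beta> p j \<and> (\<forall>k l. (k, l) \<noteq> (p, j) \<and> k \<ge> p \<and> l \<ge> j \<longrightarrow> \<not> \<beta> k l)) \<longleftrightarrow>
    (\<forall>p j. \<beta> p j \<longrightarrow> j \<le> f)"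
proof
  define ext where "ext = (\<lambda>p j. \<beta> p j \<and> (\<forall>k l. (k, l) \<noteq> (p, j) \<and> k \<ge> p \<and> l \<ge> j \<longrightarrow> \<not> \<beta> k l))"
  have e: "ext h f"
    unfolding ext_def
  proof (intro conjI allI impI notI, rule hf)
    fix k l assume kl: "(k, l) \<noteq> (h, f) \<and> h \<le> k \<and> f \<le> l" and b: "\<beta> k l"
    have "k = h" using p[OF b] kl by simp
    then show False using col[of l] b kl by simp
  qed
  have ex1: "(\<exists>!(p, j). \<beta> p j \<and> (\<forall>k l. (k, l) \<noteq> (p, j) \<and> k \<ge> p \<and> l \<ge> j \<longrightarrow> \<not> \<beta> k l)) \<longleftrightarrow>
    (\<forall>p j. ext p j \<longrightarrow> p = h \<and> j = f)"
    unfolding ext_def[symmetric] using e by (auto simp: Ex1_def)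
  {
    assume "\<exists>!(p, j). \<beta> p j \<and> (\<forall>k l. (k, l) \<noteq> (p, j) \<and> k \<ge> p \<and> l \<ge> j \<longrightarrow> \<not> \<beta> k l)"
    then have u: "ext p j \<Longrightarrow> j = f" for p j unfolding ex1 by blast
    show "\<forall>p j. \<beta> p j \<longrightarrow> j \<le> f"
    proof (rule ccontr)
      assume "\<not> ?thesis"
      then obtain p0 j0 where j0: "\<beta> p0 j0" "f < j0" by (auto simp: not_le)
      let ?R = "{j. j0 \<le> j \<and> (\<exists>p. \<beta> p j)}"
      have "?R \<subseteq> {j0..r}" using r by auto
      then have finR: "finite ?R" by (rule finite_subset) simp
      define j1 where "j1 = Max ?R"
      have "?R \<noteq> {}" using j0 by blast
      then have "j1 \<in> ?R" unfolding j1_def by (rule Max_in[OF finR])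
      then have j1: "j0 \<le> j1" "\<exists>p. \<beta> p j1" by auto
      have m1: "j \<le> j1" if "\<beta> p j" "j1 \<le> j" for p j
        unfolding j1_def by (rule Max_ge[OF finR]) (use that j1(1) in auto)
      let ?C = "{p. \<beta> p j1}"
      have "?C \<subseteq> {..h}" using p by auto
      then have finC: "finite ?C" by (rule finite_subset) simp
      define p1 where "p1 = Max ?C"
      have "?C \<noteq> {}" using j1 by blast
      then have p1: "\<beta> p1 j1" unfolding p1_def using Max_in[OF finC] by blast
      have m2: "p \<le> p1" if "\<beta> p j1" for p unfolding p1_def by (rule Max_ge[OF finC]) (use that in simp)
      have "ext p1 j1"
        unfolding ext_def
      proof (intro conjI allI impI notI, rule p1)
        fix k l assume kl: "(k, l) \<noteq> (p1, j1) \<and> p1 \<le> k \<and> j1 \<le> l" and b: "\<beta> k l"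
        have "l = j1" using m1[OF b] kl by simp
        then show False using m2[of k] b kl by simp
      qed
      then show False using u[of p1 j1] j0 j1 by simp
    qed
  }
  assume all: "\<forall>p j. \<beta> p j \<longrightarrow> j \<le> f"
  have "p' = h \<and> j = f" if x: "ext p' j" for p' j
  proof -
    have "\<beta> p' j" using x by (simp add: ext_def)
    then have "p' \<le> h" "j \<le> f" using p all by blast+
    moreover have "(h, f) \<noteq> (p', j) \<and> p' \<le> h \<and> j \<le> f \<longrightarrow> \<not> \<beta> h f" using x unfolding ext_def by blast
    ultimately show ?thesis using hf by auto
  qed
  then show "\<exists>!(p, j). \<beta> p j \<and> (\<forall>k l. (k, l) \<noteq> (p, j) \<and> k \<ge> p \<and> l \<ge> j \<longrightarrow> \<not> \<beta> k l)"
    unfolding ex1 by blast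
qed

lemma cutpoint_singleton:
  assumes "vset G \<subseteq> {a}"
  shows "\<not> cutpoint G v"
proof
  assume c: "cutpoint G v"
  then have "vset G = {v}" using assms by (auto simp: cutpoint_def)
  then have "num_components (induced G (vset G - {v})) = 0"
    by (simp add: num_components_def induced_def)
  then show False using c by (simp add: cutpoint_def)
qed

theorem theorem2p4:
  fixes G :: "nat graph" and n :: nat and J :: "('k::field) mpoly set"
  assumes "simple_graph G" and "vset G = {1..n}"
    and "connected_graph G" and "block_graph G" and "\<not> decomposable G"
    and "J = binomial_edge_ideal G"
  shows "(n \<ge> 2 \<longrightarrow> reg {1..n} J \<ge> int (num_inner G) + 1) \<and>
    ((\<exists>!(i, j). extremal_betti {1..n} J i j) \<longleftrightarrow>
       (\<forall>T\<in>{T0, T1, T2, T3}. \<not> contains_induced G T)) \<and>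
    ((\<forall>T\<in>{T0, T1, T2, T3}. \<not> contains_induced G T) \<longleftrightarrow>
       (let P = {v \<in> vset G. vertex_degree G v \<noteq> 1} in
          \<forall>v. cutpoint (induced G P) v \<longrightarrow>
            card {W. max_clique (induced G P) W \<and> v \<in> W} = 2))"
proof -
  note simp = assms(1) and V = assms(2) and conn = assms(3) and bg = assms(4) and indec = assms(5) and J = assms(6)
  let ?B = "blocks G"
  let ?\<beta> = "knz {1..n} (hgens ?B :: (int \<times> 'k mpoly) set)"
  have b: "berge ?B" by (rule berge_blocks[OF simp bg])
  have U: "\<Union>?B \<subseteq> {1..n}" using blocks_sub[OF simp] V by blast
  have fin: "finite {1..n}" by simp
  have betti: "betti {1..n} J p (int p + j) \<noteq> 0 \<longleftrightarrow> ?\<beta> p j" for p j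
    using betti_bei_iff[OF simp bg, of p j] unfolding V J .
  have B1: "\<And>p j. ?\<beta> p j \<Longrightarrow> p \<le> hpd ?B" and B2: "?\<beta> (hpd ?B) (hrow ?B)"
    and B3: "\<And>j. ?\<beta> (hpd ?B) j \<Longrightarrow> j \<le> hrow ?B" and B4: "\<exists>r. \<forall>p j. ?\<beta> p j \<longrightarrow> j \<le> r"
    and B5: "(\<forall>v. card (petals ?B v) \<le> 2) \<Longrightarrow> (\<forall>p j. ?\<beta> p j \<longrightarrow> j \<le> hrow ?B)"
    using knz_berge[OF fin b U, where 'k='k] by blast+
  from B4 obtain r where r: "\<And>p j. ?\<beta> p j \<Longrightarrow> j \<le> r" by blast
  have low: "(\<forall>p j. ?\<beta> p j \<longrightarrow> j \<le> hrow ?B) \<longleftrightarrow> (\<forall>v. card (petals ?B v) \<le> 2)"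
  proof
    assume h: "\<forall>p j. ?\<beta> p j \<longrightarrow> j \<le> hrow ?B"
    show "\<forall>v. card (petals ?B v) \<le> 2"
    proof (rule ccontr)
      assume "\<not> ?thesis"
      then obtain v where "2 < card (petals ?B v)" by (auto simp: not_le)
      then have "3 \<le> card (petals ?B v)" by simp
      then show False using knz_flower[OF fin b U, of v, where 'k='k] h by (auto simp: not_le[symmetric])
    qed
  qed (rule B5)
  have i: "(\<exists>!(i, j). extremal_betti {1..n} J i j) \<longleftrightarrow> (\<forall>v. card (petals ?B v) \<le> 2)"
  proof -
    have "extremal_betti {1..n} J = (\<lambda>p j. ?\<beta> p j \<and> (\<forall>k l. (k, l) \<noteq> (p, j) \<and> k \<ge> p \<and> l \<ge> j \<longrightarrow> \<not> ?\<beta> k l))"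
      unfolding extremal_betti_def betti[symmetric] by (simp add: fun_eq_iff)
    then show ?thesis using unique_extremal_iff[of ?\<beta>, OF B1 B2 B3 r] low by simp
  qed
  have ii: "(\<forall>T\<in>{T0, T1, T2, T3}. \<not> contains_induced G T) \<longleftrightarrow> (\<forall>v. card (petals ?B v) \<le> 2)"
    by (rule contains_iff_petals[OF simp bg])
  have iii: "(let P = {v \<in> vset G. vertex_degree G v \<noteq> 1} in
      \<forall>v. cutpoint (induced G P) v \<longrightarrow> card {W. max_clique (induced G P) W \<and> v \<in> W} = 2) \<longleftrightarrow>
    (\<forall>v. card (petals ?B v) \<le> 2)"
  proof (cases "2 \<le> n")
    case True
    then have n2: "2 \<le> card (vset G)" using V by simp
    show ?thesis
      unfolding Let_def using cutpoints_iff_petals[OF simp bg conn n2 indec] unfolding core_def[OF simp bg conn n2] .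
  next
    \<comment> \<open>With at most one vertex there are no cliques of size 2 and no cutpoints, so
      both sides hold.\<close>
    case False
    then have V1: "vset G \<subseteq> {1}" using V by auto
    have "?B = {}"
    proof (rule ccontr)
      assume "?B \<noteq> {}"
      then obtain C where C: "C \<in> ?B" by blast
      then have "card C \<le> card {1 :: nat}" using blocks_sub[OF simp C] V1 by (intro card_mono) auto
      then show False using bergeD(3)[OF b C] by simp
    qed
    then have "card (petals ?B v) \<le> 2" for v by (simp add: petals_def)
    moreover have "\<not> cutpoint (induced G P) v" for P v
      by (rule cutpoint_singleton[of _ 1]) (use V1 in \<open>auto simp: induced_def\<close>)
    ultimately show ?thesis by (simp add: Let_def)
  qed
  have a: "reg {1..n} J \<ge> int (num_inner G) + 1" if "2 \<le> n"
  proof -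
    have n2: "2 \<le> card (vset G)" using V that by simp
    have "\<Union>?B = {1..n}" using Union_blocks[OF simp bg conn n2] V by simp
    then have "?B \<noteq> {}" using that by auto
    \<comment> \<open>Only this half of the count of components is used: it already gives that
      \<open>hrow\<close> is at least i(G) + 1.\<close>
    then have "1 + hpd ?B \<le> card (\<Union>?B)" by (intro bergeD(4)[OF b]) simp_all
    then have "int (num_inner G) + 1 \<le> hrow ?B"
      unfolding num_inner_eq[OF simp bg conn n2] hrow_def by simp
    also have "\<dots> \<le> Max {j. \<exists>p. ?\<beta> p j}"
    proof (rule Max_ge)
      \<comment> \<open>Finitely many rows are nonzero, so the \<open>Max\<close> in
        \<open>reg\<close> is a genuine maximum.\<close>
      have "{j. \<exists>p. ?\<beta> p j} \<subseteq> {0..r}" using knz_bounds(1)[OF fin] r by auto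
      then show "finite {j. \<exists>p. ?\<beta> p j}" by (rule finite_subset) simp
      show "hrow ?B \<in> {j. \<exists>p. ?\<beta> p j}" using B2 by blast
    qed
    also have "\<dots> = reg {1..n} J" unfolding reg_def betti ..
    finally show ?thesis .
  qed
  show ?thesis unfolding i ii iii using a by blast
qed

end
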